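(* Let $\boldsymbol{u}_h$ be the solution of the semi-discrete virtual element problem specified in the context, with initial data $\boldsymbol{u}_{h,0},\boldsymbol{u}_{h,1}\in\mathbf{V}_h$. Then there is a constant $C>0$, independent of $h$, such that $$\sup_{t\in[0,T]}\left(\|\boldsymbol{u}_h'(t)\|+|\boldsymbol{u}_h(t)|_{1,h}\right)\le C\left(\|\boldsymbol{u}_{h,1}\|+|\boldsymbol{u}_{h,0}|_{1,h}+\int_0^T\|\boldsymbol{f}_h(s)\|\,\mathrm{d}s\right).$$
   Context: **Setting.** Let $d\in\{2,3\}$, let $\Omega\subset\mathbb{R}^d$ be a bounded simply connected polygonal ($d=2$) or polyhedral ($d=3$) domain, $T>0$, $\boldsymbol{f}\in L^2(0,T;L^2(\Omega;\mathbb{R}^d))$. $(\cdot,\cdot)$ and $\|\cdot\|$ are the $L^2(\Omega)$ inner product and norm; $(\cdot,\cdot)_K$, $\|\cdot\|_{0,K}$ those of $L^2(K)$; $|\cdot|_{1,K}$ is the $H^1(K)$ seminorm; a prime on a function of time is the time derivative. $\boldsymbol{\epsilon}(\boldsymbol{u})=\frac12(\nabla\boldsymbol{u}+(\nabla\boldsymbol{u})^{\tt t})$. For $i=1,2$ let $\mu_i,\lambda_i>0$, $A_i\boldsymbol{\tau}=2\mu_i\boldsymbol{\tau}+\lambda_i\,\mathrm{tr}(\boldsymbol{\tau})\mathbb{I}$ for $\boldsymbol{\tau}\in\mathbb{R}^{d\times d}$, and $a_i^K(\boldsymbol{u},\boldsymbol{v})=(A_i\boldsymbol{\epsilon}(\boldsymbol{u}),\boldsymbol{\epsilon}(\boldsymbol{v}))_K$.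 **Meshes.** $\{\mathcal{T}_h\}$ is a family of decompositions of $\Omega$ into simply connected polygons ($d=2$) or polyhedra ($d=3$) $K$ of diameter $h_K$, $h=\max_K h_K$. There are $\gamma_1,\gamma_2>0$ such that for all $h$ every $K\in\mathcal{T}_h$ is star-shaped with respect to a ball of radius greater than $\gamma_1h_K$ and the distance between any two vertices of $K$ is greater than $\gamma_2h_K$. **Virtual element spaces.** Fix an integer $k\ge1$. $\mathbb{P}_k(K)$ is the set of polynomials of degree $\le k$ on $K$ ($\mathbb{P}_{-1}=\{0\}$), and "$q\in\mathbb{P}_k(K)/\mathbb{P}_{k-2}(K)$" means $q$ in the span of the scaled monomials $((\boldsymbol{x}-\boldsymbol{x}_K)/h_K)^s$ of degrees $|s|=k-1,k$, where $\boldsymbol{x}_K$ is the barycenter of $K$. For scalar $v_h$, $\Pi^{\nabla,K}v_h\in\mathbb{P}_k(K)$ is defined by $(\nabla\Pi^{\nabla,K}v_h,\nabla q)_K=(\nabla v_h,\nabla q)_K$ for all $q\in\mathbb{P}_k(K)$ and $j_K(\Pi^{\nabla,K}v_h)=j_K(v_h)$, with $j_K(q)$ the average of $q$ over the vertices of $K$; $\Pi^{0,K}$ is the $L^2(K)$-projection onto $\mathbb{P}_k(K)$. - For a polygon $K$ (an element if $d=2$, or a face of an element if $d=3$): $W_h^K$ is the set of $w\in H^1(K)$ with $w|_{\partial K}\in C^0(\partial K)$, $w|_e\in\mathbb{P}_k(e)$ for each edge $e$, $\Delta w\in\mathbb{P}_k(K)$, and $(w-\Pi^{\nabla,K}w,q)_K=0$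 for all $q\in\mathbb{P}_k(K)/\mathbb{P}_{k-2}(K)$. - For a polyhedron $K$ ($d=3$): $W_h^K$ is the set of $w\in H^1(K)\cap C^0(\partial K)$ with $w|_f\in W_h^f$ for every face $f$, $\Delta w\in\mathbb{P}_k(K)$, and $(w-\Pi^{\nabla,K}w,q)_K=0$ for all $q\in\mathbb{P}_k(K)/\mathbb{P}_{k-2}(K)$. $W_h=\{v\in H_0^1(\Omega): v|_K\in W_h^K\ \forall K\}$; $\mathbf{V}_h^K=(W_h^K)^d$, $\mathbf{V}_h=(W_h)^d$; projections act componentwise (written $\Pi^{\boldsymbol{\nabla},K},\Pi^{0,K}$). $|\boldsymbol{v}_h|_{1,h}=(\sum_K|\boldsymbol{v}_h|_{1,K}^2)^{1/2}$. **Discrete forms.** For $i=1,2$, $$m_h^K(\boldsymbol{v}_h,\boldsymbol{w}_h)=(\Pi^{0,K}\boldsymbol{v}_h,\Pi^{0,K}\boldsymbol{w}_h)_K+S^K((\mathbb{I}-\Pi^{0,K})\boldsymbol{v}_h,(\mathbb{I}-\Pi^{0,K})\boldsymbol{w}_h),$$ $$a_{i,h}^K(\boldsymbol{v}_h,\boldsymbol{w}_h)=a_i^K(\Pi^{\boldsymbol{\nabla},K}\boldsymbol{v}_h,\Pi^{\boldsymbol{\nabla},K}\boldsymbol{w}_h)+\tfrac1{|K|}S^K((\mathbb{I}-\Pi^{\boldsymbol{\nabla},K})\boldsymbol{v}_h,(\mathbb{I}-\Pi^{\boldsymbol{\nabla},K})\boldsymbol{w}_h),$$ where $S^K$ is a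 symmetric positive definite bilinear form on $\mathbf{V}_h^K$ with $C_s^{-1}\|\boldsymbol{v}_h\|_{0,K}^2\le S^K(\boldsymbol{v}_h,\boldsymbol{v}_h)\le C_s\|\boldsymbol{v}_h\|_{0,K}^2$ for all $\boldsymbol{v}_h\in\mathbf{V}_h^K$ with $\Pi^{\boldsymbol{\nabla},K}\boldsymbol{v}_h=\boldsymbol{0}$, $C_s>0$ independent of $h$. Set $m_h=\sum_Km_h^K$, $a_{i,h}=\sum_Ka_{i,h}^K$. Standing properties: with constants independent of $h$, for all $\boldsymbol{u}_h,\boldsymbol{v}_h\in\mathbf{V}_h$, $m_h(\boldsymbol{u}_h,\boldsymbol{v}_h)\le C\|\boldsymbol{u}_h\|\|\boldsymbol{v}_h\|$, $a_{i,h}(\boldsymbol{u}_h,\boldsymbol{v}_h)\le C|\boldsymbol{u}_h|_{1,h}|\boldsymbol{v}_h|_{1,h}$, $m_h(\boldsymbol{v}_h,\boldsymbol{v}_h)\ge C\|\boldsymbol{v}_h\|^2$, $a_{1,h}(\boldsymbol{v}_h,\boldsymbol{v}_h)\ge\alpha_0|\boldsymbol{v}_h|_{1,h}^2$, $a_{2,h}(\boldsymbol{v}_h,\boldsymbol{v}_h)\ge\alpha_1|\boldsymbol{v}_h|_{1,h}^2$ with $\alpha_0,\alpha_1>0$. **Semi-discrete problem.** Find $\boldsymbol{u}_h\in C^2([0,T];\mathbf{V}_h)$ with $\boldsymbol{u}_h(0)=\boldsymbol{u}_{h,0}$, $\boldsymbol{u}_h'(0)=\boldsymbol{u}_{h,1}$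 and $$m_h(\boldsymbol{u}_h'',\boldsymbol{v}_h)+a_{1,h}(\boldsymbol{u}_h',\boldsymbol{v}_h)+a_{2,h}(\boldsymbol{u}_h,\boldsymbol{v}_h)=(\boldsymbol{f}_h,\boldsymbol{v}_h)\quad\forall\boldsymbol{v}_h\in\mathbf{V}_h,\ \text{a.e. }t\in(0,T],$$ with $\boldsymbol{f}_h|_K=\Pi^{0,K}\boldsymbol{f}$ for all $K\in\mathcal{T}_h$. *)

theory Defs
  imports "HOL-Analysis.Analysis"
begin

section \<open>Sobolev spaces on open sets\<close>

text \<open>
  Elements of Lebesgue and Sobolev spaces are represented by functions on the whole space, of which
  only the values almost everywhere on the set \<open>U\<close> matter.  All definitions below are insensitive
  to the choice of representatives.
\<close>

definition L2_norm :: "'a::euclidean_space set \<Rightarrow> ('a \<Rightarrow> 'b::euclidean_space) \<Rightarrow> real" where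
  "L2_norm U w = sqrt (LINT x:U|lebesgue. (norm (w x))\<^sup>2)"

definition L2 :: "'a::euclidean_space set \<Rightarrow> ('a \<Rightarrow> 'b::euclidean_space) set" where
  "L2 U = {w. set_borel_measurable lebesgue U w \<and>
              set_integrable lebesgue U (\<lambda>x. (norm (w x))\<^sup>2)}"

text \<open>
  Test functions are taken in $C^1_c(U)$.  By mollification this gives the same weak
  derivatives and the same space $H^1_0(U)$ as test functions in $C^\infty_c(U)$.
\<close>

definition test_function :: "(real^'n) set \<Rightarrow> (real^'n \<Rightarrow> real) \<Rightarrow> (real^'n \<Rightarrow> real^'n) \<Rightarrow> bool" where
  "test_function U \<phi> D\<phi> \<longleftrightarrow>
     (\<forall>x. GDERIV \<phi> x :> D\<phi> x) \<and> continuous_on UNIV D\<phi> \<and>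
     compact (closure {x. \<phi> x \<noteq> 0}) \<and> closure {x. \<phi> x \<noteq> 0} \<subseteq> U"

definition weak_gradient :: "(real^'n) set \<Rightarrow> (real^'n \<Rightarrow> real) \<Rightarrow> (real^'n \<Rightarrow> real^'n) \<Rightarrow> bool" where
  "weak_gradient U w g \<longleftrightarrow>
     (\<forall>\<phi> D\<phi>. test_function U \<phi> D\<phi> \<longrightarrow>
        (LINT x:U|lebesgue. w x *\<^sub>R D\<phi> x) = - (LINT x:U|lebesgue. \<phi> x *\<^sub>R g x))"

definition H1 :: "(real^'n) set \<Rightarrow> (real^'n \<Rightarrow> real) set" where
  "H1 U = {w \<in> L2 U. \<exists>g \<in> L2 U. weak_gradient U w g}"

definition grad :: "(real^'n) set \<Rightarrow> (real^'n \<Rightarrow> real) \<Rightarrow> real^'n \<Rightarrow> real^'n" where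
  "grad U w = (SOME g. g \<in> L2 U \<and> weak_gradient U w g)"

definition H1_norm :: "(real^'n) set \<Rightarrow> (real^'n \<Rightarrow> real) \<Rightarrow> real" where
  "H1_norm U w = sqrt ((L2_norm U w)\<^sup>2 + (L2_norm U (grad U w))\<^sup>2)"

definition H10 :: "(real^'n) set \<Rightarrow> (real^'n \<Rightarrow> real) set" where
  "H10 U = {w \<in> H1 U. \<exists>\<phi> D\<phi>. (\<forall>n::nat. test_function U (\<phi> n) (D\<phi> n)) \<and>
                         (\<lambda>n. H1_norm U (\<lambda>x. w x - \<phi> n x)) \<longlonglongrightarrow> 0}"

definition weak_laplacian :: "(real^'n) set \<Rightarrow> (real^'n \<Rightarrow> real) \<Rightarrow> (real^'n \<Rightarrow> real) \<Rightarrow> bool" where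
  "weak_laplacian U w p \<longleftrightarrow>
     (\<forall>\<phi> D\<phi>. test_function U \<phi> D\<phi> \<longrightarrow>
        (LINT x:U|lebesgue. grad U w x \<bullet> D\<phi> x) = - (LINT x:U|lebesgue. p x * \<phi> x))"

text \<open>
  The continuous function \<open>g\<close> on the boundary is the trace of \<open>w\<close> in the sense of $H^1(U)$:
  \<open>w\<close> differs by an element of $H^1_0(U)$ from a function that is continuous up to the boundary and
  equal to \<open>g\<close> there.  On Lipschitz domains, such as the elements and faces below, this says that
  the usual trace of \<open>w\<close> is \<open>g\<close>.
\<close>

definition continuous_trace :: "(real^'n) set \<Rightarrow> (real^'n \<Rightarrow> real) \<Rightarrow> (real^'n \<Rightarrow> real) \<Rightarrow> bool" where
  "continuous_trace U w g \<longleftrightarrow> continuous_on (frontier U) g \<and>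
     (\<exists>G \<in> H1 U. continuous_on (closure U) G \<and> (\<forall>x \<in> frontier U. G x = g x) \<and>
               (\<lambda>x. w x - G x) \<in> H10 U)"

definition trace_of :: "(real^'n) set \<Rightarrow> (real^'n \<Rightarrow> real) \<Rightarrow> real^'n \<Rightarrow> real" where
  "trace_of U w = (SOME g. continuous_trace U w g)"


section \<open>Polynomials\<close>

definition monomial :: "('n::finite \<Rightarrow> nat) \<Rightarrow> real^'n \<Rightarrow> real" where
  "monomial s x = (\<Prod>i\<in>UNIV. (x $ i) ^ s i)"

definition polys :: "nat \<Rightarrow> (real^'n \<Rightarrow> real) set" where
  "polys k = {p. \<exists>c. p = (\<lambda>x. \<Sum>s | (\<Sum>i\<in>UNIV. s i) \<le> k. c s * monomial s x)}"

definition barycenter :: "(real^'n) set \<Rightarrow> real^'n" where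
  "barycenter U = (1 / measure lebesgue U) *\<^sub>R (LINT x:U|lebesgue. x)"

text \<open>The span of the scaled monomials of degrees \<open>k - 1\<close> and \<open>k\<close>, denoted
  $\mathbb{P}_k(U)/\mathbb{P}_{k-2}(U)$.\<close>

definition top_polys :: "nat \<Rightarrow> (real^'n) set \<Rightarrow> (real^'n \<Rightarrow> real) set" where
  "top_polys k U = {p. \<exists>c. p = (\<lambda>x. \<Sum>s | (\<Sum>i\<in>UNIV. s i) = k \<or> (\<Sum>i\<in>UNIV. s i) + 1 = k.
                        c s * monomial s ((1 / diameter U) *\<^sub>R (x - barycenter U)))}"


section \<open>Polygons and polyhedra\<close>

text \<open>
  A polygon is given by the cyclic list of its vertices.  Straight angles are allowed, so a side
  may be subdivided by further vertices (hanging nodes).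
\<close>

definition edge :: "(real^'n) list \<Rightarrow> nat \<Rightarrow> (real^'n) set" where
  "edge vs i = closed_segment (vs ! i) (vs ! (Suc i mod length vs))"

definition edges :: "(real^'n) list \<Rightarrow> (real^'n) set set" where
  "edges vs = edge vs ` {..<length vs}"

definition simple_polygon :: "(real^'n) list \<Rightarrow> bool" where
  "simple_polygon vs \<longleftrightarrow> 3 \<le> length vs \<and> distinct vs \<and>
     (\<forall>i < length vs. \<forall>j < length vs. i \<noteq> j \<longrightarrow>
        edge vs i \<inter> edge vs j =
          {vs ! i, vs ! (Suc i mod length vs)} \<inter> {vs ! j, vs ! (Suc j mod length vs)})"

definition polygon_region :: "(real^'n) list \<Rightarrow> (real^'n) set" where
  "polygon_region vs = inside (\<Union>(edges vs))"

text \<open>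
  The faces of a polyhedron are planar polygons in space; they are transferred to polygons in
  \<^typ>\<open>real^2\<close> by an isometric parametrisation of their plane.  Nothing below depends on the choice
  of the parametrisation.
\<close>

definition plane_isometry :: "(real^2 \<Rightarrow> real^'n) \<Rightarrow> bool" where
  "plane_isometry \<psi> \<longleftrightarrow> (\<exists>a L. linear L \<and> (\<forall>x. norm (L x) = norm x) \<and> \<psi> = (\<lambda>x. a + L x))"

definition planar_polygon :: "(real^'n) list \<Rightarrow> bool" where
  "planar_polygon F \<longleftrightarrow> (\<exists>\<psi> vs. plane_isometry \<psi> \<and> simple_polygon vs \<and> F = map \<psi> vs)"

definition closed_face :: "(real^'n) list \<Rightarrow> (real^'n) set" where
  "closed_face F = {\<psi> y | \<psi> vs y. plane_isometry \<psi> \<and> F = map \<psi> vs \<and> y \<in> closure (polygon_region vs)}"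

text \<open>\<open>U\<close> is the interior of the polygon, or polyhedron, with the set \<open>B\<close> of boundary cycles: in the
  plane \<open>B\<close> consists of one cycle; in space there is one cycle for each
  face, and the condition on \<open>interior (closure U)\<close> excludes slits.\<close>

definition polygonal :: "(real^'n) set \<Rightarrow> (real^'n) list set \<Rightarrow> bool" where
  "polygonal U B \<longleftrightarrow> (\<exists>vs. B = {vs} \<and> simple_polygon vs \<and> U = polygon_region vs)"

definition polyhedral :: "(real^'n) set \<Rightarrow> (real^'n) list set \<Rightarrow> bool" where
  "polyhedral U B \<longleftrightarrow>
     finite B \<and> (\<forall>F\<in>B. planar_polygon F) \<and>
     (\<forall>F\<in>B. \<forall>G\<in>B. F \<noteq> G \<longrightarrow>
        closed_face F \<inter> closed_face G \<subseteq> \<Union>(edges F \<inter> edges G) \<union> (set F \<inter> set G)) \<and>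
     U \<noteq> {} \<and> open U \<and> bounded U \<and> connected U \<and> interior (closure U) = U \<and>
     frontier U = (\<Union>F\<in>B. closed_face F)"

definition polytopal :: "(real^'n) set \<Rightarrow> (real^'n) list set \<Rightarrow> bool" where
  "polytopal U B \<longleftrightarrow> (CARD('n) = 2 \<and> polygonal U B) \<or> (CARD('n) = 3 \<and> polyhedral U B)"

record 'n cell =
  region :: "(real^'n::finite) set"
  cycles :: "(real^'n::finite) list set"

definition vertices :: "'n::finite cell \<Rightarrow> (real^'n) set" where
  "vertices K = (\<Union>vs\<in>cycles K. set vs)"

definition decomposition :: "(real^'n) set \<Rightarrow> 'n cell set \<Rightarrow> bool" where
  "decomposition \<Omega> M \<longleftrightarrow>
     finite M \<and> (\<forall>K\<in>M. polytopal (region K) (cycles K) \<and> simply_connected (region K)) \<and>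
     (\<forall>K\<in>M. \<forall>K'\<in>M. K \<noteq> K' \<longrightarrow> region K \<inter> region K' = {}) \<and>
     closure \<Omega> = (\<Union>K\<in>M. closure (region K))"

definition mesh_size :: "'n::finite cell set \<Rightarrow> real" where
  "mesh_size M = Max ((\<lambda>K. diameter (region K)) ` M)"

definition star_shaped_wrt_ball :: "(real^'n) set \<Rightarrow> real \<Rightarrow> bool" where
  "star_shaped_wrt_ball U r \<longleftrightarrow>
     (\<exists>z. ball z r \<subseteq> U \<and> (\<forall>y \<in> ball z r. \<forall>x \<in> U. closed_segment y x \<subseteq> U))"

definition shape_regular :: "real \<Rightarrow> real \<Rightarrow> 'n::finite cell \<Rightarrow> bool" where
  "shape_regular \<gamma>1 \<gamma>2 K \<longleftrightarrow>
     (\<exists>r > \<gamma>1 * diameter (region K). star_shaped_wrt_ball (region K) r) \<and>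
     (\<forall>v \<in> vertices K. \<forall>w \<in> vertices K. v \<noteq> w \<longrightarrow> dist v w > \<gamma>2 * diameter (region K))"


section \<open>Projections and virtual element spaces\<close>

definition Pi_0 :: "nat \<Rightarrow> (real^'n) set \<Rightarrow> (real^'n \<Rightarrow> real) \<Rightarrow> real^'n \<Rightarrow> real" where
  "Pi_0 k U w = (THE p. p \<in> polys k \<and>
     (\<forall>q \<in> polys k. (LINT x:U|lebesgue. p x * q x) = (LINT x:U|lebesgue. w x * q x)))"

definition vertex_average :: "(real^'n) set \<Rightarrow> (real^'n \<Rightarrow> real) \<Rightarrow> real" where
  "vertex_average V g = (\<Sum>v\<in>V. g v) / real (card V)"

definition Pi_nabla ::
  "nat \<Rightarrow> (real^'n) set \<Rightarrow> (real^'n) set \<Rightarrow> (real^'n \<Rightarrow> real) \<Rightarrow> real^'n \<Rightarrow> real" where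
  "Pi_nabla k U V w = (THE p. p \<in> polys k \<and>
     (\<forall>q \<in> polys k. (LINT x:U|lebesgue. grad U p x \<bullet> grad U q x) =
                    (LINT x:U|lebesgue. grad U w x \<bullet> grad U q x)) \<and>
     vertex_average V p = vertex_average V (trace_of U w))"

text \<open>
  The part of the definition of the local space that polygons and polyhedra have in common; \<open>P\<close> is
  the condition on the boundary values.
\<close>

definition local_space ::
  "nat \<Rightarrow> (real^'n) set \<Rightarrow> (real^'n) set \<Rightarrow> ((real^'n \<Rightarrow> real) \<Rightarrow> bool) \<Rightarrow> (real^'n \<Rightarrow> real) set" where
  "local_space k U V P = {w \<in> H1 U.
     (\<exists>g. continuous_trace U w g \<and> P g) \<and>
     (\<exists>p \<in> polys k. weak_laplacian U w p) \<and>
     (\<forall>q \<in> top_polys k U. (LINT x:U|lebesgue. (w x - Pi_nabla k U V w x) * q x) = 0)}"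

definition W_polygon :: "nat \<Rightarrow> (real^'n) list \<Rightarrow> (real^'n \<Rightarrow> real) set" where
  "W_polygon k vs = local_space k (polygon_region vs) (set vs)
     (\<lambda>g. \<forall>e \<in> edges vs. \<exists>p \<in> polys k. \<forall>x \<in> e. g x = p x)"

definition W_polyhedron :: "nat \<Rightarrow> 'n::finite cell \<Rightarrow> (real^'n \<Rightarrow> real) set" where
  "W_polyhedron k K = local_space k (region K) (vertices K)
     (\<lambda>g. \<forall>F \<in> cycles K. \<exists>\<psi> vs. plane_isometry \<psi> \<and> F = map \<psi> vs \<and> g \<circ> \<psi> \<in> W_polygon k vs)"

definition W_cell :: "nat \<Rightarrow> 'n::finite cell \<Rightarrow> (real^'n \<Rightarrow> real) set" where
  "W_cell k K = (if CARD('n) = 2 then W_polygon k (the_elem (cycles K)) else W_polyhedron k K)"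

definition W_h :: "nat \<Rightarrow> (real^'n) set \<Rightarrow> 'n cell set \<Rightarrow> (real^'n \<Rightarrow> real) set" where
  "W_h k \<Omega> M = {v \<in> H10 \<Omega>. \<forall>K \<in> M. v \<in> W_cell k K}"

definition V_cell :: "nat \<Rightarrow> 'n::finite cell \<Rightarrow> (real^'n \<Rightarrow> real^'n) set" where
  "V_cell k K = {v. \<forall>i. (\<lambda>x. v x $ i) \<in> W_cell k K}"

definition V_h :: "nat \<Rightarrow> (real^'n) set \<Rightarrow> 'n cell set \<Rightarrow> (real^'n \<Rightarrow> real^'n) set" where
  "V_h k \<Omega> M = {v. \<forall>i. (\<lambda>x. v x $ i) \<in> W_h k \<Omega> M}"

definition Pi_0_vec :: "nat \<Rightarrow> 'n::finite cell \<Rightarrow> (real^'n \<Rightarrow> real^'n) \<Rightarrow> real^'n \<Rightarrow> real^'n" where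
  "Pi_0_vec k K v x = (\<chi> i. Pi_0 k (region K) (\<lambda>y. v y $ i) x)"

definition Pi_nabla_vec :: "nat \<Rightarrow> 'n::finite cell \<Rightarrow> (real^'n \<Rightarrow> real^'n) \<Rightarrow> real^'n \<Rightarrow> real^'n" where
  "Pi_nabla_vec k K v x = (\<chi> i. Pi_nabla k (region K) (vertices K) (\<lambda>y. v y $ i) x)"

definition jacobian :: "(real^'n) set \<Rightarrow> (real^'n \<Rightarrow> real^'n) \<Rightarrow> real^'n \<Rightarrow> real^'n^'n" where
  "jacobian U v x = (\<chi> i. grad U (\<lambda>y. v y $ i) x)"

definition broken_seminorm :: "'n::finite cell set \<Rightarrow> (real^'n \<Rightarrow> real^'n) \<Rightarrow> real" where
  "broken_seminorm M v = sqrt (\<Sum>K\<in>M. (L2_norm (region K) (jacobian (region K) v))\<^sup>2)"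


section \<open>Discrete forms\<close>

definition strain :: "(real^'n) set \<Rightarrow> (real^'n \<Rightarrow> real^'n) \<Rightarrow> real^'n \<Rightarrow> real^'n^'n" where
  "strain U v x = (1/2) *\<^sub>R (jacobian U v x + transpose (jacobian U v x))"

definition elastic :: "real \<Rightarrow> real \<Rightarrow> real^'n^'n \<Rightarrow> real^'n^'n" where
  "elastic \<mu> lam \<tau> = (2 * \<mu>) *\<^sub>R \<tau> + (lam * trace \<tau>) *\<^sub>R mat 1"

definition a_form ::
  "real \<Rightarrow> real \<Rightarrow> (real^'n) set \<Rightarrow> (real^'n \<Rightarrow> real^'n) \<Rightarrow> (real^'n \<Rightarrow> real^'n) \<Rightarrow> real" where
  "a_form \<mu> lam U u v = (LINT x:U|lebesgue. elastic \<mu> lam (strain U u x) \<bullet> strain U v x)"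

text \<open>A symmetric positive definite bilinear form on \<open>V\<close>, where functions that agree almost
  everywhere on \<open>U\<close> are identified.\<close>

definition spd_form ::
  "(real^'n) set \<Rightarrow> (real^'n \<Rightarrow> real^'n) set \<Rightarrow>
    ((real^'n \<Rightarrow> real^'n) \<Rightarrow> (real^'n \<Rightarrow> real^'n) \<Rightarrow> real) \<Rightarrow> bool" where
  "spd_form U V s \<longleftrightarrow>
     (\<forall>u\<in>V. \<forall>v\<in>V. s u v = s v u) \<and>
     (\<forall>u\<in>V. \<forall>v\<in>V. \<forall>w\<in>V. s (\<lambda>x. u x + v x) w = s u w + s v w) \<and>
     (\<forall>c. \<forall>u\<in>V. \<forall>w\<in>V. s (\<lambda>x. c *\<^sub>R u x) w = c * s u w) \<and>
     (\<forall>u\<in>V. \<forall>v\<in>V. \<forall>w\<in>V. (AE x in lebesgue. x \<in> U \<longrightarrow> u x = v x) \<longrightarrow> s u w = s v w) \<and>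
     (\<forall>v\<in>V. \<not> (AE x in lebesgue. x \<in> U \<longrightarrow> v x = 0) \<longrightarrow> s v v > 0)"

type_synonym 'n stabilisation =
  "'n cell \<Rightarrow> (real^'n \<Rightarrow> real^'n) \<Rightarrow> (real^'n \<Rightarrow> real^'n) \<Rightarrow> real"

definition admissible_stabilisation ::
  "nat \<Rightarrow> real \<Rightarrow> 'n::finite cell \<Rightarrow>
    ((real^'n \<Rightarrow> real^'n) \<Rightarrow> (real^'n \<Rightarrow> real^'n) \<Rightarrow> real) \<Rightarrow> bool" where
  "admissible_stabilisation k Cs K s \<longleftrightarrow>
     spd_form (region K) (V_cell k K) s \<and>
     (\<forall>v \<in> V_cell k K. (\<forall>x. Pi_nabla_vec k K v x = 0) \<longrightarrow>
        inverse Cs * (L2_norm (region K) v)\<^sup>2 \<le> s v v \<and> s v v \<le> Cs * (L2_norm (region K) v)\<^sup>2)"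

definition m_h ::
  "nat \<Rightarrow> 'n::finite stabilisation \<Rightarrow> 'n cell set \<Rightarrow>
    (real^'n \<Rightarrow> real^'n) \<Rightarrow> (real^'n \<Rightarrow> real^'n) \<Rightarrow> real" where
  "m_h k S M v w = (\<Sum>K\<in>M.
     (LINT x:region K|lebesgue. Pi_0_vec k K v x \<bullet> Pi_0_vec k K w x) +
     S K (\<lambda>x. v x - Pi_0_vec k K v x) (\<lambda>x. w x - Pi_0_vec k K w x))"

definition a_h ::
  "nat \<Rightarrow> real \<Rightarrow> real \<Rightarrow> 'n::finite stabilisation \<Rightarrow> 'n cell set \<Rightarrow>
    (real^'n \<Rightarrow> real^'n) \<Rightarrow> (real^'n \<Rightarrow> real^'n) \<Rightarrow> real" where
  "a_h k \<mu> lam S M v w = (\<Sum>K\<in>M.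
     a_form \<mu> lam (region K) (Pi_nabla_vec k K v) (Pi_nabla_vec k K w) +
     (1 / measure lebesgue (region K)) *
       S K (\<lambda>x. v x - Pi_nabla_vec k K v x) (\<lambda>x. w x - Pi_nabla_vec k K w x))"


section \<open>The semi-discrete problem\<close>

text \<open>$L^2(0,T;L^2(\Omega;\mathbb{R}^d))$, identified with $L^2((0,T)\times\Omega;\mathbb{R}^d)$.\<close>

definition L2_time :: "real \<Rightarrow> (real^'n) set \<Rightarrow> (real \<Rightarrow> real^'n \<Rightarrow> real^'n) set" where
  "L2_time T \<Omega> = {f. (\<lambda>(t, x). f t x) \<in> L2 ({0<..<T} \<times> \<Omega>)}"

definition f_h ::
  "nat \<Rightarrow> 'n::finite cell set \<Rightarrow> (real \<Rightarrow> real^'n \<Rightarrow> real^'n) \<Rightarrow> real \<Rightarrow> real^'n \<Rightarrow> real^'n" where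
  "f_h k M f t x = (\<Sum>K\<in>M. indicator (region K) x *\<^sub>R Pi_0_vec k K (f t) x)"

definition H1_norm_vec :: "(real^'n) set \<Rightarrow> (real^'n \<Rightarrow> real^'n) \<Rightarrow> real" where
  "H1_norm_vec U v = sqrt (\<Sum>i\<in>UNIV. (H1_norm U (\<lambda>x. v x $ i))\<^sup>2)"

text \<open>
  \<open>u \<in> C\<^sup>2([0,T]; V)\<close> with first and second derivatives \<open>u'\<close> and \<open>u''\<close> (one-sided at the
  end points).  The space \<open>V\<close> carries the norm of $H^1(\Omega)$; the virtual element space is
  finite-dimensional, so any other norm would give the same notion.
\<close>

definition time_derivative ::
  "real \<Rightarrow> (real^'n) set \<Rightarrow> (real \<Rightarrow> real^'n \<Rightarrow> real^'n) \<Rightarrow> (real \<Rightarrow> real^'n \<Rightarrow> real^'n) \<Rightarrow> bool" where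
  "time_derivative T \<Omega> u u' \<longleftrightarrow>
     (\<forall>t\<in>{0..T}. ((\<lambda>s. H1_norm_vec \<Omega> (\<lambda>x. (1 / (s - t)) *\<^sub>R (u s x - u t x) - u' t x))
                   \<longlongrightarrow> 0) (at t within {0..T}))"

definition C2_time ::
  "real \<Rightarrow> (real^'n) set \<Rightarrow> (real^'n \<Rightarrow> real^'n) set \<Rightarrow> (real \<Rightarrow> real^'n \<Rightarrow> real^'n) \<Rightarrow>
    (real \<Rightarrow> real^'n \<Rightarrow> real^'n) \<Rightarrow> (real \<Rightarrow> real^'n \<Rightarrow> real^'n) \<Rightarrow> bool" where
  "C2_time T \<Omega> V u u' u'' \<longleftrightarrow>
     (\<forall>t\<in>{0..T}. u t \<in> V \<and> u' t \<in> V \<and> u'' t \<in> V) \<and>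
     time_derivative T \<Omega> u u' \<and> time_derivative T \<Omega> u' u'' \<and>
     (\<forall>t\<in>{0..T}. ((\<lambda>s. H1_norm_vec \<Omega> (\<lambda>x. u'' s x - u'' t x)) \<longlongrightarrow> 0) (at t within {0..T}))"

text \<open>\<open>u\<close>, with time derivatives \<open>u'\<close> and \<open>u''\<close>, solves the semi-discrete problem with initial data
  \<open>u0\<close> and \<open>u1\<close>.\<close>

definition semidiscrete_solution ::
  "nat \<Rightarrow> real \<Rightarrow> real \<Rightarrow> real \<Rightarrow> real \<Rightarrow> real \<Rightarrow> (real^'n) set \<Rightarrow> 'n cell set \<Rightarrow> 'n stabilisation \<Rightarrow>
    (real \<Rightarrow> real^'n \<Rightarrow> real^'n) \<Rightarrow> (real^'n \<Rightarrow> real^'n) \<Rightarrow> (real^'n \<Rightarrow> real^'n) \<Rightarrow>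
    (real \<Rightarrow> real^'n \<Rightarrow> real^'n) \<Rightarrow> (real \<Rightarrow> real^'n \<Rightarrow> real^'n) \<Rightarrow> (real \<Rightarrow> real^'n \<Rightarrow> real^'n) \<Rightarrow> bool" where
  "semidiscrete_solution k \<mu>1 lam1 \<mu>2 lam2 T \<Omega> M S f u0 u1 u u' u'' \<longleftrightarrow>
     C2_time T \<Omega> (V_h k \<Omega> M) u u' u'' \<and>
     (AE x in lebesgue. x \<in> \<Omega> \<longrightarrow> u 0 x = u0 x) \<and>
     (AE x in lebesgue. x \<in> \<Omega> \<longrightarrow> u' 0 x = u1 x) \<and>
     (AE t in lebesgue. t \<in> {0<..T} \<longrightarrow>
        (\<forall>v \<in> V_h k \<Omega> M.
           m_h k S M (u'' t) v + a_h k \<mu>1 lam1 S M (u' t) v + a_h k \<mu>2 lam2 S M (u t) v =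
           (LINT x:\<Omega>|lebesgue. f_h k M f t x \<bullet> v x)))"

end

theory Submission imports Defs begin

text \<open>
  The estimate is the energy estimate of the damped wave equation.  Testing the semi-discrete
  equation with \<open>u' t\<close> shows that the energy \<open>E t = m_h (u' t) (u' t) + a_h (u t) (u t)\<close> (with the
  parameters \<open>\<mu>2\<close> and \<open>lam2\<close> in \<open>a_h\<close>) grows at most at the rate \<open>2 * \<parallel>f_h t\<parallel> * \<parallel>u' t\<parallel>\<close>, because the
  damping form is nonnegative on the diagonal.  By the coercivity and continuity assumptions \<open>E t\<close> is
  equivalent to \<open>\<parallel>u' t\<parallel>\<^sup>2 + |u t|\<^sup>2\<close> with constants that do not depend on the mesh, so a quadratic
  inequality for the supremum of \<open>\<parallel>u' t\<parallel>\<close> gives the result (\<open>energy_estimate\<close>).  The constant is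
  an explicit expression in the continuity and coercivity constants.

  Differentiating the energy requires that \<open>m_h\<close> and \<open>a_h\<close> are symmetric and bilinear on the virtual
  element space, and that this space is a linear space.  This is where the work lies, since the
  projection \<open>Pi_nabla\<close> and the local spaces refer to traces: a function and its trace are related by
  an existential statement, and \<open>trace_of\<close> picks some trace.  The projection is linear because
  continuous boundary values are unique at the vertices, which is shown as follows.  For a function in \<open>H10\<close> that
  is continuous up to the boundary, integration by parts on a half ball shows that it vanishes at each
  boundary point near which the boundary is a hyperplane (\<open>H10_vanishes_at_flat_point\<close>).  Interior
  points of edges of a polygon and of faces of a polyhedron are of this kind, and the vertices are
  limits of such points (\<open>polygon_trace_domain\<close>, \<open>polyhedron_trace_domain\<close>).  For polygons this uses
  the Jordan curve theorem.

  The space on a polyhedron prescribes the boundary values on each face in some isometric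
  parametrisation of its plane.  Sums of two such functions stay in the space because the face
  condition is the same in all parametrisations: two of them differ by a rigid motion
  (\<open>reparametrisation\<close>), under which all ingredients of the space on a polygon are invariant
  (\<open>W_polygon_reparametrisation\<close>).

  Finally, the integral of \<open>\<parallel>f_h t\<parallel>\<close> has to be a genuine one.  By Fubini's theorem almost every
  time slice of \<open>f\<close> is square-integrable; as the \<open>L\<^sup>2\<close> projection onto polynomials is an expansion
  whose finitely many coefficients are inner products with \<open>f t\<close>, the norm of the projected load is
  a measurable function of time, and it is dominated by \<open>\<parallel>f t\<parallel>\<close> (\<open>f_h_norm_integrable\<close>).
\<close>

section \<open>Bilinear forms on spaces of functions\<close>

definition fun_subspace :: "('a \<Rightarrow> 'b::real_vector) set \<Rightarrow> bool" where
  "fun_subspace X \<longleftrightarrow> (\<lambda>_. 0) \<in> X \<and> (\<forall>u\<in>X. \<forall>v\<in>X. (\<lambda>x. u x + v x) \<in> X) \<and>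
     (\<forall>c. \<forall>u\<in>X. (\<lambda>x. c *\<^sub>R u x) \<in> X)"

lemma fun_subspaceI:
  assumes "(\<lambda>_. 0) \<in> X" "\<And>u v. u \<in> X \<Longrightarrow> v \<in> X \<Longrightarrow> (\<lambda>x. u x + v x) \<in> X"
    "\<And>c u. u \<in> X \<Longrightarrow> (\<lambda>x. c *\<^sub>R u x) \<in> X"
  shows "fun_subspace X"
  using assms unfolding fun_subspace_def by blast

lemma fun_subspace_zero: "fun_subspace X \<Longrightarrow> (\<lambda>_. 0) \<in> X"
  and fun_subspace_add: "fun_subspace X \<Longrightarrow> u \<in> X \<Longrightarrow> v \<in> X \<Longrightarrow> (\<lambda>x. u x + v x) \<in> X"
  and fun_subspace_scale: "fun_subspace X \<Longrightarrow> u \<in> X \<Longrightarrow> (\<lambda>x. c *\<^sub>R u x) \<in> X"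
  unfolding fun_subspace_def by blast+

lemma fun_subspace_diff:
  assumes "fun_subspace X" "u \<in> X" "v \<in> X"
  shows "(\<lambda>x. u x - v x) \<in> X"
  using fun_subspace_add[OF assms(1,2) fun_subspace_scale[OF assms(1,3), of "-1"]] by simp

lemma fun_subspace_sum:
  assumes "fun_subspace X" "\<And>i. i \<in> I \<Longrightarrow> q i \<in> X"
  shows "(\<lambda>x. \<Sum>i\<in>I. q i x) \<in> X"
  using assms(2)
proof (induction I rule: infinite_finite_induct)
  case (insert i I)
  then show ?case using fun_subspace_add[OF assms(1), of "q i" "\<lambda>x. \<Sum>i\<in>I. q i x"] by simp
qed (use fun_subspace_zero[OF assms(1)] in auto)

text \<open>
  Bilinearity is asked on \<open>X\<close> only: forms given by integrals are not additive on all functions, as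
  the integral of a function that is not integrable is \<open>0\<close>.
\<close>
definition sym_bilinear :: "('a \<Rightarrow> 'b::real_vector) set \<Rightarrow> (('a \<Rightarrow> 'b) \<Rightarrow> ('a \<Rightarrow> 'b) \<Rightarrow> real) \<Rightarrow> bool" where
  "sym_bilinear X b \<longleftrightarrow> (\<forall>u\<in>X. \<forall>v\<in>X. b u v = b v u) \<and>
     (\<forall>u\<in>X. \<forall>v\<in>X. \<forall>w\<in>X. b (\<lambda>x. u x + v x) w = b u w + b v w) \<and>
     (\<forall>c. \<forall>u\<in>X. \<forall>w\<in>X. b (\<lambda>x. c *\<^sub>R u x) w = c * b u w)"

lemma sym_bilinearI:
  assumes "\<And>u v. u \<in> X \<Longrightarrow> v \<in> X \<Longrightarrow> b u v = b v u"
    "\<And>u v w. u \<in> X \<Longrightarrow> v \<in> X \<Longrightarrow> w \<in> X \<Longrightarrow> b (\<lambda>x. u x + v x) w = b u w + b v w"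
    "\<And>c u w. u \<in> X \<Longrightarrow> w \<in> X \<Longrightarrow> b (\<lambda>x. c *\<^sub>R u x) w = c * b u w"
  shows "sym_bilinear X b"
  using assms unfolding sym_bilinear_def by blast

lemma sym_bilinear_mono: "sym_bilinear X b \<Longrightarrow> Y \<subseteq> X \<Longrightarrow> sym_bilinear Y b"
  unfolding sym_bilinear_def by (meson subsetD)

context
  fixes X :: "('a \<Rightarrow> 'b::real_vector) set" and b
  assumes X: "fun_subspace X" and b: "sym_bilinear X b"
begin

lemma form_sym: "u \<in> X \<Longrightarrow> v \<in> X \<Longrightarrow> b u v = b v u"
  and form_add_left: "u \<in> X \<Longrightarrow> v \<in> X \<Longrightarrow> w \<in> X \<Longrightarrow> b (\<lambda>x. u x + v x) w = b u w + b v w"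
  and form_scale_left: "u \<in> X \<Longrightarrow> w \<in> X \<Longrightarrow> b (\<lambda>x. c *\<^sub>R u x) w = c * b u w"
  using b unfolding sym_bilinear_def by blast+

lemma form_add_right: "u \<in> X \<Longrightarrow> v \<in> X \<Longrightarrow> w \<in> X \<Longrightarrow> b w (\<lambda>x. u x + v x) = b w u + b w v"
  using form_sym[of w "\<lambda>x. u x + v x"] form_sym[of w u] form_sym[of w v] form_add_left[of u v w]
    fun_subspace_add[OF X, of u v] by simp

lemma form_scale_right: "u \<in> X \<Longrightarrow> w \<in> X \<Longrightarrow> b w (\<lambda>x. c *\<^sub>R u x) = c * b w u"
  using form_sym[of w "\<lambda>x. c *\<^sub>R u x"] form_sym[of w u] form_scale_left[of u w c]
    fun_subspace_scale[OF X, of u c] by simp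

lemma form_diff_left: "u \<in> X \<Longrightarrow> v \<in> X \<Longrightarrow> w \<in> X \<Longrightarrow> b (\<lambda>x. u x - v x) w = b u w - b v w"
  using form_add_left[of u "\<lambda>x. (-1) *\<^sub>R v x" w] form_scale_left[of v w "-1"]
    fun_subspace_scale[OF X, of v "-1"] by simp

lemma form_square:
  assumes u: "u \<in> X" and v: "v \<in> X"
  shows "b (\<lambda>x. u x + c *\<^sub>R v x) (\<lambda>x. u x + c *\<^sub>R v x) = b u u + 2 * c * b u v + c\<^sup>2 * b v v"
proof -
  define w where "w = (\<lambda>x. c *\<^sub>R v x)"
  have w: "w \<in> X" unfolding w_def using fun_subspace_scale[OF X v] .
  have s: "(\<lambda>x. u x + w x) \<in> X" using fun_subspace_add[OF X u w] .
  have bw: "b w z = c * b v z" "b z w = c * b z v" if "z \<in> X" for z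
    unfolding w_def using form_scale_left[OF v that] form_scale_right[OF v that] by auto
  have "b (\<lambda>x. u x + w x) (\<lambda>x. u x + w x) = b u u + 2 * c * b u v + c\<^sup>2 * b v v"
    using form_add_left[OF u w s] form_add_right[OF u w u] form_add_right[OF u w w]
      bw(1)[OF w] bw(1)[OF u] bw(2)[OF u] bw(2)[OF v] form_sym[OF v u]
    by (simp add: power2_eq_square)
  then show ?thesis by (simp add: w_def)
qed

lemma form_zero_left: "w \<in> X \<Longrightarrow> b (\<lambda>_. 0) w = 0"
  using form_scale_left[of "\<lambda>_. 0" w 0] fun_subspace_zero[OF X] by simp

lemma form_sum_left:
  assumes "\<And>i. i \<in> I \<Longrightarrow> q i \<in> X" "w \<in> X"
  shows "b (\<lambda>x. \<Sum>i\<in>I. c i *\<^sub>R q i x) w = (\<Sum>i\<in>I. c i * b (q i) w)"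
  using assms(1)
proof (induction I rule: infinite_finite_induct)
  case (insert i I)
  have "(\<lambda>x. \<Sum>i\<in>I. c i *\<^sub>R q i x) \<in> X" "(\<lambda>x. c i *\<^sub>R q i x) \<in> X"
    using insert.prems by (auto intro!: fun_subspace_sum[OF X] fun_subspace_scale[OF X])
  then have "b (\<lambda>x. c i *\<^sub>R q i x + (\<Sum>i\<in>I. c i *\<^sub>R q i x)) w =
      c i * b (q i) w + (\<Sum>i\<in>I. c i * b (q i) w)"
    using form_add_left form_scale_left insert assms(2) by simp
  then show ?case using insert.hyps by simp
qed (use form_zero_left assms in auto)

lemma form_sum_right:
  assumes "\<And>i. i \<in> I \<Longrightarrow> q i \<in> X" "w \<in> X"
  shows "b w (\<lambda>x. \<Sum>i\<in>I. c i *\<^sub>R q i x) = (\<Sum>i\<in>I. c i * b w (q i))"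
proof -
  have "(\<lambda>x. \<Sum>i\<in>I. c i *\<^sub>R q i x) \<in> X"
    using assms by (auto intro!: fun_subspace_sum[OF X] fun_subspace_scale[OF X])
  then have "b w (\<lambda>x. \<Sum>i\<in>I. c i *\<^sub>R q i x) = b (\<lambda>x. \<Sum>i\<in>I. c i *\<^sub>R q i x) w"
    using form_sym assms by blast
  also have "\<dots> = (\<Sum>i\<in>I. c i * b w (q i))"
    using form_sum_left[of I q w c] assms form_sym[of _ w] by simp
  finally show ?thesis .
qed

context
  assumes psd: "\<And>u. u \<in> X \<Longrightarrow> 0 \<le> b u u"
begin

lemma form_Cauchy_Schwarz:
  assumes u: "u \<in> X" and v: "v \<in> X"
  shows "(b u v)\<^sup>2 \<le> b u u * b v v"
proof -
  have expand: "0 \<le> b u u + 2 * t * b u v + t\<^sup>2 * b v v" for t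
  proof -
    have "(\<lambda>x. u x + t *\<^sub>R v x) \<in> X"
      using fun_subspace_add[OF X u fun_subspace_scale[OF X v]] .
    then show ?thesis using psd form_square[OF u v] by metis
  qed
  show ?thesis
  proof (cases "b v v = 0")
    case True
    have "b u v = 0"
    proof (rule ccontr)
      assume "b u v \<noteq> 0"
      then show False using expand[of "- (b u u + 1) / (2 * b u v)"] True by (simp add: field_simps)
    qed
    then show ?thesis using True by simp
  next
    case False
    then have p: "b v v > 0" using psd[OF v] by simp
    have "0 \<le> b u u - (b u v)\<^sup>2 / b v v"
      using expand[of "- b u v / b v v"] p by (simp add: field_simps power2_eq_square)
    then show ?thesis using p by (simp add: field_simps)
  qed
qed

lemma form_null: "u \<in> X \<Longrightarrow> v \<in> X \<Longrightarrow> b u u = 0 \<Longrightarrow> b u v = 0"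
  using form_Cauchy_Schwarz[of u v] by simp

lemma form_triangle:
  assumes u: "u \<in> X" and v: "v \<in> X"
  shows "sqrt (b (\<lambda>x. u x + v x) (\<lambda>x. u x + v x)) \<le> sqrt (b u u) + sqrt (b v v)"
proof (rule real_le_lsqrt)
  have s: "(\<lambda>x. u x + v x) \<in> X" using fun_subspace_add[OF X u v] .
  have "b u v \<le> sqrt (b u u * b v v)"
    using form_Cauchy_Schwarz[OF u v] real_le_rsqrt by blast
  then have "b u u + 2 * b u v + b v v \<le> (sqrt (b u u) + sqrt (b v v))\<^sup>2"
    using psd u v by (simp add: power2_sum real_sqrt_mult)
  then show "b (\<lambda>x. u x + v x) (\<lambda>x. u x + v x) \<le> (sqrt (b u u) + sqrt (b v v))\<^sup>2"
    using form_add_left[OF u v s] form_add_right[OF u v] u v form_sym by simp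
  show "0 \<le> sqrt (b u u) + sqrt (b v v)" using psd u v by simp
qed

text \<open>
  Gram--Schmidt for a form that is only positive semidefinite: a residual of length zero is
  orthogonal to the whole space, by the Cauchy--Schwarz inequality, and contributes no further
  vector.  The projection onto a finite-dimensional space therefore has an expansion in finitely many
  vectors \<open>e j\<close>; this holds for the \<open>L\<^sup>2\<close> projection as well as for the gradient projection,
  whose form vanishes on constants.  The explicit expansion is what later gives measurability
  of the projected load in time.
\<close>
lemma finite_projection:
  assumes I: "finite I" and q: "\<And>i. i \<in> I \<Longrightarrow> q i \<in> Y" and Y: "fun_subspace Y" "Y \<subseteq> X"
  shows "\<exists>(n::nat) e. (\<forall>j<n. e j \<in> Y) \<and>
           (\<forall>w\<in>X. \<forall>c. b (\<lambda>x. \<Sum>j<n. b w (e j) *\<^sub>R e j x) (\<lambda>x. \<Sum>i\<in>I. c i *\<^sub>R q i x) =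
                       b w (\<lambda>x. \<Sum>i\<in>I. c i *\<^sub>R q i x))"
proof -
  have "\<exists>(n::nat) e. (\<forall>j<n. e j \<in> Y) \<and> (\<forall>i<n. \<forall>j<n. b (e i) (e j) = (if i = j then 1 else 0)) \<and>
          (\<forall>i\<in>I. \<forall>x\<in>X. b (q i) x = (\<Sum>j<n. b (q i) (e j) * b (e j) x))"
    using I q
  proof (induction I)
    case empty
    show ?case by (rule exI[of _ 0]) auto
  next
    case (insert a I)
    have "i \<in> I \<Longrightarrow> q i \<in> Y" for i using insert.prems by simp
    from insert.IH[OF this] obtain n :: nat and e where e: "\<And>j. j < n \<Longrightarrow> e j \<in> Y"
      and on: "\<And>i j. i < n \<Longrightarrow> j < n \<Longrightarrow> b (e i) (e j) = (if i = j then 1 else 0)"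
      and ex: "\<And>i x. i \<in> I \<Longrightarrow> x \<in> X \<Longrightarrow> b (q i) x = (\<Sum>j<n. b (q i) (e j) * b (e j) x)"
      by blast
    have eX: "\<And>j. j < n \<Longrightarrow> e j \<in> X" and qX: "\<And>i. i \<in> insert a I \<Longrightarrow> q i \<in> X"
      using e insert.prems Y by blast+
    define s where "s = (\<lambda>x. \<Sum>j<n. b (q a) (e j) *\<^sub>R e j x)"
    define r where "r = (\<lambda>x. q a x - s x)"
    have sY: "s \<in> Y" unfolding s_def
      by (intro fun_subspace_sum[OF Y(1)] fun_subspace_scale[OF Y(1)] e) auto
    have rY: "r \<in> Y" unfolding r_def using fun_subspace_diff[OF Y(1) _ sY] insert.prems by auto
    have sX: "s \<in> X" and rX: "r \<in> X" using sY rY Y(2) by auto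
    have bs: "b s x = (\<Sum>j<n. b (q a) (e j) * b (e j) x)" if "x \<in> X" for x
      unfolding s_def using form_sum_left[of "{..<n}" e x] eX that by simp
    have br: "b r x = b (q a) x - (\<Sum>j<n. b (q a) (e j) * b (e j) x)" if "x \<in> X" for x
      unfolding r_def using form_diff_left[OF _ sX that] qX bs[OF that] by simp
    have br0: "b r (e k) = 0" if "k < n" for k
    proof -
      have "(\<Sum>j<n. b (q a) (e j) * b (e j) (e k)) = (\<Sum>j<n. if j = k then b (q a) (e j) else 0)"
        using that by (intro sum.cong) (auto simp: on)
      then show ?thesis using br[OF eX[OF that]] that by simp
    qed
    show ?case
    proof (cases "b r r = 0")
      case True
      have "b (q a) x = (\<Sum>j<n. b (q a) (e j) * b (e j) x)" if "x \<in> X" for x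
        using br[OF that] form_null[OF rX that True] by simp
      then show ?thesis using e on ex by (intro exI[of _ n] exI[of _ e]) auto
    next
      case False
      then have pos: "b r r > 0" using psd[OF rX] by simp
      define g where "g = (\<lambda>x. (1 / sqrt (b r r)) *\<^sub>R r x)"
      define e' where "e' = e(n := g)"
      have gY: "g \<in> Y" unfolding g_def using fun_subspace_scale[OF Y(1) rY] .
      then have gX: "g \<in> X" using Y(2) by auto
      have bg: "b g x = b r x / sqrt (b r r)" if "x \<in> X" for x
        unfolding g_def using form_scale_left[OF rX that, of "1 / sqrt (b r r)"] by simp
      have bgr: "b x g = b x r / sqrt (b r r)" if "x \<in> X" for x
        unfolding g_def using form_scale_right[OF rX that, of "1 / sqrt (b r r)"] by simp
      have gg: "b g g = 1" using bg[OF gX] bgr[OF rX] pos by (simp add: real_div_sqrt)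
      have ge: "b g (e k) = 0" "b (e k) g = 0" if "k < n" for k
        using bg[OF eX[OF that]] br0[OF that] form_sym[OF eX[OF that] gX] by auto
      have qg: "b (q i) g = 0" if "i \<in> I" for i
        using ex[OF that gX] ge by simp
      have qag: "b (q a) g = sqrt (b r r)"
      proof -
        have "b r g = b (q a) g" using br[OF gX] ge by simp
        moreover have "b r g = sqrt (b r r)" using bgr[OF rX] pos by (simp add: real_div_sqrt)
        ultimately show ?thesis by simp
      qed
      have "\<forall>j<Suc n. e' j \<in> Y" using e gY by (auto simp: e'_def less_Suc_eq)
      moreover have "\<forall>i<Suc n. \<forall>j<Suc n. b (e' i) (e' j) = (if i = j then 1 else 0)"
        using on ge gg by (auto simp: e'_def less_Suc_eq)
      moreover have "b (q i) x = (\<Sum>j<Suc n. b (q i) (e' j) * b (e' j) x)"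
        if "i \<in> insert a I" "x \<in> X" for i x
      proof -
        have split: "(\<Sum>j<Suc n. b (q i) (e' j) * b (e' j) x) =
            (\<Sum>j<n. b (q i) (e j) * b (e j) x) + b (q i) g * b g x"
          by (simp add: e'_def)
        show ?thesis
        proof (cases "i = a")
          case True
          have "sqrt (b r r) * (b r x / sqrt (b r r)) = b r x" using pos by simp
          then show ?thesis unfolding split using True br[OF that(2)] qag bg[OF that(2)] by simp
        next
          case False
          then show ?thesis unfolding split using that ex qg by simp
        qed
      qed
      ultimately show ?thesis by blast
    qed
  qed
  then obtain n :: nat and e where e: "\<And>j. j < n \<Longrightarrow> e j \<in> Y"
    and ex: "\<And>i x. i \<in> I \<Longrightarrow> x \<in> X \<Longrightarrow> b (q i) x = (\<Sum>j<n. b (q i) (e j) * b (e j) x)"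
    by blast
  have eX: "\<And>j. j < n \<Longrightarrow> e j \<in> X" and qX: "\<And>i. i \<in> I \<Longrightarrow> q i \<in> X"
    using e q Y by blast+
  have "b (\<lambda>x. \<Sum>j<n. b w (e j) *\<^sub>R e j x) (\<lambda>x. \<Sum>i\<in>I. c i *\<^sub>R q i x) =
      b w (\<lambda>x. \<Sum>i\<in>I. c i *\<^sub>R q i x)" if w: "w \<in> X" for w c
  proof -
    have pX: "(\<lambda>x. \<Sum>j<n. b w (e j) *\<^sub>R e j x) \<in> X"
      using eX by (intro fun_subspace_sum[OF X] fun_subspace_scale[OF X]) auto
    have "b (\<lambda>x. \<Sum>j<n. b w (e j) *\<^sub>R e j x) (q i) = b w (q i)" if i: "i \<in> I" for i
    proof -
      have "b (\<lambda>x. \<Sum>j<n. b w (e j) *\<^sub>R e j x) (q i) = (\<Sum>j<n. b w (e j) * b (e j) (q i))"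
        using form_sum_left[of "{..<n}" e "q i"] eX qX[OF i] by simp
      also have "\<dots> = (\<Sum>j<n. b (q i) (e j) * b (e j) w)"
        using eX qX[OF i] w form_sym by (intro sum.cong) (auto simp: mult.commute)
      also have "\<dots> = b w (q i)" using ex[OF i w] form_sym[OF w qX[OF i]] by simp
      finally show ?thesis .
    qed
    then show ?thesis
      using form_sum_right[of I q] qX w pX by simp
  qed
  then show ?thesis using e by blast
qed

end

end

lemma sym_bilinear_sum:
  assumes "\<And>i. i \<in> I \<Longrightarrow> sym_bilinear X (b i)"
  shows "sym_bilinear X (\<lambda>u v. \<Sum>i\<in>I. b i u v)"
  using assms unfolding sym_bilinear_def
  by (auto simp: sum.distrib sum_distrib_left intro!: sum.cong)

section \<open>The abstract energy estimate\<close>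

text \<open>
  With \<open>u s = u t + (s - t) (u' + r s)\<close> and \<open>N (r s) \<rightarrow> 0\<close>, the difference quotient of the quadratic form
  is \<open>2 b u' (u t)\<close> up to terms that contain \<open>r s\<close> or a factor \<open>s - t\<close>.  The bound on \<open>b\<close> in terms
  of \<open>N\<close> makes them vanish in the limit.
\<close>
lemma quadratic_form_derivative:
  fixes u :: "real \<Rightarrow> 'a \<Rightarrow> 'b::real_vector" and N :: "('a \<Rightarrow> 'b) \<Rightarrow> real"
  assumes V: "fun_subspace V" and b: "sym_bilinear V b"
    and N: "\<And>v. 0 \<le> N v" and bound: "\<And>v w. v \<in> V \<Longrightarrow> w \<in> V \<Longrightarrow> \<bar>b v w\<bar> \<le> C * N v * N w"
    and u: "\<And>s. s \<in> I \<Longrightarrow> u s \<in> V" and t: "t \<in> I" and u': "u' \<in> V"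
    and lim: "((\<lambda>s. N (\<lambda>x. (1 / (s - t)) *\<^sub>R (u s x - u t x) - u' x)) \<longlongrightarrow> 0) (at t within I)"
  shows "((\<lambda>s. b (u s) (u s)) has_field_derivative 2 * b u' (u t)) (at t within I)"
proof -
  define r where "r = (\<lambda>s x. (1 / (s - t)) *\<^sub>R (u s x - u t x) - u' x)"
  have r: "r s \<in> V" if "s \<in> I" for s
    unfolding r_def using u[OF that] u[OF t] u'
    by (intro fun_subspace_diff[OF V] fun_subspace_scale[OF V])
  have limr: "((\<lambda>s. N (r s)) \<longlongrightarrow> 0) (at t within I)" using lim by (simp add: r_def)
  have quotient: "(b (u s) (u s) - b (u t) (u t)) / (s - t) =
      2 * b u' (u t) + (2 * b (r s) (u t) + (s - t) * (b u' u' + 2 * b (r s) u' + b (r s) (r s)))"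
    if s: "s \<in> I" "s \<noteq> t" for s
  proof -
    define d where "d = (\<lambda>x. u' x + r s x)"
    have dV: "d \<in> V" unfolding d_def using fun_subspace_add[OF V u' r[OF s(1)]] .
    have us: "u s = (\<lambda>x. u t x + (s - t) *\<^sub>R d x)"
      using s by (auto simp: d_def r_def fun_eq_iff)
    have "b (u s) (u s) = b (u t) (u t) + 2 * (s - t) * b d (u t) + (s - t)\<^sup>2 * b d d"
      unfolding us using form_square[OF V b u[OF t] dV] form_sym[OF V b u[OF t] dV] by simp
    moreover have "b d (u t) = b u' (u t) + b (r s) (u t)"
      unfolding d_def using form_add_left[OF V b u' r[OF s(1)] u[OF t]] .
    moreover have "b d d = b u' u' + 2 * b (r s) u' + b (r s) (r s)"
      using form_add_left[OF V b u' r[OF s(1)] dV] form_add_right[OF V b u' r[OF s(1)] u']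
        form_add_right[OF V b u' r[OF s(1)] r[OF s(1)]] form_sym[OF V b u' r[OF s(1)]]
      by (simp add: d_def)
    moreover have "2 * b u' (u t) + (2 * b (r s) (u t) + (s - t) * b d d) =
        (2 * (s - t) * (b u' (u t) + b (r s) (u t)) + (s - t)\<^sup>2 * b d d) / (s - t)"
      using s(2) by (simp add: field_simps power2_eq_square)
    ultimately show ?thesis by simp
  qed
  have ev: "eventually (\<lambda>s. s \<in> I \<and> s \<noteq> t) (at t within I)"
    by (simp add: eventually_at_filter)
  have null: "((\<lambda>s. b (r s) w) \<longlongrightarrow> 0) (at t within I)" if "w \<in> V" for w
  proof (rule Lim_null_comparison)
    show "eventually (\<lambda>s. norm (b (r s) w) \<le> C * N (r s) * N w) (at t within I)"
      using ev by eventually_elim (use bound r that in auto)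
    show "((\<lambda>s. C * N (r s) * N w) \<longlongrightarrow> 0) (at t within I)"
      using tendsto_mult_right[OF tendsto_mult_left[OF limr, of C], of "N w"] by simp
  qed
  have null2: "((\<lambda>s. b (r s) (r s)) \<longlongrightarrow> 0) (at t within I)"
  proof (rule Lim_null_comparison)
    show "eventually (\<lambda>s. norm (b (r s) (r s)) \<le> C * N (r s) * N (r s)) (at t within I)"
      using ev by eventually_elim (use bound r in auto)
    show "((\<lambda>s. C * N (r s) * N (r s)) \<longlongrightarrow> 0) (at t within I)"
      using tendsto_mult[OF tendsto_mult_left[OF limr, of C] limr] by simp
  qed
  have "((\<lambda>s. 2 * b u' (u t) + (2 * b (r s) (u t) +
          (s - t) * (b u' u' + 2 * b (r s) u' + b (r s) (r s)))) \<longlongrightarrow>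
        2 * b u' (u t) + (2 * 0 + (t - t) * (b u' u' + 2 * 0 + 0))) (at t within I)"
    by (intro tendsto_intros null null2 u u' t)
  then have "((\<lambda>s. (b (u s) (u s) - b (u t) (u t)) / (s - t)) \<longlongrightarrow> 2 * b u' (u t)) (at t within I)"
  proof (rule Lim_transform_eventually[OF tendsto_eq_rhs])
    show "eventually (\<lambda>s. 2 * b u' (u t) + (2 * b (r s) (u t) +
        (s - t) * (b u' u' + 2 * b (r s) u' + b (r s) (r s))) =
      (b (u s) (u s) - b (u t) (u t)) / (s - t)) (at t within I)"
      using ev by eventually_elim (use quotient in simp)
  qed simp
  then show ?thesis by (simp add: has_field_derivative_iff)
qed

text \<open>
  The energy \<open>E t = m (u' t) (u' t) + a\<^sub>2 (u t) (u t)\<close> has derivative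
  \<open>2 (m (u'' t) (u' t) + a\<^sub>2 (u' t) (u t))\<close>, which by the equation tested with \<open>u' t\<close> is at most
  \<open>2 \<phi> t * n (u' t)\<close>, since the damping term \<open>a\<^sub>1 (u' t) (u' t)\<close> is nonnegative.  Bounding
  \<open>n (u' t)\<close> by its supremum \<open>M\<close> gives \<open>cm * M\<^sup>2 \<le> E 0 + 2 * M * \<integral>\<phi>\<close>, a quadratic inequality for
  \<open>M\<close>, so that no Gronwall argument is involved and the constant does not depend on \<open>T\<close>.
\<close>
lemma energy_estimate:
  fixes u u' u'' :: "real \<Rightarrow> 'a \<Rightarrow> 'b::real_vector" and N n s :: "('a \<Rightarrow> 'b) \<Rightarrow> real"
  assumes V: "fun_subspace V" and m: "sym_bilinear V m" and a2: "sym_bilinear V a2"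
    and N: "\<And>v. 0 \<le> N v"
    and mN: "\<And>v w. v \<in> V \<Longrightarrow> w \<in> V \<Longrightarrow> \<bar>m v w\<bar> \<le> Cm * N v * N w"
    and aN: "\<And>v w. v \<in> V \<Longrightarrow> w \<in> V \<Longrightarrow> \<bar>a2 v w\<bar> \<le> Ca * N v * N w"
    and n: "\<And>v. 0 \<le> n v" and s: "\<And>v. 0 \<le> s v"
    and m_upper: "\<And>v. v \<in> V \<Longrightarrow> m v v \<le> Cm * (n v)\<^sup>2" and a_upper: "\<And>v. v \<in> V \<Longrightarrow> a2 v v \<le> Ca * (s v)\<^sup>2"
    and m_lower: "\<And>v. v \<in> V \<Longrightarrow> cm * (n v)\<^sup>2 \<le> m v v" and a_lower: "\<And>v. v \<in> V \<Longrightarrow> ca * (s v)\<^sup>2 \<le> a2 v v"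
    and a1: "\<And>v. v \<in> V \<Longrightarrow> 0 \<le> a1 v v"
    and pos: "Cm > 0" "Ca > 0" "cm > 0" "ca > 0" "T > 0"
    and uV: "\<And>t. t \<in> {0..T} \<Longrightarrow> u t \<in> V \<and> u' t \<in> V \<and> u'' t \<in> V"
    and d1: "\<And>t. t \<in> {0..T} \<Longrightarrow>
      ((\<lambda>s. N (\<lambda>x. (1 / (s - t)) *\<^sub>R (u s x - u t x) - u' t x)) \<longlongrightarrow> 0) (at t within {0..T})"
    and d2: "\<And>t. t \<in> {0..T} \<Longrightarrow>
      ((\<lambda>s. N (\<lambda>x. (1 / (s - t)) *\<^sub>R (u' s x - u' t x) - u'' t x)) \<longlongrightarrow> 0) (at t within {0..T})"
    and eq: "AE t in lebesgue. t \<in> {0<..T} \<longrightarrow>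
      m (u'' t) (u' t) + a1 (u' t) (u' t) + a2 (u t) (u' t) \<le> \<phi> t * n (u' t)"
    and phi: "set_integrable lebesgue {0..T} \<phi>" "\<And>t. 0 \<le> \<phi> t"
    and t: "t \<in> {0..T}"
  shows "n (u' t) + s (u t) \<le> (1 / sqrt cm + 1 / sqrt ca) * (sqrt Cm + sqrt Ca + 2 / sqrt cm) *
           (n (u' 0) + s (u 0) + (LINT t:{0..T}|lebesgue. \<phi> t))"
proof -
  define E where "E = (\<lambda>t. m (u' t) (u' t) + a2 (u t) (u t))"
  define E' where "E' = (\<lambda>t. 2 * m (u'' t) (u' t) + 2 * a2 (u' t) (u t))"
  define I where "I = (LINT t:{0..T}|lebesgue. \<phi> t)"
  have V': "u t \<in> V" "u' t \<in> V" "u'' t \<in> V" if "t \<in> {0..T}" for t using uV that by auto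
  have I0: "0 \<le> I" unfolding I_def set_lebesgue_integral_def
    using phi(2) by (intro integral_nonneg_AE) (auto simp: indicator_def)
  have dE: "(E has_field_derivative E' t) (at t within {0..T})" if "t \<in> {0..T}" for t
  proof -
    have "((\<lambda>s. m (u' s) (u' s)) has_field_derivative 2 * m (u'' t) (u' t)) (at t within {0..T})"
      by (rule quadratic_form_derivative[OF V m N mN]) (use d2 V' that in auto)
    moreover have "((\<lambda>s. a2 (u s) (u s)) has_field_derivative 2 * a2 (u' t) (u t)) (at t within {0..T})"
      by (rule quadratic_form_derivative[OF V a2 N aN]) (use d1 V' that in auto)
    ultimately show ?thesis unfolding E_def E'_def by (rule DERIV_add)
  qed
  have contE: "continuous_on {0..T} E"
    unfolding continuous_on_eq_continuous_within using DERIV_continuous[OF dE] by blast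
  have lower: "cm * (n (u' t))\<^sup>2 \<le> E t" "ca * (s (u t))\<^sup>2 \<le> E t" if "t \<in> {0..T}" for t
  proof -
    have "0 \<le> cm * (n (u' t))\<^sup>2" "0 \<le> ca * (s (u t))\<^sup>2" using pos by auto
    then show "cm * (n (u' t))\<^sup>2 \<le> E t" "ca * (s (u t))\<^sup>2 \<le> E t"
      unfolding E_def using m_lower[OF V'(2)[OF that]] a_lower[OF V'(1)[OF that]] by auto
  qed
  obtain B where B: "\<And>t. t \<in> {0..T} \<Longrightarrow> E t \<le> B"
    using compact_imp_bounded[OF compact_continuous_image[OF contE compact_Icc]]
    unfolding bounded_real by (metis abs_le_D1 image_eqI)
  have bdd: "bdd_above ((\<lambda>t. n (u' t)) ` {0..T})"
  proof (rule bdd_aboveI2)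
    fix t assume t: "t \<in> {0..T}"
    have "(n (u' t))\<^sup>2 \<le> B / cm" using lower(1)[OF t] B[OF t] pos by (simp add: field_simps)
    then show "n (u' t) \<le> sqrt (B / cm)" using real_le_rsqrt by blast
  qed
  define M where "M = (SUP t\<in>{0..T}. n (u' t))"
  have M: "n (u' t) \<le> M" if "t \<in> {0..T}" for t unfolding M_def using cSUP_upper[OF that bdd] .
  have M0: "0 \<le> M" using M[OF t] n order_trans by blast
  have growth: "E t \<le> E 0 + 2 * M * I" if t: "t \<in> {0..T}" for t
  proof -
    have ftc: "(E' has_integral E t - E 0) {0..t}"
      using t by (intro fundamental_theorem_of_calculus)
        (auto simp: has_real_derivative_iff_has_vector_derivative[symmetric]
           intro!: DERIV_subset[OF dE])
    obtain Z where Z: "{t. \<not> (t \<in> {0<..T} \<longrightarrow>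
        m (u'' t) (u' t) + a1 (u' t) (u' t) + a2 (u t) (u' t) \<le> \<phi> t * n (u' t))} \<subseteq> Z" "Z \<in> null_sets lebesgue"
      using eq by (auto elim!: AE_E simp: null_sets_def)
    have neg: "negligible (insert 0 Z)"
      using Z(2) by (simp add: negligible_iff_null_sets)
    have pi: "set_integrable lebesgue {0..t} \<phi>"
      by (rule set_integrable_subset[OF phi(1)]) (use t in auto)
    have int: "((\<lambda>t. 2 * M * \<phi> t) has_integral 2 * M * (LINT t:{0..t}|lebesgue. \<phi> t)) {0..t}"
      using has_integral_set_lebesgue[OF pi] by (intro has_integral_mult_right) simp
    \<comment> \<open>The comparison of integrals needs an inequality at every point; on the null set \<open>Z\<close> where the
      energy inequality may fail, \<open>E'\<close> is replaced by its bound.\<close>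
    have "E t - E 0 \<le> 2 * M * (LINT t:{0..t}|lebesgue. \<phi> t)"
    proof (rule has_integral_le)
      let ?g = "\<lambda>r. if r \<in> insert 0 Z then 2 * M * \<phi> r else E' r"
      show "(?g has_integral E t - E 0) {0..t}"
        by (rule has_integral_spike[OF neg _ ftc]) auto
      show "((\<lambda>t. 2 * M * \<phi> t) has_integral 2 * M * (LINT t:{0..t}|lebesgue. \<phi> t)) {0..t}" by (rule int)
      fix r assume r: "r \<in> {0..t}"
      show "?g r \<le> 2 * M * \<phi> r"
      proof (cases "r \<in> insert 0 Z")
        case False
        then have rT: "r \<in> {0<..T}" "r \<in> {0..T}" using r t by auto
        have "m (u'' r) (u' r) + a1 (u' r) (u' r) + a2 (u r) (u' r) \<le> \<phi> r * n (u' r)"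
          using False Z(1) rT(1) by blast
        then have "m (u'' r) (u' r) + a2 (u r) (u' r) \<le> \<phi> r * n (u' r)"
          using a1[OF V'(2)[OF rT(2)]] by simp
        also have "\<dots> \<le> \<phi> r * M" using M[OF rT(2)] phi(2) by (intro mult_left_mono)
        finally show ?thesis
          using False form_sym[OF V a2 V'(1)[OF rT(2)] V'(2)[OF rT(2)]]
          by (simp add: E'_def algebra_simps)
      qed simp
    qed
    also have "\<dots> \<le> 2 * M * I"
    proof -
      have "(LINT t:{0..t}|lebesgue. \<phi> t) \<le> I"
        unfolding I_def set_lebesgue_integral_def
        using pi phi t unfolding set_integrable_def by (intro integral_mono) (auto simp: indicator_def)
      then show ?thesis using M0 by (intro mult_left_mono) auto
    qed
    finally show ?thesis by simp
  qed
  have E0: "0 \<le> E 0"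
  proof -
    have "0 \<le> cm * (n (u' 0))\<^sup>2" using pos by auto
    also have "\<dots> \<le> E 0" using lower(1)[of 0] pos by auto
    finally show ?thesis .
  qed
  have E0u: "sqrt (E 0) \<le> sqrt Cm * n (u' 0) + sqrt Ca * s (u 0)"
  proof -
    have "E 0 \<le> Cm * (n (u' 0))\<^sup>2 + Ca * (s (u 0))\<^sup>2"
      unfolding E_def using m_upper[of "u' 0"] a_upper[of "u 0"] V'[of 0] pos by auto
    also have "\<dots> = (sqrt Cm * n (u' 0))\<^sup>2 + (sqrt Ca * s (u 0))\<^sup>2"
      using pos by (simp add: power_mult_distrib)
    also have "\<dots> \<le> (sqrt Cm * n (u' 0) + sqrt Ca * s (u 0))\<^sup>2"
      using pos n s by (simp add: power2_sum)
    finally show ?thesis using pos n s by (intro real_le_lsqrt) auto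
  qed
  define K where "K = sqrt Cm + sqrt Ca + 2 / sqrt cm"
  define Q where "Q = sqrt (E 0) + 2 * I / sqrt cm"
  have sc: "sqrt cm > 0" "sqrt ca > 0" using pos by auto
  have Q0: "0 \<le> Q" unfolding Q_def using E0 I0 sc by simp
  have MQ: "sqrt cm * M \<le> Q"
  proof -
    have "M \<le> sqrt ((E 0 + 2 * M * I) / cm)"
      unfolding M_def
    proof (rule cSUP_least)
      fix t assume t: "t \<in> {0..T}"
      have "(n (u' t))\<^sup>2 \<le> (E 0 + 2 * M * I) / cm"
        using lower(1)[OF t] growth[OF t] pos by (simp add: field_simps)
      then show "n (u' t) \<le> sqrt ((E 0 + 2 * (SUP t\<in>{0..T}. n (u' t)) * I) / cm)"
        using real_le_rsqrt unfolding M_def by blast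
    qed (use pos in auto)
    then have "M\<^sup>2 \<le> (E 0 + 2 * M * I) / cm"
      using M0 E0 I0 pos by (metis real_sqrt_le_iff real_sqrt_unique)
    then have quad: "(sqrt cm * M)\<^sup>2 \<le> E 0 + 2 * (sqrt cm * M) * (I / sqrt cm)"
      using pos sc by (simp add: field_simps power_mult_distrib)
    \<comment> \<open>Completing the square bounds \<open>sqrt cm * M\<close> by \<open>Q\<close>.\<close>
    then have "(sqrt cm * M - I / sqrt cm)\<^sup>2 \<le> E 0 + (I / sqrt cm)\<^sup>2"
      by (simp add: power2_diff)
    also have "\<dots> \<le> (sqrt (E 0) + I / sqrt cm)\<^sup>2"
      using E0 I0 sc by (simp add: power2_sum)
    finally have sq: "(sqrt cm * M - I / sqrt cm)\<^sup>2 \<le> (sqrt (E 0) + I / sqrt cm)\<^sup>2" .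
    have "sqrt cm * M - I / sqrt cm \<le> sqrt (E 0) + I / sqrt cm"
      by (rule power2_le_imp_le[OF sq]) (use E0 I0 sc in auto)
    then show ?thesis unfolding Q_def by simp
  qed
  have EQ: "E t \<le> Q\<^sup>2" if t: "t \<in> {0..T}" for t
  proof -
    have "E t \<le> E 0 + 2 * (sqrt cm * M) * (I / sqrt cm)" using growth[OF t] sc by simp
    also have "\<dots> \<le> E 0 + 2 * Q * (I / sqrt cm)"
      using MQ I0 sc by (intro add_left_mono mult_right_mono mult_left_mono) auto
    also have "\<dots> \<le> Q\<^sup>2"
    proof -
      have "Q\<^sup>2 - (E 0 + 2 * Q * (I / sqrt cm)) = sqrt (E 0) * (2 * I / sqrt cm)"
        using E0 by (simp add: Q_def power2_eq_square algebra_simps)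
      moreover have "0 \<le> sqrt (E 0) * (2 * I / sqrt cm)" using E0 I0 sc by simp
      ultimately show ?thesis by linarith
    qed
    finally show ?thesis .
  qed
  have "n (u' t) \<le> Q / sqrt cm"
  proof -
    have "(sqrt cm * n (u' t))\<^sup>2 \<le> Q\<^sup>2"
      using lower(1)[OF t] EQ[OF t] pos by (simp add: power_mult_distrib)
    then have "sqrt cm * n (u' t) \<le> Q" using Q0 by (rule power2_le_imp_le)
    then show ?thesis using sc by (simp add: field_simps)
  qed
  moreover have "s (u t) \<le> Q / sqrt ca"
  proof -
    have "(sqrt ca * s (u t))\<^sup>2 \<le> Q\<^sup>2"
      using lower(2)[OF t] EQ[OF t] pos by (simp add: power_mult_distrib)
    then have "sqrt ca * s (u t) \<le> Q" using Q0 by (rule power2_le_imp_le)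
    then show ?thesis using sc by (simp add: field_simps)
  qed
  ultimately have "n (u' t) + s (u t) \<le> (1 / sqrt cm + 1 / sqrt ca) * Q" by (simp add: field_simps)
  also have "\<dots> \<le> (1 / sqrt cm + 1 / sqrt ca) *
      (K * (n (u' 0) + s (u 0) + I))"
  proof (rule mult_left_mono)
    have "Q \<le> sqrt Cm * n (u' 0) + sqrt Ca * s (u 0) + 2 / sqrt cm * I"
      unfolding Q_def using E0u by simp
    also have "\<dots> \<le> K * n (u' 0) + K * s (u 0) + K * I"
    proof -
      have c: "0 < sqrt Cm" "0 < sqrt Ca" "0 < 2 / sqrt cm" using pos by auto
      have "sqrt Cm * n (u' 0) \<le> K * n (u' 0)" "sqrt Ca * s (u 0) \<le> K * s (u 0)" "2 / sqrt cm * I \<le> K * I"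
        by (rule mult_right_mono; use n s I0 c in \<open>simp add: K_def\<close>)+
      then show ?thesis by linarith
    qed
    finally show "Q \<le> K * (n (u' 0) + s (u 0) + I)"
      by (simp add: algebra_simps)
  qed (use sc in auto)
  finally show ?thesis unfolding I_def K_def by (simp only: mult.assoc)
qed

section \<open>Square-integrable functions\<close>

definition L2_inner :: "'a::euclidean_space set \<Rightarrow> ('a \<Rightarrow> 'b::euclidean_space) \<Rightarrow> ('a \<Rightarrow> 'b) \<Rightarrow> real" where
  "L2_inner U u v = (LINT x:U|lebesgue. u x \<bullet> v x)"

text \<open>
  Norms, inner products and integrability on \<open>U\<close> become statements about the whole space, which hold
  without any assumption on \<open>U\<close>.
\<close>
definition zero_ext :: "'a set \<Rightarrow> ('a \<Rightarrow> 'b::real_vector) \<Rightarrow> 'a \<Rightarrow> 'b" where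
  "zero_ext U w x = (if x \<in> U then w x else 0)"

lemma indicator_scale_eq: "indicat_real U x *\<^sub>R w x = zero_ext U w x"
  by (simp add: zero_ext_def)

lemma set_integral_zero_ext: "(LINT x:U|M. w x) = integral\<^sup>L M (zero_ext U w)"
  unfolding set_lebesgue_integral_def indicator_scale_eq ..

lemma set_integrable_zero_ext: "set_integrable M U w \<longleftrightarrow> integrable M (zero_ext U w)"
  unfolding set_integrable_def indicator_scale_eq ..

lemma zero_ext_power2_norm: "zero_ext U (\<lambda>x. (norm (w x))\<^sup>2) = (\<lambda>x. (norm (zero_ext U w x))\<^sup>2)"
  and zero_ext_inner: "zero_ext U (\<lambda>x. u x \<bullet> v x) = (\<lambda>x. zero_ext U u x \<bullet> zero_ext U v x)"
  and zero_ext_add: "zero_ext U (\<lambda>x. f x + g x) = (\<lambda>x. zero_ext U f x + zero_ext U g x)"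
  and zero_ext_scale: "zero_ext U (\<lambda>x. c *\<^sub>R f x) = (\<lambda>x. c *\<^sub>R zero_ext U f x)"
  and zero_ext_scaleR: "zero_ext U (\<lambda>x. h x *\<^sub>R f x) = (\<lambda>x. zero_ext U h x *\<^sub>R zero_ext U f x)"
  and zero_ext_norm: "zero_ext U (\<lambda>x. norm (w x)) = (\<lambda>x. norm (zero_ext U w x))"
  and zero_ext_nth: "zero_ext U (\<lambda>x. F x $ i) = (\<lambda>x. zero_ext U F x $ i)"
  by (auto simp: zero_ext_def fun_eq_iff)

lemma zero_ext_eq_0: "x \<notin> U \<Longrightarrow> zero_ext U w x = 0" and zero_ext_eq: "x \<in> U \<Longrightarrow> zero_ext U w x = w x"
  by (auto simp: zero_ext_def)

lemma L2_iff:
  "w \<in> L2 U \<longleftrightarrow> zero_ext U w \<in> borel_measurable lebesgue \<and>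
     integrable lebesgue (\<lambda>x. (norm (zero_ext U w x))\<^sup>2)"
  unfolding L2_def set_borel_measurable_def set_integrable_zero_ext indicator_scale_eq
    zero_ext_power2_norm by simp

lemma L2_inner_zero_ext: "L2_inner U u v = (\<integral>x. zero_ext U u x \<bullet> zero_ext U v x \<partial>lebesgue)"
  unfolding L2_inner_def set_integral_zero_ext zero_ext_inner ..

lemma L2_norm_fun: "w \<in> L2 U \<Longrightarrow> (\<lambda>x. norm (w x)) \<in> L2 U"
  unfolding L2_iff zero_ext_norm by (auto intro: borel_measurable_norm)

lemma L2_norm_inner: "L2_norm U w = sqrt (L2_inner U w w)"
  by (simp add: L2_norm_def L2_inner_def power2_norm_eq_inner)

lemma L2_inner_nonneg: "0 \<le> L2_inner U w w"
  unfolding L2_inner_zero_ext by (intro integral_nonneg_AE) auto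

lemma L2_norm_nonneg: "0 \<le> L2_norm U w"
  by (simp add: L2_norm_inner L2_inner_nonneg)

lemma L2_norm_power2: "(L2_norm U w)\<^sup>2 = L2_inner U w w"
  by (simp add: L2_norm_inner L2_inner_nonneg)

lemma L2_norm_power2_zero_ext: "(L2_norm U w)\<^sup>2 = (\<integral>x. (norm (zero_ext U w x))\<^sup>2 \<partial>lebesgue)"
  by (simp add: L2_norm_power2 L2_inner_zero_ext power2_norm_eq_inner)

lemma L2_product_integrable:
  assumes "u \<in> L2 U" "v \<in> L2 U"
  shows "set_integrable lebesgue U (\<lambda>x. u x \<bullet> v x)"
  unfolding set_integrable_zero_ext zero_ext_inner
proof (rule Bochner_Integration.integrable_bound)
  let ?u = "zero_ext U u" and ?v = "zero_ext U v"
  show "integrable lebesgue (\<lambda>x. (norm (?u x))\<^sup>2 + (norm (?v x))\<^sup>2)"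
    using assms unfolding L2_iff by (intro Bochner_Integration.integrable_add) auto
  show "(\<lambda>x. ?u x \<bullet> ?v x) \<in> borel_measurable lebesgue"
    using assms unfolding L2_iff by (intro borel_measurable_inner) auto
  show "AE x in lebesgue. norm (?u x \<bullet> ?v x) \<le> norm ((norm (?u x))\<^sup>2 + (norm (?v x))\<^sup>2)"
  proof (intro AE_I2)
    fix x
    have "\<bar>?u x \<bullet> ?v x\<bar> \<le> norm (?u x) * norm (?v x)" by (rule Cauchy_Schwarz_ineq2)
    also have "\<dots> \<le> (norm (?u x))\<^sup>2 + (norm (?v x))\<^sup>2"
      using sum_squares_bound[of "norm (?u x)" "norm (?v x)"]
        mult_nonneg_nonneg[OF norm_ge_zero[of "?u x"] norm_ge_zero[of "?v x"]] by linarith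
    finally show "norm (?u x \<bullet> ?v x) \<le> norm ((norm (?u x))\<^sup>2 + (norm (?v x))\<^sup>2)"
      by simp
  qed
qed

lemma L2_scaleR_integrable:
  assumes u: "(u :: _ \<Rightarrow> real) \<in> L2 U" and v: "v \<in> L2 U"
  shows "set_integrable lebesgue U (\<lambda>x. u x *\<^sub>R v x)"
  unfolding set_integrable_zero_ext zero_ext_scaleR
proof (rule Bochner_Integration.integrable_bound)
  show "integrable lebesgue (\<lambda>x. norm (zero_ext U u x) \<bullet> norm (zero_ext U v x))"
    using L2_product_integrable[OF L2_norm_fun[OF u] L2_norm_fun[OF v]]
    unfolding set_integrable_zero_ext zero_ext_inner zero_ext_norm .
  show "(\<lambda>x. zero_ext U u x *\<^sub>R zero_ext U v x) \<in> borel_measurable lebesgue"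
    using u v unfolding L2_iff by (intro borel_measurable_scaleR) auto
qed auto

lemma L2_subspace: "fun_subspace (L2 U :: ('a::euclidean_space \<Rightarrow> 'b::euclidean_space) set)"
proof (rule fun_subspaceI)
  have "zero_ext U (\<lambda>_. 0::'b) = (\<lambda>_. 0)" by (auto simp: zero_ext_def)
  then show "(\<lambda>_. 0::'b) \<in> L2 U" by (simp add: L2_iff)
next
  fix u v :: "'a \<Rightarrow> 'b" assume uv: "u \<in> L2 U" "v \<in> L2 U"
  let ?u = "zero_ext U u" and ?v = "zero_ext U v"
  have "integrable lebesgue (\<lambda>x. (norm (?u x))\<^sup>2 + 2 * (?u x \<bullet> ?v x) + (norm (?v x))\<^sup>2)"
    using uv L2_product_integrable[OF uv] unfolding L2_iff set_integrable_zero_ext zero_ext_inner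
    by auto
  then have "integrable lebesgue (\<lambda>x. (norm (?u x + ?v x))\<^sup>2)"
    by (simp add: power2_norm_eq_inner inner_add inner_commute algebra_simps)
  then show "(\<lambda>x. u x + v x) \<in> L2 U"
    unfolding L2_iff zero_ext_add using uv unfolding L2_iff by auto
next
  fix c and u :: "'a \<Rightarrow> 'b" assume u: "u \<in> L2 U"
  then show "(\<lambda>x. c *\<^sub>R u x) \<in> L2 U"
    unfolding L2_iff zero_ext_scale by (auto simp: power_mult_distrib)
qed

lemma L2_inner_bilinear: "sym_bilinear (L2 U) (L2_inner U)"
proof (rule sym_bilinearI)
  fix u v w :: "'a \<Rightarrow> 'b" assume uvw: "u \<in> L2 U" "v \<in> L2 U" "w \<in> L2 U"
  show "L2_inner U (\<lambda>x. u x + v x) w = L2_inner U u w + L2_inner U v w"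
    unfolding L2_inner_def inner_add_left
    by (rule set_integral_add(2)) (use L2_product_integrable uvw in auto)
qed (auto simp: L2_inner_def inner_commute)

lemma L2_Cauchy_Schwarz:
  assumes "u \<in> L2 U" "v \<in> L2 U"
  shows "\<bar>L2_inner U u v\<bar> \<le> L2_norm U u * L2_norm U v"
proof -
  have "\<bar>L2_inner U u v\<bar> = sqrt ((L2_inner U u v)\<^sup>2)" by simp
  also have "\<dots> \<le> sqrt (L2_inner U u u * L2_inner U v v)"
    using form_Cauchy_Schwarz[OF L2_subspace L2_inner_bilinear L2_inner_nonneg assms]
    by (simp only: real_sqrt_le_mono)
  finally show ?thesis by (simp add: L2_norm_inner real_sqrt_mult)
qed

text \<open>
  Lebesgue measure is complete, so functions that agree almost everywhere have the same integral
  with no measurability assumption: either both are measurable or both integrals are \<open>0\<close>.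
\<close>
lemma lebesgue_integral_cong_AE:
  fixes f g :: "'a::euclidean_space \<Rightarrow> 'b::euclidean_space"
  assumes ae: "AE x in lebesgue. f x = g x"
  shows "f \<in> borel_measurable lebesgue \<longleftrightarrow> g \<in> borel_measurable lebesgue"
    and "integrable lebesgue f \<longleftrightarrow> integrable lebesgue g"
    and "integral\<^sup>L lebesgue f = integral\<^sup>L lebesgue g"
proof -
  have ae': "AE x in lebesgue. g x = f x" using ae by eventually_elim simp
  show meas: "f \<in> borel_measurable lebesgue \<longleftrightarrow> g \<in> borel_measurable lebesgue"
    using borel_measurable_AE[OF _ ae] borel_measurable_AE[OF _ ae'] by blast
  show int: "integrable lebesgue f \<longleftrightarrow> integrable lebesgue g"
    using integrable_cong_AE[OF _ _ ae] meas borel_measurable_integrable by blast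
  show "integral\<^sup>L lebesgue f = integral\<^sup>L lebesgue g"
  proof (cases "integrable lebesgue f")
    case True
    then show ?thesis
      using int meas by (intro integral_cong_AE ae) (auto dest: borel_measurable_integrable)
  next
    case False
    then show ?thesis using int by (simp add: not_integrable_integral_eq)
  qed
qed

lemma set_lebesgue_integral_cong_ae:
  fixes f g :: "'a::euclidean_space \<Rightarrow> 'b::euclidean_space"
  assumes ae: "AE x in lebesgue. x \<in> U \<longrightarrow> f x = g x"
  shows "set_integrable lebesgue U f \<longleftrightarrow> set_integrable lebesgue U g"
    and "(LINT x:U|lebesgue. f x) = (LINT x:U|lebesgue. g x)"
proof -
  have "AE x in lebesgue. zero_ext U f x = zero_ext U g x"
    using ae by eventually_elim (auto simp: zero_ext_def)
  note cong = lebesgue_integral_cong_AE[OF this]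
  show "set_integrable lebesgue U f \<longleftrightarrow> set_integrable lebesgue U g"
    "(LINT x:U|lebesgue. f x) = (LINT x:U|lebesgue. g x)"
    unfolding set_integrable_zero_ext set_integral_zero_ext using cong by auto
qed

lemma L2_cong_AE:
  fixes u v :: "'a::euclidean_space \<Rightarrow> 'b::euclidean_space"
  assumes ae: "AE x in lebesgue. x \<in> U \<longrightarrow> u x = v x"
  shows "u \<in> L2 U \<longleftrightarrow> v \<in> L2 U" "L2_norm U u = L2_norm U v" "L2_inner U u w = L2_inner U v w"
    "L2_inner U w u = L2_inner U w v"
proof -
  have 1: "AE x in lebesgue. zero_ext U u x = zero_ext U v x"
    using ae by eventually_elim (auto simp: zero_ext_def)
  then have 2: "AE x in lebesgue. (norm (zero_ext U u x))\<^sup>2 = (norm (zero_ext U v x))\<^sup>2"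
    by eventually_elim auto
  show "u \<in> L2 U \<longleftrightarrow> v \<in> L2 U"
    unfolding L2_iff lebesgue_integral_cong_AE(1)[OF 1] lebesgue_integral_cong_AE(2)[OF 2] ..
  show "L2_norm U u = L2_norm U v" unfolding L2_norm_def
    by (subst set_lebesgue_integral_cong_ae(2)[where g = "\<lambda>x. (norm (v x))\<^sup>2"]) 
      (use ae in \<open>auto elim: eventually_mono\<close>)
  show "L2_inner U u w = L2_inner U v w" "L2_inner U w u = L2_inner U w v" unfolding L2_inner_def
    by (rule set_lebesgue_integral_cong_ae(2); use ae in \<open>auto elim: eventually_mono\<close>)+
qed

lemma L2_norm_zero_iff:
  assumes "w \<in> L2 U"
  shows "L2_norm U w = 0 \<longleftrightarrow> (AE x in lebesgue. x \<in> U \<longrightarrow> w x = 0)"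
proof -
  have "L2_norm U w = 0 \<longleftrightarrow> (\<integral>x. (norm (zero_ext U w x))\<^sup>2 \<partial>lebesgue) = 0"
    using L2_norm_power2_zero_ext[of U w] by (metis power_eq_0_iff zero_less_numeral)
  also have "\<dots> \<longleftrightarrow> (AE x in lebesgue. (norm (zero_ext U w x))\<^sup>2 = 0)"
    using assms unfolding L2_iff by (intro integral_nonneg_eq_0_iff_AE) auto
  also have "\<dots> \<longleftrightarrow> (AE x in lebesgue. x \<in> U \<longrightarrow> w x = 0)"
    by (intro AE_cong) (auto simp: zero_ext_def)
  finally show ?thesis .
qed

lemma L2_mono:
  assumes w: "w \<in> L2 U" and U': "U' \<subseteq> U" "U' \<in> sets lebesgue"
  shows "w \<in> L2 U'" "L2_norm U' w \<le> L2_norm U w"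
proof -
  have eq: "zero_ext U' w = (\<lambda>x. indicat_real U' x *\<^sub>R zero_ext U w x)"
    using U' by (auto simp: zero_ext_def fun_eq_iff)
  have le: "(norm (zero_ext U' w x))\<^sup>2 \<le> (norm (zero_ext U w x))\<^sup>2" for x
    using U' by (auto simp: zero_ext_def)
  have m: "zero_ext U' w \<in> borel_measurable lebesgue"
    unfolding eq using w U' unfolding L2_iff
    by (intro borel_measurable_scaleR borel_measurable_indicator) auto
  have i: "integrable lebesgue (\<lambda>x. (norm (zero_ext U' w x))\<^sup>2)"
  proof (rule Bochner_Integration.integrable_bound)
    show "integrable lebesgue (\<lambda>x. (norm (zero_ext U w x))\<^sup>2)" using w by (simp add: L2_iff)
  qed (use m le in auto)
  show "w \<in> L2 U'" using m i by (simp add: L2_iff)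
  have "(L2_norm U' w)\<^sup>2 \<le> (L2_norm U w)\<^sup>2"
    unfolding L2_norm_power2_zero_ext using i w le by (intro integral_mono) (auto simp: L2_iff)
  then show "L2_norm U' w \<le> L2_norm U w" by (rule power2_le_imp_le[OF _ L2_norm_nonneg])
qed

lemma L2_I_bounded:
  fixes f :: "'a::euclidean_space \<Rightarrow> 'b::euclidean_space"
  assumes f: "f \<in> borel_measurable lebesgue" and U: "U \<in> lmeasurable" and B: "\<And>x. x \<in> U \<Longrightarrow> norm (f x) \<le> B"
  shows "f \<in> L2 U"
proof -
  have m: "zero_ext U f \<in> borel_measurable lebesgue"
    unfolding indicator_scale_eq[symmetric] using f U by (intro borel_measurable_scaleR borel_measurable_indicator) (auto simp: fmeasurable_def)
  have "integrable lebesgue (\<lambda>x. (norm (zero_ext U f x))\<^sup>2)"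
  proof (rule Bochner_Integration.integrable_bound)
    show "integrable lebesgue (\<lambda>x. B\<^sup>2 * indicat_real U x)"
      using U by (intro integrable_mult_right) (auto simp: fmeasurable_def)
    show "AE x in lebesgue. norm ((norm (zero_ext U f x))\<^sup>2) \<le> norm (B\<^sup>2 * indicat_real U x)"
      using B by (intro AE_I2) (auto simp: zero_ext_def intro: power_mono)
  qed (use m in auto)
  then show ?thesis using m by (simp add: L2_iff)
qed

lemma L2_I_compact_support:
  fixes f :: "'a::euclidean_space \<Rightarrow> 'b::euclidean_space"
  assumes f: "continuous_on UNIV f" and C: "compact C" "\<And>x. x \<notin> C \<Longrightarrow> f x = 0" and U: "U \<in> sets lebesgue"
  shows "f \<in> L2 U"
proof -
  obtain B where B: "\<And>x. x \<in> C \<Longrightarrow> norm (f x) \<le> B"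
    using compact_imp_bounded[OF compact_continuous_image[OF continuous_on_subset[OF f] C(1)]]
    unfolding bounded_iff by blast
  have m: "f \<in> borel_measurable lebesgue"
    using borel_measurable_continuous_onI[OF f] by (simp add: measurable_completion)
  have "f \<in> L2 (U \<inter> C)"
    using U C(1) B by (intro L2_I_bounded[OF m, where B=B]) (auto intro: fmeasurable_Int_fmeasurable lmeasurable_compact simp: Int_commute)
  moreover have "zero_ext (U \<inter> C) f = zero_ext U f"
    using C(2) by (auto simp: zero_ext_def fun_eq_iff)
  ultimately show ?thesis by (simp add: L2_iff)
qed

lemma L2_I_continuous:
  fixes f :: "'a::euclidean_space \<Rightarrow> 'b::euclidean_space"
  assumes f: "continuous_on UNIV f" and U: "bounded U" "U \<in> sets lebesgue"
  shows "f \<in> L2 U"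
proof -
  have c: "compact (closure U)" using U by simp
  obtain B where B: "\<And>x. x \<in> closure U \<Longrightarrow> norm (f x) \<le> B"
    using compact_imp_bounded[OF compact_continuous_image[OF continuous_on_subset[OF f] c]]
    unfolding bounded_iff by blast
  have "f \<in> borel_measurable lebesgue"
    using borel_measurable_continuous_onI[OF f] by (simp add: measurable_completion)
  then show ?thesis
    by (rule L2_I_bounded[where B=B])
      (use B U closure_subset in \<open>auto intro: bounded_set_imp_lmeasurable\<close>)
qed

lemma L2_const:
  assumes "bounded U" "U \<in> sets lebesgue" shows "(\<lambda>_. c) \<in> L2 U"
  by (rule L2_I_continuous) (use assms in auto)

lemma L2_set_integrable:
  fixes f :: "'a::euclidean_space \<Rightarrow> 'b::euclidean_space"
  assumes f: "f \<in> L2 U" and U: "bounded U" "U \<in> sets lebesgue"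
  shows "set_integrable lebesgue U f"
  using L2_scaleR_integrable[OF L2_const[OF U, of "1::real"] f] by simp

lemma norm_vec_power2: "(norm (v :: 'b::real_normed_vector ^ 'n))\<^sup>2 = (\<Sum>i\<in>UNIV. (norm (v $ i))\<^sup>2)"
  by (simp add: norm_vec_def L2_set_def sum_nonneg)

lemma measurable_vec_iff:
  fixes f :: "'a::euclidean_space \<Rightarrow> 'b::euclidean_space ^ 'n"
  shows "f \<in> borel_measurable lebesgue \<longleftrightarrow> (\<forall>i. (\<lambda>x. f x $ i) \<in> borel_measurable lebesgue)"
proof
  assume f: "f \<in> borel_measurable lebesgue"
  show "\<forall>i. (\<lambda>x. f x $ i) \<in> borel_measurable lebesgue"
  proof
    fix i
    have "(\<lambda>v::'b^'n. v $ i) \<in> borel_measurable borel"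
      by (intro borel_measurable_continuous_onI continuous_intros)
    then show "(\<lambda>x. f x $ i) \<in> borel_measurable lebesgue"
      using measurable_compose[OF f] by blast
  qed
next
  assume c: "\<forall>i. (\<lambda>x. f x $ i) \<in> borel_measurable lebesgue"
  show "f \<in> borel_measurable lebesgue"
  proof (subst borel_measurable_euclidean_space, rule ballI)
    fix b :: "'b^'n" assume "b \<in> Basis"
    then obtain i c' where b: "b = axis i c'" by (auto simp: Basis_vec_def)
    then show "(\<lambda>x. f x \<bullet> b) \<in> borel_measurable lebesgue"
      using c by (simp add: inner_axis borel_measurable_inner)
  qed
qed

lemma L2_vec_iff:
  fixes f :: "'a::euclidean_space \<Rightarrow> 'b::euclidean_space ^ 'n"
  shows "f \<in> L2 U \<longleftrightarrow> (\<forall>i. (\<lambda>x. f x $ i) \<in> L2 U)"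
proof
  assume f: "f \<in> L2 U"
  show "\<forall>i. (\<lambda>x. f x $ i) \<in> L2 U"
  proof
    fix i
    have m: "(\<lambda>x. zero_ext U f x $ i) \<in> borel_measurable lebesgue"
      using f unfolding L2_iff by (subst (asm) measurable_vec_iff) blast
    have "integrable lebesgue (\<lambda>x. (norm (zero_ext U f x $ i))\<^sup>2)"
    proof (rule Bochner_Integration.integrable_bound)
      show "integrable lebesgue (\<lambda>x. (norm (zero_ext U f x))\<^sup>2)" using f by (simp add: L2_iff)
      show "AE x in lebesgue. norm ((norm (zero_ext U f x $ i))\<^sup>2)
              \<le> norm ((norm (zero_ext U f x))\<^sup>2)"
        by (intro AE_I2) (simp add: power_mono Finite_Cartesian_Product.norm_nth_le)
    qed (use m in auto)
    then show "(\<lambda>x. f x $ i) \<in> L2 U" using m unfolding L2_iff zero_ext_nth by simp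
  qed
next
  assume c: "\<forall>i. (\<lambda>x. f x $ i) \<in> L2 U"
  have "zero_ext U f \<in> borel_measurable lebesgue"
    using c unfolding L2_iff zero_ext_nth by (subst measurable_vec_iff) simp
  moreover have "integrable lebesgue (\<lambda>x. (norm (zero_ext U f x))\<^sup>2)"
    unfolding norm_vec_power2 using c unfolding L2_iff zero_ext_nth
    by (intro Bochner_Integration.integrable_sum) simp
  ultimately show "f \<in> L2 U" by (simp add: L2_iff)
qed

lemma L2_norm_vec_power2:
  fixes f :: "'a::euclidean_space \<Rightarrow> 'b::euclidean_space ^ 'n"
  assumes "f \<in> L2 U"
  shows "(L2_norm U f)\<^sup>2 = (\<Sum>i\<in>UNIV. (L2_norm U (\<lambda>x. f x $ i))\<^sup>2)"
proof -
  show ?thesis unfolding L2_norm_power2_zero_ext norm_vec_power2 zero_ext_nth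
    using assms L2_vec_iff[of f U] unfolding L2_iff zero_ext_nth
    by (subst Bochner_Integration.integral_sum) auto
qed

section \<open>Vanishing integrals over boxes\<close>

text \<open>
  Open boxes are stable under intersection and generate the Borel sets, so the integral over every
  Borel set vanishes.  A function is determined almost everywhere by these integrals.
\<close>
lemma AE_zero_if_box_integrals_zero:
  fixes g :: "'a::euclidean_space \<Rightarrow> real"
  assumes g: "integrable lebesgue g" and box: "\<And>a b. (LINT x:box a b|lebesgue. g x) = 0"
  shows "AE x in lebesgue. g x = 0"
proof -
  obtain h where h[measurable]: "h \<in> borel_measurable lborel" and gh: "AE x in lborel. g x = h x"
    using completion_ex_borel_measurable_real[OF borel_measurable_integrable[OF g]] by blast
  have gh': "AE x in lebesgue. g x = h x" using AE_completion[OF gh] .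
  have hi: "integrable lborel h"
    using g lebesgue_integral_cong_AE(2)[OF gh'] integrable_completion[OF h] by simp
  have hb: "(LINT x:box a b|lborel. h x) = 0" for a b
  proof -
    have "(LINT x:box a b|lebesgue. g x) = (LINT x:box a b|lebesgue. h x)"
      by (rule set_lebesgue_integral_cong_ae(2)) (use gh' in \<open>auto elim: eventually_mono\<close>)
    also have "\<dots> = (LINT x:box a b|lborel. h x)"
      unfolding set_lebesgue_integral_def by (rule integral_completion) measurable
    finally show ?thesis using box by simp
  qed
  let ?E = "range (\<lambda>(a, b). box a b) :: 'a set set"
  have cI: "Int_stable ?E"
    unfolding Int_stable_def by (auto simp: box_Int_box intro: range_eqI[where x="(a, b)" for a b])
  have si: "set_integrable lborel A h" if "A \<in> sets borel" for A
    unfolding set_integrable_def using integrable_mult_indicator[of A lborel h] hi that by simp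
  have lim: "(LINT x|lborel. h x) = 0"
  proof -
    have "(\<lambda>n. LINT x:box (- (real n *\<^sub>R One)) (real n *\<^sub>R One)|lborel. h x) \<longlonglongrightarrow> (LINT x|lborel. h x)"
      unfolding set_lebesgue_integral_def
    proof (rule integral_dominated_convergence[where w = "\<lambda>x. norm (h x)"])
      show "AE x in lborel. (\<lambda>n. indicat_real (box (- (real n *\<^sub>R One)) (real n *\<^sub>R One)) x *\<^sub>R h x) \<longlonglongrightarrow> h x"
      proof (intro AE_I2)
        fix x :: 'a
        obtain n where n: "x \<in> box (- (real n *\<^sub>R One)) (real n *\<^sub>R One)"
          using UN_box_eq_UNIV by blast
        have "\<forall>\<^sub>F k in sequentially. indicat_real (box (- (real k *\<^sub>R One)) (real k *\<^sub>R One)) x *\<^sub>R h x = h x"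
          using eventually_ge_at_top[of n]
        proof eventually_elim
          case (elim k)
          have "x \<in> box (- (real k *\<^sub>R One)) (real k *\<^sub>R One)"
            using n elim by (auto simp: mem_box dest!: bspec)
          then show ?case by simp
        qed
        then show "(\<lambda>n. indicat_real (box (- (real n *\<^sub>R One)) (real n *\<^sub>R One)) x *\<^sub>R h x) \<longlonglongrightarrow> h x"
          by (rule tendsto_eventually)
      qed
    qed (use hi in \<open>auto simp: indicator_def\<close>)
    then show ?thesis using hb LIMSEQ_unique[of "\<lambda>_. 0::real" 0] by simp
  qed
  have all: "(LINT x:A|lborel. h x) = 0" if "A \<in> sets borel" for A
  proof -
    have "A \<in> sigma_sets UNIV ?E" using that unfolding borel_eq_box by simp
    have E: "?E \<subseteq> Pow UNIV" by simp
    from cI E \<open>A \<in> sigma_sets UNIV ?E\<close> show ?thesis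
    proof (induction rule: sigma_sets_induct_disjoint)
      case (basic A) then show ?case using hb by auto
    next
      case empty show ?case by (simp add: set_lebesgue_integral_def)
    next
      case (compl A)
      then have A: "A \<in> sets borel" unfolding borel_eq_box by simp
      have "(LINT x:(UNIV - A) \<union> A|lborel. h x) = (LINT x:UNIV - A|lborel. h x) + (LINT x:A|lborel. h x)"
        using A by (intro set_integral_Un si) auto
      moreover have "(UNIV - A) \<union> A = UNIV" by auto
      ultimately show ?case using compl lim by (simp add: set_lebesgue_integral_def)
    next
      case (union A)
      then have A: "\<And>i. A i \<in> sets borel" unfolding borel_eq_box by auto
      have "(LINT x:(\<Union>i. A i)|lborel. h x) = (\<Sum>i. (LINT x:A i|lborel. h x))"
        by (rule lebesgue_integral_countable_add)
          (use A union in \<open>auto simp: disjoint_family_on_def intro!: si\<close>)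
      then show ?case using union by simp
    qed
  qed
  have "AE x in lborel. h x = 0"
    using density_unique_real[of lborel h "\<lambda>_. 0"] hi all by (simp add: set_lebesgue_integral_def)
  then have "AE x in lebesgue. h x = 0" by (rule AE_completion)
  then show ?thesis using gh' by eventually_elim simp
qed

section \<open>Continuously differentiable functions and test functions\<close>

definition C1_fun :: "(real^'n \<Rightarrow> real) \<Rightarrow> (real^'n \<Rightarrow> real^'n) \<Rightarrow> bool" where
  "C1_fun f Df \<longleftrightarrow> (\<forall>x. GDERIV f x :> Df x) \<and> continuous_on UNIV Df"

lemma C1_fun_gderiv: "C1_fun f Df \<Longrightarrow> GDERIV f x :> Df x"
  and C1_fun_continuous_gradient: "C1_fun f Df \<Longrightarrow> continuous_on UNIV Df"
  by (auto simp: C1_fun_def)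

lemma C1_fun_continuous: "C1_fun f Df \<Longrightarrow> continuous_on UNIV f"
  unfolding C1_fun_def gderiv_def
  by (auto intro!: continuous_at_imp_continuous_on has_derivative_continuous)

lemma C1_fun_const: "C1_fun (\<lambda>_. c) (\<lambda>_. 0)"
  by (simp add: C1_fun_def GDERIV_const)

lemma C1_fun_add: "C1_fun f Df \<Longrightarrow> C1_fun g Dg \<Longrightarrow> C1_fun (\<lambda>x. f x + g x) (\<lambda>x. Df x + Dg x)"
  unfolding C1_fun_def by (auto intro: GDERIV_add continuous_on_add)

lemma C1_fun_mult:
  assumes "C1_fun f Df" "C1_fun g Dg"
  shows "C1_fun (\<lambda>x. f x * g x) (\<lambda>x. f x *\<^sub>R Dg x + g x *\<^sub>R Df x)"
  using assms C1_fun_continuous[OF assms(1)] C1_fun_continuous[OF assms(2)]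
  unfolding C1_fun_def by (auto intro!: GDERIV_mult continuous_intros)

lemma C1_fun_compose:
  assumes f: "C1_fun f Df" and h: "\<And>x. (h has_field_derivative h' (f x)) (at (f x))"
    and c: "continuous_on (range f) h'"
  shows "C1_fun (\<lambda>x. h (f x)) (\<lambda>x. h' (f x) *\<^sub>R Df x)"
proof -
  have "continuous_on UNIV (\<lambda>x. h' (f x))"
    using continuous_on_compose[OF C1_fun_continuous[OF f]] c by (simp add: o_def)
  then show ?thesis
    using f GDERIV_DERIV_compose[OF C1_fun_gderiv[OF f] h] unfolding C1_fun_def
    by (auto intro: continuous_intros)
qed

lemma C1_fun_inner: "C1_fun (\<lambda>x. x \<bullet> v) (\<lambda>_. v)"
  unfolding C1_fun_def gderiv_def by (auto intro!: derivative_eq_intros)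

lemma C1_fun_component: "C1_fun (\<lambda>x. x $ i) (\<lambda>_. axis i 1)"
  using C1_fun_inner[of "axis i 1"] by (simp add: inner_axis)

lemma C1_fun_prod:
  assumes "finite I" "\<And>i. i \<in> I \<Longrightarrow> \<exists>Df. C1_fun (f i) Df"
  shows "\<exists>Df. C1_fun (\<lambda>x. \<Prod>i\<in>I. f i x) Df"
  using assms
proof (induction I)
  case empty
  then show ?case using C1_fun_const by auto
next
  case (insert i I)
  then obtain Df Dg where "C1_fun (f i) Df" "C1_fun (\<lambda>x. \<Prod>i\<in>I. f i x) Dg" by blast
  from C1_fun_mult[OF this] show ?case using insert by auto
qed

lemma gderiv_unique:
  assumes "GDERIV f x :> D" "GDERIV f x :> D'"
  shows "D = D'"
proof -
  have "(\<lambda>h. h \<bullet> D) = (\<lambda>h. h \<bullet> D')"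
    using assms has_derivative_unique unfolding gderiv_def by blast
  then have "(D - D') \<bullet> D = (D - D') \<bullet> D'" by meson
  then have "(D - D') \<bullet> (D - D') = 0" by (simp add: inner_diff_right)
  then show ?thesis by simp
qed

lemma gderiv_vanishing:
  assumes "GDERIV f x :> D" "open S" "x \<in> S" "\<And>y. y \<in> S \<Longrightarrow> f y = 0"
  shows "D = 0"
proof -
  have "GDERIV f x :> 0" unfolding gderiv_def
    by (rule has_derivative_transform_within_open[OF _ assms(2,3), of "\<lambda>_. 0"])
      (use assms(4) in auto)
  then show ?thesis using gderiv_unique[OF assms(1)] by blast
qed

lemma test_function_C1: "test_function U \<phi> D\<phi> \<Longrightarrow> C1_fun \<phi> D\<phi>"
  by (simp add: test_function_def C1_fun_def)

lemma test_functionI: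
  assumes "C1_fun \<phi> D\<phi>" "compact C" "C \<subseteq> U" "\<And>x. x \<notin> C \<Longrightarrow> \<phi> x = 0"
  shows "test_function U \<phi> D\<phi>"
proof -
  have "closure {x. \<phi> x \<noteq> 0} \<subseteq> C"
    by (rule closure_minimal) (use assms compact_imp_closed in auto)
  moreover from this have "compact (closure {x. \<phi> x \<noteq> 0})"
    using assms(2) compact_imp_closed compact_Int_closed[OF assms(2) closed_closure] by (metis inf.absorb2)
  ultimately show ?thesis using assms by (auto simp: test_function_def C1_fun_def)
qed

lemma test_function_support:
  assumes "test_function U \<phi> D\<phi>"
  shows "\<exists>C. compact C \<and> C \<subseteq> U \<and> (\<forall>x. x \<notin> C \<longrightarrow> \<phi> x = 0 \<and> D\<phi> x = 0)"
proof -
  let ?C = "closure {x. \<phi> x \<noteq> 0}"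
  have zero: "\<phi> x = 0" if "x \<notin> ?C" for x
    using that subsetD[OF closure_subset, of x "{x. \<phi> x \<noteq> 0}"] by blast
  have "D\<phi> x = 0" if "x \<notin> ?C" for x
  proof (rule gderiv_vanishing[where S = "- ?C" and f = \<phi>])
    show "GDERIV \<phi> x :> D\<phi> x" using assms unfolding test_function_def by blast
    show "open (- ?C)" "x \<in> - ?C" using that by (simp_all add: open_Compl)
    show "\<phi> y = 0" if "y \<in> - ?C" for y using zero that by blast
  qed
  moreover have "compact ?C" "?C \<subseteq> U" using assms unfolding test_function_def by blast+
  ultimately show ?thesis using zero by blast
qed

lemma test_function_mono: "test_function U \<phi> D\<phi> \<Longrightarrow> U \<subseteq> U' \<Longrightarrow> test_function U' \<phi> D\<phi>"
  by (auto simp: test_function_def)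

lemma test_function_zero: "test_function U (\<lambda>_. 0) (\<lambda>_. 0)"
  by (rule test_functionI[OF C1_fun_const, of "{}"]) auto

lemma test_function_add:
  assumes f: "test_function U \<phi> D\<phi>" and g: "test_function U \<psi> D\<psi>"
  shows "test_function U (\<lambda>x. \<phi> x + \<psi> x) (\<lambda>x. D\<phi> x + D\<psi> x)"
proof -
  obtain C where C: "compact C" "C \<subseteq> U" "\<forall>x. x \<notin> C \<longrightarrow> \<phi> x = 0 \<and> D\<phi> x = 0"
    using test_function_support[OF f] by auto
  obtain C' where C': "compact C'" "C' \<subseteq> U" "\<forall>x. x \<notin> C' \<longrightarrow> \<psi> x = 0 \<and> D\<psi> x = 0"
    using test_function_support[OF g] by auto
  show ?thesis
    by (rule test_functionI[OF C1_fun_add[OF test_function_C1[OF f] test_function_C1[OF g]], of "C \<union> C'"])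
      (use C C' in auto)
qed

lemma test_function_mult:
  assumes f: "test_function U \<phi> D\<phi>" and g: "C1_fun \<psi> D\<psi>"
  shows "test_function U (\<lambda>x. \<phi> x * \<psi> x) (\<lambda>x. \<phi> x *\<^sub>R D\<psi> x + \<psi> x *\<^sub>R D\<phi> x)"
proof -
  obtain C where C: "compact C" "C \<subseteq> U" "\<forall>x. x \<notin> C \<longrightarrow> \<phi> x = 0 \<and> D\<phi> x = 0"
    using test_function_support[OF f] by auto
  show ?thesis
    by (rule test_functionI[OF C1_fun_mult[OF test_function_C1[OF f] g] C(1,2)]) (use C in simp)
qed

lemma test_function_scale:
  assumes "test_function U \<phi> D\<phi>"
  shows "test_function U (\<lambda>x. c * \<phi> x) (\<lambda>x. c *\<^sub>R D\<phi> x)"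
  using test_function_mult[OF assms C1_fun_const[of c]] by (simp add: mult.commute)

lemma test_function_L2:
  assumes "test_function U \<phi> D\<phi>" "U' \<in> sets lebesgue"
  shows "\<phi> \<in> L2 U'" "D\<phi> \<in> L2 U'"
proof -
  obtain C where C: "compact C" "C \<subseteq> U" "\<forall>x. x \<notin> C \<longrightarrow> \<phi> x = 0 \<and> D\<phi> x = 0"
    using test_function_support[OF assms(1)] by auto
  note c = test_function_C1[OF assms(1)]
  show "\<phi> \<in> L2 U'" "D\<phi> \<in> L2 U'"
    by (rule L2_I_compact_support[OF _ C(1) _ assms(2)];
      use C C1_fun_continuous[OF c] C1_fun_continuous_gradient[OF c] in auto)+
qed

subsection \<open>Approximation of the indicator function of a box\<close>

lemma deriv_pos_part_power2:
  "((\<lambda>t. (max 0 t)\<^sup>2) has_field_derivative 2 * max 0 t) (at (t::real))"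
proof -
  consider "t > 0" | "t < 0" | "t = 0" by linarith
  then show ?thesis
  proof cases
    case 1
    have "((\<lambda>t. (max 0 t)\<^sup>2) has_field_derivative 2 * t) (at t)"
      by (rule DERIV_cong_ev[THEN iffD1, of t t "\<lambda>t. t\<^sup>2" _ "2 * t"])
        (use 1 in \<open>auto intro!: derivative_eq_intros eventually_mono[OF eventually_gt_at_top]
          eventually_mono[OF eventually_nhds_in_open[of "{0<..}"]]\<close>)
    then show ?thesis using 1 by simp
  next
    case 2
    have "((\<lambda>t. (max 0 t)\<^sup>2) has_field_derivative 0) (at t)"
      by (rule DERIV_cong_ev[THEN iffD1, of t t "\<lambda>t. 0" _ 0])
        (use 2 in \<open>auto intro!: eventually_mono[OF eventually_nhds_in_open[of "{..<0}"]]\<close>)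
    then show ?thesis using 2 by simp
  next
    case 3
    have "((\<lambda>y. ((max 0 y)\<^sup>2 - (max 0 0)\<^sup>2) / (y - 0)) \<longlongrightarrow> 0) (at (0::real))"
    proof (rule Lim_null_comparison[where g = "\<lambda>y. \<bar>y\<bar>"])
      show "\<forall>\<^sub>F y in at (0::real). norm (((max 0 y)\<^sup>2 - (max 0 0)\<^sup>2) / (y - 0)) \<le> \<bar>y\<bar>"
        by (intro always_eventually allI) (auto simp: max_def power2_eq_square)
      show "((\<lambda>y. \<bar>y\<bar>) \<longlongrightarrow> 0) (at (0::real))" by (intro tendsto_rabs_zero tendsto_ident_at)
    qed
    then show ?thesis using 3 by (simp add: has_field_derivative_iff)
  qed
qed

lemma C1_fun_pos_part_power2:
  assumes "C1_fun f Df"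
  shows "C1_fun (\<lambda>x. (max 0 (f x))\<^sup>2) (\<lambda>x. (2 * max 0 (f x)) *\<^sub>R Df x)"
  by (rule C1_fun_compose[OF assms deriv_pos_part_power2]) (intro continuous_intros)

text \<open>
  With \<open>\<theta>\<close> of class \<open>C\<^sup>1\<close>, positive in the open box and zero elsewhere, the functions
  \<open>n \<theta> / (1 + n \<theta>)\<close> increase to the indicator function of the open box.
\<close>
lemma box_indicator_approximation:
  fixes a b :: "real^'n"
  assumes "cbox a b \<subseteq> U"
  shows "\<exists>\<phi> D\<phi>. (\<forall>n::nat. test_function U (\<phi> n) (D\<phi> n)) \<and>
           (\<forall>n x. 0 \<le> \<phi> n x \<and> \<phi> n x \<le> indicat_real (cbox a b) x) \<and>
           (\<forall>x. (\<lambda>n. \<phi> n x) \<longlonglongrightarrow> indicat_real (box a b) x)"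
proof -
  define \<theta> where "\<theta> = (\<lambda>x::real^'n. \<Prod>i\<in>UNIV. (max 0 (x $ i + (- a $ i)))\<^sup>2 * (max 0 (b $ i + (-1) * x $ i))\<^sup>2)"
  have "\<exists>D. C1_fun \<theta> D" unfolding \<theta>_def
  proof (rule C1_fun_prod, simp)
    fix i
    have 1: "C1_fun (\<lambda>x::real^'n. x $ i + (- a $ i)) (\<lambda>x. axis i 1 + 0)"
      by (intro C1_fun_add C1_fun_component C1_fun_const)
    have 2: "C1_fun (\<lambda>x::real^'n. b $ i + (-1) * x $ i) (\<lambda>x. 0 + ((-1) *\<^sub>R axis i 1 + x $ i *\<^sub>R 0))"
      by (intro C1_fun_add C1_fun_mult C1_fun_component C1_fun_const)
    show "\<exists>Df. C1_fun (\<lambda>x. (max 0 (x $ i + (- a $ i)))\<^sup>2 * (max 0 (b $ i + (-1) * x $ i))\<^sup>2) Df"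
      using C1_fun_mult[OF C1_fun_pos_part_power2[OF 1] C1_fun_pos_part_power2[OF 2]] by blast
  qed
  then obtain D where D: "C1_fun \<theta> D" by blast
  have nonneg: "0 \<le> \<theta> x" for x unfolding \<theta>_def by (intro prod_nonneg) auto
  have pos: "\<theta> x > 0 \<longleftrightarrow> x \<in> box a b" for x
  proof
    assume "x \<in> box a b"
    then have "a $ i < x $ i" "x $ i < b $ i" for i by (auto simp: mem_box_cart)
    then show "\<theta> x > 0" unfolding \<theta>_def
      by (intro prod_pos ballI mult_pos_pos zero_less_power) (auto simp: less_max_iff_disj)
  next
    assume *: "\<theta> x > 0"
    show "x \<in> box a b" unfolding mem_box_cart
    proof (intro allI, rule ccontr)
      fix i assume "\<not> (a $ i < x $ i \<and> x $ i < b $ i)"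
      then have "(max 0 (x $ i + (- a $ i)))\<^sup>2 * (max 0 (b $ i + (-1) * x $ i))\<^sup>2 = 0" by auto
      then have "\<theta> x = 0" unfolding \<theta>_def by (intro prod_zero) auto
      then show False using * by simp
    qed
  qed
  define \<phi> where "\<phi> = (\<lambda>n x. 1 - inverse (1 + real n * \<theta> x))"
  define D\<phi> where "D\<phi> = (\<lambda>n x. (real n * (inverse (1 + real n * \<theta> x))\<^sup>2) *\<^sub>R D x)"
  have p: "1 + real n * \<theta> x \<ge> 1" for n x using nonneg by simp
  have C: "C1_fun (\<phi> n) (D\<phi> n)" for n unfolding \<phi>_def D\<phi>_def
  proof (rule C1_fun_compose[OF D])
    fix x
    show "((\<lambda>t. 1 - inverse (1 + real n * t)) has_real_derivative
         real n * (inverse (1 + real n * \<theta> x))\<^sup>2) (at (\<theta> x))"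
      using p[of n x] by (auto intro!: derivative_eq_intros simp: power2_eq_square)
    show "continuous_on (range \<theta>) (\<lambda>t. real n * (inverse (1 + real n * t))\<^sup>2)"
      using p by (intro continuous_intros) (auto, smt (verit))
  qed
  have z: "\<phi> n x = 0" if "x \<notin> cbox a b" for n x
  proof -
    have "\<theta> x = 0" using pos[of x] nonneg[of x] box_subset_cbox that by fastforce
    then show ?thesis by (simp add: \<phi>_def)
  qed
  have "test_function U (\<phi> n) (D\<phi> n)" for n
    by (rule test_functionI[OF C compact_cbox assms z])
  moreover have "0 \<le> \<phi> n x \<and> \<phi> n x \<le> indicat_real (cbox a b) x" for n x
  proof -
    have "0 \<le> \<phi> n x" "\<phi> n x \<le> 1"
      unfolding \<phi>_def using p[of n x] by (auto simp: inverse_le_1_iff intro: order_trans)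
    then show ?thesis using z[of x n] by (auto simp: indicator_def)
  qed
  moreover have "(\<lambda>n. \<phi> n x) \<longlonglongrightarrow> indicat_real (box a b) x" for x
  proof (cases "x \<in> box a b")
    case True
    then have t: "\<theta> x > 0" using pos by simp
    have "filterlim (\<lambda>n. 1 + real n * \<theta> x) at_top sequentially"
      by (intro filterlim_tendsto_add_at_top[OF tendsto_const]
        filterlim_at_top_mult_tendsto_pos[OF tendsto_const t] filterlim_real_sequentially)
    then have "(\<lambda>n. inverse (1 + real n * \<theta> x)) \<longlonglongrightarrow> 0"
      by (rule tendsto_inverse_0_at_top)
    from tendsto_diff[OF tendsto_const[of 1] this] show ?thesis
      using True by (simp add: \<phi>_def)
  next
    case False
    then have "\<theta> x = 0" using pos[of x] nonneg[of x] by simp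
    then show ?thesis using False by (simp add: \<phi>_def)
  qed
  ultimately show ?thesis by blast
qed

section \<open>Weak gradients\<close>

text \<open>
  An open set is a countable union of closed boxes contained in it, and the boundary of a box is a
  null set.
\<close>
lemma AE_on_open_if_AE_on_boxes:
  fixes U :: "'a::euclidean_space set"
  assumes U: "open U" and box: "\<And>a b. cbox a b \<subseteq> U \<Longrightarrow> AE x in lebesgue. x \<in> box a b \<longrightarrow> P x"
  shows "AE x in lebesgue. x \<in> U \<longrightarrow> P x"
proof -
  obtain D where D: "countable D" "D \<subseteq> Pow U" "\<forall>X\<in>D. \<exists>a b. X = cbox a b" "\<Union>D = U"
    using open_countable_Union_open_cbox[OF U] by (metis (no_types, lifting))
  have "AE x in lebesgue. x \<in> X \<longrightarrow> P x" if X: "X \<in> D" for X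
  proof -
    obtain a b where ab: "X = cbox a b" using D(3) X by blast
    have "AE x in lebesgue. x \<notin> frontier (cbox a b)"
      using negligible_frontier_interval[of a b] negligible_convex_frontier[OF convex_box(1)[of a b]]
      by (intro AE_not_in) (simp add: negligible_iff_null_sets)
    moreover have "AE x in lebesgue. x \<in> box a b \<longrightarrow> P x" using box D(2) X ab by blast
    ultimately show ?thesis
      by eventually_elim (auto simp: ab frontier_cbox)
  qed
  then have "AE x in lebesgue. \<forall>X\<in>D. x \<in> X \<longrightarrow> P x"
    using D(1) by (subst AE_ball_countable) auto
  then show ?thesis by eventually_elim (use D(4) in blast)
qed

text \<open>
  Testing with approximations of the indicator function of a box \<open>cbox a b \<subseteq> U\<close> shows that the
  difference of the two gradients has vanishing integral over every box in \<open>U\<close>.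
\<close>
lemma weak_gradient_unique:
  fixes U :: "(real^'n) set"
  assumes U: "open U" and g: "g \<in> L2 U" "g' \<in> L2 U" and w: "weak_gradient U w g" "weak_gradient U w g'"
  shows "AE x in lebesgue. x \<in> U \<longrightarrow> g x = g' x"
proof (rule AE_on_open_if_AE_on_boxes[OF U])
  fix a b assume ab: "cbox a b \<subseteq> U"
  have meas: "U \<in> sets lebesgue" using U by simp
  define d where "d = (\<lambda>x. g x - g' x)"
  have d: "d \<in> L2 U" unfolding d_def by (rule fun_subspace_diff[OF L2_subspace g])
  have test: "(LINT x:U|lebesgue. \<phi> x *\<^sub>R d x) = 0" if t: "test_function U \<phi> D\<phi>" for \<phi> D\<phi>
  proof -
    have "(LINT x:U|lebesgue. \<phi> x *\<^sub>R d x) =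
        (LINT x:U|lebesgue. \<phi> x *\<^sub>R g x) - (LINT x:U|lebesgue. \<phi> x *\<^sub>R g' x)"
      unfolding d_def scaleR_diff_right
      by (rule set_integral_diff(2)) (use L2_scaleR_integrable[OF test_function_L2(1)[OF t meas]] g in auto)
    also have "\<dots> = 0"
    proof -
      have "(LINT x:U|lebesgue. w x *\<^sub>R D\<phi> x) = - (LINT x:U|lebesgue. \<phi> x *\<^sub>R g x)"
        "(LINT x:U|lebesgue. w x *\<^sub>R D\<phi> x) = - (LINT x:U|lebesgue. \<phi> x *\<^sub>R g' x)"
        using w t unfolding weak_gradient_def by blast+
      then show ?thesis by simp
    qed
    finally show ?thesis .
  qed
  have dc: "set_integrable lebesgue (cbox a b) d"
    by (rule L2_set_integrable[OF L2_mono(1)[OF d ab]]) auto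
  have box0: "(LINT x:box a' b'|lebesgue. d x) = 0" if a'b': "cbox a' b' \<subseteq> U" for a' b'
  proof -
    obtain \<phi> D\<phi> where \<phi>: "\<And>n::nat. test_function U (\<phi> n) (D\<phi> n)"
      "\<And>n x. 0 \<le> \<phi> n x \<and> \<phi> n x \<le> indicat_real (cbox a' b') x"
      "\<And>x. (\<lambda>n. \<phi> n x) \<longlonglongrightarrow> indicat_real (box a' b') x"
      using box_indicator_approximation[OF a'b'] by blast
    have dc': "set_integrable lebesgue (cbox a' b') d"
      by (rule L2_set_integrable[OF L2_mono(1)[OF d a'b']]) auto
    have "(\<lambda>n. LINT x:U|lebesgue. \<phi> n x *\<^sub>R d x) \<longlonglongrightarrow> (LINT x:box a' b'|lebesgue. d x)"
      unfolding set_integral_zero_ext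
    proof (rule integral_dominated_convergence[where w = "\<lambda>x. norm (zero_ext (cbox a' b') d x)"])
      show "zero_ext (box a' b') d \<in> borel_measurable lebesgue"
        using set_integrable_subset[OF dc', of "box a' b'"] box_subset_cbox[of a' b']
        unfolding set_integrable_zero_ext by (auto intro: borel_measurable_integrable)
      show "zero_ext U (\<lambda>x. \<phi> n x *\<^sub>R d x) \<in> borel_measurable lebesgue" for n
        using L2_scaleR_integrable[OF test_function_L2(1)[OF \<phi>(1) meas] d]
        unfolding set_integrable_zero_ext by (auto intro: borel_measurable_integrable)
      show "integrable lebesgue (\<lambda>x. norm (zero_ext (cbox a' b') d x))"
        using dc' unfolding set_integrable_zero_ext by simp
      show "AE x in lebesgue. (\<lambda>n. zero_ext U (\<lambda>x. \<phi> n x *\<^sub>R d x) x) \<longlonglongrightarrow> zero_ext (box a' b') d x"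
      proof (intro AE_I2)
        fix x
        have "(\<lambda>n. \<phi> n x *\<^sub>R zero_ext U d x) \<longlonglongrightarrow> indicat_real (box a' b') x *\<^sub>R zero_ext U d x"
          by (intro tendsto_scaleR \<phi>(3) tendsto_const)
        moreover have "indicat_real (box a' b') x *\<^sub>R zero_ext U d x = zero_ext (box a' b') d x"
          using a'b' box_subset_cbox[of a' b'] by (auto simp: zero_ext_def)
        moreover have "(\<lambda>n. \<phi> n x *\<^sub>R zero_ext U d x) = (\<lambda>n. zero_ext U (\<lambda>x. \<phi> n x *\<^sub>R d x) x)"
          by (auto simp: zero_ext_def)
        ultimately show "(\<lambda>n. zero_ext U (\<lambda>x. \<phi> n x *\<^sub>R d x) x) \<longlonglongrightarrow> zero_ext (box a' b') d x"
          by simp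
      qed
      show "AE x in lebesgue. norm (zero_ext U (\<lambda>x. \<phi> n x *\<^sub>R d x) x) \<le> norm (zero_ext (cbox a' b') d x)" for n
      proof (intro AE_I2)
        fix x
        show "norm (zero_ext U (\<lambda>x. \<phi> n x *\<^sub>R d x) x) \<le> norm (zero_ext (cbox a' b') d x)"
          using \<phi>(2)[of n x] by (auto simp: zero_ext_def indicator_def mult_left_le_one_le)
      qed
    qed
    then have "(\<lambda>n. 0::real^'n) \<longlonglongrightarrow> (LINT x:box a' b'|lebesgue. d x)" using test[OF \<phi>(1)] by simp
    then show ?thesis using LIMSEQ_unique tendsto_const by blast
  qed
  have db: "set_integrable lebesgue (box a b) d"
    using set_integrable_subset[OF dc, of "box a b"] box_subset_cbox[of a b] by auto
  have "AE x in lebesgue. zero_ext (box a b) d x $ i = 0" for i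
  proof (rule AE_zero_if_box_integrals_zero)
    show "integrable lebesgue (\<lambda>x. zero_ext (box a b) d x $ i)"
      using db unfolding set_integrable_zero_ext
      by (rule integrable_bounded_linear[OF bounded_linear_vec_nth])
    fix a' b' :: "real^'n"
    obtain c c' where c: "box a b \<inter> box a' b' = box c c'" by (meson box_Int_box)
    have "(LINT x:box a' b'|lebesgue. zero_ext (box a b) d x $ i) = (LINT x:box c c'|lebesgue. d x $ i)"
      unfolding set_integral_zero_ext c[symmetric]
      by (rule Bochner_Integration.integral_cong) (auto simp: zero_ext_def)
    also have "\<dots> = 0"
    proof (cases "box c c' = {}")
      case True then show ?thesis by (simp add: set_lebesgue_integral_def)
    next
      case False
      then have "cbox c c' \<subseteq> cbox a b"
        using c by (metis Int_lower1 closure_box closure_mono box_subset_cbox closure_cbox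
          subset_trans)
      then have cU: "cbox c c' \<subseteq> U" using ab by blast
      have "set_integrable lebesgue (box c c') d"
        using L2_set_integrable[OF L2_mono(1)[OF d, of "box c c'"]] cU box_subset_cbox[of c c'] by auto
      then have "integrable lebesgue (zero_ext (box c c') d)" unfolding set_integrable_zero_ext .
      from integral_bounded_linear[OF bounded_linear_vec_nth this, of i]
      show ?thesis using box0[OF cU] unfolding set_integral_zero_ext zero_ext_nth by simp
    qed
    finally show "(LINT x:box a' b'|lebesgue. zero_ext (box a b) d x $ i) = 0" .
  qed
  then have "AE x in lebesgue. \<forall>i. zero_ext (box a b) d x $ i = 0" by (simp add: AE_all_countable)
  then show "AE x in lebesgue. x \<in> box a b \<longrightarrow> g x = g' x"
    by eventually_elim (auto simp: zero_ext_def d_def vec_eq_iff)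
qed

lemma set_integral_outside_zero:
  assumes "\<And>x. x \<notin> U \<Longrightarrow> f x = 0"
  shows "(LINT x:U|M. f x) = integral\<^sup>L M f"
proof -
  have "zero_ext U f = f" using assms by (auto simp: zero_ext_def fun_eq_iff)
  then show ?thesis by (simp add: set_integral_zero_ext)
qed

lemma weak_gradient_add:
  assumes U: "U \<in> sets lebesgue" and L: "w \<in> L2 U" "w' \<in> L2 U" "g \<in> L2 U" "g' \<in> L2 U"
    and w: "weak_gradient U w g" "weak_gradient U w' g'"
  shows "weak_gradient U (\<lambda>x. w x + w' x) (\<lambda>x. g x + g' x)"
  unfolding weak_gradient_def
proof (intro allI impI)
  fix \<phi> D\<phi> assume t: "test_function U \<phi> D\<phi>"
  note t2 = test_function_L2[OF t U]
  have "(LINT x:U|lebesgue. (w x + w' x) *\<^sub>R D\<phi> x) =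
      (LINT x:U|lebesgue. w x *\<^sub>R D\<phi> x) + (LINT x:U|lebesgue. w' x *\<^sub>R D\<phi> x)"
    unfolding scaleR_add_left
    by (rule set_integral_add(2)) (use L2_scaleR_integrable[OF _ t2(2)] L in auto)
  also have "\<dots> = - ((LINT x:U|lebesgue. \<phi> x *\<^sub>R g x) + (LINT x:U|lebesgue. \<phi> x *\<^sub>R g' x))"
    using w t unfolding weak_gradient_def by simp
  also have "(LINT x:U|lebesgue. \<phi> x *\<^sub>R g x) + (LINT x:U|lebesgue. \<phi> x *\<^sub>R g' x) =
      (LINT x:U|lebesgue. \<phi> x *\<^sub>R (g x + g' x))"
    unfolding scaleR_add_right
    by (rule set_integral_add(2)[symmetric]) (use L2_scaleR_integrable[OF t2(1)] L in auto)
  finally show "(LINT x:U|lebesgue. (w x + w' x) *\<^sub>R D\<phi> x) = - (LINT x:U|lebesgue. \<phi> x *\<^sub>R (g x + g' x))" .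
qed

lemma weak_gradient_scale:
  assumes "weak_gradient U w g"
  shows "weak_gradient U (\<lambda>x. c *\<^sub>R w x) (\<lambda>x. c *\<^sub>R g x)"
  using assms unfolding weak_gradient_def
  by (simp add: scaleR_left_commute[of _ c] scaleR_scaleR[symmetric] del: scaleR_scaleR)

lemma weak_gradient_mono:
  assumes w: "weak_gradient U w g" and U': "U' \<subseteq> U"
  shows "weak_gradient U' w g"
  unfolding weak_gradient_def
proof (intro allI impI)
  fix \<phi> D\<phi> assume t: "test_function U' \<phi> D\<phi>"
  obtain C where C: "C \<subseteq> U'" "\<forall>x. x \<notin> C \<longrightarrow> \<phi> x = 0 \<and> D\<phi> x = 0"
    using test_function_support[OF t] by auto
  have "(LINT x:S|lebesgue. w x *\<^sub>R D\<phi> x) = integral\<^sup>L lebesgue (\<lambda>x. w x *\<^sub>R D\<phi> x)"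
    "(LINT x:S|lebesgue. \<phi> x *\<^sub>R g x) = integral\<^sup>L lebesgue (\<lambda>x. \<phi> x *\<^sub>R g x)" if "U' \<subseteq> S" for S
    by (rule set_integral_outside_zero; use C that in auto)+
  note this[of U'] this[of U]
  moreover have "(LINT x:U|lebesgue. w x *\<^sub>R D\<phi> x) = - (LINT x:U|lebesgue. \<phi> x *\<^sub>R g x)"
    using w test_function_mono[OF t U'] unfolding weak_gradient_def by blast
  ultimately show "(LINT x:U'|lebesgue. w x *\<^sub>R D\<phi> x) = - (LINT x:U'|lebesgue. \<phi> x *\<^sub>R g x)"
    using U' by simp
qed

lemma weak_gradient_cong_AE:
  assumes ae: "AE x in lebesgue. x \<in> U \<longrightarrow> w x = w' x"
  shows "weak_gradient U w = weak_gradient U w'"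
proof -
  have "(LINT x:U|lebesgue. w x *\<^sub>R D\<phi> x) = (LINT x:U|lebesgue. w' x *\<^sub>R D\<phi> x)" for D\<phi> :: "real^'a \<Rightarrow> real^'a"
    by (rule set_lebesgue_integral_cong_ae(2)) (use ae in \<open>auto elim: eventually_mono\<close>)
  then show ?thesis unfolding weak_gradient_def fun_eq_iff by simp
qed

subsection \<open>Integration by parts against test functions\<close>

lemma lebesgue_integral_translation:
  fixes f :: "'a::euclidean_space \<Rightarrow> 'b::euclidean_space"
  assumes [measurable]: "f \<in> borel_measurable borel"
  shows "(\<integral>x. f (c + x) \<partial>lebesgue) = integral\<^sup>L lebesgue f"
proof -
  have "(\<integral>x. f (c + x) \<partial>lebesgue) = (\<integral>x. f (c + x) \<partial>lborel)"
    by (rule integral_completion) measurable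
  also have "\<dots> = integral\<^sup>L (distr lborel borel ((+) c)) f"
    by (subst integral_distr) auto
  also have "\<dots> = integral\<^sup>L lebesgue f"
    unfolding lborel_distr_plus by (rule integral_completion[symmetric]) measurable
  finally show ?thesis .
qed

text \<open>
  The difference quotients of \<open>\<phi>\<close> in a fixed direction have vanishing integral, since Lebesgue
  measure is invariant under translations; they converge boundedly to the directional derivative.
\<close>
lemma integral_test_gradient_zero:
  assumes t: "test_function U \<phi> D\<phi>"
  shows "(\<integral>x. D\<phi> x \<partial>lebesgue) = 0"
proof -
  obtain C where C: "compact C" "\<forall>x. x \<notin> C \<longrightarrow> \<phi> x = 0 \<and> D\<phi> x = 0"
    using test_function_support[OF t] by auto
  note c = test_function_C1[OF t]
  have cD: "continuous_on UNIV D\<phi>" and c\<phi>: "continuous_on UNIV \<phi>"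
    using C1_fun_continuous_gradient[OF c] C1_fun_continuous[OF c] .
  have m[measurable]: "\<phi> \<in> borel_measurable borel" "D\<phi> \<in> borel_measurable borel"
    using cD c\<phi> by (auto intro: borel_measurable_continuous_onI)
  obtain B where "\<And>x. x \<in> C \<Longrightarrow> norm (D\<phi> x) \<le> B"
    using compact_imp_bounded[OF compact_continuous_image[OF continuous_on_subset[OF cD] C(1)]]
    unfolding bounded_iff by blast
  then have B: "norm (D\<phi> x) \<le> max B 0" for x using C(2) by (cases "x \<in> C") (auto simp: le_max_iff_disj)
  obtain R where R: "\<And>x. x \<in> C \<Longrightarrow> norm x \<le> R"
    using compact_imp_bounded[OF C(1)] unfolding bounded_iff by blast
  have lip: "\<bar>\<phi> y - \<phi> x\<bar> \<le> max B 0 * norm (y - x)" for x y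
  proof -
    have "norm (\<phi> y - \<phi> x) \<le> max B 0 * norm (y - x)"
    proof (rule differentiable_bound[where S = UNIV and f' = "\<lambda>x h. h \<bullet> D\<phi> x"])
      fix x :: "real^'a"
      show "(\<phi> has_derivative (\<lambda>h. h \<bullet> D\<phi> x)) (at x within UNIV)"
        using C1_fun_gderiv[OF c, of x] unfolding gderiv_def .
      show "onorm (\<lambda>h. h \<bullet> D\<phi> x) \<le> max B 0"
      proof (rule onorm_bound)
        fix h
        have "\<bar>h \<bullet> D\<phi> x\<bar> \<le> norm h * norm (D\<phi> x)" by (rule Cauchy_Schwarz_ineq2)
        also have "\<dots> \<le> norm h * max B 0" using B by (intro mult_left_mono) auto
        finally show "norm (h \<bullet> D\<phi> x) \<le> max B 0 * norm h" by (simp add: mult.commute)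
      qed simp
    qed auto
    then show ?thesis by simp
  qed
  have dint: "integrable lebesgue D\<phi>"
  proof (rule Bochner_Integration.integrable_bound)
    show "integrable lebesgue (\<lambda>x. max B 0 * indicat_real (cball 0 R) x)"
      by (intro integrable_mult_right) (simp add: lmeasurable_iff_integrable[symmetric])
    show "AE x in lebesgue. norm (D\<phi> x) \<le> norm (max B 0 * indicat_real (cball 0 R) x)"
      using B C(2) R by (intro AE_I2) (auto simp: indicator_def dist_norm)
    show "D\<phi> \<in> borel_measurable lebesgue" by (rule measurable_completion) measurable
  qed
  have "(\<integral>x. D\<phi> x \<partial>lebesgue) \<bullet> e = 0" if e: "norm e = 1" for e
  proof -
    define q where "q = (\<lambda>n x. real (Suc n) * (\<phi> (inverse (real (Suc n)) *\<^sub>R e + x) - \<phi> x))"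
    have [measurable]: "q n \<in> borel_measurable borel" for n unfolding q_def by measurable
    have bound: "\<bar>q n x\<bar> \<le> max B 0 * indicat_real (cball 0 (R + 1)) x" for n x
    proof (cases "x \<in> cball 0 (R + 1)")
      case True
      have "\<bar>q n x\<bar> \<le> real (Suc n) * (max B 0 * norm (inverse (real (Suc n)) *\<^sub>R e))"
        unfolding q_def abs_mult using lip[of "inverse (real (Suc n)) *\<^sub>R e + x" x]
        by (intro mult_mono) auto
      also have "\<dots> = max B 0" using e by simp
      finally show ?thesis using True by simp
    next
      case False
      have "inverse (real (Suc n)) \<le> 1" by (simp add: field_simps)
      then have "norm (inverse (real (Suc n)) *\<^sub>R e) \<le> 1" using e by simp
      then have "norm (inverse (real (Suc n)) *\<^sub>R e + x) \<ge> norm x - 1"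
        using norm_diff_ineq[of x "inverse (real (Suc n)) *\<^sub>R e"] by (simp add: add.commute)
      then have "inverse (real (Suc n)) *\<^sub>R e + x \<notin> C" "x \<notin> C"
        using False R[of x] R[of "inverse (real (Suc n)) *\<^sub>R e + x"] by auto
      then have "q n x = 0" using C(2) by (simp add: q_def)
      then show ?thesis by simp
    qed
    have dom: "integrable lebesgue (\<lambda>x. max B 0 * indicat_real (cball 0 (R + 1) :: (real^'a) set) x)"
      by (intro integrable_mult_right) (simp add: lmeasurable_iff_integrable[symmetric])
    have zero: "(\<integral>x. q n x \<partial>lebesgue) = 0" for n
    proof -
      have i: "integrable lebesgue \<phi>"
      proof -
        have "set_integrable lebesgue (cball 0 R) \<phi>"
          by (rule L2_set_integrable[OF test_function_L2(1)[OF t]]) auto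
        moreover have "zero_ext (cball 0 R) \<phi> = \<phi>"
          using C(2) R by (auto simp: zero_ext_def fun_eq_iff dist_norm)
        ultimately show ?thesis by (simp add: set_integrable_zero_ext)
      qed
      have qi: "integrable lebesgue (q n)"
        by (rule Bochner_Integration.integrable_bound[OF dom])
          (use bound in \<open>auto intro!: measurable_completion\<close>)
      have "(\<integral>x. q n x / real (Suc n) + \<phi> x \<partial>lebesgue) = (\<integral>x. \<phi> (inverse (real (Suc n)) *\<^sub>R e + x) \<partial>lebesgue)"
        by (simp add: q_def)
      also have "\<dots> = integral\<^sup>L lebesgue \<phi>" by (rule lebesgue_integral_translation) measurable
      also have "(\<integral>x. q n x / real (Suc n) + \<phi> x \<partial>lebesgue) =
          (\<integral>x. q n x \<partial>lebesgue) / real (Suc n) + integral\<^sup>L lebesgue \<phi>"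
        using qi i by simp
      finally show ?thesis by simp
    qed
    have "(\<lambda>n. \<integral>x. q n x \<partial>lebesgue) \<longlonglongrightarrow> (\<integral>x. D\<phi> x \<bullet> e \<partial>lebesgue)"
    proof (rule integral_dominated_convergence[OF _ _ dom])
      show "(\<lambda>x. D\<phi> x \<bullet> e) \<in> borel_measurable lebesgue" "\<And>n. q n \<in> borel_measurable lebesgue"
        by (rule measurable_completion, measurable)+
      show "AE x in lebesgue. norm (q n x) \<le> max B 0 * indicat_real (cball 0 (R + 1)) x" for n
        using bound by (intro AE_I2) simp
      show "AE x in lebesgue. (\<lambda>n. q n x) \<longlonglongrightarrow> D\<phi> x \<bullet> e"
      proof (intro AE_I2)
        fix x
        have "((\<lambda>r. \<phi> (x + r *\<^sub>R e)) has_derivative (\<lambda>h. (h *\<^sub>R e) \<bullet> D\<phi> x)) (at 0)"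
          by (rule has_derivative_compose[where g = \<phi> and g' = "\<lambda>h. h \<bullet> D\<phi> x"])
            (use C1_fun_gderiv[OF c, of x] in \<open>auto simp: gderiv_def intro!: derivative_eq_intros\<close>)
        then have "((\<lambda>r. \<phi> (x + r *\<^sub>R e)) has_field_derivative (D\<phi> x \<bullet> e)) (at 0)"
          unfolding has_field_derivative_def by (simp add: inner_commute mult_commute_abs)
        then have "((\<lambda>r. (\<phi> (x + r *\<^sub>R e) - \<phi> x) / r) \<longlongrightarrow> D\<phi> x \<bullet> e) (at 0)"
          by (simp add: has_field_derivative_iff)
        moreover have "filterlim (\<lambda>n. inverse (real (Suc n))) (at 0) sequentially"
          unfolding filterlim_at using LIMSEQ_inverse_real_of_nat by auto
        ultimately have "(\<lambda>n. (\<phi> (x + inverse (real (Suc n)) *\<^sub>R e) - \<phi> x) / inverse (real (Suc n))) \<longlonglongrightarrow> D\<phi> x \<bullet> e"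
          by (rule filterlim_compose)
        then show "(\<lambda>n. q n x) \<longlonglongrightarrow> D\<phi> x \<bullet> e"
          by (simp add: q_def field_simps add.commute)
      qed
    qed
    then have "(\<integral>x. D\<phi> x \<bullet> e \<partial>lebesgue) = 0" using zero by (simp add: LIMSEQ_const_iff)
    then show ?thesis using integral_inner_left[OF dint] by simp
  qed
  then show ?thesis by (simp add: euclidean_eq_iff[where 'a = "real^'a"])
qed

text \<open>
  For a test function \<open>\<phi>\<close> the product \<open>\<phi> f\<close> is a test function as well, and its gradient has integral \<open>0\<close>.
\<close>
lemma C1_weak_gradient:
  assumes f: "C1_fun f Df" and U: "U \<in> sets lebesgue"
  shows "weak_gradient U f Df"
  unfolding weak_gradient_def
proof (intro allI impI)
  fix \<phi> D\<phi> assume t: "test_function U \<phi> D\<phi>"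
  obtain C where C: "compact C" "C \<subseteq> U" "\<forall>x. x \<notin> C \<longrightarrow> \<phi> x = 0 \<and> D\<phi> x = 0"
    using test_function_support[OF t] by auto
  have z: "(LINT x:U|lebesgue. g x) = (LINT x:C|lebesgue. g x)" if "\<And>x. x \<notin> C \<Longrightarrow> g x = 0" for g :: "real^'a \<Rightarrow> real^'a"
    using set_integral_outside_zero[of C g] set_integral_outside_zero[of U g] that C(2) by (metis subsetD)
  have bC: "bounded C" "C \<in> sets lebesgue"
    using C(1) compact_imp_bounded by (auto simp: lmeasurable_compact fmeasurableD)
  have fC: "f \<in> L2 C" "Df \<in> L2 C"
    by (rule L2_I_continuous[OF _ bC]; use C1_fun_continuous[OF f] C1_fun_continuous_gradient[OF f] in simp)+
  have "0 = (LINT x:U|lebesgue. \<phi> x *\<^sub>R Df x + f x *\<^sub>R D\<phi> x)"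
    using integral_test_gradient_zero[OF test_function_mult[OF t f]] C(2,3)
    by (subst set_integral_outside_zero) auto
  also have "\<dots> = (LINT x:C|lebesgue. \<phi> x *\<^sub>R Df x + f x *\<^sub>R D\<phi> x)" by (rule z) (use C(3) in auto)
  also have "\<dots> = (LINT x:C|lebesgue. \<phi> x *\<^sub>R Df x) + (LINT x:C|lebesgue. f x *\<^sub>R D\<phi> x)"
    by (intro set_integral_add(2) L2_scaleR_integrable fC test_function_L2[OF t] bC(2))
  also have "\<dots> = (LINT x:U|lebesgue. \<phi> x *\<^sub>R Df x) + (LINT x:U|lebesgue. f x *\<^sub>R D\<phi> x)"
    by (subst (1 2) z) (use C(3) in auto)
  finally show "(LINT x:U|lebesgue. f x *\<^sub>R D\<phi> x) = - (LINT x:U|lebesgue. \<phi> x *\<^sub>R Df x)"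
    by (simp add: eq_neg_iff_add_eq_0 add.commute)
qed

section \<open>The spaces $H^1$ and $H^1_0$\<close>

lemma H1_L2: "w \<in> H1 U \<Longrightarrow> w \<in> L2 U" by (simp add: H1_def)

lemma H1_I: "w \<in> L2 U \<Longrightarrow> g \<in> L2 U \<Longrightarrow> weak_gradient U w g \<Longrightarrow> w \<in> H1 U"
  by (auto simp: H1_def)

lemma grad_weak_gradient:
  assumes "w \<in> H1 U" shows "grad U w \<in> L2 U" "weak_gradient U w (grad U w)"
proof -
  have "\<exists>g. g \<in> L2 U \<and> weak_gradient U w g" using assms by (auto simp: H1_def)
  from someI_ex[OF this] show "grad U w \<in> L2 U" "weak_gradient U w (grad U w)"
    by (simp_all add: grad_def)
qed

definition grad_inner :: "(real^'n) set \<Rightarrow> (real^'n \<Rightarrow> real) \<Rightarrow> (real^'n \<Rightarrow> real) \<Rightarrow> real" where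
  "grad_inner U u v = L2_inner U (grad U u) (grad U v)"

lemma grad_inner_nonneg: "0 \<le> grad_inner U u u"
  by (simp add: grad_inner_def L2_inner_nonneg)

lemma H1_norm_inner: "H1_norm U w = sqrt (L2_inner U w w + grad_inner U w w)"
  by (simp add: H1_norm_def grad_inner_def L2_norm_power2)

lemma C1_H1:
  assumes "C1_fun f Df" "bounded U" "U \<in> sets lebesgue"
  shows "f \<in> H1 U"
  using assms C1_fun_continuous[OF assms(1)] C1_fun_continuous_gradient[OF assms(1)]
  by (intro H1_I[OF _ _ C1_weak_gradient] L2_I_continuous)

context
  fixes U :: "(real^'n) set"
  assumes U: "open U"
begin

lemma U_meas: "U \<in> sets lebesgue" using U by simp

lemma grad_AE:
  assumes w: "w \<in> L2 U" and g: "g \<in> L2 U" "weak_gradient U w g"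
  shows "AE x in lebesgue. x \<in> U \<longrightarrow> grad U w x = g x"
  using weak_gradient_unique[OF U _ g(1) _ g(2)] grad_weak_gradient[OF H1_I[OF w g]] by blast

lemma H1_subspace: "fun_subspace (H1 U)"
proof (rule fun_subspaceI)
  have "weak_gradient U (\<lambda>_. 0) (\<lambda>_. 0)"
    using C1_weak_gradient[OF C1_fun_const[of 0] U_meas] .
  then show "(\<lambda>_. 0) \<in> H1 U"
    by (rule H1_I[OF fun_subspace_zero[OF L2_subspace] fun_subspace_zero[OF L2_subspace]])
next
  fix u v assume u: "u \<in> H1 U" and v: "v \<in> H1 U"
  show "(\<lambda>x. u x + v x) \<in> H1 U"
    by (rule H1_I[OF _ _ weak_gradient_add[OF U_meas H1_L2[OF u] H1_L2[OF v]
          grad_weak_gradient(1)[OF u] grad_weak_gradient(1)[OF v]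
          grad_weak_gradient(2)[OF u] grad_weak_gradient(2)[OF v]]])
      (intro fun_subspace_add[OF L2_subspace] H1_L2 grad_weak_gradient u v)+
next
  fix c u assume u: "u \<in> H1 U"
  show "(\<lambda>x. c *\<^sub>R u x) \<in> H1 U"
    by (rule H1_I[OF _ _ weak_gradient_scale[OF grad_weak_gradient(2)[OF u]]])
      (intro fun_subspace_scale[OF L2_subspace] H1_L2 grad_weak_gradient u)+
qed

lemma grad_add:
  assumes u: "u \<in> H1 U" and v: "v \<in> H1 U"
  shows "AE x in lebesgue. x \<in> U \<longrightarrow> grad U (\<lambda>x. u x + v x) x = grad U u x + grad U v x"
  by (rule grad_AE[OF _ _ weak_gradient_add[OF U_meas H1_L2[OF u] H1_L2[OF v]
          grad_weak_gradient(1)[OF u] grad_weak_gradient(1)[OF v]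
          grad_weak_gradient(2)[OF u] grad_weak_gradient(2)[OF v]]])
    (intro fun_subspace_add[OF L2_subspace] H1_L2 grad_weak_gradient u v)+

lemma grad_scale:
  assumes u: "u \<in> H1 U"
  shows "AE x in lebesgue. x \<in> U \<longrightarrow> grad U (\<lambda>x. c *\<^sub>R u x) x = c *\<^sub>R grad U u x"
  by (rule grad_AE[OF _ _ weak_gradient_scale[OF grad_weak_gradient(2)[OF u]]])
    (intro fun_subspace_scale[OF L2_subspace] H1_L2 grad_weak_gradient u)+

lemma grad_inner_bilinear: "sym_bilinear (H1 U) (grad_inner U)"
proof (rule sym_bilinearI)
  fix u v w assume uvw: "u \<in> H1 U" "v \<in> H1 U" "w \<in> H1 U"
  have "grad_inner U (\<lambda>x. u x + v x) w = L2_inner U (\<lambda>x. grad U u x + grad U v x) (grad U w)"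
    unfolding grad_inner_def by (rule L2_cong_AE(3)[OF grad_add]) fact+
  then show "grad_inner U (\<lambda>x. u x + v x) w = grad_inner U u w + grad_inner U v w"
    using form_add_left[OF L2_subspace L2_inner_bilinear grad_weak_gradient(1)[OF uvw(1)]
        grad_weak_gradient(1)[OF uvw(2)] grad_weak_gradient(1)[OF uvw(3)]]
    by (simp add: grad_inner_def)
next
  fix u v assume "u \<in> H1 U" "v \<in> H1 U"
  show "grad_inner U u v = grad_inner U v u"
    by (simp add: grad_inner_def L2_inner_def inner_commute)
next
  fix c u w assume uw: "u \<in> H1 U" "w \<in> H1 U"
  have "grad_inner U (\<lambda>x. c *\<^sub>R u x) w = L2_inner U (\<lambda>x. c *\<^sub>R grad U u x) (grad U w)"
    unfolding grad_inner_def by (rule L2_cong_AE(3)[OF grad_scale]) fact+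
  then show "grad_inner U (\<lambda>x. c *\<^sub>R u x) w = c * grad_inner U u w"
    using form_scale_left[OF L2_subspace L2_inner_bilinear grad_weak_gradient(1)[OF uw(1)]
        grad_weak_gradient(1)[OF uw(2)]]
    by (simp add: grad_inner_def)
qed

lemma H1_inner_bilinear: "sym_bilinear (H1 U) (\<lambda>u v. L2_inner U u v + grad_inner U u v)"
  using grad_inner_bilinear sym_bilinear_mono[OF L2_inner_bilinear, of "H1 U" U]
  unfolding sym_bilinear_def by (auto simp: H1_L2 distrib_left subset_iff)

lemma H1_inner_nonneg: "0 \<le> L2_inner U u u + grad_inner U u u"
  by (intro add_nonneg_nonneg L2_inner_nonneg grad_inner_nonneg)

lemmas H1_norm_triangle = form_triangle[OF H1_subspace H1_inner_bilinear H1_inner_nonneg,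
    folded H1_norm_inner]

lemma H1_norm_scale:
  assumes u: "u \<in> H1 U"
  shows "H1_norm U (\<lambda>x. c *\<^sub>R u x) = \<bar>c\<bar> * H1_norm U u"
proof -
  let ?b = "\<lambda>u v. L2_inner U u v + grad_inner U u v"
  have c: "(\<lambda>x. c *\<^sub>R u x) \<in> H1 U" using fun_subspace_scale[OF H1_subspace u] .
  have "?b (\<lambda>x. c *\<^sub>R u x) (\<lambda>x. c *\<^sub>R u x) = c\<^sup>2 * ?b u u"
    using form_scale_left[OF H1_subspace H1_inner_bilinear u c, of c]
      form_scale_right[OF H1_subspace H1_inner_bilinear u u, of c]
    by (simp add: power2_eq_square)
  then show ?thesis by (simp add: H1_norm_inner real_sqrt_mult)
qed

lemma H1_norm_nonneg: "0 \<le> H1_norm U u"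
  by (simp add: H1_norm_inner H1_inner_nonneg)

lemma test_function_H1:
  assumes "test_function U \<phi> D\<phi>"
  shows "\<phi> \<in> H1 U"
  using test_function_L2[OF assms U_meas] C1_weak_gradient[OF test_function_C1[OF assms] U_meas]
  by (intro H1_I)

lemma H10_H1: "w \<in> H10 U \<Longrightarrow> w \<in> H1 U" by (simp add: H10_def)

lemma H10_I:
  assumes "w \<in> H1 U" "\<And>n::nat. test_function U (\<phi> n) (D\<phi> n)" "(\<lambda>n. H1_norm U (\<lambda>x. w x - \<phi> n x)) \<longlonglongrightarrow> 0"
  shows "w \<in> H10 U"
  unfolding H10_def using assms by (intro CollectI conjI exI[of _ \<phi>] exI[of _ D\<phi>]) auto

lemma H10_subspace: "fun_subspace (H10 U)"
proof (rule fun_subspaceI)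
  have "H1_norm U (\<lambda>x. 0) = 0"
    using H1_norm_scale[OF fun_subspace_zero[OF H1_subspace], of 0] by simp
  then show "(\<lambda>_. 0) \<in> H10 U"
    by (intro H10_I[where \<phi> = "\<lambda>n x. 0" and D\<phi> = "\<lambda>n x. 0"] fun_subspace_zero[OF H1_subspace])
      (auto simp: test_function_zero)
next
  fix u v assume uv: "u \<in> H10 U" "v \<in> H10 U"
  then obtain \<phi> D\<phi> \<psi> D\<psi> where
    \<phi>: "\<And>n::nat. test_function U (\<phi> n) (D\<phi> n)" "(\<lambda>n. H1_norm U (\<lambda>x. u x - \<phi> n x)) \<longlonglongrightarrow> 0" and
    \<psi>: "\<And>n::nat. test_function U (\<psi> n) (D\<psi> n)" "(\<lambda>n. H1_norm U (\<lambda>x. v x - \<psi> n x)) \<longlonglongrightarrow> 0"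
    unfolding H10_def by blast
  have d: "(\<lambda>x. u x - \<phi> n x) \<in> H1 U" "(\<lambda>x. v x - \<psi> n x) \<in> H1 U" for n
    by (intro fun_subspace_diff[OF H1_subspace] test_function_H1[OF \<phi>(1)] test_function_H1[OF \<psi>(1)]
        H10_H1 uv)+
  have "(\<lambda>n. H1_norm U (\<lambda>x. u x + v x - (\<phi> n x + \<psi> n x))) \<longlonglongrightarrow> 0"
  proof (rule tendsto_sandwich[OF _ _ tendsto_const])
    show "(\<lambda>n. H1_norm U (\<lambda>x. u x - \<phi> n x) + H1_norm U (\<lambda>x. v x - \<psi> n x)) \<longlonglongrightarrow> 0"
      using tendsto_add[OF \<phi>(2) \<psi>(2)] by simp
    have "H1_norm U (\<lambda>x. u x + v x - (\<phi> n x + \<psi> n x)) \<le> H1_norm U (\<lambda>x. u x - \<phi> n x) + H1_norm U (\<lambda>x. v x - \<psi> n x)" for n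
      using H1_norm_triangle[OF d] by (simp add: algebra_simps)
    then show "\<forall>\<^sub>F n in sequentially. H1_norm U (\<lambda>x. u x + v x - (\<phi> n x + \<psi> n x))
        \<le> H1_norm U (\<lambda>x. u x - \<phi> n x) + H1_norm U (\<lambda>x. v x - \<psi> n x)" by simp
  qed (use H1_norm_nonneg in simp)
  then show "(\<lambda>x. u x + v x) \<in> H10 U"
    by (rule H10_I[OF fun_subspace_add[OF H1_subspace H10_H1[OF uv(1)] H10_H1[OF uv(2)]]
          test_function_add[OF \<phi>(1) \<psi>(1)]])
next
  fix c u assume u: "u \<in> H10 U"
  then obtain \<phi> D\<phi> where
    \<phi>: "\<And>n::nat. test_function U (\<phi> n) (D\<phi> n)" "(\<lambda>n. H1_norm U (\<lambda>x. u x - \<phi> n x)) \<longlonglongrightarrow> 0"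
    unfolding H10_def by blast
  have d: "(\<lambda>x. u x - \<phi> n x) \<in> H1 U" for n
    by (intro fun_subspace_diff[OF H1_subspace] test_function_H1[OF \<phi>(1)] H10_H1 u)
  have "H1_norm U (\<lambda>x. c *\<^sub>R u x - c * \<phi> n x) = \<bar>c\<bar> * H1_norm U (\<lambda>x. u x - \<phi> n x)" for n
    using H1_norm_scale[OF d, of c] by (simp add: right_diff_distrib)
  then have "(\<lambda>n. H1_norm U (\<lambda>x. c *\<^sub>R u x - c * \<phi> n x)) \<longlonglongrightarrow> 0"
    using tendsto_mult_left[OF \<phi>(2), of "\<bar>c\<bar>"] by simp
  then show "(\<lambda>x. c *\<^sub>R u x) \<in> H10 U"
    by (rule H10_I[OF fun_subspace_scale[OF H1_subspace H10_H1[OF u]] test_function_scale[OF \<phi>(1)]])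
qed

end

section \<open>Polynomials\<close>

text \<open>
  The polynomials of degree at most \<open>k\<close>, the homogeneous ones, and, in scaled coordinates, those
  in \<open>top_polys\<close> are all of this form.
\<close>
definition monomial_span :: "('n::finite \<Rightarrow> nat) set \<Rightarrow> (real^'n \<Rightarrow> real) set" where
  "monomial_span I = {p. \<exists>c. p = (\<lambda>x. \<Sum>s\<in>I. c s * monomial s x)}"

lemma polys_span: "polys k = monomial_span {s. (\<Sum>i\<in>UNIV. s i) \<le> k}"
  by (simp add: polys_def monomial_span_def)

lemma finite_multiindices: "finite {s :: 'n::finite \<Rightarrow> nat. (\<Sum>i\<in>UNIV. s i) \<le> k}"
proof (rule finite_subset)
  show "{s :: 'n \<Rightarrow> nat. (\<Sum>i\<in>UNIV. s i) \<le> k} \<subseteq> PiE UNIV (\<lambda>_. {..k})"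
  proof
    fix s :: "'n \<Rightarrow> nat" assume s: "s \<in> {s. (\<Sum>i\<in>UNIV. s i) \<le> k}"
    have "s i \<le> k" for i using member_le_sum[of i UNIV s] s by simp
    then show "s \<in> PiE UNIV (\<lambda>_. {..k})" by auto
  qed
  show "finite (PiE (UNIV::'n set) (\<lambda>_. {..k}))" by (intro finite_PiE) auto
qed

lemma monomial_span_subspace: "fun_subspace (monomial_span I)"
proof (rule fun_subspaceI)
  show "(\<lambda>_. 0) \<in> monomial_span I"
    unfolding monomial_span_def by (intro CollectI exI[of _ "\<lambda>_. 0"]) simp
next
  fix u v assume "u \<in> monomial_span I" "v \<in> monomial_span I"
  then obtain c c' where "u = (\<lambda>x. \<Sum>s\<in>I. c s * monomial s x)" "v = (\<lambda>x. \<Sum>s\<in>I. c' s * monomial s x)"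
    unfolding monomial_span_def by auto
  then show "(\<lambda>x. u x + v x) \<in> monomial_span I"
    unfolding monomial_span_def
    by (intro CollectI exI[of _ "\<lambda>s. c s + c' s"]) (simp add: sum.distrib distrib_right)
next
  fix r u assume "u \<in> monomial_span I"
  then obtain c where "u = (\<lambda>x. \<Sum>s\<in>I. c s * monomial s x)" unfolding monomial_span_def by auto
  then show "(\<lambda>x. r *\<^sub>R u x) \<in> monomial_span I"
    unfolding monomial_span_def
    by (intro CollectI exI[of _ "\<lambda>s. r * c s"]) (simp add: sum_distrib_left mult.assoc)
qed

lemma monomial_in_span:
  assumes "finite I" "s \<in> I" shows "monomial s \<in> monomial_span I"
proof -
  have "monomial s = (\<lambda>x. \<Sum>t\<in>I. (if t = s then 1 else 0) * monomial t x)"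
  proof
    fix x
    have "(\<Sum>t\<in>I. (if t = s then 1 else 0) * monomial t x) = (\<Sum>t\<in>I. if t = s then monomial t x else 0)"
      by (intro sum.cong) auto
    then show "monomial s x = (\<Sum>t\<in>I. (if t = s then 1 else 0) * monomial t x)" using assms by simp
  qed
  then show ?thesis unfolding monomial_span_def by (intro CollectI exI)
qed

lemma monomial_span_least:
  assumes p: "p \<in> monomial_span I" and Y: "fun_subspace Y" "\<And>s. s \<in> I \<Longrightarrow> monomial s \<in> Y"
  shows "p \<in> Y"
proof -
  obtain c where c: "p = (\<lambda>x. \<Sum>s\<in>I. c s * monomial s x)" using p unfolding monomial_span_def by auto
  have "(\<lambda>x. \<Sum>s\<in>I. c s *\<^sub>R monomial s x) \<in> Y"
    by (intro fun_subspace_sum[OF Y(1)] fun_subspace_scale[OF Y(1)] Y(2))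
  then show ?thesis by (simp add: c)
qed

lemma monomial_mult: "monomial s x * monomial t x = monomial (\<lambda>i. s i + t i) x"
  by (simp add: monomial_def power_add prod.distrib)

lemma monomial_span_mult:
  assumes p: "p \<in> monomial_span I" and q: "q \<in> monomial_span J" and K: "finite K"
    and IJ: "\<And>s t. s \<in> I \<Longrightarrow> t \<in> J \<Longrightarrow> (\<lambda>i. s i + t i) \<in> K"
  shows "(\<lambda>x. p x * q x) \<in> monomial_span K"
proof -
  obtain c where c: "p = (\<lambda>x. \<Sum>s\<in>I. c s * monomial s x)" using p unfolding monomial_span_def by auto
  obtain d where d: "q = (\<lambda>x. \<Sum>s\<in>J. d s * monomial s x)" using q unfolding monomial_span_def by auto
  have "(\<lambda>x. \<Sum>s\<in>I. \<Sum>t\<in>J. (c s * d t) *\<^sub>R monomial (\<lambda>i. s i + t i) x) \<in> monomial_span K"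
    by (intro fun_subspace_sum[OF monomial_span_subspace] fun_subspace_scale[OF monomial_span_subspace]
        monomial_in_span K IJ)
  moreover have "(\<lambda>x. p x * q x) = (\<lambda>x. \<Sum>s\<in>I. \<Sum>t\<in>J. (c s * d t) *\<^sub>R monomial (\<lambda>i. s i + t i) x)"
    by (simp add: c d sum_product monomial_mult[symmetric] algebra_simps)
  ultimately show ?thesis by simp
qed

definition homogeneous_polys :: "nat \<Rightarrow> (real^'n \<Rightarrow> real) set" where
  "homogeneous_polys m = monomial_span {s. (\<Sum>i\<in>UNIV. s i) = m}"

lemma finite_homogeneous: "finite {s :: 'n::finite \<Rightarrow> nat. (\<Sum>i\<in>UNIV. s i) = m}"
  by (rule finite_subset[OF _ finite_multiindices[of m]]) auto

lemma polys_subspace: "fun_subspace (polys k)"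
  and homogeneous_polys_subspace: "fun_subspace (homogeneous_polys k)"
  by (simp_all add: polys_span homogeneous_polys_def monomial_span_subspace)

lemma monomial_span_mono: "finite J \<Longrightarrow> I \<subseteq> J \<Longrightarrow> monomial_span I \<subseteq> monomial_span J"
  using monomial_span_least[OF _ monomial_span_subspace[of J]] monomial_in_span[of J] by blast

lemma polys_mono: "j \<le> k \<Longrightarrow> polys j \<subseteq> polys k"
  unfolding polys_span by (rule monomial_span_mono[OF finite_multiindices]) auto

lemma homogeneous_polys_subset: "homogeneous_polys k \<subseteq> polys k"
  unfolding polys_span homogeneous_polys_def by (rule monomial_span_mono[OF finite_multiindices]) auto

lemma polys_mult: "p \<in> polys j \<Longrightarrow> q \<in> polys k \<Longrightarrow> (\<lambda>x. p x * q x) \<in> polys (j + k)"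
  unfolding polys_span
  by (erule monomial_span_mult) (auto simp: sum.distrib add_mono intro: finite_multiindices)

lemma homogeneous_polys_mult:
  "p \<in> homogeneous_polys j \<Longrightarrow> q \<in> homogeneous_polys k \<Longrightarrow> (\<lambda>x. p x * q x) \<in> homogeneous_polys (j + k)"
  unfolding homogeneous_polys_def
  by (erule monomial_span_mult) (auto simp: sum.distrib intro: finite_homogeneous)

lemma monomial_zero: "monomial (\<lambda>_. 0) = (\<lambda>_. 1)"
  by (simp add: monomial_def fun_eq_iff)

lemma homogeneous_const: "(\<lambda>_. c) \<in> homogeneous_polys 0"
proof -
  have "monomial (\<lambda>_. 0) \<in> homogeneous_polys 0"
    unfolding homogeneous_polys_def by (rule monomial_in_span[OF finite_homogeneous]) simp
  from fun_subspace_scale[OF homogeneous_polys_subspace this, of c] show ?thesis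
    by (simp add: monomial_zero)
qed

lemma polys_const: "(\<lambda>_. c) \<in> polys k"
  using homogeneous_const homogeneous_polys_subset polys_mono[of 0 k] by blast

lemma homogeneous_component: "(\<lambda>x. x $ j) \<in> homogeneous_polys 1"
proof -
  have eq: "monomial (\<lambda>i. if i = j then 1 else 0) = (\<lambda>x. x $ j)"
  proof
    fix x :: "real^'a"
    have "monomial (\<lambda>i. if i = j then 1 else 0) x = (\<Prod>i\<in>UNIV. if i = j then x $ i else 1)"
      unfolding monomial_def by (intro prod.cong) auto
    then show "monomial (\<lambda>i. if i = j then 1 else 0) x = x $ j" by simp
  qed
  have "monomial (\<lambda>i. if i = j then 1 else 0) \<in> homogeneous_polys 1"
    unfolding homogeneous_polys_def by (rule monomial_in_span[OF finite_homogeneous]) simp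
  then show ?thesis by (simp add: eq)
qed

text \<open>
  \<open>F\<close> is the filtration \<open>polys\<close> or the grading \<open>homogeneous_polys\<close>.
\<close>
lemma graded_prod_power:
  assumes one: "(\<lambda>_. 1::real) \<in> F (0::nat)"
    and mult: "\<And>p q j k. p \<in> F j \<Longrightarrow> q \<in> F k \<Longrightarrow> (\<lambda>x. p x * q x) \<in> F (j + k)"
    and f: "\<And>i. i \<in> J \<Longrightarrow> f i \<in> F 1" and J: "finite J"
  shows "(\<lambda>x. \<Prod>i\<in>J. f i x ^ s i) \<in> F (\<Sum>i\<in>J. s i)"
  using J f
proof (induction J)
  case empty then show ?case using one by simp
next
  case (insert i J)
  have "(\<lambda>x. f i x ^ m) \<in> F m" for m
  proof (induction m)
    case 0 then show ?case using one by simp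
  next
    case (Suc m)
    show ?case using mult[OF _ Suc, of "f i" 1] insert.prems by simp
  qed
  from mult[OF this] insert show ?case by simp
qed

lemma linear_component_homogeneous:
  fixes L :: "real^'n \<Rightarrow> real^'m"
  assumes "linear L"
  shows "(\<lambda>x. L x $ i) \<in> homogeneous_polys 1"
proof -
  have eq: "(\<lambda>x. L x $ i) = (\<lambda>x. \<Sum>j\<in>UNIV. (L (axis j 1) $ i) *\<^sub>R x $ j)"
  proof
    fix x
    have "L x = L (\<Sum>j\<in>UNIV. x $ j *\<^sub>R axis j 1)"
      using basis_expansion[of x] by (simp add: scalar_mult_eq_scaleR)
    also have "\<dots> = (\<Sum>j\<in>UNIV. x $ j *\<^sub>R L (axis j 1))"
      using assms by (simp add: linear_sum linear_cmul)
    finally show "L x $ i = (\<Sum>j\<in>UNIV. (L (axis j 1) $ i) *\<^sub>R x $ j)" by (simp add: mult.commute)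
  qed
  show ?thesis by (subst eq) (intro fun_subspace_sum[OF homogeneous_polys_subspace]
        fun_subspace_scale[OF homogeneous_polys_subspace] homogeneous_component)
qed

text \<open>
  This makes \<open>top_polys\<close> invariant under rotations, which mix monomials of the same degree.
\<close>
lemma homogeneous_polys_linear:
  fixes L :: "real^'n \<Rightarrow> real^'m"
  assumes L: "linear L" and p: "p \<in> homogeneous_polys k"
  shows "(\<lambda>x. p (L x)) \<in> homogeneous_polys k"
proof -
  have "fun_subspace {p. (\<lambda>x. p (L x)) \<in> homogeneous_polys k}"
    using homogeneous_polys_subspace[of k] unfolding fun_subspace_def by auto
  moreover have "monomial s \<in> {p. (\<lambda>x. p (L x)) \<in> homogeneous_polys k}" if "(\<Sum>i\<in>UNIV. s i) = k" for s
  proof -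
    have "(\<lambda>x. \<Prod>i\<in>UNIV. L x $ i ^ s i) \<in> homogeneous_polys (\<Sum>i\<in>UNIV. s i)"
      by (rule graded_prod_power, rule homogeneous_const, erule (1) homogeneous_polys_mult,
          rule linear_component_homogeneous[OF L], simp)
    then show ?thesis using that by (simp add: monomial_def)
  qed
  ultimately show ?thesis
    using monomial_span_least[of p] p unfolding homogeneous_polys_def by blast
qed

lemma polys_affine:
  fixes L :: "real^'n \<Rightarrow> real^'m"
  assumes L: "linear L" and p: "p \<in> polys k"
  shows "(\<lambda>x. p (a + L x)) \<in> polys k"
proof -
  have 1: "(\<lambda>x. (a + L x) $ i) \<in> polys 1" for i
    using fun_subspace_add[OF polys_subspace polys_const[of "a $ i"], of "\<lambda>x. L x $ i" 1]
      linear_component_homogeneous[OF L] homogeneous_polys_subset by (auto simp: subset_iff)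
  have "fun_subspace {p. (\<lambda>x. p (a + L x)) \<in> polys k}"
    using polys_subspace[of k] unfolding fun_subspace_def by auto
  moreover have "monomial s \<in> {p. (\<lambda>x. p (a + L x)) \<in> polys k}" if "(\<Sum>i\<in>UNIV. s i) \<le> k" for s
  proof -
    have "(\<lambda>x. \<Prod>i\<in>UNIV. (a + L x) $ i ^ s i) \<in> polys (\<Sum>i\<in>UNIV. s i)"
      by (rule graded_prod_power, rule polys_const, erule (1) polys_mult, rule 1, simp)
    then show ?thesis using polys_mono[OF that] by (auto simp: monomial_def)
  qed
  ultimately show ?thesis
    using monomial_span_least[of p] p unfolding polys_span by blast
qed

subsection \<open>Derivatives of polynomials\<close>

lemma monomial_C1: "\<exists>D. C1_fun (monomial s) D \<and> (\<forall>i. (\<lambda>x. D x $ i) \<in> polys (\<Sum>i\<in>UNIV. s i))"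
proof (induction "\<Sum>i\<in>UNIV. s i" arbitrary: s)
  case 0
  then have "s = (\<lambda>_. 0)" by auto
  then show ?case
    by (intro exI[of _ "\<lambda>_. 0"]) (simp add: monomial_zero C1_fun_const polys_const)
next
  case (Suc m)
  then obtain j where j: "s j \<noteq> 0" by (metis sum.neutral Zero_not_Suc)
  define e where "e = (\<lambda>i. if i = j then 1 else 0 :: nat)"
  define t where "t = (\<lambda>i. s i - e i)"
  have st: "s = (\<lambda>i. e i + t i)" using j by (auto simp: t_def e_def fun_eq_iff)
  have sume: "(\<Sum>i\<in>UNIV. e i) = 1" by (simp add: e_def)
  have "(\<Sum>i\<in>UNIV. s i) = (\<Sum>i\<in>UNIV. e i) + (\<Sum>i\<in>UNIV. t i)" by (subst st) (simp add: sum.distrib)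
  then have m: "m = (\<Sum>i\<in>UNIV. t i)" using Suc.hyps(2) sume by simp
  have e: "monomial e = (\<lambda>x. x $ j)"
  proof
    fix x
    have "monomial e x = (\<Prod>i\<in>UNIV. if i = j then x $ i else 1)"
      unfolding monomial_def e_def by (intro prod.cong) auto
    then show "monomial e x = x $ j" by simp
  qed
  obtain D where D: "C1_fun (monomial t) D" "\<And>i. (\<lambda>x. D x $ i) \<in> polys m"
    using Suc.hyps(1)[OF m] m by auto
  have comp: "(\<lambda>x. x $ j) \<in> polys 1" using homogeneous_component homogeneous_polys_subset by blast
  have "monomial s = (\<lambda>x. x $ j * monomial t x)"
    unfolding e[symmetric, THEN fun_cong] monomial_mult st[symmetric] ..
  then have "C1_fun (monomial s) (\<lambda>x. x $ j *\<^sub>R D x + monomial t x *\<^sub>R axis j 1)"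
    using C1_fun_mult[OF C1_fun_component D(1)] by simp
  moreover have "(\<lambda>x. (x $ j *\<^sub>R D x + monomial t x *\<^sub>R axis j 1) $ i) \<in> polys (\<Sum>i\<in>UNIV. s i)" for i
  proof -
    have "(\<lambda>x. x $ j * D x $ i) \<in> polys (Suc m)" using polys_mult[OF comp D(2)] by simp
    moreover have "monomial t \<in> polys (Suc m)"
      unfolding polys_span using m by (intro monomial_in_span finite_multiindices) auto
    ultimately have "(\<lambda>x. x $ j * D x $ i + (axis j 1 $ i) *\<^sub>R monomial t x) \<in> polys (Suc m)"
      using fun_subspace_add[OF polys_subspace _ fun_subspace_scale[OF polys_subspace]] by blast
    then show ?thesis using Suc.hyps(2) by (simp add: mult.commute)
  qed
  ultimately show ?case by blast
qed

lemma polys_C1: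
  assumes p: "p \<in> polys k"
  shows "\<exists>D. C1_fun p D \<and> (\<forall>i. (\<lambda>x. D x $ i) \<in> polys k)"
proof -
  let ?Y = "{p. \<exists>D. C1_fun p D \<and> (\<forall>i. (\<lambda>x. D x $ i) \<in> polys k)} :: (real^'a \<Rightarrow> real) set"
  have "fun_subspace ?Y"
  proof (rule fun_subspaceI)
    show "(\<lambda>_. 0) \<in> ?Y"
      by (intro CollectI exI[of _ "\<lambda>_. 0"]) (simp add: C1_fun_const polys_const)
  next
    fix u v assume "u \<in> ?Y" "v \<in> ?Y"
    then obtain D D' where D: "C1_fun u D" "\<forall>i. (\<lambda>x. D x $ i) \<in> polys k" "C1_fun v D'" "\<forall>i. (\<lambda>x. D' x $ i) \<in> polys k"
      by auto
    then show "(\<lambda>x. u x + v x) \<in> ?Y"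
      by (intro CollectI exI[of _ "\<lambda>x. D x + D' x"])
        (simp add: C1_fun_add fun_subspace_add[OF polys_subspace])
  next
    fix c u assume "u \<in> ?Y"
    then obtain D where D: "C1_fun u D" "\<forall>i. (\<lambda>x. D x $ i) \<in> polys k" by auto
    have "C1_fun (\<lambda>x. c *\<^sub>R u x) (\<lambda>x. c *\<^sub>R D x)"
      using C1_fun_mult[OF C1_fun_const[of c] D(1)] by simp
    moreover have "(\<lambda>x. (c *\<^sub>R D x) $ i) \<in> polys k" for i
      using fun_subspace_scale[OF polys_subspace, of "\<lambda>x. D x $ i" k c] D(2) by simp
    ultimately show "(\<lambda>x. c *\<^sub>R u x) \<in> ?Y" by blast
  qed
  moreover have "monomial s \<in> ?Y" if "s \<in> {s. (\<Sum>i\<in>UNIV. s i) \<le> k}" for s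
    using monomial_C1[of s] polys_mono[of "\<Sum>i\<in>UNIV. s i" k] that by (auto simp: subset_iff)
  ultimately show ?thesis using monomial_span_least[of p] p unfolding polys_span by blast
qed

lemma polys_continuous: "p \<in> polys k \<Longrightarrow> continuous_on A p"
  using polys_C1[of p k] C1_fun_continuous continuous_on_subset by blast

lemma polys_on_line:
  assumes p: "p \<in> polys k"
  shows "\<exists>P::real poly. \<forall>t. p (a + t *\<^sub>R b) = poly P t"
proof -
  let ?Y = "{p. \<exists>P::real poly. \<forall>t. p (a + t *\<^sub>R b) = poly P t}"
  have "fun_subspace ?Y"
  proof (rule fun_subspaceI)
    show "(\<lambda>_. 0) \<in> ?Y" by (intro CollectI exI[of _ 0]) simp
  next
    fix u v assume "u \<in> ?Y" "v \<in> ?Y"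
    then obtain P Q :: "real poly" where "\<forall>t. u (a + t *\<^sub>R b) = poly P t" "\<forall>t. v (a + t *\<^sub>R b) = poly Q t" by auto
    then show "(\<lambda>x. u x + v x) \<in> ?Y" by (intro CollectI exI[of _ "P + Q"]) simp
  next
    fix c u assume "u \<in> ?Y"
    then obtain P :: "real poly" where "\<forall>t. u (a + t *\<^sub>R b) = poly P t" by auto
    then show "(\<lambda>x. c *\<^sub>R u x) \<in> ?Y" by (intro CollectI exI[of _ "smult c P"]) simp
  qed
  moreover have "monomial s \<in> ?Y" for s
    by (intro CollectI exI[of _ "\<Prod>i\<in>UNIV. [:a $ i, b $ i:] ^ s i"]) (simp add: monomial_def poly_prod)
  ultimately show ?thesis using monomial_span_least[of p] p unfolding polys_span by blast
qed

lemma continuous_zero_if_AE_zero: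
  fixes f :: "'a::euclidean_space \<Rightarrow> 'b::euclidean_space"
  assumes f: "continuous_on U f" and U: "open U" and ae: "AE x in lebesgue. x \<in> U \<longrightarrow> f x = 0" and x: "x \<in> U"
  shows "f x = 0"
proof (rule ccontr)
  assume nz: "f x \<noteq> 0"
  let ?S = "U \<inter> f -` (- {0})"
  have "open ?S" using continuous_open_preimage[OF f U, of "- {0}"] by (simp add: open_Compl)
  moreover have "?S \<noteq> {}" using x nz by auto
  moreover have "negligible ?S"
  proof -
    have "AE x in lebesgue. x \<notin> ?S" using ae by eventually_elim auto
    then have "?S \<in> null_sets lebesgue"
      using \<open>open ?S\<close> by (subst AE_iff_null_sets) auto
    then show ?thesis by (simp add: negligible_iff_null_sets)
  qed
  ultimately show False using open_not_negligible by blast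
qed

text \<open>
  On each line through a point of \<open>U\<close> the polynomial \<open>p\<close> is a polynomial in one variable, whose
  derivative vanishes on an interval and hence identically.
\<close>
lemma poly_constant_if_gradient_zero:
  assumes p: "p \<in> polys k" and D: "C1_fun p D" and U: "open U" "U \<noteq> {}"
    and ae: "AE x in lebesgue. x \<in> U \<longrightarrow> D x = 0"
  shows "\<exists>c. p = (\<lambda>_. c)"
proof -
  obtain a where a: "a \<in> U" using U(2) by auto
  obtain r where r: "r > 0" "ball a r \<subseteq> U" using U(1) a openE by blast
  have zero: "D x = 0" if "x \<in> U" for x
    using continuous_zero_if_AE_zero[OF _ U(1) ae that] C1_fun_continuous_gradient[OF D] continuous_on_subset
    by blast
  have "p x = p a" for x
  proof -
    obtain P :: "real poly" where P: "\<And>t. p (a + t *\<^sub>R (x - a)) = poly P t" using polys_on_line[OF p] by blast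
    define d where "d = r / (norm (x - a) + 1)"
    have d: "d > 0" unfolding d_def using r(1) by (simp add: add_nonneg_pos)
    have "poly (pderiv P) t = 0" if t: "t \<in> {0<..<d}" for t
    proof -
      have "norm (t *\<^sub>R (x - a)) < r"
      proof -
        have "norm (t *\<^sub>R (x - a)) = t * norm (x - a)" using t by simp
        also have "\<dots> \<le> t * (norm (x - a) + 1)" using t by simp
        also have "\<dots> < d * (norm (x - a) + 1)" using t by (intro mult_strict_right_mono) (auto simp: add_nonneg_pos)
        also have "\<dots> = r"
        proof -
          have "norm (x - a) + 1 \<noteq> 0" using norm_ge_zero[of "x - a"] by linarith
          then show ?thesis by (simp add: d_def)
        qed
        finally show ?thesis .
      qed
      then have "a + t *\<^sub>R (x - a) \<in> U" using r(2) by (auto simp: dist_norm)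
      then have "GDERIV p (a + t *\<^sub>R (x - a)) :> 0" using C1_fun_gderiv[OF D] zero by metis
      then have "((\<lambda>t. p (a + t *\<^sub>R (x - a))) has_derivative (\<lambda>h. (h *\<^sub>R (x - a)) \<bullet> 0)) (at t)"
      proof -
        assume "GDERIV p (a + t *\<^sub>R (x - a)) :> 0"
        moreover have "((\<lambda>t. a + t *\<^sub>R (x - a)) has_derivative (\<lambda>h. h *\<^sub>R (x - a))) (at t)"
          by (auto intro!: derivative_eq_intros)
        ultimately show ?thesis unfolding gderiv_def using has_derivative_compose by fastforce
      qed
      then have "(poly P has_field_derivative 0) (at t)"
        unfolding P has_field_derivative_def by (simp add: lambda_zero)
      then show ?thesis using poly_DERIV DERIV_unique by blast
    qed
    then have "{0<..<d} \<subseteq> {t. poly (pderiv P) t = 0}" by auto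
    then have "infinite {t. poly (pderiv P) t = 0}"
      using d infinite_Ioo finite_subset by blast
    then have "pderiv P = 0" using poly_roots_finite by blast
    then have "degree P = 0" by (simp add: pderiv_eq_0_iff)
    then have "poly P 1 = poly P 0" by (metis degree_0_id poly_pCons poly_0 mult_zero_right)
    then show ?thesis using P[of 1] P[of 0] by simp
  qed
  then show ?thesis by (intro exI[of _ "p a"]) auto
qed

lemma poly_zero_if_AE_zero:
  assumes p: "p \<in> polys k" and U: "open U" "U \<noteq> {}" and ae: "AE x in lebesgue. x \<in> U \<longrightarrow> p x = 0"
  shows "p = (\<lambda>_. 0)"
proof -
  obtain D where D: "C1_fun p D" using polys_C1[OF p] by blast
  have zero: "p x = 0" if "x \<in> U" for x
    using continuous_zero_if_AE_zero[OF polys_continuous[OF p] U(1) ae that] .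
  have "D x = 0" if "x \<in> U" for x
    using gderiv_vanishing[OF C1_fun_gderiv[OF D] U(1) that] zero by blast
  then obtain c where c: "p = (\<lambda>_. c)" using poly_constant_if_gradient_zero[OF p D U] by auto
  then show ?thesis using zero U(2) by auto
qed

context
  fixes U :: "(real^'n) set"
  assumes U: "open U" "bounded U"
begin

lemma polys_H1: "p \<in> polys k \<Longrightarrow> p \<in> H1 U"
  using polys_C1[of p k] C1_H1[of p _ U] U by auto

lemma C1_grad_AE:
  assumes "C1_fun f Df"
  shows "AE x in lebesgue. x \<in> U \<longrightarrow> grad U f x = Df x"
  by (rule grad_AE[OF U(1) _ _ C1_weak_gradient[OF assms]])
    (use U C1_fun_continuous[OF assms] C1_fun_continuous_gradient[OF assms] in \<open>auto intro: L2_I_continuous\<close>)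

text \<open>
  The classical Laplacian \<open>q\<close> of \<open>p\<close> is the weak one by integration by parts in each component of the
  gradient.
\<close>
lemma polys_weak_laplacian:
  assumes p: "p \<in> polys k"
  shows "\<exists>q \<in> polys k. weak_laplacian U p q"
proof -
  obtain D where D: "C1_fun p D" "\<forall>i. (\<lambda>x. D x $ i) \<in> polys k" using polys_C1[OF p] by blast
  have "\<forall>i. \<exists>E. C1_fun (\<lambda>x. D x $ i) E \<and> (\<forall>j. (\<lambda>x. E x $ j) \<in> polys k)"
    using polys_C1 D(2) by blast
  from choice[OF this] obtain D2 where D2: "\<And>i. C1_fun (\<lambda>x. D x $ i) (D2 i)"
      "\<And>i j. (\<lambda>x. D2 i x $ j) \<in> polys k"
    by blast
  let ?q = "\<lambda>x. \<Sum>i\<in>UNIV. D2 i x $ i"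
  have q: "?q \<in> polys k" by (intro fun_subspace_sum[OF polys_subspace] D2)
  have meas: "U \<in> sets lebesgue" using U by simp
  have "weak_laplacian U p ?q" unfolding weak_laplacian_def
  proof (intro allI impI)
    fix \<phi> D\<phi> assume t: "test_function U \<phi> D\<phi>"
    note t2 = test_function_L2[OF t meas]
    have d2: "D2 i \<in> L2 U" for i
      by (rule L2_I_continuous[OF C1_fun_continuous_gradient[OF D2(1)] U(2) meas])
    have d1: "(\<lambda>x. D x $ i) \<in> L2 U" for i
      by (rule L2_I_continuous[OF C1_fun_continuous[OF D2(1)] U(2) meas])
    have nth: "(LINT x:U|lebesgue. F x $ i) = (LINT x:U|lebesgue. F x) $ i"
      if "set_integrable lebesgue U F" for F :: "real^'n \<Rightarrow> real^'n" and i
      using integral_bounded_linear[OF bounded_linear_vec_nth that[unfolded set_integrable_zero_ext], of i]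
      unfolding set_integral_zero_ext zero_ext_nth by simp
    have "(LINT x:U|lebesgue. grad U p x \<bullet> D\<phi> x) = (LINT x:U|lebesgue. D x \<bullet> D\<phi> x)"
      by (rule set_lebesgue_integral_cong_ae(2)) (use C1_grad_AE[OF D(1)] in \<open>auto elim: eventually_mono\<close>)
    also have "\<dots> = (LINT x:U|lebesgue. \<Sum>i\<in>UNIV. (D x $ i *\<^sub>R D\<phi> x) $ i)"
      by (simp add: inner_vec_def)
    also have "\<dots> = (\<Sum>i\<in>UNIV. (LINT x:U|lebesgue. (D x $ i *\<^sub>R D\<phi> x) $ i))"
    proof -
      have "integrable lebesgue (zero_ext U (\<lambda>x. (D x $ i *\<^sub>R D\<phi> x) $ i))" for i
        using integrable_bounded_linear[OF bounded_linear_vec_nth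
            L2_scaleR_integrable[OF d1 t2(2), unfolded set_integrable_zero_ext], of i i]
        unfolding zero_ext_nth .
      moreover have "zero_ext U (\<lambda>x. \<Sum>i\<in>UNIV. (D x $ i *\<^sub>R D\<phi> x) $ i) =
          (\<lambda>x. \<Sum>i\<in>UNIV. zero_ext U (\<lambda>x. (D x $ i *\<^sub>R D\<phi> x) $ i) x)"
        by (auto simp: zero_ext_def fun_eq_iff)
      ultimately show ?thesis unfolding set_integral_zero_ext by simp
    qed
    also have "\<dots> = (\<Sum>i\<in>UNIV. (LINT x:U|lebesgue. D x $ i *\<^sub>R D\<phi> x) $ i)"
      using nth[OF L2_scaleR_integrable[OF d1 t2(2)]] by simp
    also have "\<dots> = (\<Sum>i\<in>UNIV. - (LINT x:U|lebesgue. \<phi> x *\<^sub>R D2 i x) $ i)"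
      using C1_weak_gradient[OF D2(1) meas] t unfolding weak_gradient_def by simp
    also have "\<dots> = - (\<Sum>i\<in>UNIV. (LINT x:U|lebesgue. (\<phi> x *\<^sub>R D2 i x) $ i))"
      using nth[OF L2_scaleR_integrable[OF t2(1) d2]] by (simp add: sum_negf)
    also have "(\<Sum>i\<in>UNIV. (LINT x:U|lebesgue. (\<phi> x *\<^sub>R D2 i x) $ i)) = (LINT x:U|lebesgue. ?q x * \<phi> x)"
    proof -
      have "integrable lebesgue (zero_ext U (\<lambda>x. (\<phi> x *\<^sub>R D2 i x) $ i))" for i
        using integrable_bounded_linear[OF bounded_linear_vec_nth
            L2_scaleR_integrable[OF t2(1) d2, unfolded set_integrable_zero_ext], of i i]
        unfolding zero_ext_nth .
      moreover have "zero_ext U (\<lambda>x. ?q x * \<phi> x) =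
          (\<lambda>x. \<Sum>i\<in>UNIV. zero_ext U (\<lambda>x. (\<phi> x *\<^sub>R D2 i x) $ i) x)"
        by (auto simp: zero_ext_def fun_eq_iff sum_distrib_right sum_distrib_left mult.commute)
      ultimately show ?thesis unfolding set_integral_zero_ext by simp
    qed
    finally show "(LINT x:U|lebesgue. grad U p x \<bullet> D\<phi> x) = - (LINT x:U|lebesgue. ?q x * \<phi> x)" .
  qed
  then show ?thesis using q by blast
qed

end

section \<open>Uniqueness of continuous boundary values\<close>

text \<open>
  A product of a test function \<open>\<phi>\<close> on \<open>U\<close> and a test function \<open>\<eta>\<close> on a ball in which the boundary
  of \<open>U\<close> is flat, cut off to the half ball in \<open>U\<close>, is still a test function, as \<open>\<phi>\<close> vanishes near
  the flat boundary part.
\<close>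
lemma half_ball_test_function:
  fixes U B H :: "(real^'n) set"
  assumes \<phi>: "test_function U \<phi> D\<phi>" and \<eta>: "test_function B \<eta> D\<eta>"
    and H: "H = {x \<in> B. 0 < (x - x0) \<bullet> \<nu>}" and B: "open B"
    and flat: "\<And>x. x \<in> B \<Longrightarrow> x \<in> U \<Longrightarrow> (x - x0) \<bullet> \<nu> \<noteq> 0"
  shows "test_function H (zero_ext H (\<lambda>x. \<phi> x * \<eta> x)) (zero_ext H (\<lambda>x. \<phi> x *\<^sub>R D\<eta> x + \<eta> x *\<^sub>R D\<phi> x))"
proof -
  obtain C1 where C1: "compact C1" "C1 \<subseteq> U" "\<forall>x. x \<notin> C1 \<longrightarrow> \<phi> x = 0 \<and> D\<phi> x = 0"
    using test_function_support[OF \<phi>] by auto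
  obtain C2 where C2: "compact C2" "C2 \<subseteq> B" "\<forall>x. x \<notin> C2 \<longrightarrow> \<eta> x = 0 \<and> D\<eta> x = 0"
    using test_function_support[OF \<eta>] by auto
  let ?f = "\<lambda>x. \<phi> x * \<eta> x" and ?D = "\<lambda>x. \<phi> x *\<^sub>R D\<eta> x + \<eta> x *\<^sub>R D\<phi> x"
  define C where "C = C1 \<inter> C2 \<inter> {x. 0 \<le> (x - x0) \<bullet> \<nu>}"
  have "closed {x. 0 \<le> (x - x0) \<bullet> \<nu>}"
    by (intro closed_Collect_le continuous_intros)
  then have C: "compact C" unfolding C_def using C1(1) C2(1) by (intro compact_Int_closed compact_Int) auto
  have CH: "C \<subseteq> H" using C1(2) C2(2) flat unfolding C_def H by force
  have oH: "open H"
  proof -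
    have "H = B \<inter> {x. 0 < (x - x0) \<bullet> \<nu>}" using H by auto
    moreover have "open {x. 0 < (x - x0) \<bullet> \<nu>}" by (intro open_Collect_less continuous_intros)
    ultimately show ?thesis using B by auto
  qed
  have oC: "open (- C)" by (rule open_Compl[OF compact_imp_closed[OF C]])
  have zero: "zero_ext H ?f x = 0" "zero_ext H ?D x = 0" if "x \<notin> C" for x
  proof -
    have "x \<in> H \<Longrightarrow> x \<notin> C1 \<or> x \<notin> C2" using that by (auto simp: C_def H)
    then have "x \<in> H \<Longrightarrow> ?f x = 0 \<and> ?D x = 0" using C1(3) C2(3) by auto
    then show "zero_ext H ?f x = 0" "zero_ext H ?D x = 0" by (auto simp: zero_ext_def)
  qed
  have c: "C1_fun ?f ?D" using C1_fun_mult[OF test_function_C1[OF \<phi>] test_function_C1[OF \<eta>]] .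
  have "C1_fun (zero_ext H ?f) (zero_ext H ?D)"
    unfolding C1_fun_def
  proof
    show "\<forall>x. GDERIV (zero_ext H ?f) x :> zero_ext H ?D x"
    proof
      fix x
      show "GDERIV (zero_ext H ?f) x :> zero_ext H ?D x"
      proof (cases "x \<in> H")
        case True
        have "GDERIV ?f x :> ?D x" using C1_fun_gderiv[OF c] .
        then show ?thesis unfolding gderiv_def zero_ext_eq[OF True]
          by (rule has_derivative_transform_within_open[OF _ oH True]) (simp add: zero_ext_def)
      next
        case False
        then have x: "x \<in> - C" using CH by auto
        have "GDERIV (\<lambda>_. 0) x :> 0" by (rule GDERIV_const)
        then show ?thesis unfolding gderiv_def zero_ext_eq_0[OF False]
          by (rule has_derivative_transform_within_open[OF _ oC x]) (use zero in auto)
      qed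
    qed
    have "continuous_on H ?D"
      using C1_fun_continuous_gradient[OF c] continuous_on_subset by blast
    then have "continuous_on H (zero_ext H ?D)"
      by (rule continuous_on_eq) (simp add: zero_ext_def)
    moreover have "continuous_on (- C) (zero_ext H ?D)"
      by (rule continuous_on_eq[OF continuous_on_const[of _ 0]]) (use zero in simp)
    ultimately have "continuous_on (H \<union> - C) (zero_ext H ?D)"
      using continuous_on_open_Un[OF oH oC] by blast
    moreover have "H \<union> - C = UNIV" using CH by auto
    ultimately show "continuous_on UNIV (zero_ext H ?D)" by simp
  qed
  then show ?thesis by (rule test_functionI[OF _ C CH zero(1)])
qed

text \<open>
  If \<open>w\<close> is a test function, then \<open>w \<eta>\<close> cut off to \<open>H\<close> is a test function on \<open>H\<close> and the left-hand
  side is the \<open>\<nu>\<close>-component of the integral of its gradient.  Both terms are continuous with respect to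
  the \<open>H\<^sup>1\<close> norm of \<open>w\<close>, so the identity carries over to limits of test functions.
\<close>
lemma half_ball_integration_by_parts:
  fixes U B H :: "(real^'n) set"
  assumes U: "open U" and w: "w \<in> H10 U" and \<eta>: "test_function B \<eta> D\<eta>"
    and H: "H = {x \<in> B. 0 < (x - x0) \<bullet> \<nu>}" and B: "open B" and HU: "H \<subseteq> U"
    and flat: "\<And>x. x \<in> B \<Longrightarrow> x \<in> U \<Longrightarrow> (x - x0) \<bullet> \<nu> \<noteq> 0" and Hm: "H \<in> sets lebesgue"
  shows "L2_inner H w (\<lambda>x. D\<eta> x \<bullet> \<nu>) + L2_inner H (grad U w) (\<lambda>x. \<eta> x *\<^sub>R \<nu>) = 0"
proof -
  let ?l = "\<lambda>v. L2_inner H v (\<lambda>x. D\<eta> x \<bullet> \<nu>) + L2_inner H (grad U v) (\<lambda>x. \<eta> x *\<^sub>R \<nu>)"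
  let ?a = "\<lambda>x. D\<eta> x \<bullet> \<nu>" and ?b = "\<lambda>x. \<eta> x *\<^sub>R \<nu>"
  obtain \<phi> D\<phi> where \<phi>: "\<And>n::nat. test_function U (\<phi> n) (D\<phi> n)" "(\<lambda>n. H1_norm U (\<lambda>x. w x - \<phi> n x)) \<longlonglongrightarrow> 0"
    using w unfolding H10_def by blast
  obtain C where C: "compact C" "\<forall>x. x \<notin> C \<longrightarrow> \<eta> x = 0 \<and> D\<eta> x = 0"
    using test_function_support[OF \<eta>] by auto
  have a: "?a \<in> L2 H" and b: "?b \<in> L2 H"
    by (rule L2_I_compact_support[OF _ C(1) _ Hm];
        use C(2) C1_fun_continuous[OF test_function_C1[OF \<eta>]]
          C1_fun_continuous_gradient[OF test_function_C1[OF \<eta>]] in \<open>auto intro!: continuous_intros\<close>)+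
  have L2H: "v \<in> L2 H" "grad U v \<in> L2 H" if "v \<in> H1 U" for v
    using L2_mono(1)[OF H1_L2[OF that] HU Hm] L2_mono(1)[OF grad_weak_gradient(1)[OF that] HU Hm] .
  have wH1: "w \<in> H1 U" using H10_H1[OF U w] .
  have \<phi>H1: "\<phi> n \<in> H1 U" for n using test_function_H1[OF U \<phi>(1)] .
  have test0: "?l (\<phi> n) = 0" for n
  proof -
    have "AE x in lebesgue. x \<in> U \<longrightarrow> grad U (\<phi> n) x = D\<phi> n x"
      using grad_AE[OF U test_function_L2[OF \<phi>(1)] C1_weak_gradient[OF test_function_C1[OF \<phi>(1)]]] U
      by simp
    then have ae: "AE x in lebesgue. x \<in> H \<longrightarrow> grad U (\<phi> n) x = D\<phi> n x"
      by eventually_elim (use HU in blast)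
    have D\<phi>: "D\<phi> n \<in> L2 H" using test_function_L2(2)[OF \<phi>(1) Hm] .
    note t = half_ball_test_function[OF \<phi>(1) \<eta> H B flat, of n]
    have "?l (\<phi> n) = L2_inner H (\<phi> n) ?a + L2_inner H (D\<phi> n) ?b"
      using L2_cong_AE(3)[OF ae] by simp
    also have "\<dots> = (LINT x:H|lebesgue. \<phi> n x \<bullet> ?a x + D\<phi> n x \<bullet> ?b x)"
      unfolding L2_inner_def
      by (rule set_integral_add(2)[symmetric]; intro L2_product_integrable L2H(1) \<phi>H1 a b D\<phi>)
    also have "\<dots> = (LINT x:H|lebesgue. (\<phi> n x *\<^sub>R D\<eta> x + \<eta> x *\<^sub>R D\<phi> n x) \<bullet> \<nu>)"
      by (simp add: inner_add_left)
    also have "\<dots> = (\<integral>x. zero_ext H (\<lambda>x. \<phi> n x *\<^sub>R D\<eta> x + \<eta> x *\<^sub>R D\<phi> n x) x \<bullet> \<nu> \<partial>lebesgue)"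
      unfolding set_integral_zero_ext
      by (rule Bochner_Integration.integral_cong) (auto simp: zero_ext_def)
    also have "\<dots> = 0"
    proof -
      have "zero_ext UNIV f = f" for f :: "real^'n \<Rightarrow> real^'n" by (auto simp: zero_ext_def)
      moreover have "set_integrable lebesgue H (zero_ext H (\<lambda>x. \<phi> n x *\<^sub>R D\<eta> x + \<eta> x *\<^sub>R D\<phi> n x))"
      proof -
        obtain C' where C': "compact C'" "C' \<subseteq> H"
          "\<forall>x. x \<notin> C' \<longrightarrow> zero_ext H (\<lambda>x. \<phi> n x * \<eta> x) x = 0 \<and> zero_ext H (\<lambda>x. \<phi> n x *\<^sub>R D\<eta> x + \<eta> x *\<^sub>R D\<phi> n x) x = 0"
          using test_function_support[OF t] by auto
        have "set_integrable lebesgue C' (zero_ext H (\<lambda>x. \<phi> n x *\<^sub>R D\<eta> x + \<eta> x *\<^sub>R D\<phi> n x))"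
          by (rule L2_set_integrable[OF test_function_L2(2)[OF t]])
            (use C'(1) compact_imp_bounded in \<open>auto simp: lmeasurable_compact fmeasurableD\<close>)
        moreover have "zero_ext C' (zero_ext H (\<lambda>x. \<phi> n x *\<^sub>R D\<eta> x + \<eta> x *\<^sub>R D\<phi> n x)) =
            zero_ext H (zero_ext H (\<lambda>x. \<phi> n x *\<^sub>R D\<eta> x + \<eta> x *\<^sub>R D\<phi> n x))"
          using C' by (auto simp: zero_ext_def fun_eq_iff)
        ultimately show ?thesis by (simp add: set_integrable_zero_ext)
      qed
      then have "integrable lebesgue (zero_ext H (\<lambda>x. \<phi> n x *\<^sub>R D\<eta> x + \<eta> x *\<^sub>R D\<phi> n x))"
        unfolding set_integrable_zero_ext
        by (rule back_subst[where P = "integrable lebesgue"]) (auto simp: zero_ext_def)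
      from integral_inner_left[OF this, of \<nu>] show ?thesis
        using integral_test_gradient_zero[OF t] by simp
    qed
    finally show ?thesis .
  qed
  have diff: "?l w = ?l (\<lambda>x. w x - \<phi> n x)" for n
  proof -
    have d: "(\<lambda>x. w x - \<phi> n x) \<in> H1 U" using fun_subspace_diff[OF H1_subspace[OF U] wH1 \<phi>H1] .
    have 1: "L2_inner H (\<lambda>x. w x - \<phi> n x) ?a = L2_inner H w ?a - L2_inner H (\<phi> n) ?a"
      by (rule form_diff_left[OF L2_subspace L2_inner_bilinear L2H(1)[OF wH1] L2H(1)[OF \<phi>H1] a])
    have "AE x in lebesgue. x \<in> H \<longrightarrow> grad U (\<lambda>x. (w x - \<phi> n x) + \<phi> n x) x = grad U (\<lambda>x. w x - \<phi> n x) x + grad U (\<phi> n) x"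
      using grad_add[OF U d \<phi>H1[of n]] HU by (auto elim: eventually_mono)
    from L2_cong_AE(3)[OF this, of ?b]
    have 2: "L2_inner H (grad U w) ?b = L2_inner H (grad U (\<lambda>x. w x - \<phi> n x)) ?b + L2_inner H (grad U (\<phi> n)) ?b"
      using form_add_left[OF L2_subspace L2_inner_bilinear L2H(2)[OF d] L2H(2)[OF \<phi>H1] b] by simp
    show ?thesis using 1 2 test0[of n] by simp
  qed
  have bound: "\<bar>?l v\<bar> \<le> (L2_norm H ?a + L2_norm H ?b) * H1_norm U v" if v: "v \<in> H1 U" for v
  proof -
    have le: "L2_norm U v \<le> H1_norm U v" "L2_norm U (grad U v) \<le> H1_norm U v"
      unfolding H1_norm_def by (auto intro!: real_le_rsqrt)
    have "\<bar>L2_inner H v ?a\<bar> \<le> H1_norm U v * L2_norm H ?a"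
      using L2_Cauchy_Schwarz[OF L2H(1)[OF v] a] L2_mono(2)[OF H1_L2[OF v] HU Hm] le(1)
      by (smt (verit) L2_norm_nonneg mult_right_mono)
    moreover have "\<bar>L2_inner H (grad U v) ?b\<bar> \<le> H1_norm U v * L2_norm H ?b"
      using L2_Cauchy_Schwarz[OF L2H(2)[OF v] b] L2_mono(2)[OF grad_weak_gradient(1)[OF v] HU Hm] le(2)
      by (smt (verit) L2_norm_nonneg mult_right_mono)
    ultimately show ?thesis by (simp add: algebra_simps)
  qed
  have "(\<lambda>n. (L2_norm H ?a + L2_norm H ?b) * H1_norm U (\<lambda>x. w x - \<phi> n x)) \<longlonglongrightarrow> 0"
    using tendsto_mult_left[OF \<phi>(2), of "L2_norm H ?a + L2_norm H ?b"] by simp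
  moreover have "\<bar>?l w\<bar> \<le> (L2_norm H ?a + L2_norm H ?b) * H1_norm U (\<lambda>x. w x - \<phi> n x)" for n
    unfolding diff[of n] by (rule bound[OF fun_subspace_diff[OF H1_subspace[OF U] wH1 \<phi>H1]])
  ultimately have "\<bar>?l w\<bar> \<le> 0"
    using LIMSEQ_le_const[of _ 0 "\<bar>?l w\<bar>"] by blast
  then show ?thesis by simp
qed

text \<open>
  Moving a point of the half ball towards the plane keeps it in the ball.  Hence each point of the
  half ball is moved into the layer of thickness \<open>r / N\<close> by one of the \<open>N\<close> translations by
  \<open>- (j r / N) \<nu>\<close>, and Lebesgue measure is translation invariant.
\<close>
lemma half_ball_layer_measure:
  fixes x0 \<nu> :: "real^'n"
  assumes \<nu>: "norm \<nu> = 1" and r: "r > 0" and N: "N > 0"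
  shows "measure lebesgue {x \<in> ball x0 r. 0 < (x - x0) \<bullet> \<nu>} \<le>
         real N * measure lebesgue {x \<in> ball x0 r. 0 < (x - x0) \<bullet> \<nu> \<and> (x - x0) \<bullet> \<nu> \<le> r / real N}"
    (is "measure lebesgue ?Q \<le> real N * measure lebesgue ?A")
proof -
  define t where "t = r / real N"
  have t: "t > 0" "real N * t = r" using r N by (auto simp: t_def)
  have half: "{x. 0 < (x - x0) \<bullet> \<nu>} \<in> sets borel" "{x. (x - x0) \<bullet> \<nu> \<le> r / real N} \<in> sets borel"
    by (auto intro!: borel_open borel_closed open_Collect_less closed_Collect_le continuous_intros)
  have Ab: "?A \<in> sets borel" "?Q \<in> sets borel"
  proof -
    have "ball x0 r \<inter> ({x. 0 < (x - x0) \<bullet> \<nu>} \<inter> {x. (x - x0) \<bullet> \<nu> \<le> r / real N}) \<in> sets borel"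
      "ball x0 r \<inter> {x. 0 < (x - x0) \<bullet> \<nu>} \<in> sets borel"
      by (intro sets.Int half borel_open open_ball)+
    moreover have "ball x0 r \<inter> ({x. 0 < (x - x0) \<bullet> \<nu>} \<inter> {x. (x - x0) \<bullet> \<nu> \<le> r / real N}) = ?A"
      "ball x0 r \<inter> {x. 0 < (x - x0) \<bullet> \<nu>} = ?Q" by auto
    ultimately show "?A \<in> sets borel" "?Q \<in> sets borel" by simp_all
  qed
  have A: "?A \<in> lmeasurable" and Q: "?Q \<in> lmeasurable"
    using Ab by (auto intro!: bounded_set_imp_lmeasurable intro: bounded_subset[OF bounded_ball[of x0 r]])
  have sub: "?Q \<subseteq> (\<Union>j<N. (+) ((real j * t) *\<^sub>R \<nu>) ` ?A)"
  proof
    fix x assume x: "x \<in> ?Q"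
    define \<tau> where "\<tau> = (x - x0) \<bullet> \<nu>"
    have \<tau>: "0 < \<tau>" "\<tau> < r"
    proof -
      show "0 < \<tau>" using x by (simp add: \<tau>_def)
      have "\<tau> \<le> norm (x - x0)" unfolding \<tau>_def using norm_cauchy_schwarz[of "x - x0" \<nu>] \<nu> by simp
      then show "\<tau> < r" using x by (simp add: dist_norm norm_minus_commute)
    qed
    define j where "j = nat (\<lceil>\<tau> / t\<rceil> - 1)"
    have "0 < \<lceil>\<tau> / t\<rceil>" using \<tau> t by simp
    then have "real j = of_int \<lceil>\<tau> / t\<rceil> - 1" by (simp add: j_def)
    then have "real j < \<tau> / t" "\<tau> / t \<le> real j + 1" by linarith+
    then have j: "real j * t < \<tau>" "\<tau> \<le> real j * t + t" using t by (auto simp: field_simps)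
    have jN: "j < N"
    proof -
      have "real j * t < real N * t" using j(1) \<tau>(2) t(2) by simp
      then show ?thesis using t(1) by simp
    qed
    define z where "z = x - (real j * t) *\<^sub>R \<nu>"
    have \<nu>\<nu>: "\<nu> \<bullet> \<nu> = 1" using \<nu> by (simp add: norm_eq_sqrt_inner)
    have z\<tau>: "(z - x0) \<bullet> \<nu> = \<tau> - real j * t"
      by (simp add: z_def \<tau>_def inner_diff_left \<nu>\<nu>)
    have "(norm (z - x0))\<^sup>2 = (norm (x - x0))\<^sup>2 - (real j * t) * (2 * \<tau> - real j * t)"
      unfolding power2_norm_eq_inner z_def \<tau>_def
      by (simp add: inner_diff_left inner_diff_right \<nu>\<nu> inner_commute algebra_simps)
    also have "\<dots> \<le> (norm (x - x0))\<^sup>2"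
      using j(1) \<tau>(1) t(1) mult_nonneg_nonneg[of "real j * t" "2 * \<tau> - real j * t"] by simp
    finally have "norm (z - x0) \<le> norm (x - x0)" by (rule power2_le_imp_le) simp
    then have "z \<in> ?A" using x j z\<tau> by (auto simp: dist_norm norm_minus_commute t_def)
    moreover have "x = (real j * t) *\<^sub>R \<nu> + z" by (simp add: z_def)
    ultimately show "x \<in> (\<Union>j<N. (+) ((real j * t) *\<^sub>R \<nu>) ` ?A)" using jN by blast
  qed
  have tr: "(+) c ` ?A \<in> lmeasurable" for c using A by (simp add: measurable_translation)
  have "measure lebesgue ?Q \<le> measure lebesgue (\<Union>j<N. (+) ((real j * t) *\<^sub>R \<nu>) ` ?A)"
    using tr by (intro measure_mono_fmeasurable[OF sub] fmeasurableD[OF Q] fmeasurable.finite_UN) auto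
  also have "\<dots> \<le> (\<Sum>j<N. measure lebesgue ((+) ((real j * t) *\<^sub>R \<nu>) ` ?A))"
    using tr by (intro measure_UNION_le) (auto dest: fmeasurableD)
  also have "\<dots> = real N * measure lebesgue ?A" by (simp add: measure_translation)
  finally show ?thesis .
qed

text \<open>
  Near a flat boundary point \<open>x0\<close> with inner normal \<open>\<nu>\<close>, integration by parts on the half ball has no
  boundary term for \<open>w \<in> H10 U\<close>.  It is applied to \<open>\<eta> = \<beta> \<zeta>\<close> with a bump function \<open>\<beta>\<close> that decreases in the
  direction \<open>\<nu>\<close> and a cut-off function \<open>\<zeta>\<close> supported in the layer of thickness \<open>\<rho> / N\<close> at the boundary.
  If \<open>w \<ge> \<delta> > 0\<close> near \<open>x0\<close>, the term with the normal derivative of \<open>\<eta>\<close> stays away from \<open>0\<close>, since the slope \<open>N / \<rho>\<close>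
  of \<open>\<zeta>\<close> balances the measure of the layer, whereas the term with the gradient of \<open>w\<close> tends to \<open>0\<close> for \<open>N \<rightarrow> \<infinity>\<close>.
\<close>
lemma H10_not_positive_at_flat_point:
  fixes U :: "(real^'n) set"
  assumes U: "open U" and w: "w \<in> H10 U" and cont: "continuous_on (closure U) w"
    and \<nu>: "norm \<nu> = 1" and \<epsilon>: "\<epsilon> > 0" and x0: "x0 \<in> closure U"
    and HU: "{x \<in> ball x0 \<epsilon>. 0 < (x - x0) \<bullet> \<nu>} \<subseteq> U"
    and flat: "\<And>x. x \<in> ball x0 \<epsilon> \<Longrightarrow> x \<in> U \<Longrightarrow> (x - x0) \<bullet> \<nu> \<noteq> 0"
  shows "w x0 \<le> 0"
proof (rule ccontr)
  assume "\<not> w x0 \<le> 0"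
  define \<delta> where "\<delta> = w x0 / 2"
  have \<delta>: "\<delta> > 0" "w x0 = 2 * \<delta>" using \<open>\<not> w x0 \<le> 0\<close> by (auto simp: \<delta>_def)
  obtain r1 where r1: "r1 > 0" "\<And>x. x \<in> closure U \<Longrightarrow> dist x x0 < r1 \<Longrightarrow> dist (w x) (w x0) < \<delta>"
    using cont x0 \<delta>(1) unfolding continuous_on_iff by metis
  define \<rho> where "\<rho> = min r1 \<epsilon> / 2"
  have \<rho>: "\<rho> > 0" "\<rho> < r1" "\<rho> < \<epsilon>" using r1(1) \<epsilon> by (auto simp: \<rho>_def)
  define B where "B = ball x0 \<epsilon>"
  define H where "H = {x \<in> B. 0 < (x - x0) \<bullet> \<nu>}"
  define Q where "Q = {x \<in> ball x0 (\<rho> / 2). 0 < (x - x0) \<bullet> \<nu>}"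
  have \<nu>\<nu>: "\<nu> \<bullet> \<nu> = 1" using \<nu> by (simp add: norm_eq_sqrt_inner)
  have oHs: "open {x. 0 < (x - x0) \<bullet> \<nu>}" by (intro open_Collect_less continuous_intros)
  have "H = B \<inter> {x. 0 < (x - x0) \<bullet> \<nu>}" by (auto simp: H_def)
  then have oH: "open H" using oHs by (simp add: B_def open_Int)
  have bH: "bounded H" by (rule bounded_subset[OF bounded_ball[of x0 \<epsilon>]]) (auto simp: H_def B_def)
  have Hm: "H \<in> sets lebesgue" using oH by simp
  have HU': "H \<subseteq> U" using HU by (simp add: H_def B_def)
  have wpos: "w x > \<delta>" if "x \<in> H" "norm (x - x0) \<le> \<rho>" for x
    using r1(2)[of x] that HU' closure_subset[of U] \<rho>(2) \<delta>(2) by (auto simp: dist_norm abs_diff_less_iff)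
  define \<beta> where "\<beta> = (\<lambda>x. (max 0 (\<rho>\<^sup>2 + (-1) * ((x - x0) \<bullet> (x - x0))))\<^sup>2)"
  define D\<beta> where "D\<beta> = (\<lambda>x. (2 * max 0 (\<rho>\<^sup>2 + (-1) * ((x - x0) \<bullet> (x - x0)))) *\<^sub>R ((-2) *\<^sub>R (x - x0)))"
  have \<beta>C: "C1_fun \<beta> D\<beta>"
  proof -
    have "C1_fun (\<lambda>x. \<rho>\<^sup>2 + (-1) * ((x - x0) \<bullet> (x - x0))) (\<lambda>x. (-2) *\<^sub>R (x - x0))"
      unfolding C1_fun_def gderiv_def
      by (auto intro!: derivative_eq_intros continuous_intros simp: inner_commute algebra_simps)
    from C1_fun_pos_part_power2[OF this] show ?thesis unfolding \<beta>_def D\<beta>_def .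
  qed
  have \<beta>0: "\<beta> x = 0" "D\<beta> x = 0" if "norm (x - x0) \<ge> \<rho>" for x
  proof -
    have "\<rho>\<^sup>2 \<le> (norm (x - x0))\<^sup>2" using that \<rho>(1) by (intro power_mono) auto
    then have "max 0 (\<rho>\<^sup>2 + (-1) * ((x - x0) \<bullet> (x - x0))) = 0" by (simp add: power2_norm_eq_inner)
    then show "\<beta> x = 0" "D\<beta> x = 0" by (simp_all add: \<beta>_def D\<beta>_def)
  qed
  have \<beta>nn: "0 \<le> \<beta> x" for x by (simp add: \<beta>_def)
  have \<beta>le: "\<beta> x \<le> (\<rho>\<^sup>2)\<^sup>2" for x
    unfolding \<beta>_def by (intro power_mono) auto
  have \<beta>low: "(\<rho>\<^sup>2 / 2)\<^sup>2 \<le> \<beta> x" if "norm (x - x0) < \<rho> / 2" for x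
  proof -
    have "(norm (x - x0))\<^sup>2 \<le> (\<rho> / 2)\<^sup>2" using that by (intro power_mono) auto
    then have "(x - x0) \<bullet> (x - x0) \<le> \<rho>\<^sup>2 / 4" by (simp add: power2_norm_eq_inner power_divide)
    then have "(x - x0) \<bullet> (x - x0) \<le> \<rho>\<^sup>2 / 2" using inner_ge_zero[of "x - x0"] by linarith
    then have "\<rho>\<^sup>2 / 2 \<le> max 0 (\<rho>\<^sup>2 + (-1) * ((x - x0) \<bullet> (x - x0)))" by linarith
    then show ?thesis unfolding \<beta>_def by (intro power_mono) auto
  qed
  define \<tau> where "\<tau> = (\<lambda>x. (x - x0) \<bullet> \<nu>)"
  define \<zeta> where "\<zeta> = (\<lambda>N x. (max 0 (1 + (- (real N / \<rho>)) * \<tau> x))\<^sup>2)"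
  define D\<zeta> where "D\<zeta> = (\<lambda>N x. (2 * max 0 (1 + (- (real N / \<rho>)) * \<tau> x)) *\<^sub>R ((- (real N / \<rho>)) *\<^sub>R \<nu>))"
  have \<zeta>C: "C1_fun (\<zeta> N) (D\<zeta> N)" for N
  proof -
    have "C1_fun (\<lambda>x. 1 + (- (real N / \<rho>)) * \<tau> x) (\<lambda>x. (- (real N / \<rho>)) *\<^sub>R \<nu>)"
      unfolding C1_fun_def gderiv_def \<tau>_def using \<rho>(1)
      by (auto intro!: derivative_eq_intros continuous_intros)
    from C1_fun_pos_part_power2[OF this] show ?thesis unfolding \<zeta>_def D\<zeta>_def .
  qed
  define \<eta> where "\<eta> = (\<lambda>N x. \<beta> x * \<zeta> N x)"
  define D\<eta> where "D\<eta> = (\<lambda>N x. \<beta> x *\<^sub>R D\<zeta> N x + \<zeta> N x *\<^sub>R D\<beta> x)"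
  have test: "test_function B (\<eta> N) (D\<eta> N)" for N
  proof -
    have "test_function B \<beta> D\<beta>"
      by (rule test_functionI[OF \<beta>C, of "cball x0 \<rho>"])
        (use \<rho> \<beta>0 in \<open>auto simp: B_def dist_norm norm_minus_commute\<close>)
    from test_function_mult[OF this \<zeta>C] show ?thesis unfolding \<eta>_def D\<eta>_def .
  qed
  have flat': "\<And>x. x \<in> B \<Longrightarrow> x \<in> U \<Longrightarrow> (x - x0) \<bullet> \<nu> \<noteq> 0" using flat by (simp add: B_def)
  define P where "P = (\<lambda>N x. w x * (- (D\<eta> N x \<bullet> \<nu>)))"
  define G where "G = (\<lambda>N x. grad U w x \<bullet> (\<eta> N x *\<^sub>R \<nu>))"
  have wH1: "w \<in> H1 U" by (rule H10_H1[OF U w])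
  have wH: "w \<in> L2 H" and gH: "grad U w \<in> L2 H"
    by (rule L2_mono(1)[OF H1_L2[OF wH1] HU' Hm], rule L2_mono(1)[OF grad_weak_gradient(1)[OF wH1] HU' Hm])
  have eL: "(\<lambda>x. D\<eta> N x \<bullet> \<nu>) \<in> L2 H" "(\<lambda>x. \<eta> N x *\<^sub>R \<nu>) \<in> L2 H" for N
    by (rule L2_I_continuous[OF _ bH Hm];
        use C1_fun_continuous[OF test_function_C1[OF test[of N]]]
          C1_fun_continuous_gradient[OF test_function_C1[OF test[of N]]] in \<open>auto intro!: continuous_intros\<close>)+
  have parts: "(LINT x:H|lebesgue. P N x) = (LINT x:H|lebesgue. G N x)" for N
  proof -
    have "(LINT x:H|lebesgue. P N x) = - L2_inner H w (\<lambda>x. D\<eta> N x \<bullet> \<nu>)"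
      unfolding P_def L2_inner_def set_lebesgue_integral_def by simp
    moreover have "open B" by (simp add: B_def)
    ultimately show ?thesis
      using half_ball_integration_by_parts[OF U w test H_def _ HU' flat' Hm, of N]
      by (simp add: G_def L2_inner_def)
  qed
  have Pint: "set_integrable lebesgue H (P N)" for N
    using L2_product_integrable[OF wH eL(1)] unfolding P_def by (simp add: set_integrable_def)
  have normal: "- (D\<eta> N x \<bullet> \<nu>) = \<beta> x * (2 * max 0 (1 + (- (real N / \<rho>)) * \<tau> x)) * (real N / \<rho>) +
      \<zeta> N x * ((2 * max 0 (\<rho>\<^sup>2 + (-1) * ((x - x0) \<bullet> (x - x0)))) * (2 * \<tau> x))" for N x
    by (simp add: D\<eta>_def D\<zeta>_def D\<beta>_def inner_add_left \<nu>\<nu> \<tau>_def algebra_simps)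
  have \<tau>H: "\<tau> x > 0" if "x \<in> H" for x using that by (simp add: H_def \<tau>_def)
  \<comment> \<open>In the layer \<open>A N\<close> the slope of \<open>\<zeta> N\<close> in the direction \<open>- \<nu>\<close> is at least \<open>N / \<rho>\<close>, as the
    layer reaches only half way through the support of \<open>\<zeta> N\<close>.\<close>
  define A where "A = (\<lambda>N. {x \<in> ball x0 (\<rho> / 2). 0 < (x - x0) \<bullet> \<nu> \<and> (x - x0) \<bullet> \<nu> \<le> (\<rho> / 2) / real N})"
  define \<kappa> where "\<kappa> = \<delta> * (\<rho>\<^sup>2 / 2)\<^sup>2 / \<rho> * measure lebesgue Q"
  have Qpos: "measure lebesgue Q > 0"
  proof -
    have "Q = ball x0 (\<rho> / 2) \<inter> {x. 0 < (x - x0) \<bullet> \<nu>}" by (auto simp: Q_def)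
    then have oQ: "open Q" using oHs by (simp add: open_Int)
    moreover have "x0 + (\<rho> / 4) *\<^sub>R \<nu> \<in> Q" using \<rho>(1) \<nu> by (simp add: Q_def dist_norm \<nu>\<nu>)
    ultimately have "\<not> negligible Q" using open_not_negligible by blast
    moreover have "Q \<in> lmeasurable"
      using oQ by (intro bounded_set_imp_lmeasurable bounded_subset[OF bounded_ball[of x0 "\<rho> / 2"]]) (auto simp: Q_def)
    ultimately show ?thesis using negligible_iff_measure zero_less_measure_iff by blast
  qed
  then have \<kappa>: "\<kappa> > 0" using \<delta>(1) \<rho>(1) by (simp add: \<kappa>_def)
  have lower: "\<kappa> \<le> (LINT x:H|lebesgue. P N x)" if N: "N > 0" for N
  proof -
    define c where "c = \<delta> * (\<rho>\<^sup>2 / 2)\<^sup>2 * (real N / \<rho>)"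
    have c: "c > 0" using \<delta>(1) \<rho>(1) N by (simp add: c_def)
    have "A N = ball x0 (\<rho> / 2) \<inter> ({x. 0 < (x - x0) \<bullet> \<nu>} \<inter> {x. (x - x0) \<bullet> \<nu> \<le> (\<rho> / 2) / real N})"
      by (auto simp: A_def)
    moreover have "closed {x. (x - x0) \<bullet> \<nu> \<le> (\<rho> / 2) / real N}" by (intro closed_Collect_le continuous_intros)
    ultimately have "A N \<in> sets borel" using oHs by auto
    then have Am: "A N \<in> lmeasurable"
      by (intro bounded_set_imp_lmeasurable bounded_subset[OF bounded_ball[of x0 "\<rho> / 2"]]) (auto simp: A_def)
    have pointwise: "c * indicat_real (A N) x \<le> zero_ext H (P N) x" for x
    proof (cases "x \<in> H")
      case True
      note tp = \<tau>H[OF True]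
      have second: "0 \<le> \<zeta> N x * ((2 * max 0 (\<rho>\<^sup>2 + (-1) * ((x - x0) \<bullet> (x - x0)))) * (2 * \<tau> x))"
        using tp by (simp add: \<zeta>_def)
      have first: "0 \<le> \<beta> x * (2 * max 0 (1 + (- (real N / \<rho>)) * \<tau> x)) * (real N / \<rho>)"
        using \<beta>nn \<rho>(1) by simp
      show ?thesis
      proof (cases "norm (x - x0) \<le> \<rho>")
        case near: True
        have wx: "w x > \<delta>" using wpos[OF True near] .
        show ?thesis
        proof (cases "x \<in> A N")
          case A: True
          have bx: "(\<rho>\<^sup>2 / 2)\<^sup>2 \<le> \<beta> x" using A by (intro \<beta>low) (simp add: A_def dist_norm norm_minus_commute)
          have "\<tau> x \<le> (\<rho> / 2) / real N" using A by (simp add: A_def \<tau>_def)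
          then have "(real N / \<rho>) * \<tau> x \<le> 1 / 2" using N \<rho>(1) by (simp add: field_simps)
          then have "1 / 2 \<le> 1 + (- (real N / \<rho>)) * \<tau> x" by simp
          then have "1 / 2 \<le> max 0 (1 + (- (real N / \<rho>)) * \<tau> x)"
            by (rule order_trans[OF _ max.cobounded2])
          then have "2 * (1 / 2) \<le> 2 * max 0 (1 + (- (real N / \<rho>)) * \<tau> x)"
            by (rule mult_left_mono) simp
          moreover have "2 * (1 / 2 :: real) = 1" by simp
          ultimately have slope: "1 \<le> 2 * max 0 (1 + (- (real N / \<rho>)) * \<tau> x)" by (simp only:)
          have "(\<rho>\<^sup>2 / 2)\<^sup>2 * 1 \<le> \<beta> x * (2 * max 0 (1 + (- (real N / \<rho>)) * \<tau> x))"
            by (rule mult_mono[OF bx slope \<beta>nn]) simp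
          then have "(\<rho>\<^sup>2 / 2)\<^sup>2 * (real N / \<rho>) \<le> \<beta> x * (2 * max 0 (1 + (- (real N / \<rho>)) * \<tau> x)) * (real N / \<rho>)"
            using \<rho>(1) by (intro mult_right_mono) auto
          then have "(\<rho>\<^sup>2 / 2)\<^sup>2 * (real N / \<rho>) \<le> - (D\<eta> N x \<bullet> \<nu>)" unfolding normal using second by linarith
          then have "\<delta> * ((\<rho>\<^sup>2 / 2)\<^sup>2 * (real N / \<rho>)) \<le> w x * (- (D\<eta> N x \<bullet> \<nu>))"
            using wx \<delta>(1) \<rho>(1) by (intro mult_mono) auto
          then show ?thesis using A True by (simp add: P_def zero_ext_def c_def mult.assoc)
        next
          case False
          have "0 \<le> - (D\<eta> N x \<bullet> \<nu>)" unfolding normal using first second by linarith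
          then have "0 \<le> w x * (- (D\<eta> N x \<bullet> \<nu>))" using wx \<delta>(1) by (intro mult_nonneg_nonneg) auto
          then show ?thesis using False True by (simp add: P_def zero_ext_def)
        qed
      next
        case False
        then have "D\<eta> N x = 0" using \<beta>0[of x] by (simp add: D\<eta>_def)
        moreover have "x \<notin> A N" using False \<rho>(1) by (auto simp: A_def dist_norm norm_minus_commute)
        ultimately show ?thesis by (simp add: P_def zero_ext_def)
      qed
    next
      case False
      have "x \<notin> A N" using False \<rho> by (auto simp: A_def H_def B_def)
      then show ?thesis using False by (simp add: zero_ext_def)
    qed
    have "\<kappa> = \<delta> * (\<rho>\<^sup>2 / 2)\<^sup>2 / \<rho> * measure lebesgue Q" by (simp add: \<kappa>_def)
    also have "\<dots> \<le> \<delta> * (\<rho>\<^sup>2 / 2)\<^sup>2 / \<rho> * (real N * measure lebesgue (A N))"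
      unfolding Q_def A_def using half_ball_layer_measure[OF \<nu> _ N, of "\<rho> / 2" x0] \<rho>(1) \<delta>(1)
      by (intro mult_left_mono) auto
    also have "\<dots> = c * measure lebesgue (A N)" by (simp add: c_def)
    also have "\<dots> = (\<integral>x. c * indicat_real (A N) x \<partial>lebesgue)" by simp
    also have "\<dots> \<le> (\<integral>x. zero_ext H (P N) x \<partial>lebesgue)"
    proof (rule integral_mono[OF _ _ pointwise])
      show "integrable lebesgue (\<lambda>x. c * indicat_real (A N) x)"
        using Am by (intro integrable_mult_right) (simp add: lmeasurable_iff_integrable[symmetric])
      show "integrable lebesgue (zero_ext H (P N))" using Pint unfolding set_integrable_zero_ext .
    qed
    finally show ?thesis unfolding set_integral_zero_ext .
  qed
  have lim: "(\<lambda>N. LINT x:H|lebesgue. G N x) \<longlonglongrightarrow> 0"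
  proof -
    let ?W = "\<lambda>x. (\<rho>\<^sup>2)\<^sup>2 * norm (zero_ext H (grad U w) x)"
    have "(\<lambda>N. \<integral>x. zero_ext H (G N) x \<partial>lebesgue) \<longlonglongrightarrow> (\<integral>x. 0 \<partial>(lebesgue :: (real^'n) measure))"
    proof (rule integral_dominated_convergence[where w = ?W])
      show "zero_ext H (G N) \<in> borel_measurable lebesgue" for N
        using L2_product_integrable[OF gH eL(2)] unfolding G_def set_integrable_zero_ext
        by (rule borel_measurable_integrable)
      show "integrable lebesgue ?W"
        using L2_set_integrable[OF gH bH Hm] unfolding set_integrable_zero_ext by simp
      show "AE x in lebesgue. norm (zero_ext H (G N) x) \<le> ?W x" for N
      proof (intro AE_I2)
        fix x
        show "norm (zero_ext H (G N) x) \<le> ?W x"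
        proof (cases "x \<in> H")
          case True
          have "\<zeta> N x \<le> 1" unfolding \<zeta>_def using \<tau>H[OF True] \<rho>(1) by (intro power_le_one) (auto simp: max_def)
          then have "\<beta> x * \<zeta> N x \<le> (\<rho>\<^sup>2)\<^sup>2 * 1" using \<beta>nn \<beta>le by (intro mult_mono) (auto simp: \<zeta>_def)
          then have e: "\<bar>\<eta> N x\<bar> \<le> (\<rho>\<^sup>2)\<^sup>2" unfolding \<eta>_def using \<beta>nn by (simp add: \<zeta>_def abs_mult)
          have "\<bar>grad U w x \<bullet> (\<eta> N x *\<^sub>R \<nu>)\<bar> \<le> norm (grad U w x) * norm (\<eta> N x *\<^sub>R \<nu>)"
            by (rule Cauchy_Schwarz_ineq2)
          also have "\<dots> \<le> norm (grad U w x) * (\<rho>\<^sup>2)\<^sup>2" using e \<nu> by (intro mult_left_mono) auto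
          finally show ?thesis using True by (simp add: G_def zero_ext_def mult.commute)
        qed (simp add: zero_ext_def)
      qed
      show "AE x in lebesgue. (\<lambda>N. zero_ext H (G N) x) \<longlonglongrightarrow> 0"
      proof (intro AE_I2)
        fix x
        show "(\<lambda>N. zero_ext H (G N) x) \<longlonglongrightarrow> 0"
        proof (cases "x \<in> H")
          case True
          obtain N0 where N0: "real N0 > \<rho> / \<tau> x" using reals_Archimedean2 by blast
          have "\<forall>\<^sub>F N in sequentially. zero_ext H (G N) x = 0"
            using eventually_ge_at_top[of N0]
          proof eventually_elim
            case (elim N)
            have "\<rho> / \<tau> x < real N" using N0 elim by linarith
            then have "1 + (- (real N / \<rho>)) * \<tau> x \<le> 0" using \<tau>H[OF True] \<rho>(1) by (simp add: field_simps)
            then have "\<zeta> N x = 0" by (simp add: \<zeta>_def)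
            then show ?case by (simp add: G_def \<eta>_def zero_ext_def)
          qed
          then show ?thesis by (rule tendsto_eventually)
        qed (simp add: zero_ext_def)
      qed
    qed auto
    then show ?thesis unfolding set_integral_zero_ext by simp
  qed
  have "\<kappa> \<le> 0"
  proof (rule LIMSEQ_le_const[OF lim])
    show "\<exists>M. \<forall>N\<ge>M. \<kappa> \<le> (LINT x:H|lebesgue. G N x)"
      using lower parts by (intro exI[of _ 1]) auto
  qed
  then show False using \<kappa> by simp
qed

text \<open>
  The half balls on the two sides of the hyperplane do not meet the boundary, so the one that meets
  \<open>U\<close> is contained in \<open>U\<close>.  The one-sided bound applies to \<open>w\<close> and to \<open>- w\<close>.
\<close>
lemma H10_vanishes_at_flat_point:
  fixes U :: "(real^'n) set"
  assumes U: "open U" and w: "w \<in> H10 U" and cont: "continuous_on (closure U) w"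
    and \<nu>: "norm \<nu> = 1" and \<epsilon>: "\<epsilon> > 0" and x0: "x0 \<in> frontier U"
    and flat: "\<And>x. x \<in> ball x0 \<epsilon> \<Longrightarrow> x \<in> frontier U \<longleftrightarrow> (x - x0) \<bullet> \<nu> = 0"
  shows "w x0 = 0"
proof -
  have fU: "frontier U \<inter> U = {}" using U by (auto simp: frontier_def interior_open)
  have x0c: "x0 \<in> closure U" using x0 by (simp add: frontier_def)
  then obtain y where y: "y \<in> U" "dist y x0 < \<epsilon>" using \<epsilon> by (meson closure_approachable)
  have yb: "y \<in> ball x0 \<epsilon>" using y(2) by (simp add: dist_commute)
  have ynz: "(y - x0) \<bullet> \<nu> \<noteq> 0" using flat[OF yb] fU y(1) by blast
  obtain \<mu> where \<mu>: "norm \<mu> = 1" "0 < (y - x0) \<bullet> \<mu>" "\<mu> = \<nu> \<or> \<mu> = - \<nu>"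
  proof (cases "0 < (y - x0) \<bullet> \<nu>")
    case True then show ?thesis using that[of \<nu>] \<nu> by simp
  next
    case False then show ?thesis using that[of "- \<nu>"] \<nu> ynz by simp
  qed
  have flat\<mu>: "x \<in> frontier U \<longleftrightarrow> (x - x0) \<bullet> \<mu> = 0" if "x \<in> ball x0 \<epsilon>" for x
    using flat[OF that] \<mu>(3) by auto
  let ?H = "{x \<in> ball x0 \<epsilon>. 0 < (x - x0) \<bullet> \<mu>}"
  have "?H = ball x0 \<epsilon> \<inter> {x. \<mu> \<bullet> x > \<mu> \<bullet> x0}" by (auto simp: inner_diff_right inner_commute)
  then have "connected ?H" by (auto intro!: convex_connected convex_Int convex_halfspace_gt)
  moreover have "?H \<inter> frontier U = {}" using flat\<mu> by auto
  moreover have "?H \<inter> U \<noteq> {}" using y yb \<mu>(2) by auto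
  ultimately have HU: "?H \<subseteq> U" using connected_Int_frontier[of ?H U] by blast
  have fl: "(x - x0) \<bullet> \<mu> \<noteq> 0" if "x \<in> ball x0 \<epsilon>" "x \<in> U" for x using flat\<mu>[OF that(1)] that(2) fU by blast
  have "w x0 \<le> 0" by (rule H10_not_positive_at_flat_point[OF U w cont \<mu>(1) \<epsilon> x0c HU fl])
  moreover have "(-1) *\<^sub>R w x0 \<le> 0"
    by (rule H10_not_positive_at_flat_point[OF U fun_subspace_scale[OF H10_subspace[OF U] w] _ \<mu>(1) \<epsilon> x0c HU fl])
      (auto intro: continuous_intros cont)
  ultimately show ?thesis by simp
qed

section \<open>Polygons and polyhedra\<close>

text \<open>
  On a trace domain, continuous boundary values of \<open>H\<^sup>1\<close> functions are unique at the points of \<open>V\<close>.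
  This property of the elements, and of the faces of polyhedra, with their vertices makes the vertex
  average of a trace, and with it the projection \<open>Pi_nabla\<close>, independent of the choice of the trace.
\<close>
definition trace_domain :: "(real^'n) set \<Rightarrow> (real^'n) set \<Rightarrow> bool" where
  "trace_domain U V \<longleftrightarrow> open U \<and> bounded U \<and> U \<noteq> {} \<and> finite V \<and> V \<noteq> {} \<and> V \<subseteq> frontier U \<and>
     (\<forall>w\<in>H10 U. continuous_on (closure U) w \<longrightarrow> (\<forall>v\<in>V. w v = 0))"

subsection \<open>Simple polygons as Jordan curves\<close>

lemma inside_homeomorphic_subset:
  fixes f :: "'a::euclidean_space \<Rightarrow> 'b::euclidean_space"
  assumes f: "continuous_on UNIV f" and g: "continuous_on UNIV g"
    and gf: "\<And>x. g (f x) = x" and fg: "\<And>y. f (g y) = y"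
  shows "f ` inside S \<subseteq> inside (f ` S)"
proof
  fix y assume "y \<in> f ` inside S"
  then obtain x where x: "y = f x" "x \<notin> S" "bounded (connected_component_set (- S) x)"
    by (auto simp: inside_def)
  have "f x \<notin> f ` S" using x(2) gf by (metis imageE)
  moreover have "connected_component_set (- (f ` S)) (f x) \<subseteq> f ` connected_component_set (- S) x"
  proof
    fix z assume "z \<in> connected_component_set (- (f ` S)) (f x)"
    then obtain T where T: "connected T" "T \<subseteq> - (f ` S)" "f x \<in> T" "z \<in> T"
      by (auto simp: connected_component_def)
    have "connected (g ` T)" using connected_continuous_image[OF continuous_on_subset[OF g] T(1)] by simp
    moreover have "g ` T \<subseteq> - S"
    proof
      fix a assume "a \<in> g ` T"
      then obtain b where b: "b \<in> T" "a = g b" by auto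
      then have "f a \<in> T" using fg by simp
      then show "a \<in> - S" using T(2) by auto
    qed
    moreover have "x \<in> g ` T" using T(3) gf by (metis imageI)
    moreover have "g z \<in> g ` T" using T(4) by auto
    ultimately have "connected_component (- S) x (g z)" by (auto simp: connected_component_def)
    then show "z \<in> f ` connected_component_set (- S) x" using fg by (metis imageI mem_Collect_eq)
  qed
  moreover have "bounded (f ` connected_component_set (- S) x)"
  proof -
    have "compact (closure (connected_component_set (- S) x))" using x(3) by simp
    then have "bounded (f ` closure (connected_component_set (- S) x))"
      using compact_imp_bounded[OF compact_continuous_image[OF continuous_on_subset[OF f]]] by simp
    then show ?thesis by (rule bounded_subset) (rule image_mono[OF closure_subset])
  qed
  ultimately show "y \<in> inside (f ` S)" unfolding inside_def x(1) using bounded_subset by blast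
qed

lemma inside_homeomorphic_image:
  fixes f :: "'a::euclidean_space \<Rightarrow> 'b::euclidean_space"
  assumes "continuous_on UNIV f" "continuous_on UNIV g"
    and gf: "\<And>x. g (f x) = x" and fg: "\<And>y. f (g y) = y"
  shows "inside (f ` S) = f ` inside S"
proof
  show "f ` inside S \<subseteq> inside (f ` S)" using inside_homeomorphic_subset assms by blast
  have "g ` inside (f ` S) \<subseteq> inside (g ` f ` S)"
    using inside_homeomorphic_subset[of g f "f ` S"] assms by blast
  also have "g ` f ` S = S" using gf by (simp add: image_image)
  finally have "f ` g ` inside (f ` S) \<subseteq> f ` inside S" by (rule image_mono)
  then show "inside (f ` S) \<subseteq> f ` inside S" using fg by (simp add: image_image)
qed

lemma polygon_edge_Suc: "Suc i < length vs \<Longrightarrow> edge vs i = closed_segment (vs ! i) (vs ! Suc i)"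
  by (simp add: edge_def)

text \<open>
  The edges are joined one after the other.  Two edges meet only in common end points, so the path
  stays injective until the last edge closes it.
\<close>
lemma polygon_simple_path:
  assumes "simple_polygon vs"
  shows "\<exists>c. simple_path c \<and> pathfinish c = pathstart c \<and> path_image c = \<Union>(edges vs)"
proof -
  let ?n = "length vs"
  have n: "3 \<le> ?n" and d: "distinct vs"
    and meet: "\<And>i j. i < ?n \<Longrightarrow> j < ?n \<Longrightarrow> i \<noteq> j \<Longrightarrow> edge vs i \<inter> edge vs j =
          {vs ! i, vs ! (Suc i mod ?n)} \<inter> {vs ! j, vs ! (Suc j mod ?n)}"
    using assms by (auto simp: simple_polygon_def)
  have neq: "vs ! i \<noteq> vs ! j" if "i < ?n" "j < ?n" "i \<noteq> j" for i j
    using d that by (simp add: nth_eq_iff_index_eq)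
  have chain: "m < ?n - 1 \<Longrightarrow> \<exists>g. arc g \<and> pathstart g = vs ! 0 \<and> pathfinish g = vs ! Suc m \<and>
      path_image g = (\<Union>i\<le>m. edge vs i)" for m
  proof (induction m)
    case 0
    have "vs ! 0 \<noteq> vs ! Suc 0" by (rule neq) (use n in linarith)+
    moreover have "Suc 0 < ?n" using n by linarith
    ultimately show ?case
      by (intro exI[of _ "linepath (vs ! 0) (vs ! Suc 0)"]) (auto simp: arc_linepath polygon_edge_Suc)
  next
    case (Suc m)
    then obtain g where g: "arc g" "pathstart g = vs ! 0" "pathfinish g = vs ! Suc m"
      "path_image g = (\<Union>i\<le>m. edge vs i)" by auto
    let ?l = "linepath (vs ! Suc m) (vs ! Suc (Suc m))"
    have im: "path_image ?l = edge vs (Suc m)" using Suc.prems by (simp add: polygon_edge_Suc)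
    have "path_image g \<inter> path_image ?l \<subseteq> {pathstart ?l}"
    proof
      fix x assume "x \<in> path_image g \<inter> path_image ?l"
      then obtain i where i: "i \<le> m" "x \<in> edge vs i \<inter> edge vs (Suc m)" using g(4) im by auto
      then have "x \<in> {vs ! i, vs ! Suc i} \<inter> {vs ! Suc m, vs ! Suc (Suc m)}"
        using meet[of i "Suc m"] Suc.prems by auto
      moreover have "Suc (Suc m) < ?n" using Suc.prems by linarith
      ultimately show "x \<in> {pathstart ?l}"
        using neq[of i "Suc m"] neq[of i "Suc (Suc m)"] neq[of "Suc i" "Suc (Suc m)"] i(1) Suc.prems by auto
    qed
    then have "arc (g +++ ?l)"
      using neq[of "Suc m" "Suc (Suc m)"] Suc.prems g by (intro arc_join) (auto intro: arc_linepath)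
    moreover have "path_image (g +++ ?l) = (\<Union>i\<le>Suc m. edge vs i)"
      using g by (subst path_image_join) (auto simp: im atMost_Suc simp del: path_image_linepath)
    ultimately show ?case using g by (intro exI[of _ "g +++ ?l"]) auto
  qed
  have "?n - 2 < ?n - 1" "Suc (?n - 2) = ?n - 1" using n by auto
  with chain[of "?n - 2"] obtain g where g: "arc g" "pathstart g = vs ! 0" "pathfinish g = vs ! (?n - 1)"
    "path_image g = (\<Union>i\<le>?n - 2. edge vs i)" by auto
  let ?l = "linepath (vs ! (?n - 1)) (vs ! 0)"
  have S: "Suc (?n - 1) mod ?n = 0" using n by (simp add: Suc_diff_le[symmetric])
  have im: "path_image ?l = edge vs (?n - 1)" by (simp only: path_image_linepath edge_def S)
  have "path_image g \<inter> path_image ?l \<subseteq> {pathstart g, pathstart ?l}"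
  proof
    fix x assume "x \<in> path_image g \<inter> path_image ?l"
    then obtain i where i: "i \<le> ?n - 2" "x \<in> edge vs i \<inter> edge vs (?n - 1)" using g(4) im by auto
    then have "x \<in> {vs ! i, vs ! (Suc i mod ?n)} \<inter> {vs ! (?n - 1), vs ! 0}"
    proof -
      have "i < ?n" "?n - 1 < ?n" "i \<noteq> ?n - 1" using i(1) n by linarith+
      from meet[OF this] i(2) show ?thesis unfolding S by simp
    qed
    then show "x \<in> {pathstart g, pathstart ?l}" using g(2) by auto
  qed
  moreover have "vs ! (?n - 1) \<noteq> vs ! 0" by (rule neq) (use n in linarith)+
  ultimately have "simple_path (g +++ ?l)"
    using g by (intro simple_path_join_loop) (auto intro: arc_linepath)
  moreover have "path_image (g +++ ?l) = \<Union>(edges vs)"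
  proof -
    have "{..<?n} = insert (?n - 1) {..?n - 2}" using n by auto
    then have E: "\<Union>(edges vs) = edge vs (?n - 1) \<union> (\<Union>i\<le>?n - 2. edge vs i)" by (simp add: edges_def)
    have "path_image (g +++ ?l) = path_image g \<union> path_image ?l" by (rule path_image_join) (use g in simp)
    then show ?thesis unfolding E im g(4) by blast
  qed
  ultimately show ?thesis using g by (intro exI[of _ "g +++ ?l"]) auto
qed

text \<open>The Jordan curve theorem is transferred from the complex plane along a linear isomorphism.\<close>
lemma polygon_Jordan:
  fixes vs :: "(real^'n) list"
  assumes card: "CARD('n) = 2" and vs: "simple_polygon vs"
  shows "polygon_region vs \<noteq> {}" "open (polygon_region vs)" "bounded (polygon_region vs)"
    "frontier (polygon_region vs) = \<Union>(edges vs)"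
    "interior (closure (polygon_region vs)) = polygon_region vs"
proof -
  have dim: "DIM(real^'n) = DIM(complex)" using card by simp
  obtain f :: "real^'n \<Rightarrow> complex" and g where fg: "linear f" "linear g" "\<And>x. g (f x) = x" "\<And>y. f (g y) = y"
    by (metis isomorphisms_UNIV_UNIV[OF dim])
  have cf: "continuous_on A f" "continuous_on A' g" for A A'
    using fg linear_continuous_on linear_conv_bounded_linear by blast+
  have inj: "inj f" using fg(3) by (metis injI)
  let ?E = "\<Union>(edges vs)"
  obtain c where c: "simple_path c" "pathfinish c = pathstart c" "path_image c = ?E"
    using polygon_simple_path[OF vs] by blast
  have c': "simple_path (f \<circ> c)" "pathfinish (f \<circ> c) = pathstart (f \<circ> c)" "path_image (f \<circ> c) = f ` ?E"
  proof -
    show "simple_path (f \<circ> c)" using c(1) fg(1) inj by (simp add: simple_path_linear_image_eq)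
    show "pathfinish (f \<circ> c) = pathstart (f \<circ> c)" using c(2) by (simp add: pathstart_def pathfinish_def)
    show "path_image (f \<circ> c) = f ` ?E" unfolding c(3)[symmetric] path_image_def by (simp add: image_comp)
  qed
  note J = Jordan_inside_outside[OF c'(1,2), unfolded c'(3)]
  have ins: "inside (f ` ?E) = f ` inside ?E"
    by (rule inside_homeomorphic_image[OF cf fg(3,4)])
  then have ins': "inside ?E = g ` inside (f ` ?E)" using fg(3) by (simp add: image_image)
  have vim: "g ` A = f -` A" for A using fg(3,4) by (auto simp: image_iff) metis+
  show ne: "polygon_region vs \<noteq> {}" using J ins by (auto simp: polygon_region_def)
  have E: "closed ?E" "bounded ?E"
    using c(1,3) compact_simple_path_image[of c] by (auto simp: compact_imp_closed compact_imp_bounded)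
  show op: "open (polygon_region vs)" unfolding polygon_region_def using E(1) by (rule open_inside)
  show "bounded (polygon_region vs)" unfolding polygon_region_def
    by (rule bounded_inside[OF E(2)])
  have clf: "closure (f ` A) = f ` closure A" for A
    using closure_injective_linear_image[OF fg(1) inj] by simp
  have sf: "surj f" using fg(4) by (metis surjI)
  have fr: "frontier (f ` A) = f ` frontier A" for A
  proof -
    have "- (f ` A) = f ` (- A)" using bij_image_Compl_eq[of f A] inj sf by (simp add: bij_def)
    then show ?thesis unfolding frontier_closures by (simp add: clf image_Int[OF inj])
  qed
  have "f ` frontier (inside ?E) = f ` ?E" using J fr[of "inside ?E"] ins by simp
  then show frE: "frontier (polygon_region vs) = ?E" unfolding polygon_region_def
    using inj by (simp add: inj_image_eq_iff)
  have "f ` outside ?E = outside (f ` ?E)"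
  proof -
    have "f ` outside ?E = f ` (- (?E \<union> inside ?E))" by (simp add: outside_inside)
    also have "\<dots> = - (f ` ?E \<union> f ` inside ?E)"
      using bij_image_Compl_eq[of f "?E \<union> inside ?E"] inj sf by (simp add: bij_def image_Un)
    finally show ?thesis by (simp add: outside_inside ins)
  qed
  then have "f ` frontier (outside ?E) = f ` ?E" using J fr[of "outside ?E"] by simp
  then have frO: "frontier (outside ?E) = ?E" using inj by (simp add: inj_image_eq_iff)
  show "interior (closure (polygon_region vs)) = polygon_region vs"
  proof
    show "polygon_region vs \<subseteq> interior (closure (polygon_region vs))"
      by (rule interior_maximal[OF closure_subset op])
    show "interior (closure (polygon_region vs)) \<subseteq> polygon_region vs"
    proof
      fix x assume x: "x \<in> interior (closure (polygon_region vs))"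
      then have xc: "x \<in> closure (polygon_region vs)" using interior_subset by blast
      show "x \<in> polygon_region vs"
      proof (rule ccontr)
        assume "x \<notin> polygon_region vs"
        then have "x \<in> ?E" using xc frE op by (auto simp: frontier_def interior_open)
        then have "x \<in> closure (outside ?E)" using frO by (auto simp: frontier_def)
        then obtain y where y: "y \<in> outside ?E" "y \<in> interior (closure (polygon_region vs))"
          using x open_interior by (metis closure_iff_nhds_not_empty disjoint_iff subset_refl)
        then have "y \<in> closure (polygon_region vs)" using interior_subset by blast
        then have "y \<in> inside ?E \<union> ?E"
          using frE op by (auto simp: frontier_def interior_open polygon_region_def)
        moreover have "outside ?E \<inter> ?E = {}" "inside ?E \<inter> outside ?E = {}" by auto
        ultimately show False using y(1) by blast
      qed
    qed
  qed
qed

lemma vertices_subset_edges: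
  assumes "simple_polygon vs" shows "set vs \<subseteq> \<Union>(edges vs)"
proof
  fix v assume "v \<in> set vs"
  then obtain i where "i < length vs" "v = vs ! i" by (auto simp: in_set_conv_nth)
  then show "v \<in> \<Union>(edges vs)" by (auto simp: edges_def edge_def)
qed

lemma polygon_region_subset_hull:
  assumes "simple_polygon vs" shows "polygon_region vs \<subseteq> convex hull (set vs)"
proof -
  have "edge vs i \<subseteq> convex hull (set vs)" if "i < length vs" for i
  proof -
    have "0 < length vs" using that by linarith
    then have "Suc i mod length vs < length vs" by simp
    then show ?thesis unfolding edge_def segment_convex_hull using that
      by (intro hull_mono) auto
  qed
  then have "\<Union>(edges vs) \<subseteq> convex hull (set vs)" by (auto simp: edges_def)
  then have "- (convex hull (set vs)) \<subseteq> outside (\<Union>(edges vs))"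
    by (intro outside_subset_convex) auto
  then show ?thesis unfolding polygon_region_def using inside_Int_outside[of "\<Union>(edges vs)"] by blast
qed

subsection \<open>Flat boundary points\<close>

lemma subspace_as_hyperplane:
  fixes S :: "'a::euclidean_space set"
  assumes S: "subspace S" and d: "dim S = DIM('a) - 1"
  shows "\<exists>\<nu>. norm \<nu> = 1 \<and> (\<forall>x. x \<bullet> \<nu> = 0 \<longleftrightarrow> x \<in> S)"
proof -
  have "dim S < DIM('a)" using d DIM_positive[where 'a='a] by linarith
  then obtain n where n: "n \<noteq> 0" "\<And>y. y \<in> span S \<Longrightarrow> orthogonal n y"
    using orthogonal_to_subspace_exists by metis
  have "S = {x. n \<bullet> x = 0}"
  proof (rule subspace_dim_equal[OF S subspace_hyperplane])
    show "S \<subseteq> {x. n \<bullet> x = 0}" using n(2) span_base by (auto simp: orthogonal_def)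
    show "dim {x. n \<bullet> x = 0} \<le> dim S" using dim_hyperplane[OF n(1)] d by simp
  qed
  then have "x \<bullet> (n /\<^sub>R norm n) = 0 \<longleftrightarrow> x \<in> S" for x using n(1) by (auto simp: inner_commute)
  moreover have "norm (n /\<^sub>R norm n) = 1" using n(1) by simp
  ultimately show ?thesis by blast
qed

text \<open>
  Near an interior point of an edge all other edges are absent, so the boundary is a line there.  The
  end point \<open>v\<close> of the edge is a limit of such points.
\<close>
lemma polygon_trace_domain:
  fixes vs :: "(real^'n) list"
  assumes card: "CARD('n) = 2" and vs: "simple_polygon vs"
  shows "trace_domain (polygon_region vs) (set vs)"
proof -
  let ?U = "polygon_region vs" and ?n = "length vs"
  note J = polygon_Jordan[OF card vs]
  have n: "3 \<le> ?n" and d: "distinct vs"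
    and meet: "\<And>i j. i < ?n \<Longrightarrow> j < ?n \<Longrightarrow> i \<noteq> j \<Longrightarrow> edge vs i \<inter> edge vs j =
          {vs ! i, vs ! (Suc i mod ?n)} \<inter> {vs ! j, vs ! (Suc j mod ?n)}"
    using vs by (auto simp: simple_polygon_def)
  have "w v = 0" if w: "w \<in> H10 ?U" and cont: "continuous_on (closure ?U) w" and v: "v \<in> set vs" for w v
  proof -
    obtain i where i: "i < ?n" "v = vs ! i" using v by (auto simp: in_set_conv_nth)
    define b where "b = vs ! (Suc i mod ?n)"
    have Si: "Suc i mod ?n < ?n" "Suc i mod ?n \<noteq> i" using n i(1) by (auto simp: mod_Suc)
    have vb: "v \<noteq> b" using d i Si by (simp add: b_def nth_eq_iff_index_eq)
    have ei: "edge vs i = closed_segment v b" by (simp add: edge_def i b_def)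
    have flat: "w x0 = 0" if x0: "x0 \<in> open_segment v b" for x0
    proof -
      obtain t where t: "0 < t" "t < 1" "x0 = (1 - t) *\<^sub>R v + t *\<^sub>R b" using x0 by (auto simp: in_segment)
      define Z where "Z = (\<Union>j\<in>{..<?n} - {i}. edge vs j)"
      have "closed Z" unfolding Z_def by (intro closed_UN) (auto simp: edge_def)
      moreover have "x0 \<notin> Z"
      proof
        assume "x0 \<in> Z"
        then obtain j where j: "j < ?n" "j \<noteq> i" "x0 \<in> edge vs j" by (auto simp: Z_def)
        moreover have "x0 \<in> edge vs i" using x0 segment_open_subset_closed ei by blast
        ultimately have "x0 \<in> {v, b}" using meet[of i j] i by (auto simp: b_def)
        then show False using x0 by (auto simp: open_segment_def)
      qed
      ultimately obtain r where r: "r > 0" "ball x0 r \<inter> Z = {}"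
        using openE[of "- Z" x0] by (auto simp: open_Compl disjoint_eq_subset_Compl)
      have nb: "norm (b - v) > 0" using vb by simp
      define \<epsilon> where "\<epsilon> = min r (min t (1 - t) * norm (b - v))"
      have \<epsilon>: "\<epsilon> > 0" "\<epsilon> \<le> r" "\<epsilon> \<le> t * norm (b - v)" "\<epsilon> \<le> (1 - t) * norm (b - v)"
        using r(1) t nb by (auto simp: \<epsilon>_def min_le_iff_disj intro: mult_right_mono)
      have "dim (span {b - v}) = DIM(real^'n) - 1" using card vb by (simp add: dim_singleton)
      then obtain \<nu> where \<nu>: "norm \<nu> = 1" "\<And>x. x \<bullet> \<nu> = 0 \<longleftrightarrow> x \<in> span {b - v}"
        using subspace_as_hyperplane[OF subspace_span, of "{b - v}"] by blast
      have "x \<in> frontier ?U \<longleftrightarrow> (x - x0) \<bullet> \<nu> = 0" if x: "x \<in> ball x0 \<epsilon>" for x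
      proof
        assume "x \<in> frontier ?U"
        then have "x \<in> \<Union>(edges vs)" using J by simp
        then obtain j where j: "j < ?n" "x \<in> edge vs j" by (auto simp: edges_def)
        have "x \<in> ball x0 r" using x \<epsilon>(2) by auto
        then have "x \<notin> Z" using r(2) by blast
        then have "x \<in> closed_segment v b" using j ei by (auto simp: Z_def)
        then obtain s where "x = (1 - s) *\<^sub>R v + s *\<^sub>R b" by (auto simp: in_segment)
        then have "x = v + s *\<^sub>R (b - v)" "x0 = v + t *\<^sub>R (b - v)" using t(3) by (auto simp: algebra_simps)
        then have "x - x0 = (s - t) *\<^sub>R (b - v)" by (simp add: scaleR_left_diff_distrib)
        then have "x - x0 \<in> span {b - v}" by (simp add: span_mul span_base)
        then show "(x - x0) \<bullet> \<nu> = 0" using \<nu>(2) by simp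
      next
        assume "(x - x0) \<bullet> \<nu> = 0"
        then have "x - x0 \<in> span {b - v}" using \<nu>(2) by simp
        then obtain s where s: "x - x0 = s *\<^sub>R (b - v)" by (auto simp: span_singleton)
        have "norm (x - x0) < \<epsilon>" using x by (simp add: dist_norm norm_minus_commute)
        then have "\<bar>s\<bar> * norm (b - v) < t * norm (b - v)" "\<bar>s\<bar> * norm (b - v) < (1 - t) * norm (b - v)"
          using s \<epsilon>(3,4) by auto
        then have "\<bar>s\<bar> < t" "\<bar>s\<bar> < 1 - t" using nb by auto
        then have s': "0 \<le> t + s" "t + s \<le> 1" by auto
        have "x = (1 - (t + s)) *\<^sub>R v + (t + s) *\<^sub>R b" using s t(3) by (simp add: algebra_simps)
        then have "x \<in> closed_segment v b" using s' by (auto simp: in_segment)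
        then have "x \<in> \<Union>(edges vs)" using ei i(1) by (auto simp: edges_def)
        then show "x \<in> frontier ?U" using J by simp
      qed
      moreover have "x0 \<in> frontier ?U"
        using x0 segment_open_subset_closed[of v b] ei i(1) J(4) by (auto simp: edges_def)
      ultimately show ?thesis using H10_vanishes_at_flat_point[OF J(2) w cont \<nu>(1) \<epsilon>(1)] by blast
    qed
    have "closed_segment v b \<subseteq> frontier ?U" using J(4) ei i(1) by (auto simp: edges_def)
    then have "closure (open_segment v b) \<subseteq> closure ?U" using vb by (auto simp: frontier_def)
    then have "continuous_on (closure (open_segment v b)) w" using cont continuous_on_subset by blast
    moreover have "v \<in> closure (open_segment v b)" using vb by simp
    ultimately show ?thesis using continuous_constant_on_closure[of "open_segment v b" w 0 v] flat by blast
  qed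
  then show ?thesis
    using J vertices_subset_edges[OF vs] n unfolding trace_domain_def by auto
qed

subsection \<open>Rigid motions and parametrisations of faces\<close>

definition rigid :: "(real^'n \<Rightarrow> real^'n) \<Rightarrow> bool" where
  "rigid \<rho> \<longleftrightarrow> (\<exists>a L. orthogonal_transformation L \<and> \<rho> = (\<lambda>x. a + L x))"

lemma isometry_continuous: "linear L \<Longrightarrow> continuous_on A (\<lambda>x. a + L x)"
  for L :: "'a::euclidean_space \<Rightarrow> 'b::euclidean_space"
  by (intro continuous_on_add continuous_on_const linear_continuous_on) (simp add: linear_conv_bounded_linear)

lemma edges_affine_image:
  fixes L :: "real^'m \<Rightarrow> real^'n"
  assumes L: "linear L"
  shows "edges (map (\<lambda>x. a + L x) vs) = (\<lambda>e. (\<lambda>x. a + L x) ` e) ` edges vs"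
proof -
  have "edge (map (\<lambda>x. a + L x) vs) i = (\<lambda>x. a + L x) ` edge vs i" if i: "i < length vs" for i
  proof -
    have "0 < length vs" using i by linarith
    then have Si: "Suc i mod length vs < length vs" by simp
    have "closed_segment (a + L p) (a + L q) = (\<lambda>x. a + L x) ` closed_segment p q" for p q
      unfolding closed_segment_translation closed_segment_linear_image[OF L] by (simp add: image_image)
    then show ?thesis unfolding edge_def using i Si by simp
  qed
  then show ?thesis unfolding edges_def by (auto simp: image_image)
qed

lemma rigid_inverse:
  assumes "rigid \<rho>"
  obtains \<sigma> where "rigid \<sigma>" "\<And>x. \<sigma> (\<rho> x) = x" "\<And>y. \<rho> (\<sigma> y) = y"
proof -
  obtain a L where L: "orthogonal_transformation L" "\<rho> = (\<lambda>x. a + L x)" using assms by (auto simp: rigid_def)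
  have i: "orthogonal_transformation (inv L)" using orthogonal_transformation_inv[OF L(1)] .
  have li: "linear (inv L)" using i by (simp add: orthogonal_transformation_def)
  have e: "inv L (L x) = x" "L (inv L x) = x" for x
    using orthogonal_transformation_inj[OF L(1)] orthogonal_transformation_surj[OF L(1)]
    by (simp_all add: inv_f_f surj_f_inv_f)
  show ?thesis
  proof (rule that[of "\<lambda>y. inv L (- a) + inv L y"])
    show "rigid (\<lambda>y. inv L (- a) + inv L y)" using i by (auto simp: rigid_def)
    show "inv L (- a) + inv L (\<rho> x) = x" for x
      using linear_add[OF li, of "-a" "\<rho> x"] by (simp add: L(2) e)
    show "\<rho> (inv L (- a) + inv L y) = y" for y
      using linear_add[OF li, of "-a" y] by (simp add: L(2) linear_add[OF orthogonal_transformation_linear[OF L(1)]] e)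
  qed
qed

lemma rigid_continuous: "rigid \<rho> \<Longrightarrow> continuous_on A \<rho>"
  by (auto simp: rigid_def orthogonal_transformation_linear intro: isometry_continuous)

lemma rigid_polygon_region:
  assumes \<rho>: "rigid \<rho>"
  shows "polygon_region (map \<rho> vs) = \<rho> ` polygon_region vs"
proof -
  obtain \<sigma> where \<sigma>: "rigid \<sigma>" "\<And>x. \<sigma> (\<rho> x) = x" "\<And>y. \<rho> (\<sigma> y) = y" using rigid_inverse[OF \<rho>] by blast
  obtain a L where L: "linear L" "\<rho> = (\<lambda>x. a + L x)"
    using \<rho> unfolding rigid_def orthogonal_transformation_def by blast
  have "\<Union>(edges (map \<rho> vs)) = \<rho> ` \<Union>(edges vs)"
    unfolding L(2) edges_affine_image[OF L(1)] by (simp add: image_Union)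
  then show ?thesis unfolding polygon_region_def
    using inside_homeomorphic_image[OF rigid_continuous[OF \<rho>] rigid_continuous[OF \<sigma>(1)] \<sigma>(2,3)] by simp
qed

lemma plane_isometry_inj: "plane_isometry \<psi> \<Longrightarrow> inj \<psi>"
proof -
  assume "plane_isometry \<psi>"
  then obtain a L where L: "linear L" "\<And>x. norm (L x) = norm x" "\<psi> = (\<lambda>x. a + L x)"
    by (auto simp: plane_isometry_def)
  show "inj \<psi>"
  proof (rule injI)
    fix x y assume "\<psi> x = \<psi> y"
    then have "L (x - y) = 0" using L(3) by (simp add: linear_diff[OF L(1)])
    then show "x = y" using L(2)[of "x - y"] by simp
  qed
qed

text \<open>
  Two parametrisations of the same planar polygon differ by a rigid motion of the parameter plane:
  the vertices of a simple polygon span the plane affinely, since they span a convex set that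
  contains the nonempty open inside of the polygon.
\<close>
lemma reparametrisation:
  fixes \<psi>0 \<psi> :: "real^2 \<Rightarrow> real^'n"
  assumes \<psi>0: "plane_isometry \<psi>0" and \<psi>: "plane_isometry \<psi>" and eq: "map \<psi>0 vs0 = map \<psi> vs"
    and s: "simple_polygon vs0"
  shows "\<exists>\<rho>. rigid \<rho> \<and> \<psi>0 = \<psi> \<circ> \<rho> \<and> vs = map \<rho> vs0"
proof -
  obtain a0 L0 where L0: "linear L0" "\<And>x. norm (L0 x) = norm x" "\<psi>0 = (\<lambda>x. a0 + L0 x)"
    using \<psi>0 by (auto simp: plane_isometry_def)
  obtain b M where M: "linear M" "\<And>x. norm (M x) = norm x" "\<psi> = (\<lambda>x. b + M x)"
    using \<psi> by (auto simp: plane_isometry_def)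
  have Mi: "M x \<bullet> M y = x \<bullet> y" for x y
    using M(2)[of "x + y"] M(2)[of x] M(2)[of y] by (simp add: dot_norm linear_add[OF M(1), symmetric])
  have adj: "adjoint M (M x) = x" for x
  proof -
    have "(adjoint M (M x) - x) \<bullet> y = 0" for y
      using adjoint_works[OF M(1), of y "M x"] Mi[of y x]
      by (simp add: inner_diff_left inner_diff_right inner_commute)
    then show ?thesis using inner_eq_zero_iff[of "adjoint M (M x) - x"] by simp
  qed
  have "interior (convex hull (set vs0)) \<noteq> {}"
    using interior_maximal[OF polygon_region_subset_hull[OF s]] polygon_Jordan(1,2)[OF _ s] by auto
  then have "affine hull (convex hull (set vs0)) = UNIV" by (rule affine_hull_nonempty_interior)
  then have aff: "affine hull (set vs0) = UNIV" by simp
  have in_range: "\<psi>0 x - b \<in> range M" for x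
  proof -
    have "affine {x. \<psi>0 x - b \<in> range M}"
      unfolding affine_def
    proof (intro ballI allI impI)
      fix x y u v assume x: "x \<in> {x. \<psi>0 x - b \<in> range M}" and y: "y \<in> {x. \<psi>0 x - b \<in> range M}" and uv: "u + v = (1::real)"
      then obtain x' y' where x': "\<psi>0 x - b = M x'" "\<psi>0 y - b = M y'" by auto
      have "\<psi>0 (u *\<^sub>R x + v *\<^sub>R y) - b = u *\<^sub>R (\<psi>0 x - b) + v *\<^sub>R (\<psi>0 y - b)"
      proof -
        have "u *\<^sub>R (\<psi>0 x - b) + v *\<^sub>R (\<psi>0 y - b) = (u + v) *\<^sub>R (a0 - b) + (u *\<^sub>R L0 x + v *\<^sub>R L0 y)"
          unfolding L0(3) by (simp add: algebra_simps)
        then show ?thesis using uv by (simp add: L0(3) linear_add[OF L0(1)] linear_cmul[OF L0(1)])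
      qed
      also have "\<dots> = M (u *\<^sub>R x' + v *\<^sub>R y')" by (simp add: x' linear_add[OF M(1)] linear_cmul[OF M(1)])
      finally show "u *\<^sub>R x + v *\<^sub>R y \<in> {x. \<psi>0 x - b \<in> range M}" by auto
    qed
    moreover have "set vs0 \<subseteq> {x. \<psi>0 x - b \<in> range M}"
    proof
      fix v assume "v \<in> set vs0"
      then have "\<psi>0 v \<in> set (map \<psi> vs)" unfolding eq[symmetric] by simp
      then obtain z where "\<psi>0 v = \<psi> z" by auto
      then show "v \<in> {x. \<psi>0 x - b \<in> range M}" by (auto simp: M(3))
    qed
    ultimately show ?thesis using hull_minimal[of "set vs0" "{x. \<psi>0 x - b \<in> range M}" affine] aff by blast
  qed
  define L where "L = (\<lambda>x. adjoint M (L0 x))"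
  define a where "a = adjoint M (a0 - b)"
  define \<rho> where "\<rho> = (\<lambda>x. a + L x)"
  have lA: "linear (adjoint M)" by (rule adjoint_linear[OF M(1)])
  have \<psi>\<rho>: "\<psi> (\<rho> x) = \<psi>0 x" for x
  proof -
    obtain z where z: "\<psi>0 x - b = M z" using in_range[of x] by auto
    have "\<rho> x = adjoint M (\<psi>0 x - b)"
      using linear_add[OF lA, of "a0 - b" "L0 x"] by (simp add: \<rho>_def a_def L_def L0(3) algebra_simps)
    then have "\<rho> x = z" using z adj by simp
    then show ?thesis using z by (simp add: M(3) algebra_simps)
  qed
  have lL: "linear L" unfolding L_def using linear_compose[OF L0(1) lA] by (simp add: o_def)
  have "norm (L x) = norm x" for x
  proof -
    have "M (L x) = L0 x"
    proof -
      have 0: "b + M a = a0"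
        using \<psi>\<rho>[of 0] linear_0[OF lL] linear_0[OF L0(1)] by (simp add: \<rho>_def M(3) L0(3))
      have "(b + M a) + M (L x) = a0 + L0 x"
        using \<psi>\<rho>[of x] by (simp add: \<rho>_def M(3) L0(3) linear_add[OF M(1)] add.assoc)
      then show ?thesis unfolding 0 by simp
    qed
    then show ?thesis using M(2)[of "L x"] L0(2)[of x] by simp
  qed
  then have r: "rigid \<rho>" unfolding rigid_def \<rho>_def orthogonal_transformation using lL by blast
  have c: "\<psi>0 = \<psi> \<circ> \<rho>" using \<psi>\<rho> by (auto simp: fun_eq_iff)
  have "map \<psi> (map \<rho> vs0) = map \<psi> vs" using eq c by simp
  then have "vs = map \<rho> vs0" using plane_isometry_inj[OF \<psi>] by (simp only: inj_map_eq_map)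
  then show ?thesis using r c by blast
qed

text \<open>
  The set \<open>closed_face F\<close> collects the images under all parametrisations of the face; these coincide.
\<close>
lemma closed_face_eq:
  assumes \<psi>0: "plane_isometry \<psi>0" and s: "simple_polygon vs0" and F: "F = map \<psi>0 vs0"
  shows "closed_face F = \<psi>0 ` closure (polygon_region vs0)"
proof
  show "\<psi>0 ` closure (polygon_region vs0) \<subseteq> closed_face F"
    unfolding closed_face_def using \<psi>0 F by blast
  show "closed_face F \<subseteq> \<psi>0 ` closure (polygon_region vs0)"
  proof
    fix x assume "x \<in> closed_face F"
    then obtain \<psi> vs y where *: "x = \<psi> y" "plane_isometry \<psi>" "F = map \<psi> vs" "y \<in> closure (polygon_region vs)"
      unfolding closed_face_def by blast
    obtain \<rho> where \<rho>: "rigid \<rho>" "\<psi>0 = \<psi> \<circ> \<rho>" "vs = map \<rho> vs0"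
      using reparametrisation[OF \<psi>0 *(2) _ s, of vs] F *(3) by auto
    have "\<rho> ` closure (polygon_region vs0) = closure (\<rho> ` polygon_region vs0)"
    proof -
      have b: "compact (closure (polygon_region vs0))" using polygon_Jordan(3)[OF _ s] by simp
      have "closed (\<rho> ` closure (polygon_region vs0))"
        by (intro compact_imp_closed compact_continuous_image[OF rigid_continuous[OF \<rho>(1)] b])
      then have "closure (\<rho> ` polygon_region vs0) \<subseteq> \<rho> ` closure (polygon_region vs0)"
        by (intro closure_minimal image_mono closure_subset)
      moreover have "\<rho> ` closure (polygon_region vs0) \<subseteq> closure (\<rho> ` polygon_region vs0)"
        by (rule image_closure_subset[OF rigid_continuous[OF \<rho>(1)] closed_closure closure_subset])
      ultimately show ?thesis by blast
    qed
    then have "y \<in> \<rho> ` closure (polygon_region vs0)" using *(4) \<rho>(3) rigid_polygon_region[OF \<rho>(1)] by simp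
    then show "x \<in> \<psi>0 ` closure (polygon_region vs0)" using *(1) \<rho>(2) by auto
  qed
qed

lemma closed_closed_face:
  assumes "planar_polygon F" shows "closed (closed_face F)"
proof -
  obtain \<psi> vs where *: "plane_isometry \<psi>" "simple_polygon vs" "F = map \<psi> vs"
    using assms by (auto simp: planar_polygon_def)
  have "continuous_on A \<psi>" for A using *(1) by (auto simp: plane_isometry_def intro: isometry_continuous)
  then show ?thesis unfolding closed_face_eq[OF *]
    using polygon_Jordan(3)[OF _ *(2)] by (intro compact_imp_closed compact_continuous_image) auto
qed

text \<open>
  By the condition on intersections of faces, another face can meet a face only in its edges, so at
  points of the relative interior of a face the boundary is a plane.  The vertices of the face are
  limits of such points.
\<close>
lemma polyhedron_trace_domain:
  fixes U :: "(real^'n) set"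
  assumes card: "CARD('n) = 3" and U: "polyhedral U B"
  shows "trace_domain U (\<Union>F\<in>B. set F)"
proof -
  have fin: "finite B" and planar: "\<And>F. F \<in> B \<Longrightarrow> planar_polygon F"
    and meet: "\<And>F G. F \<in> B \<Longrightarrow> G \<in> B \<Longrightarrow> F \<noteq> G \<Longrightarrow>
        closed_face F \<inter> closed_face G \<subseteq> \<Union>(edges F \<inter> edges G) \<union> (set F \<inter> set G)"
    and U': "U \<noteq> {}" "open U" "bounded U" and fr: "frontier U = (\<Union>F\<in>B. closed_face F)"
    using U by (auto simp: polyhedral_def)
  have "U \<noteq> UNIV" using U'(3) not_bounded_UNIV by blast
  then have Bne: "B \<noteq> {}" using fr U'(1) frontier_eq_empty[of U] by auto
  have vertex: "v \<in> frontier U \<and> (\<forall>w\<in>H10 U. continuous_on (closure U) w \<longrightarrow> w v = 0)"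
    if F: "F \<in> B" and v: "v \<in> set F" for F v
  proof -
    obtain \<psi> vs where \<psi>: "plane_isometry \<psi>" and s: "simple_polygon vs" and FF: "F = map \<psi> vs"
      using planar[OF F] by (auto simp: planar_polygon_def)
    obtain a L where L: "linear L" "\<And>x. norm (L x) = norm x" "\<psi> = (\<lambda>x. a + L x)"
      using \<psi> by (auto simp: plane_isometry_def)
    let ?R = "polygon_region vs"
    note J = polygon_Jordan[OF _ s, simplified]
    have cF: "closed_face F = \<psi> ` closure ?R" by (rule closed_face_eq[OF \<psi> s FF])
    have c\<psi>: "continuous_on A \<psi>" for A unfolding L(3) by (rule isometry_continuous[OF L(1)])
    have sub: "\<psi> ` closure ?R \<subseteq> frontier U" using cF fr F by auto
    obtain y0 where y0: "v = \<psi> y0" "y0 \<in> set vs" using v FF by auto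
    have "y0 \<in> frontier ?R" using y0(2) vertices_subset_edges[OF s] J(4) by blast
    then have y0c: "y0 \<in> closure ?R" by (simp add: frontier_def)
    then have vfr: "v \<in> frontier U" using sub y0(1) by blast
    have "w v = 0" if w: "w \<in> H10 U" and cont: "continuous_on (closure U) w" for w
    proof -
      have flat: "w (\<psi> y) = 0" if y: "y \<in> ?R" for y
      proof -
        have x0F: "\<psi> y \<in> closed_face F" using y cF closure_subset by blast
        have "\<psi> y \<notin> closed_face G" if G: "G \<in> B" "G \<noteq> F" for G
        proof
          assume "\<psi> y \<in> closed_face G"
          then have "\<psi> y \<in> \<Union>(edges F \<inter> edges G) \<union> (set F \<inter> set G)" using meet[OF F G(1)] G(2) x0F by blast
          moreover have E: "\<Union>(edges F) = \<psi> ` \<Union>(edges vs)"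
            unfolding FF L(3) edges_affine_image[OF L(1)] by (simp add: image_Union)
          moreover have "set F \<subseteq> \<psi> ` \<Union>(edges vs)" using vertices_subset_edges[OF s] FF by auto
          ultimately have "\<psi> y \<in> \<psi> ` \<Union>(edges vs)" by blast
          then have "y \<in> \<Union>(edges vs)" using plane_isometry_inj[OF \<psi>] by (simp add: inj_image_mem_iff)
          then show False using y inside_no_overlap[of "\<Union>(edges vs)"] unfolding polygon_region_def by blast
        qed
        then have "\<psi> y \<in> - (\<Union>G\<in>B - {F}. closed_face G)" by auto
        moreover have "open (- (\<Union>G\<in>B - {F}. closed_face G))"
          using fin planar closed_closed_face by (intro open_Compl closed_UN) auto
        ultimately obtain r where r: "r > 0" "ball (\<psi> y) r \<subseteq> - (\<Union>G\<in>B - {F}. closed_face G)" using openE by blast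
        obtain r' where r': "r' > 0" "ball y r' \<subseteq> ?R" using J(2) y openE by blast
        define \<epsilon> where "\<epsilon> = min r r'"
        have \<epsilon>: "\<epsilon> > 0" "\<epsilon> \<le> r" "\<epsilon> \<le> r'" using r(1) r'(1) by (auto simp: \<epsilon>_def)
        have injL: "inj L" using L(1,2) by (auto simp: linear_injective_0) (metis norm_eq_zero)
        have "dim (range L) = dim (UNIV :: (real^2) set)"
          using dim_image_eq[OF L(1), of UNIV] injL by simp
        then have "dim (range L) = DIM(real^'n) - 1" using card by simp
        then obtain \<nu> where \<nu>: "norm \<nu> = 1" "\<And>x. x \<bullet> \<nu> = 0 \<longleftrightarrow> x \<in> range L"
          using subspace_as_hyperplane[OF linear_subspace_image[OF L(1) subspace_UNIV]] by blast
        have "x \<in> frontier U \<longleftrightarrow> (x - \<psi> y) \<bullet> \<nu> = 0" if x: "x \<in> ball (\<psi> y) \<epsilon>" for x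
        proof
          assume "x \<in> frontier U"
          then obtain G where G: "G \<in> B" "x \<in> closed_face G" using fr by auto
          have "x \<in> ball (\<psi> y) r" using x \<epsilon>(2) by auto
          then have "G = F" using G r(2) by blast
          then obtain z where "x = \<psi> z" using G(2) cF by auto
          then have "x - \<psi> y = L (z - y)" by (simp add: L(3) linear_diff[OF L(1)])
          then show "(x - \<psi> y) \<bullet> \<nu> = 0" using \<nu>(2) by simp
        next
          assume "(x - \<psi> y) \<bullet> \<nu> = 0"
          then obtain h where h: "x - \<psi> y = L h" using \<nu>(2) by auto
          have "norm h < r'" using h x \<epsilon>(3) L(2)[of h] by (simp add: dist_norm norm_minus_commute)
          then have "y + h \<in> ?R" using r'(2) by (auto simp: dist_norm)
          moreover have "x = \<psi> (y + h)" using h by (simp add: L(3) linear_add[OF L(1)] algebra_simps)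
          ultimately show "x \<in> frontier U" using sub closure_subset by blast
        qed
        moreover have "\<psi> y \<in> frontier U" using x0F fr F by auto
        ultimately show ?thesis using H10_vanishes_at_flat_point[OF U'(2) w cont \<nu>(1) \<epsilon>(1)] by blast
      qed
      have "\<psi> ` ?R \<subseteq> closure U" using sub closure_subset[of ?R] by (auto simp: frontier_def)
      then have "closure (\<psi> ` ?R) \<subseteq> closure U" by (simp add: closure_minimal)
      then have cw: "continuous_on (closure (\<psi> ` ?R)) w" using cont continuous_on_subset by blast
      have "\<psi> ` closure ?R \<subseteq> closure (\<psi> ` ?R)"
        by (rule image_closure_subset[OF c\<psi> closed_closure closure_subset])
      then have "v \<in> closure (\<psi> ` ?R)" using y0(1) y0c by blast
      then show ?thesis using continuous_constant_on_closure[OF cw, of 0 v] flat by blast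
    qed
    then show ?thesis using vfr by blast
  qed
  have "(\<Union>F\<in>B. set F) \<noteq> {}"
  proof -
    obtain F where F: "F \<in> B" using Bne by auto
    obtain \<psi> :: "real^2 \<Rightarrow> real^'n" and vs where "F = map \<psi> vs" "simple_polygon vs"
      using planar[OF F] unfolding planar_polygon_def by blast
    then have "F \<noteq> []" by (auto simp: simple_polygon_def)
    then have "hd F \<in> set F" by simp
    then have "hd F \<in> (\<Union>F\<in>B. set F)" using F by (rule UN_I[rotated])
    then show ?thesis by (metis empty_iff)
  qed
  moreover have "finite (\<Union>F\<in>B. set F)" using fin by simp
  moreover have "(\<Union>F\<in>B. set F) \<subseteq> frontier U" using vertex by blast
  moreover have "\<forall>w\<in>H10 U. continuous_on (closure U) w \<longrightarrow> (\<forall>v\<in>(\<Union>F\<in>B. set F). w v = 0)"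
    using vertex by blast
  ultimately show ?thesis unfolding trace_domain_def using U' by blast
qed

section \<open>The polynomial projections\<close>

lemma polys_as_combination:
  assumes "p \<in> polys k"
  shows "\<exists>c. p = (\<lambda>x. \<Sum>s | (\<Sum>i\<in>UNIV. s i) \<le> k. c s *\<^sub>R monomial s x)"
  using assms by (auto simp: polys_def)

lemma monomial_in_polys: "(\<Sum>i\<in>UNIV. s i) \<le> k \<Longrightarrow> monomial s \<in> polys k"
  unfolding polys_span by (intro monomial_in_span finite_multiindices) simp

context
  fixes U :: "(real^'n) set"
  assumes U: "open U" "bounded U" "U \<noteq> {}"
begin

lemma polys_L2: "p \<in> polys k \<Longrightarrow> p \<in> L2 U"
  using polys_H1[OF U(1,2)] H1_L2 by blast

lemma polys_subset_L2: "polys k \<subseteq> L2 U" using polys_L2 by blast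

lemma Pi_0_unique:
  assumes p: "p \<in> polys k" and eq: "\<And>q. q \<in> polys k \<Longrightarrow> L2_inner U p q = L2_inner U w q"
  shows "Pi_0 k U w = p"
  unfolding Pi_0_def
proof (rule the_equality)
  show "p \<in> polys k \<and> (\<forall>q\<in>polys k. (LINT x:U|lebesgue. p x * q x) = (LINT x:U|lebesgue. w x * q x))"
    using p eq by (simp add: L2_inner_def)
next
  fix p' assume p': "p' \<in> polys k \<and> (\<forall>q\<in>polys k. (LINT x:U|lebesgue. p' x * q x) = (LINT x:U|lebesgue. w x * q x))"
  define d where "d = (\<lambda>x. p' x - p x)"
  have d: "d \<in> polys k" unfolding d_def using fun_subspace_diff[OF polys_subspace _ p] p' by blast
  have "L2_inner U p' d = L2_inner U p d" using p' eq[OF d] d by (simp add: L2_inner_def)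
  then have "L2_inner U d d = 0"
    unfolding d_def using form_diff_left[OF L2_subspace L2_inner_bilinear polys_L2 polys_L2 polys_L2[OF d], of p' k p k]
      p p' by (simp add: d_def)
  then have "L2_norm U d = 0" by (simp add: L2_norm_inner)
  then have "AE x in lebesgue. x \<in> U \<longrightarrow> d x = 0" using L2_norm_zero_iff[OF polys_L2[OF d]] by simp
  then have "d = (\<lambda>_. 0)" by (rule poly_zero_if_AE_zero[OF d U(1,3)])
  then show "p' = p" by (auto simp: d_def fun_eq_iff dest: fun_cong)
qed

text \<open>The coefficients \<open>L2_inner U w (e j)\<close> make the dependence of the projection on \<open>w\<close> explicit.\<close>
lemma Pi_0_expansion:
  "\<exists>(n::nat) e. (\<forall>j<n. e j \<in> polys k) \<and>
     (\<forall>w\<in>L2 U. Pi_0 k U w = (\<lambda>x. \<Sum>j<n. L2_inner U w (e j) * e j x) \<and>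
        (\<forall>q\<in>polys k. L2_inner U (Pi_0 k U w) q = L2_inner U w q))"
proof -
  have "\<exists>(n::nat) e. (\<forall>j<n. e j \<in> polys k) \<and> (\<forall>w\<in>L2 U. \<forall>c. L2_inner U (\<lambda>x. \<Sum>j<n. L2_inner U w (e j) *\<^sub>R e j x)
         (\<lambda>x. \<Sum>s | (\<Sum>i\<in>UNIV. s i) \<le> k. c s *\<^sub>R monomial s x) =
       L2_inner U w (\<lambda>x. \<Sum>s | (\<Sum>i\<in>UNIV. s i) \<le> k. c s *\<^sub>R monomial s x))"
    by (rule finite_projection[OF L2_subspace L2_inner_bilinear L2_inner_nonneg finite_multiindices
          _ polys_subspace polys_subset_L2]) (simp add: monomial_in_polys)
  then obtain n :: nat and e where e: "\<forall>j<n. e j \<in> polys k" and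
    proj: "\<forall>w\<in>L2 U. \<forall>c. L2_inner U (\<lambda>x. \<Sum>j<n. L2_inner U w (e j) *\<^sub>R e j x)
         (\<lambda>x. \<Sum>s | (\<Sum>i\<in>UNIV. s i) \<le> k. c s *\<^sub>R monomial s x) =
       L2_inner U w (\<lambda>x. \<Sum>s | (\<Sum>i\<in>UNIV. s i) \<le> k. c s *\<^sub>R monomial s x)"
    by blast
  have "Pi_0 k U w = (\<lambda>x. \<Sum>j<n. L2_inner U w (e j) * e j x) \<and>
      (\<forall>q\<in>polys k. L2_inner U (Pi_0 k U w) q = L2_inner U w q)" if w: "w \<in> L2 U" for w
  proof -
    let ?p = "\<lambda>x. \<Sum>j<n. L2_inner U w (e j) *\<^sub>R e j x"
    have p: "?p \<in> polys k"
      using e by (intro fun_subspace_sum[OF polys_subspace] fun_subspace_scale[OF polys_subspace]) auto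
    have eq: "L2_inner U ?p q = L2_inner U w q" if "q \<in> polys k" for q
    proof -
      obtain c where c: "q = (\<lambda>x. \<Sum>s | (\<Sum>i\<in>UNIV. s i) \<le> k. c s *\<^sub>R monomial s x)"
        using polys_as_combination[OF \<open>q \<in> polys k\<close>] by blast
      show ?thesis unfolding c using proj w by blast
    qed
    have "Pi_0 k U w = ?p" by (rule Pi_0_unique[OF p eq])
    then show ?thesis using eq by simp
  qed
  then show ?thesis using e by blast
qed

lemma Pi_0_polys: "w \<in> L2 U \<Longrightarrow> Pi_0 k U w \<in> polys k"
  and Pi_0_inner: "w \<in> L2 U \<Longrightarrow> q \<in> polys k \<Longrightarrow> L2_inner U (Pi_0 k U w) q = L2_inner U w q"
proof -
  assume w: "w \<in> L2 U"
  obtain n :: nat and e where e: "\<forall>j<n. e j \<in> polys k"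
    "\<forall>w\<in>L2 U. Pi_0 k U w = (\<lambda>x. \<Sum>j<n. L2_inner U w (e j) * e j x) \<and>
        (\<forall>q\<in>polys k. L2_inner U (Pi_0 k U w) q = L2_inner U w q)"
    using Pi_0_expansion[of k] by blast
  have "(\<lambda>x. \<Sum>j<n. L2_inner U w (e j) *\<^sub>R e j x) \<in> polys k"
    using e(1) by (intro fun_subspace_sum[OF polys_subspace] fun_subspace_scale[OF polys_subspace]) auto
  then show "Pi_0 k U w \<in> polys k" using e(2) w by simp
  show "q \<in> polys k \<Longrightarrow> L2_inner U (Pi_0 k U w) q = L2_inner U w q" using e(2) w by blast
qed

lemma Pi_0_add:
  assumes u: "u \<in> L2 U" and v: "v \<in> L2 U"
  shows "Pi_0 k U (\<lambda>x. u x + v x) = (\<lambda>x. Pi_0 k U u x + Pi_0 k U v x)"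
proof (rule Pi_0_unique)
  show "(\<lambda>x. Pi_0 k U u x + Pi_0 k U v x) \<in> polys k"
    by (intro fun_subspace_add[OF polys_subspace] Pi_0_polys u v)
  fix q :: "real^'n \<Rightarrow> real" assume q: "q \<in> polys k"
  note add = form_add_left[OF L2_subspace L2_inner_bilinear _ _ polys_L2[OF q]]
  show "L2_inner U (\<lambda>x. Pi_0 k U u x + Pi_0 k U v x) q = L2_inner U (\<lambda>x. u x + v x) q"
    using add[OF u v] add[OF polys_L2[OF Pi_0_polys[OF u, of k]] polys_L2[OF Pi_0_polys[OF v, of k]]]
      Pi_0_inner[OF u q] Pi_0_inner[OF v q] by simp
qed

lemma Pi_0_scale:
  assumes u: "u \<in> L2 U"
  shows "Pi_0 k U (\<lambda>x. c *\<^sub>R u x) = (\<lambda>x. c *\<^sub>R Pi_0 k U u x)"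
proof (rule Pi_0_unique)
  show "(\<lambda>x. c *\<^sub>R Pi_0 k U u x) \<in> polys k"
    by (intro fun_subspace_scale[OF polys_subspace] Pi_0_polys u)
  fix q :: "real^'n \<Rightarrow> real" assume q: "q \<in> polys k"
  note scale = form_scale_left[OF L2_subspace L2_inner_bilinear _ polys_L2[OF q]]
  show "L2_inner U (\<lambda>x. c *\<^sub>R Pi_0 k U u x) q = L2_inner U (\<lambda>x. c *\<^sub>R u x) q"
    using scale[OF u] scale[OF polys_L2[OF Pi_0_polys[OF u, of k]]] Pi_0_inner[OF u q] by simp
qed

lemma Pi_0_norm_le:
  assumes w: "w \<in> L2 U"
  shows "L2_norm U (Pi_0 k U w) \<le> L2_norm U w"
proof -
  let ?p = "Pi_0 k U w"
  have p: "?p \<in> L2 U" by (rule polys_L2[OF Pi_0_polys[OF w]])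
  have "(L2_norm U ?p)\<^sup>2 = L2_inner U w ?p"
    using Pi_0_inner[OF w Pi_0_polys[OF w]] by (simp add: L2_norm_power2)
  also have "\<dots> \<le> L2_norm U w * L2_norm U ?p" using L2_Cauchy_Schwarz[OF w p] by simp
  finally have "L2_norm U ?p * L2_norm U ?p \<le> L2_norm U w * L2_norm U ?p" by (simp add: power2_eq_square)
  then show ?thesis using L2_norm_nonneg[of U ?p] L2_norm_nonneg[of U w]
    by (cases "L2_norm U ?p = 0") (auto simp: mult_le_cancel_right)
qed

end

subsection \<open>Traces\<close>

definition traced :: "(real^'n) set \<Rightarrow> (real^'n \<Rightarrow> real) set" where
  "traced U = {w \<in> H1 U. \<exists>g. continuous_trace U w g}"

context
  fixes U V :: "(real^'n) set"
  assumes dom: "trace_domain U V"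
begin

lemma domU: "open U" "bounded U" "U \<noteq> {}" "finite V" "V \<noteq> {}" "V \<subseteq> frontier U"
  using dom by (auto simp: trace_domain_def)

text \<open>
  The two extensions of the boundary values differ by an element of \<open>H10\<close> that is continuous up to the
  boundary.
\<close>
lemma continuous_trace_unique:
  assumes w: "continuous_trace U w g" "continuous_trace U w g'" and v: "v \<in> V"
  shows "g v = g' v"
proof -
  obtain G where G: "G \<in> H1 U" "continuous_on (closure U) G" "\<forall>x \<in> frontier U. G x = g x" "(\<lambda>x. w x - G x) \<in> H10 U"
    using w(1) by (auto simp: continuous_trace_def)
  obtain G' where G': "G' \<in> H1 U" "continuous_on (closure U) G'" "\<forall>x \<in> frontier U. G' x = g' x" "(\<lambda>x. w x - G' x) \<in> H10 U"
    using w(2) by (auto simp: continuous_trace_def)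
  have "(\<lambda>x. (w x - G' x) - (w x - G x)) \<in> H10 U"
    by (rule fun_subspace_diff[OF H10_subspace[OF domU(1)] G'(4) G(4)])
  then have "(\<lambda>x. G x - G' x) \<in> H10 U" by simp
  moreover have "continuous_on (closure U) (\<lambda>x. G x - G' x)" by (intro continuous_on_diff G G')
  ultimately have "G v - G' v = 0" using dom v by (auto simp: trace_domain_def)
  moreover have "v \<in> frontier U" using domU(6) v by blast
  ultimately show ?thesis using G(3) G'(3) by simp
qed

lemma trace_of_eq:
  assumes w: "continuous_trace U w g" and v: "v \<in> V"
  shows "trace_of U w v = g v"
proof -
  have "continuous_trace U w (trace_of U w)" unfolding trace_of_def by (rule someI[of _ g]) (rule w)
  then show ?thesis using continuous_trace_unique w v by blast
qed

lemma continuous_trace_add: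
  assumes "continuous_trace U w g" "continuous_trace U w' g'"
  shows "continuous_trace U (\<lambda>x. w x + w' x) (\<lambda>x. g x + g' x)"
proof -
  obtain G where G: "G \<in> H1 U" "continuous_on (closure U) G" "\<forall>x \<in> frontier U. G x = g x" "(\<lambda>x. w x - G x) \<in> H10 U"
    and g: "continuous_on (frontier U) g"
    using assms(1) by (auto simp: continuous_trace_def)
  obtain G' where G': "G' \<in> H1 U" "continuous_on (closure U) G'" "\<forall>x \<in> frontier U. G' x = g' x" "(\<lambda>x. w' x - G' x) \<in> H10 U"
    and g': "continuous_on (frontier U) g'"
    using assms(2) by (auto simp: continuous_trace_def)
  have "(\<lambda>x. (w x - G x) + (w' x - G' x)) \<in> H10 U"
    by (rule fun_subspace_add[OF H10_subspace[OF domU(1)] G(4) G'(4)])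
  then have "(\<lambda>x. w x + w' x - (G x + G' x)) \<in> H10 U" by (simp add: algebra_simps)
  then show ?thesis unfolding continuous_trace_def
    using fun_subspace_add[OF H1_subspace[OF domU(1)] G(1) G'(1)] G(2,3) G'(2,3) g g'
    by (intro conjI bexI[of _ "\<lambda>x. G x + G' x"]) (auto intro: continuous_on_add)
qed

lemma continuous_trace_scale:
  assumes "continuous_trace U w g"
  shows "continuous_trace U (\<lambda>x. c *\<^sub>R w x) (\<lambda>x. c *\<^sub>R g x)"
proof -
  obtain G where G: "G \<in> H1 U" "continuous_on (closure U) G" "\<forall>x \<in> frontier U. G x = g x" "(\<lambda>x. w x - G x) \<in> H10 U"
    and g: "continuous_on (frontier U) g"
    using assms(1) by (auto simp: continuous_trace_def)
  have "(\<lambda>x. c *\<^sub>R (w x - G x)) \<in> H10 U"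
    by (rule fun_subspace_scale[OF H10_subspace[OF domU(1)] G(4)])
  then have "(\<lambda>x. c *\<^sub>R w x - c *\<^sub>R G x) \<in> H10 U" by (simp add: algebra_simps)
  then show ?thesis unfolding continuous_trace_def
    using fun_subspace_scale[OF H1_subspace[OF domU(1)] G(1), of c] G(2,3) g
    by (intro conjI bexI[of _ "\<lambda>x. c *\<^sub>R G x"]) (auto intro!: continuous_intros)
qed

lemma continuous_trace_polys:
  assumes p: "p \<in> polys k" shows "continuous_trace U p p"
  unfolding continuous_trace_def
  using polys_continuous[OF p] polys_H1[OF domU(1,2) p] fun_subspace_zero[OF H10_subspace[OF domU(1)]]
  by (intro conjI bexI[of _ p]) auto

lemma traced_H1: "w \<in> traced U \<Longrightarrow> w \<in> H1 U" by (simp add: traced_def)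

lemma vertex_average_cong: "(\<And>v. v \<in> V \<Longrightarrow> g v = g' v) \<Longrightarrow> vertex_average V g = vertex_average V g'"
  by (simp add: vertex_average_def)

lemma vertex_average_add: "vertex_average V (\<lambda>x. g x + g' x) = vertex_average V g + vertex_average V g'"
  by (simp add: vertex_average_def sum.distrib add_divide_distrib)

lemma vertex_average_scale: "vertex_average V (\<lambda>x. c *\<^sub>R g x) = c * vertex_average V g"
  by (simp add: vertex_average_def sum_distrib_left)

lemma vertex_average_const: "vertex_average V (\<lambda>_. c) = c"
  using domU(4,5) by (simp add: vertex_average_def)

lemma trace_average_add:
  assumes "u \<in> traced U" "v \<in> traced U"
  shows "vertex_average V (trace_of U (\<lambda>x. u x + v x)) =
    vertex_average V (trace_of U u) + vertex_average V (trace_of U v)"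
proof -
  obtain g g' where "continuous_trace U u g" "continuous_trace U v g'" using assms by (auto simp: traced_def)
  then show ?thesis
    unfolding vertex_average_add[symmetric]
    by (intro vertex_average_cong) (simp add: trace_of_eq[OF continuous_trace_add] trace_of_eq)
qed

lemma trace_average_scale:
  assumes "u \<in> traced U"
  shows "vertex_average V (trace_of U (\<lambda>x. c *\<^sub>R u x)) = c * vertex_average V (trace_of U u)"
proof -
  obtain g where "continuous_trace U u g" using assms by (auto simp: traced_def)
  then show ?thesis
    unfolding vertex_average_scale[symmetric]
    by (intro vertex_average_cong) (simp add: trace_of_eq[OF continuous_trace_scale, unfolded real_scaleR_def] trace_of_eq)
qed

lemma trace_average_polys:
  assumes "p \<in> polys k"
  shows "vertex_average V (trace_of U p) = vertex_average V p"
  by (intro vertex_average_cong trace_of_eq[OF continuous_trace_polys[OF assms]])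

subsection \<open>The gradient projection\<close>

lemma grad_inner_const: "q \<in> H1 U \<Longrightarrow> grad_inner U (\<lambda>_. c) q = 0"
proof -
  assume q: "q \<in> H1 U"
  have "AE x in lebesgue. x \<in> U \<longrightarrow> grad U (\<lambda>_. c) x = (\<lambda>_. 0) x"
    using C1_grad_AE[OF domU(1,2) C1_fun_const[of c]] .
  from L2_cong_AE(3)[OF this] show ?thesis
    using form_zero_left[OF L2_subspace L2_inner_bilinear grad_weak_gradient(1)[OF q]]
    by (simp add: grad_inner_def)
qed

text \<open>
  Two candidates differ by a polynomial with vanishing gradient, that is, by a constant; the vertex
  average fixes this constant.
\<close>
lemma Pi_nabla_unique:
  assumes p: "p \<in> polys k" and eq: "\<And>q. q \<in> polys k \<Longrightarrow> grad_inner U p q = grad_inner U w q"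
    and av: "vertex_average V p = vertex_average V (trace_of U w)"
  shows "Pi_nabla k U V w = p"
  unfolding Pi_nabla_def
proof (rule the_equality)
  show "p \<in> polys k \<and> (\<forall>q \<in> polys k. (LINT x:U|lebesgue. grad U p x \<bullet> grad U q x) =
                    (LINT x:U|lebesgue. grad U w x \<bullet> grad U q x)) \<and>
     vertex_average V p = vertex_average V (trace_of U w)"
    using p eq av by (simp add: grad_inner_def L2_inner_def)
next
  fix p' assume p': "p' \<in> polys k \<and> (\<forall>q \<in> polys k. (LINT x:U|lebesgue. grad U p' x \<bullet> grad U q x) =
                    (LINT x:U|lebesgue. grad U w x \<bullet> grad U q x)) \<and>
     vertex_average V p' = vertex_average V (trace_of U w)"
  have pp: "p' \<in> polys k" using p' by blast
  define d where "d = (\<lambda>x. p' x - p x)"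
  have d: "d \<in> polys k" unfolding d_def by (rule fun_subspace_diff[OF polys_subspace pp p])
  note H1 = polys_H1[OF domU(1,2)]
  have "grad_inner U p' d = grad_inner U p d" using p' eq[OF d] d by (simp add: grad_inner_def L2_inner_def)
  then have "grad_inner U d d = 0"
    using form_diff_left[OF H1_subspace[OF domU(1)] grad_inner_bilinear[OF domU(1)] H1[OF pp] H1[OF p] H1[OF d]]
    by (simp add: d_def)
  then have "L2_norm U (grad U d) = 0" by (simp add: L2_norm_inner grad_inner_def)
  then have ae: "AE x in lebesgue. x \<in> U \<longrightarrow> grad U d x = 0"
    using L2_norm_zero_iff[OF grad_weak_gradient(1)[OF H1[OF d]]] by simp
  obtain D where D: "C1_fun d D" using polys_C1[OF d] by blast
  have "AE x in lebesgue. x \<in> U \<longrightarrow> D x = 0"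
    using ae C1_grad_AE[OF domU(1,2) D] by eventually_elim auto
  then obtain c where c: "d = (\<lambda>_. c)" using poly_constant_if_gradient_zero[OF d D domU(1,3)] by blast
  have p'eq: "p' = (\<lambda>x. p x + c)" using fun_cong[OF c] by (auto simp: d_def fun_eq_iff algebra_simps)
  have "vertex_average V p' = vertex_average V p" using p' av by simp
  then have "c = 0" unfolding p'eq vertex_average_add vertex_average_const by simp
  then show "p' = p" using p'eq by simp
qed

text \<open>
  Any projection with respect to the gradient form, corrected by the constant that adjusts the vertex
  average.
\<close>
lemma Pi_nabla_exists:
  assumes w: "w \<in> traced U"
  shows "\<exists>p \<in> polys k. (\<forall>q\<in>polys k. grad_inner U p q = grad_inner U w q) \<and>
           vertex_average V p = vertex_average V (trace_of U w)"
proof -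
  have sub: "polys k \<subseteq> H1 U" using polys_H1[OF domU(1,2)] by blast
  note wH = traced_H1[OF w]
  have "\<exists>(n::nat) e. (\<forall>j<n. e j \<in> polys k) \<and> (\<forall>w\<in>H1 U. \<forall>c. grad_inner U (\<lambda>x. \<Sum>j<n. grad_inner U w (e j) *\<^sub>R e j x)
         (\<lambda>x. \<Sum>s | (\<Sum>i\<in>UNIV. s i) \<le> k. c s *\<^sub>R monomial s x) =
       grad_inner U w (\<lambda>x. \<Sum>s | (\<Sum>i\<in>UNIV. s i) \<le> k. c s *\<^sub>R monomial s x))"
    by (rule finite_projection[OF H1_subspace[OF domU(1)] grad_inner_bilinear[OF domU(1)] grad_inner_nonneg
        finite_multiindices _ polys_subspace sub]) (simp add: monomial_in_polys)
  then obtain n :: nat and e where e: "\<forall>j<n. e j \<in> polys k" and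
    proj: "\<forall>w\<in>H1 U. \<forall>c. grad_inner U (\<lambda>x. \<Sum>j<n. grad_inner U w (e j) *\<^sub>R e j x)
         (\<lambda>x. \<Sum>s | (\<Sum>i\<in>UNIV. s i) \<le> k. c s *\<^sub>R monomial s x) =
       grad_inner U w (\<lambda>x. \<Sum>s | (\<Sum>i\<in>UNIV. s i) \<le> k. c s *\<^sub>R monomial s x)"
    by blast
  let ?p = "\<lambda>x. \<Sum>j<n. grad_inner U w (e j) *\<^sub>R e j x"
  have p: "?p \<in> polys k"
    using e by (intro fun_subspace_sum[OF polys_subspace] fun_subspace_scale[OF polys_subspace]) auto
  have eq: "grad_inner U ?p q = grad_inner U w q" if "q \<in> polys k" for q
  proof -
    obtain c where c: "q = (\<lambda>x. \<Sum>s | (\<Sum>i\<in>UNIV. s i) \<le> k. c s *\<^sub>R monomial s x)"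
      using polys_as_combination[OF \<open>q \<in> polys k\<close>] by blast
    show ?thesis unfolding c using proj wH by blast
  qed
  define c where "c = vertex_average V (trace_of U w) - vertex_average V ?p"
  let ?r = "\<lambda>x. ?p x + c"
  have r: "?r \<in> polys k" by (rule fun_subspace_add[OF polys_subspace p polys_const])
  have "grad_inner U ?r q = grad_inner U w q" if q: "q \<in> polys k" for q
  proof -
    have "q \<in> H1 U" using sub q by blast
    then have "grad_inner U ?r q = grad_inner U ?p q + grad_inner U (\<lambda>_. c) q"
      using form_add_left[OF H1_subspace[OF domU(1)] grad_inner_bilinear[OF domU(1)], of ?p "\<lambda>_. c" q]
        sub p polys_const[of c k] by blast
    then show ?thesis using eq[OF q] grad_inner_const[OF \<open>q \<in> H1 U\<close>] by simp
  qed
  moreover have "vertex_average V ?r = vertex_average V (trace_of U w)"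
    unfolding vertex_average_add vertex_average_const c_def by simp
  ultimately show ?thesis using r by blast
qed

lemma Pi_nabla_polys: "w \<in> traced U \<Longrightarrow> Pi_nabla k U V w \<in> polys k"
  and Pi_nabla_grad: "w \<in> traced U \<Longrightarrow> q \<in> polys k \<Longrightarrow> grad_inner U (Pi_nabla k U V w) q = grad_inner U w q"
  and Pi_nabla_average: "w \<in> traced U \<Longrightarrow>
    vertex_average V (Pi_nabla k U V w) = vertex_average V (trace_of U w)"
proof -
  assume w: "w \<in> traced U"
  obtain p where p: "p \<in> polys k" "\<And>q. q\<in>polys k \<Longrightarrow> grad_inner U p q = grad_inner U w q"
    "vertex_average V p = vertex_average V (trace_of U w)"
    using Pi_nabla_exists[OF w, of k] by blast
  have P: "Pi_nabla k U V w = p" by (rule Pi_nabla_unique[OF p])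
  show "Pi_nabla k U V w \<in> polys k" using P p by simp
  show "q \<in> polys k \<Longrightarrow> grad_inner U (Pi_nabla k U V w) q = grad_inner U w q" using P p by simp
  show "vertex_average V (Pi_nabla k U V w) = vertex_average V (trace_of U w)" using P p by simp
qed

lemma Pi_nabla_id:
  assumes p: "p \<in> polys k" shows "Pi_nabla k U V p = p"
  by (rule Pi_nabla_unique[OF p refl]) (simp add: trace_average_polys[OF p])

lemma Pi_nabla_add:
  assumes u: "u \<in> traced U" and v: "v \<in> traced U"
  shows "Pi_nabla k U V (\<lambda>x. u x + v x) = (\<lambda>x. Pi_nabla k U V u x + Pi_nabla k U V v x)"
proof (rule Pi_nabla_unique)
  note H1 = polys_H1[OF domU(1,2)]
  show "(\<lambda>x. Pi_nabla k U V u x + Pi_nabla k U V v x) \<in> polys k"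
    by (intro fun_subspace_add[OF polys_subspace] Pi_nabla_polys u v)
  fix q :: "real^'n \<Rightarrow> real" assume q: "q \<in> polys k"
  note add = form_add_left[OF H1_subspace[OF domU(1)] grad_inner_bilinear[OF domU(1)] _ _ H1[OF q]]
  show "grad_inner U (\<lambda>x. Pi_nabla k U V u x + Pi_nabla k U V v x) q = grad_inner U (\<lambda>x. u x + v x) q"
    using add[OF traced_H1[OF u] traced_H1[OF v]]
      add[OF H1[OF Pi_nabla_polys[OF u, of k]] H1[OF Pi_nabla_polys[OF v, of k]]]
      Pi_nabla_grad[OF u q] Pi_nabla_grad[OF v q] by simp
next
  show "vertex_average V (\<lambda>x. Pi_nabla k U V u x + Pi_nabla k U V v x) = vertex_average V (trace_of U (\<lambda>x. u x + v x))"
    unfolding vertex_average_add trace_average_add[OF u v] by (simp add: Pi_nabla_average u v)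
qed

lemma Pi_nabla_scale:
  assumes u: "u \<in> traced U"
  shows "Pi_nabla k U V (\<lambda>x. c *\<^sub>R u x) = (\<lambda>x. c *\<^sub>R Pi_nabla k U V u x)"
proof (rule Pi_nabla_unique)
  note H1 = polys_H1[OF domU(1,2)]
  show "(\<lambda>x. c *\<^sub>R Pi_nabla k U V u x) \<in> polys k"
    by (intro fun_subspace_scale[OF polys_subspace] Pi_nabla_polys u)
  fix q :: "real^'n \<Rightarrow> real" assume q: "q \<in> polys k"
  note scale = form_scale_left[OF H1_subspace[OF domU(1)] grad_inner_bilinear[OF domU(1)] _ H1[OF q]]
  show "grad_inner U (\<lambda>x. c *\<^sub>R Pi_nabla k U V u x) q = grad_inner U (\<lambda>x. c *\<^sub>R u x) q"
    using scale[OF traced_H1[OF u], of c] scale[OF H1[OF Pi_nabla_polys[OF u, of k]], of c]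
      Pi_nabla_grad[OF u q] by simp
next
  show "vertex_average V (\<lambda>x. c *\<^sub>R Pi_nabla k U V u x) = vertex_average V (trace_of U (\<lambda>x. c *\<^sub>R u x))"
    unfolding vertex_average_scale trace_average_scale[OF u] by (simp add: Pi_nabla_average u)
qed

section \<open>Local virtual element spaces\<close>

lemma top_polys_subset: "top_polys k (S :: (real^'n) set) \<subseteq> polys k"
proof
  fix q :: "real^'n \<Rightarrow> real" assume "q \<in> top_polys k S"
  then obtain c where c: "q = (\<lambda>x. \<Sum>s | (\<Sum>i\<in>UNIV. s i) = k \<or> (\<Sum>i\<in>UNIV. s i) + 1 = k.
                        c s * monomial s ((1 / diameter S) *\<^sub>R (x - barycenter S)))"
    by (auto simp: top_polys_def)
  let ?I = "{s :: 'n \<Rightarrow> nat. (\<Sum>i\<in>UNIV. s i) = k \<or> (\<Sum>i\<in>UNIV. s i) + 1 = k}"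
  have "(\<lambda>x. \<Sum>s\<in>?I. c s * monomial s x) \<in> monomial_span ?I"
    by (auto simp: monomial_span_def)
  moreover have "monomial_span ?I \<subseteq> polys k"
    unfolding polys_span by (rule monomial_span_mono[OF finite_multiindices]) auto
  ultimately have r: "(\<lambda>x. \<Sum>s\<in>?I. c s * monomial s x) \<in> polys k" by blast
  have "linear (\<lambda>x::real^'n. (1 / diameter S) *\<^sub>R x)" by (rule linear_scale_self)
  from polys_affine[OF this r, of "- ((1 / diameter S) *\<^sub>R barycenter S)"]
  show "q \<in> polys k" by (simp add: c scaleR_diff_right)
qed

lemma local_space_traced: "w \<in> local_space k U V P \<Longrightarrow> w \<in> traced U"
  by (auto simp: local_space_def traced_def)

lemma weak_laplacian_add:
  assumes u: "u \<in> H1 U" "weak_laplacian U u p" and v: "v \<in> H1 U" "weak_laplacian U v q"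
    and pq: "p \<in> polys k" "q \<in> polys k"
  shows "weak_laplacian U (\<lambda>x. u x + v x) (\<lambda>x. p x + q x)"
  unfolding weak_laplacian_def
proof (intro allI impI)
  fix \<phi> D\<phi> assume t: "test_function U \<phi> D\<phi>"
  have meas: "U \<in> sets lebesgue" using domU(1) by simp
  note t2 = test_function_L2[OF t meas]
  have f: "(LINT x:U|lebesgue. f x * \<phi> x) = L2_inner U f \<phi>" for f by (simp add: L2_inner_def)
  note add = form_add_left[OF L2_subspace L2_inner_bilinear]
  have "L2_inner U (grad U (\<lambda>x. u x + v x)) D\<phi> = L2_inner U (\<lambda>x. grad U u x + grad U v x) D\<phi>"
    by (rule L2_cong_AE(3)[OF grad_add[OF domU(1) u(1) v(1)]])
  also have "\<dots> = L2_inner U (grad U u) D\<phi> + L2_inner U (grad U v) D\<phi>"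
    by (rule add[OF grad_weak_gradient(1)[OF u(1)] grad_weak_gradient(1)[OF v(1)] t2(2)])
  also have "\<dots> = - L2_inner U p \<phi> - L2_inner U q \<phi>"
    using u(2) v(2) t unfolding weak_laplacian_def by (simp add: f L2_inner_def[of U _ D\<phi>])
  also have "\<dots> = - L2_inner U (\<lambda>x. p x + q x) \<phi>"
    using add[OF polys_L2[OF domU(1-3) pq(1)] polys_L2[OF domU(1-3) pq(2)] t2(1)] by simp
  finally show "(LINT x:U|lebesgue. grad U (\<lambda>x. u x + v x) x \<bullet> D\<phi> x) = - (LINT x:U|lebesgue. (p x + q x) * \<phi> x)"
    unfolding f by (simp add: L2_inner_def[of U _ D\<phi>])
qed

lemma weak_laplacian_scale:
  assumes u: "u \<in> H1 U" "weak_laplacian U u p"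
  shows "weak_laplacian U (\<lambda>x. c *\<^sub>R u x) (\<lambda>x. c *\<^sub>R p x)"
  unfolding weak_laplacian_def
proof (intro allI impI)
  fix \<phi> D\<phi> assume t: "test_function U \<phi> D\<phi>"
  have "(LINT x:U|lebesgue. grad U (\<lambda>x. c *\<^sub>R u x) x \<bullet> D\<phi> x) = L2_inner U (\<lambda>x. c *\<^sub>R grad U u x) D\<phi>"
    unfolding L2_inner_def[symmetric] by (rule L2_cong_AE(3)[OF grad_scale[OF domU(1) u(1)]])
  also have "\<dots> = c * (LINT x:U|lebesgue. grad U u x \<bullet> D\<phi> x)" by (simp add: L2_inner_def)
  also have "\<dots> = - (LINT x:U|lebesgue. c *\<^sub>R p x * \<phi> x)"
    using u(2) t unfolding weak_laplacian_def by (simp add: mult.assoc)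
  finally show "(LINT x:U|lebesgue. grad U (\<lambda>x. c *\<^sub>R u x) x \<bullet> D\<phi> x) = - (LINT x:U|lebesgue. c *\<^sub>R p x * \<phi> x)" .
qed

lemma polys_local_space:
  assumes P: "P p" and p: "p \<in> polys k"
  shows "p \<in> local_space k U V P"
proof -
  have "(LINT x:U|lebesgue. (p x - Pi_nabla k U V p x) * q x) = 0" for q
    by (simp add: Pi_nabla_id[OF p])
  then show ?thesis unfolding local_space_def
    using P continuous_trace_polys[OF p] polys_H1[OF domU(1,2) p] polys_weak_laplacian[OF domU(1,2) p] by blast
qed

text \<open>
  The orthogonality condition is linear because \<open>Pi_nabla\<close> is linear on functions with a continuous
  trace.
\<close>
lemma local_space_subspace:
  assumes P0: "P (\<lambda>_. 0)" and Padd: "\<And>g g'. P g \<Longrightarrow> P g' \<Longrightarrow> P (\<lambda>x. g x + g' x)"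
    and Pscale: "\<And>c g. P g \<Longrightarrow> P (\<lambda>x. c *\<^sub>R g x)"
  shows "fun_subspace (local_space k U V P)"
proof (rule fun_subspaceI)
  show "(\<lambda>_. 0) \<in> local_space k U V P" by (rule polys_local_space[where P = P, OF P0 polys_const])
next
  fix u v assume u: "u \<in> local_space k U V P" and v: "v \<in> local_space k U V P"
  note ut = local_space_traced[OF u] and vt = local_space_traced[OF v]
  obtain g g' where g: "continuous_trace U u g" "P g" "continuous_trace U v g'" "P g'"
    using u v by (auto simp: local_space_def)
  obtain p q where p: "p \<in> polys k" "weak_laplacian U u p" and q: "q \<in> polys k" "weak_laplacian U v q"
    using u v by (auto simp: local_space_def)
  have orth: "(LINT x:U|lebesgue. ((u x + v x) - Pi_nabla k U V (\<lambda>x. u x + v x) x) * r x) = 0" if r: "r \<in> top_polys k U" for r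
  proof -
    have rL: "r \<in> L2 U" using polys_L2[OF domU(1-3)] top_polys_subset r by blast
    let ?f = "\<lambda>w x. w x - Pi_nabla k U V w x"
    have f: "?f w \<in> L2 U" if "w \<in> traced U" for w
      by (rule fun_subspace_diff[OF L2_subspace H1_L2[OF traced_H1[OF that]] polys_L2[OF domU(1-3) Pi_nabla_polys[OF that]]])
    have "(\<lambda>x. (u x + v x) - Pi_nabla k U V (\<lambda>x. u x + v x) x) = (\<lambda>x. ?f u x + ?f v x)"
      unfolding Pi_nabla_add[OF ut vt] by auto
    then have "L2_inner U (\<lambda>x. (u x + v x) - Pi_nabla k U V (\<lambda>x. u x + v x) x) r = L2_inner U (?f u) r + L2_inner U (?f v) r"
      using form_add_left[OF L2_subspace L2_inner_bilinear f[OF ut] f[OF vt] rL] by simp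
    also have "\<dots> = 0" using u v r unfolding local_space_def by (simp add: L2_inner_def)
    finally show ?thesis by (simp add: L2_inner_def)
  qed
  have "(\<lambda>x. u x + v x) \<in> H1 U" by (rule fun_subspace_add[OF H1_subspace[OF domU(1)] traced_H1[OF ut] traced_H1[OF vt]])
  then show "(\<lambda>x. u x + v x) \<in> local_space k U V P"
    unfolding local_space_def
    using orth continuous_trace_add[OF g(1,3)] Padd[OF g(2,4)]
      weak_laplacian_add[OF traced_H1[OF ut] p(2) traced_H1[OF vt] q(2) p(1) q(1)]
      fun_subspace_add[OF polys_subspace p(1) q(1)] by blast
next
  fix c u assume u: "u \<in> local_space k U V P"
  note ut = local_space_traced[OF u]
  obtain g where g: "continuous_trace U u g" "P g" using u by (auto simp: local_space_def)
  obtain p where p: "p \<in> polys k" "weak_laplacian U u p" using u by (auto simp: local_space_def)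
  have orth: "(LINT x:U|lebesgue. (c *\<^sub>R u x - Pi_nabla k U V (\<lambda>x. c *\<^sub>R u x) x) * r x) = 0" if r: "r \<in> top_polys k U" for r
  proof -
    have "(LINT x:U|lebesgue. (c *\<^sub>R u x - Pi_nabla k U V (\<lambda>x. c *\<^sub>R u x) x) * r x) =
        (LINT x:U|lebesgue. c * ((u x - Pi_nabla k U V u x) * r x))"
      unfolding Pi_nabla_scale[OF ut] by (simp add: algebra_simps)
    also have "\<dots> = 0" using u r unfolding local_space_def by simp
    finally show ?thesis .
  qed
  have "(\<lambda>x. c *\<^sub>R u x) \<in> H1 U" by (rule fun_subspace_scale[OF H1_subspace[OF domU(1)] traced_H1[OF ut]])
  then show "(\<lambda>x. c *\<^sub>R u x) \<in> local_space k U V P"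
    unfolding local_space_def
    using orth continuous_trace_scale[OF g(1), of c] Pscale[OF g(2), of c]
      weak_laplacian_scale[OF traced_H1[OF ut] p(2), of c]
      fun_subspace_scale[OF polys_subspace p(1), of c] by blast
qed

end

section \<open>Invariance of the spaces on faces under rigid motions\<close>

text \<open>
  A rigid motion \<open>\<rho>\<close> of the plane with its inverse \<open>\<sigma>\<close>, and their linear parts \<open>L\<close> and \<open>K\<close>.  The
  inverse is carried along so that every statement about \<open>\<rho>\<close> can be used for \<open>\<sigma>\<close> as well.
\<close>
locale rigid_pair =
  fixes \<rho> \<sigma> L K :: "real^2 \<Rightarrow> real^2" and a :: "real^2"
  assumes orth: "orthogonal_transformation L" and lK: "linear K"
    and \<rho>_def: "\<rho> = (\<lambda>x. a + L x)" and \<sigma>_def: "\<sigma> = (\<lambda>y. K (- a) + K y)"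
    and LK: "\<And>y. L (K y) = y" and KL: "\<And>x. K (L x) = x"
begin

lemma lL: "linear L" using orth by (simp add: orthogonal_transformation_def)

lemma adj: "L x \<bullet> y = x \<bullet> K y"
  using orth LK[of y] unfolding orthogonal_transformation_def by metis

lemma \<sigma>\<rho>: "\<sigma> (\<rho> x) = x"
  by (simp add: \<sigma>_def \<rho>_def linear_add[OF lK] KL linear_neg[OF lK])

lemma \<rho>\<sigma>: "\<rho> (\<sigma> y) = y"
  by (simp add: \<sigma>_def \<rho>_def linear_add[OF lL] LK)

lemma Korth: "orthogonal_transformation K"
  unfolding orthogonal_transformation_def using lK adj LK by metis

lemma swap: "rigid_pair \<sigma> \<rho> K L (K (- a))"
proof (rule rigid_pair.intro)
  show "\<rho> = (\<lambda>y. L (- K (- a)) + L y)"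
    by (simp add: \<rho>_def linear_neg[OF lL] LK)
qed (use Korth lL \<sigma>_def LK KL in auto)

lemma dist_\<rho>: "dist (\<rho> x) (\<rho> y) = dist x y"
  using orthogonal_transformation_norm[OF orth, of "x - y"] by (simp add: \<rho>_def dist_norm linear_diff[OF lL])

lemma norm_K: "norm (K x) = norm x"
  using orthogonal_transformation_norm[OF Korth] by simp

lemma inner_K: "K x \<bullet> K y = x \<bullet> y"
  using Korth by (simp add: orthogonal_transformation_def)

lemma cont_\<rho>: "continuous_on A \<rho>" and cont_\<sigma>: "continuous_on A \<sigma>"
  unfolding \<rho>_def \<sigma>_def by (rule isometry_continuous[OF lL], rule isometry_continuous[OF lK])

lemma bl: "bounded_linear L" "bounded_linear K"
  using lL lK by (simp_all add: linear_conv_bounded_linear)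

lemma inj_\<rho>: "inj \<rho>" using \<sigma>\<rho> by (metis injI)

lemma \<rho>_image_vimage: "\<rho> ` A = \<sigma> -` A"
  using \<sigma>\<rho> \<rho>\<sigma> by (auto simp: image_iff) metis

lemma \<sigma>\<rho>_image: "\<sigma> ` \<rho> ` A = A" using \<sigma>\<rho> by (simp add: image_image)

lemma open_\<rho>: "open U \<Longrightarrow> open (\<rho> ` U)"
  unfolding \<rho>_image_vimage by (rule open_vimage[OF _ cont_\<sigma>])

lemma closure_\<rho>: "closure (\<rho> ` U) = \<rho> ` closure U"
  unfolding \<rho>_def using closure_translation[of a "L ` U"]
    closure_injective_linear_image[OF lL orthogonal_transformation_inj[OF orth], of U, symmetric]
  by (simp add: image_image)

lemma Compl_\<rho>: "- (\<rho> ` U) = \<rho> ` (- U)" unfolding \<rho>_image_vimage by auto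

lemma frontier_\<rho>: "frontier (\<rho> ` U) = \<rho> ` frontier U"
  unfolding frontier_closures Compl_\<rho> closure_\<rho> by (simp add: image_Int[OF inj_\<rho>])

lemma compact_\<rho>: "compact C \<Longrightarrow> compact (\<rho> ` C)"
  by (rule compact_continuous_image[OF cont_\<rho>])

subsection \<open>Lebesgue measure\<close>

text \<open>
  The preimage of a box under \<open>\<sigma>\<close> is the image of the box under the rigid motion \<open>\<rho>\<close>, which preserves
  its measure.
\<close>
lemma lborel_\<sigma>: "distr lborel borel \<sigma> = lborel"
proof (rule lborel_eqI[symmetric])
  fix l u :: "real^2" assume le: "\<And>b. b \<in> Basis \<Longrightarrow> l \<bullet> b \<le> u \<bullet> b"
  have [measurable]: "\<sigma> \<in> borel \<rightarrow>\<^sub>M borel" by (rule borel_measurable_continuous_onI[OF cont_\<sigma>])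
  have vim: "\<sigma> -` box l u = (+) a ` L ` box l u"
    unfolding \<rho>_image_vimage[symmetric] by (auto simp: \<rho>_def image_image)
  have m: "L ` box l u \<in> lmeasurable" "measure lebesgue (L ` box l u) = measure lebesgue (box l u)"
    by (rule measurable_orthogonal_image[OF orth lmeasurable_box], rule measure_orthogonal_image[OF orth lmeasurable_box])
  have "emeasure (distr lborel borel \<sigma>) (box l u) = emeasure lborel (\<sigma> -` box l u)"
    by (subst emeasure_distr) auto
  also have "\<dots> = emeasure lebesgue (\<sigma> -` box l u)"
  proof -
    have "open (\<sigma> -` box l u)" by (rule open_vimage[OF open_box cont_\<sigma>])
    then show ?thesis by simp
  qed
  also have "\<dots> = ennreal (measure lebesgue ((+) a ` L ` box l u))"
    unfolding vim using m(1) measurable_translation by (metis emeasure_eq_measure2)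
  also have "measure lebesgue ((+) a ` L ` box l u) = measure lebesgue (box l u)"
    by (simp add: measure_translation m(2))
  also have "ennreal (measure lebesgue (box l u)) = (\<Prod>b\<in>Basis. (u - l) \<bullet> b)"
    using emeasure_eq_measure2[OF lmeasurable_box, of l u] emeasure_lborel_box[OF le] by simp
  finally show "emeasure (distr lborel borel \<sigma>) (box l u) = (\<Prod>b\<in>Basis. (u - l) \<bullet> b)" .
qed simp

lemma lebesgue_\<sigma>: "\<sigma> \<in> lebesgue \<rightarrow>\<^sub>M lebesgue" "distr lebesgue lebesgue \<sigma> = lebesgue"
proof -
  have b: "\<sigma> \<in> lborel \<rightarrow>\<^sub>M lborel"
    using borel_measurable_continuous_onI[OF cont_\<sigma>] by simp
  have b': "\<sigma> \<in> lebesgue \<rightarrow>\<^sub>M lborel" by (rule measurable_completion[OF b])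
  have "distr lborel lborel \<sigma> = distr lborel borel \<sigma>" by (rule distr_cong) auto
  then have d: "distr lebesgue lborel \<sigma> = lborel" using distr_completion[OF b] lborel_\<sigma> by simp
  show "\<sigma> \<in> lebesgue \<rightarrow>\<^sub>M lebesgue"
    by (rule completion.measurable_completion2[OF b']) (simp add: d)
  show "distr lebesgue lebesgue \<sigma> = lebesgue"
    using completion.completion_distr_eq[OF b'] by (simp add: d)
qed

end

context rigid_pair
begin

interpretation swapped: rigid_pair \<sigma> \<rho> K L "K (- a)" by (rule swap)

lemmas lebesgue_\<rho> = swapped.lebesgue_\<sigma>

lemma measurable_\<rho>:
  fixes f :: "real^2 \<Rightarrow> 'b::euclidean_space"
  shows "(\<lambda>x. f (\<rho> x)) \<in> borel_measurable lebesgue \<longleftrightarrow> f \<in> borel_measurable lebesgue"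
proof
  assume "(\<lambda>x. f (\<rho> x)) \<in> borel_measurable lebesgue"
  from measurable_compose[OF lebesgue_\<sigma>(1) this] show "f \<in> borel_measurable lebesgue" by (simp add: \<rho>\<sigma>)
qed (rule measurable_compose[OF lebesgue_\<rho>(1)])

lemma integrable_\<rho>:
  fixes f :: "real^2 \<Rightarrow> 'b::euclidean_space"
  shows "integrable lebesgue (\<lambda>x. f (\<rho> x)) \<longleftrightarrow> integrable lebesgue f"
proof (cases "f \<in> borel_measurable lebesgue")
  case True
  then show ?thesis using integrable_distr_eq[OF lebesgue_\<rho>(1), of f] lebesgue_\<rho>(2) by simp
next
  case False
  then show ?thesis using measurable_\<rho>[of f] borel_measurable_integrable by blast
qed

lemma integral_\<rho>:
  fixes f :: "real^2 \<Rightarrow> 'b::euclidean_space"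
  shows "(\<integral>x. f (\<rho> x) \<partial>lebesgue) = integral\<^sup>L lebesgue f"
proof (cases "f \<in> borel_measurable lebesgue")
  case True
  then show ?thesis using integral_distr[OF lebesgue_\<rho>(1), of f] lebesgue_\<rho>(2) by simp
next
  case False
  then have "\<not> integrable lebesgue f" using borel_measurable_integrable by blast
  then show ?thesis using integrable_\<rho>[of f] by (simp add: not_integrable_integral_eq)
qed

lemma zero_ext_\<rho>: "zero_ext U (\<lambda>x. f (\<rho> x)) = (\<lambda>x. zero_ext (\<rho> ` U) f (\<rho> x))"
  using inj_\<rho> by (auto simp: zero_ext_def inj_image_mem_iff fun_eq_iff)

lemma set_integral_\<rho>:
  fixes f :: "real^2 \<Rightarrow> 'b::euclidean_space"
  shows "(LINT x:U|lebesgue. f (\<rho> x)) = (LINT y:\<rho> ` U|lebesgue. f y)"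
  unfolding set_integral_zero_ext zero_ext_\<rho> by (rule integral_\<rho>)

lemma L2_\<rho>:
  fixes f :: "real^2 \<Rightarrow> 'b::euclidean_space"
  shows "(\<lambda>x. f (\<rho> x)) \<in> L2 U \<longleftrightarrow> f \<in> L2 (\<rho> ` U)"
  unfolding L2_iff zero_ext_\<rho> measurable_\<rho>
    integrable_\<rho>[where f = "\<lambda>x. (norm (zero_ext (\<rho> ` U) f x))\<^sup>2"] ..

lemma L2_inner_\<rho>: "L2_inner U (\<lambda>x. u (\<rho> x)) (\<lambda>x. v (\<rho> x)) = L2_inner (\<rho> ` U) u v"
  unfolding L2_inner_def by (rule set_integral_\<rho>)

lemma zero_ext_K: "zero_ext U (\<lambda>x. K (f x)) = (\<lambda>x. K (zero_ext U f x))"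
  using linear_0[OF lK] by (auto simp: zero_ext_def fun_eq_iff)

lemma L2_K: "f \<in> L2 U \<Longrightarrow> (\<lambda>x. K (f x)) \<in> L2 U"
  unfolding L2_iff zero_ext_K norm_K
  using measurable_compose[OF _ borel_measurable_continuous_onI[OF linear_continuous_on[OF bl(2)]]] by blast

lemma L2_inner_K: "L2_inner U (\<lambda>x. K (u x)) (\<lambda>x. K (v x)) = L2_inner U u v"
  by (simp add: L2_inner_def inner_K)

lemma set_integral_K: "(LINT x:U|lebesgue. K (f x)) = K (LINT x:U|lebesgue. f x)"
  unfolding set_integral_zero_ext zero_ext_K
  by (rule integral_bounded_linear'[OF bl(2,1)]) (simp add: LK KL)

subsection \<open>Test functions and Sobolev spaces\<close>

lemma C1_fun_\<rho>:
  assumes "C1_fun f Df" shows "C1_fun (\<lambda>x. f (\<rho> x)) (\<lambda>x. K (Df (\<rho> x)))"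
  unfolding C1_fun_def
proof
  show "\<forall>x. GDERIV (\<lambda>x. f (\<rho> x)) x :> K (Df (\<rho> x))"
  proof
    fix x
    have "(\<rho> has_derivative L) (at x)"
      unfolding \<rho>_def using bounded_linear_imp_has_derivative[OF bl(1), of "at x"]
      by (auto intro!: derivative_eq_intros)
    moreover have "(f has_derivative (\<lambda>h. h \<bullet> Df (\<rho> x))) (at (\<rho> x))"
      using C1_fun_gderiv[OF assms] unfolding gderiv_def .
    ultimately have "((\<lambda>x. f (\<rho> x)) has_derivative (\<lambda>h. L h \<bullet> Df (\<rho> x))) (at x)"
      by (rule has_derivative_compose)
    then show "GDERIV (\<lambda>x. f (\<rho> x)) x :> K (Df (\<rho> x))" unfolding gderiv_def adj .
  qed
  show "continuous_on UNIV (\<lambda>x. K (Df (\<rho> x)))"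
    using continuous_on_compose[OF continuous_on_compose[OF cont_\<rho> continuous_on_subset[OF C1_fun_continuous_gradient[OF assms]]]
        linear_continuous_on[OF bl(2)], of UNIV] by (simp add: o_def)
qed

lemma test_function_\<rho>:
  assumes "test_function (\<rho> ` U) \<phi> D\<phi>"
  shows "test_function U (\<lambda>x. \<phi> (\<rho> x)) (\<lambda>x. K (D\<phi> (\<rho> x)))"
proof -
  obtain C where C: "compact C" "C \<subseteq> \<rho> ` U" "\<forall>x. x \<notin> C \<longrightarrow> \<phi> x = 0 \<and> D\<phi> x = 0"
    using test_function_support[OF assms] by auto
  show ?thesis
  proof (rule test_functionI[OF C1_fun_\<rho>[OF test_function_C1[OF assms]]])
    show "compact (\<sigma> ` C)" by (rule rigid_pair.compact_\<rho>[OF swap  C(1)])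
    show "\<sigma> ` C \<subseteq> U" using image_mono[OF C(2), of \<sigma>] by (simp add: \<sigma>\<rho>_image)
    show "\<phi> (\<rho> x) = 0" if "x \<notin> \<sigma> ` C" for x
    proof -
      have "\<rho> x \<notin> C" using that \<sigma>\<rho> by (metis imageI)
      then show ?thesis using C(3) by blast
    qed
  qed
qed

lemma test_function_\<sigma>:
  assumes "test_function U \<phi> D\<phi>"
  shows "test_function (\<rho> ` U) (\<lambda>y. \<phi> (\<sigma> y)) (\<lambda>y. L (D\<phi> (\<sigma> y)))"
  by (rule rigid_pair.test_function_\<rho>[OF swap]) (simp add: \<sigma>\<rho>_image assms)

text \<open>
  By the chain rule the gradient of \<open>w \<circ> \<rho>\<close> is the transpose of \<open>L\<close>, that is \<open>K\<close>, applied to the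
  gradient of \<open>w\<close>.
\<close>
lemma weak_gradient_\<rho>:
  assumes "weak_gradient (\<rho> ` U) w g"
  shows "weak_gradient U (\<lambda>x. w (\<rho> x)) (\<lambda>x. K (g (\<rho> x)))"
  unfolding weak_gradient_def
proof (intro allI impI)
  fix \<phi> D\<phi> assume t: "test_function U \<phi> D\<phi>"
  have "(LINT y:\<rho> ` U|lebesgue. w y *\<^sub>R L (D\<phi> (\<sigma> y))) = - (LINT y:\<rho> ` U|lebesgue. \<phi> (\<sigma> y) *\<^sub>R g y)"
    using assms test_function_\<sigma>[OF t] unfolding weak_gradient_def by blast
  then have "(LINT x:U|lebesgue. w (\<rho> x) *\<^sub>R L (D\<phi> x)) = - (LINT x:U|lebesgue. \<phi> x *\<^sub>R g (\<rho> x))"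
    unfolding set_integral_\<rho>[symmetric] \<sigma>\<rho> .
  then have "K (LINT x:U|lebesgue. w (\<rho> x) *\<^sub>R L (D\<phi> x)) = - K (LINT x:U|lebesgue. \<phi> x *\<^sub>R g (\<rho> x))"
    by (simp add: linear_neg[OF lK])
  then show "(LINT x:U|lebesgue. w (\<rho> x) *\<^sub>R D\<phi> x) = - (LINT x:U|lebesgue. \<phi> x *\<^sub>R K (g (\<rho> x)))"
    unfolding set_integral_K[symmetric] by (simp add: linear_cmul[OF lK] KL)
qed

lemma H1_\<rho>:
  assumes "w \<in> H1 (\<rho> ` U)" shows "(\<lambda>x. w (\<rho> x)) \<in> H1 U"
proof (rule H1_I[OF _ _ weak_gradient_\<rho>[OF grad_weak_gradient(2)[OF assms]]])
  show "(\<lambda>x. w (\<rho> x)) \<in> L2 U" using H1_L2[OF assms] by (simp add: L2_\<rho>)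
  show "(\<lambda>x. K (grad (\<rho> ` U) w (\<rho> x))) \<in> L2 U"
    by (rule L2_K) (use L2_\<rho> grad_weak_gradient(1)[OF assms] in blast)
qed

lemma grad_\<rho>:
  assumes U: "open U" and w: "w \<in> H1 (\<rho> ` U)"
  shows "AE x in lebesgue. x \<in> U \<longrightarrow> grad U (\<lambda>x. w (\<rho> x)) x = K (grad (\<rho> ` U) w (\<rho> x))"
proof (rule grad_AE[OF U _ _ weak_gradient_\<rho>[OF grad_weak_gradient(2)[OF w]]])
  show "(\<lambda>x. w (\<rho> x)) \<in> L2 U" using H1_L2[OF w] by (simp add: L2_\<rho>)
  show "(\<lambda>x. K (grad (\<rho> ` U) w (\<rho> x))) \<in> L2 U"
    by (rule L2_K) (use L2_\<rho> grad_weak_gradient(1)[OF w] in blast)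
qed

lemma grad_inner_\<rho>:
  assumes U: "open U" and w: "w \<in> H1 (\<rho> ` U)" "v \<in> H1 (\<rho> ` U)"
  shows "grad_inner U (\<lambda>x. w (\<rho> x)) (\<lambda>x. v (\<rho> x)) = grad_inner (\<rho> ` U) w v"
proof -
  have "grad_inner U (\<lambda>x. w (\<rho> x)) (\<lambda>x. v (\<rho> x)) =
      L2_inner U (\<lambda>x. K (grad (\<rho> ` U) w (\<rho> x))) (\<lambda>x. K (grad (\<rho> ` U) v (\<rho> x)))"
    unfolding grad_inner_def L2_cong_AE(3)[OF grad_\<rho>[OF U w(1)]] L2_cong_AE(4)[OF grad_\<rho>[OF U w(2)]] ..
  also have "\<dots> = grad_inner (\<rho> ` U) w v"
    unfolding L2_inner_K grad_inner_def by (rule L2_inner_\<rho>)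
  finally show ?thesis .
qed

lemma H1_norm_\<rho>:
  assumes "open U" "w \<in> H1 (\<rho> ` U)"
  shows "H1_norm U (\<lambda>x. w (\<rho> x)) = H1_norm (\<rho> ` U) w"
  unfolding H1_norm_inner using grad_inner_\<rho>[OF assms(1) assms(2) assms(2)] L2_inner_\<rho>[of U w w] by simp

lemma H10_\<rho>:
  assumes U: "open U" and w: "w \<in> H10 (\<rho> ` U)" shows "(\<lambda>x. w (\<rho> x)) \<in> H10 U"
proof -
  obtain \<phi> D\<phi> where \<phi>: "\<And>n::nat. test_function (\<rho> ` U) (\<phi> n) (D\<phi> n)"
    "(\<lambda>n. H1_norm (\<rho> ` U) (\<lambda>x. w x - \<phi> n x)) \<longlonglongrightarrow> 0"
    using w unfolding H10_def by blast
  have wH: "w \<in> H1 (\<rho> ` U)" by (rule H10_H1[OF open_\<rho>[OF U] w])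
  show ?thesis
  proof (rule H10_I[OF U H1_\<rho>[OF wH] test_function_\<rho>[OF \<phi>(1)]])
    have "(\<lambda>x. w x - \<phi> n x) \<in> H1 (\<rho> ` U)" for n
      by (rule fun_subspace_diff[OF H1_subspace[OF open_\<rho>[OF U]] wH test_function_H1[OF open_\<rho>[OF U] \<phi>(1)]])
    from H1_norm_\<rho>[OF U this] show "(\<lambda>n. H1_norm U (\<lambda>x. w (\<rho> x) - \<phi> n (\<rho> x))) \<longlonglongrightarrow> 0"
      using \<phi>(2) by simp
  qed
qed

lemma continuous_trace_\<rho>:
  assumes U: "open U" and w: "continuous_trace (\<rho> ` U) w g"
  shows "continuous_trace U (\<lambda>x. w (\<rho> x)) (\<lambda>x. g (\<rho> x))"
proof -
  obtain G where G: "G \<in> H1 (\<rho> ` U)" "continuous_on (closure (\<rho> ` U)) G"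
    "\<forall>x \<in> frontier (\<rho> ` U). G x = g x" "(\<lambda>x. w x - G x) \<in> H10 (\<rho> ` U)"
    and g: "continuous_on (frontier (\<rho> ` U)) g"
    using w by (auto simp: continuous_trace_def)
  have "continuous_on (frontier U) (\<lambda>x. g (\<rho> x))" "continuous_on (closure U) (\<lambda>x. G (\<rho> x))"
    using g G(2) unfolding frontier_\<rho> closure_\<rho>
    by (auto intro: continuous_on_compose2[OF _ cont_\<rho>])
  moreover have "\<forall>x \<in> frontier U. G (\<rho> x) = g (\<rho> x)" using G(3) by (auto simp: frontier_\<rho>)
  ultimately show ?thesis unfolding continuous_trace_def
    using H1_\<rho>[OF G(1)] H10_\<rho>[OF U G(4)] by blast
qed

lemma weak_laplacian_\<rho>:
  assumes U: "open U" and w: "w \<in> H1 (\<rho> ` U)" and p: "weak_laplacian (\<rho> ` U) w p"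
  shows "weak_laplacian U (\<lambda>x. w (\<rho> x)) (\<lambda>x. p (\<rho> x))"
  unfolding weak_laplacian_def
proof (intro allI impI)
  fix \<phi> D\<phi> assume t: "test_function U \<phi> D\<phi>"
  have "(LINT x:U|lebesgue. grad U (\<lambda>x. w (\<rho> x)) x \<bullet> D\<phi> x) = L2_inner U (\<lambda>x. K (grad (\<rho> ` U) w (\<rho> x))) D\<phi>"
    unfolding L2_inner_def[symmetric] by (rule L2_cong_AE(3)[OF grad_\<rho>[OF U w]])
  also have "\<dots> = (LINT x:U|lebesgue. grad (\<rho> ` U) w (\<rho> x) \<bullet> L (D\<phi> (\<sigma> (\<rho> x))))"
    by (simp add: L2_inner_def \<sigma>\<rho> inner_commute[of _ "L _"] adj inner_commute)
  also have "\<dots> = (LINT y:\<rho> ` U|lebesgue. grad (\<rho> ` U) w y \<bullet> L (D\<phi> (\<sigma> y)))"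
    by (rule set_integral_\<rho>)
  also have "\<dots> = - (LINT y:\<rho> ` U|lebesgue. p y * \<phi> (\<sigma> y))"
    using p test_function_\<sigma>[OF t] unfolding weak_laplacian_def by blast
  also have "\<dots> = - (LINT x:U|lebesgue. p (\<rho> x) * \<phi> x)"
    unfolding set_integral_\<rho>[symmetric] \<sigma>\<rho> ..
  finally show "(LINT x:U|lebesgue. grad U (\<lambda>x. w (\<rho> x)) x \<bullet> D\<phi> x) = - (LINT x:U|lebesgue. p (\<rho> x) * \<phi> x)" .
qed

subsection \<open>Projections\<close>

lemma polys_\<rho>: "p \<in> polys k \<Longrightarrow> (\<lambda>x. p (\<rho> x)) \<in> polys k"
  unfolding \<rho>_def by (rule polys_affine[OF lL])

lemma vertex_average_\<rho>: "vertex_average V (\<lambda>x. g (\<rho> x)) = vertex_average (\<rho> ` V) g"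
  using inj_on_subset[OF inj_\<rho>, of V] by (simp add: vertex_average_def sum.reindex card_image)

lemma Pi_nabla_\<rho>:
  assumes dom: "trace_domain U V" and dom': "trace_domain (\<rho> ` U) (\<rho> ` V)" and w: "w \<in> traced (\<rho> ` U)"
  shows "Pi_nabla k U V (\<lambda>x. w (\<rho> x)) = (\<lambda>x. Pi_nabla k (\<rho> ` U) (\<rho> ` V) w (\<rho> x))"
proof (rule Pi_nabla_unique[OF dom])
  have U: "open U" and U': "open (\<rho> ` U)" "bounded (\<rho> ` U)" using domU[OF dom] domU[OF dom'] by auto
  note P = Pi_nabla_polys[OF dom' w, of k]
  show "(\<lambda>x. Pi_nabla k (\<rho> ` U) (\<rho> ` V) w (\<rho> x)) \<in> polys k" by (rule polys_\<rho>[OF P])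
  show "grad_inner U (\<lambda>x. Pi_nabla k (\<rho> ` U) (\<rho> ` V) w (\<rho> x)) q = grad_inner U (\<lambda>x. w (\<rho> x)) q"
    if q: "q \<in> polys k" for q
  proof -
    have q': "(\<lambda>y. q (\<sigma> y)) \<in> polys k" by (rule rigid_pair.polys_\<rho>[OF swap  q])
    have "q = (\<lambda>x. q (\<sigma> (\<rho> x)))" by (simp add: \<sigma>\<rho>)
    then show ?thesis
      using grad_inner_\<rho>[OF U polys_H1[OF U' P] polys_H1[OF U' q']] grad_inner_\<rho>[OF U traced_H1[OF dom' w] polys_H1[OF U' q']]
        Pi_nabla_grad[OF dom' w q'] by simp
  qed
  obtain g where g: "continuous_trace (\<rho> ` U) w g" using w by (auto simp: traced_def)
  have "vertex_average V (trace_of U (\<lambda>x. w (\<rho> x))) = vertex_average V (\<lambda>x. g (\<rho> x))"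
    by (rule vertex_average_cong[OF dom]) (rule trace_of_eq[OF dom continuous_trace_\<rho>[OF U g]])
  also have "\<dots> = vertex_average (\<rho> ` V) (trace_of (\<rho> ` U) w)"
    unfolding vertex_average_\<rho> by (rule vertex_average_cong[OF dom']) (rule trace_of_eq[OF dom' g, symmetric])
  also have "\<dots> = vertex_average V (\<lambda>x. Pi_nabla k (\<rho> ` U) (\<rho> ` V) w (\<rho> x))"
    unfolding vertex_average_\<rho> by (rule Pi_nabla_average[OF dom' w, symmetric])
  finally show "vertex_average V (\<lambda>x. Pi_nabla k (\<rho> ` U) (\<rho> ` V) w (\<rho> x)) = vertex_average V (trace_of U (\<lambda>x. w (\<rho> x)))" ..
qed

lemma measure_\<rho>: "measure lebesgue (\<rho> ` U) = measure lebesgue U"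
proof -
  have m: "(LINT x:S|lebesgue. 1::real) = measure lebesgue S" for S :: "(real^2) set"
    unfolding set_lebesgue_integral_def by simp
  show ?thesis using set_integral_\<rho>[of U "\<lambda>_. 1::real"] unfolding m by simp
qed

lemma barycenter_\<rho>:
  assumes U: "open U" "bounded U" "U \<noteq> {}"
  shows "barycenter (\<rho> ` U) = \<rho> (barycenter U)"
proof -
  have Um: "U \<in> sets lebesgue" using U by simp
  have mpos: "measure lebesgue U > 0"
  proof -
    have "\<not> negligible U" using U open_not_negligible by blast
    moreover have "U \<in> lmeasurable" using U Um by (simp add: bounded_set_imp_lmeasurable)
    ultimately show ?thesis using negligible_iff_measure zero_less_measure_iff by blast
  qed
  have id: "set_integrable lebesgue U (\<lambda>x. x)" "set_integrable lebesgue U (\<lambda>x. L x)" "set_integrable lebesgue U (\<lambda>x. a)"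
    by (rule L2_set_integrable[OF L2_I_continuous[OF _ U(2) Um] U(2) Um]; intro continuous_intros linear_continuous_on bl)+
  have "(LINT y:\<rho> ` U|lebesgue. y) = (LINT x:U|lebesgue. a + L x)"
    using set_integral_\<rho>[of U "\<lambda>y. y"] by (simp add: \<rho>_def)
  also have "\<dots> = (LINT x:U|lebesgue. a) + (LINT x:U|lebesgue. L x)" by (rule set_integral_add(2)[OF id(3,2)])
  also have "(LINT x:U|lebesgue. a) = measure lebesgue U *\<^sub>R a"
    using U Um by (simp add: set_lebesgue_integral_def bounded_set_imp_lmeasurable lmeasurable_iff_integrable[symmetric])
  also have "(LINT x:U|lebesgue. L x) = L (LINT x:U|lebesgue. x)" by (rule rigid_pair.set_integral_K[OF swap])
  finally show ?thesis
    unfolding barycenter_def measure_\<rho> using mpos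
    by (simp add: \<rho>_def scaleR_add_right linear_cmul[OF lL])
qed

lemma diameter_\<rho>: "diameter (\<rho> ` U) = diameter U"
proof -
  have "(\<lambda>(x, y). dist x y) ` (\<rho> ` U \<times> \<rho> ` U) = (\<lambda>(x, y). dist x y) ` (U \<times> U)"
    by (force simp: dist_\<rho> image_iff)
  then show ?thesis by (simp add: diameter_def)
qed

text \<open>
  Barycenter and diameter follow the rigid motion, so the scaled coordinates are transformed by the
  linear map \<open>K\<close>, which preserves the degrees of homogeneous polynomials.
\<close>
lemma top_polys_\<sigma>:
  assumes U: "open U" "bounded U" "U \<noteq> {}" and q: "q \<in> top_polys k U"
  shows "(\<lambda>y. q (\<sigma> y)) \<in> top_polys k (\<rho> ` U)"
proof -
  let ?I = "{s :: 2 \<Rightarrow> nat. (\<Sum>i\<in>UNIV. s i) = k \<or> (\<Sum>i\<in>UNIV. s i) + 1 = k}"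
  obtain c where c: "q = (\<lambda>x. \<Sum>s\<in>?I. c s * monomial s ((1 / diameter U) *\<^sub>R (x - barycenter U)))"
    using q by (auto simp: top_polys_def)
  have finI: "finite ?I" by (rule finite_subset[OF _ finite_multiindices[of k]]) auto
  have "(\<lambda>x. \<Sum>s\<in>?I. c s *\<^sub>R monomial s (K x)) \<in> monomial_span ?I"
  proof (intro fun_subspace_sum[OF monomial_span_subspace] fun_subspace_scale[OF monomial_span_subspace])
    fix s :: "2 \<Rightarrow> nat" assume s: "s \<in> ?I"
    have "monomial s \<in> homogeneous_polys (\<Sum>i\<in>UNIV. s i)"
      unfolding homogeneous_polys_def by (rule monomial_in_span[OF finite_homogeneous]) simp
    then have "(\<lambda>x. monomial s (K x)) \<in> homogeneous_polys (\<Sum>i\<in>UNIV. s i)"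
      by (rule homogeneous_polys_linear[OF lK])
    moreover have "homogeneous_polys (\<Sum>i\<in>UNIV. s i) \<subseteq> monomial_span ?I"
      unfolding homogeneous_polys_def by (rule monomial_span_mono[OF finI]) (use s in auto)
    ultimately show "(\<lambda>x. monomial s (K x)) \<in> monomial_span ?I" by blast
  qed
  then obtain d where d: "(\<lambda>x. \<Sum>s\<in>?I. c s *\<^sub>R monomial s (K x)) = (\<lambda>x. \<Sum>s\<in>?I. d s * monomial s x)"
    unfolding monomial_span_def by blast
  have "q (\<sigma> y) = (\<Sum>s\<in>?I. d s * monomial s ((1 / diameter (\<rho> ` U)) *\<^sub>R (y - barycenter (\<rho> ` U))))" for y
  proof -
    have "(1 / diameter U) *\<^sub>R (\<sigma> y - barycenter U) = K ((1 / diameter (\<rho> ` U)) *\<^sub>R (y - barycenter (\<rho> ` U)))"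
    proof -
      have "K (y - \<rho> (barycenter U)) = \<sigma> y - barycenter U"
        by (simp add: \<sigma>_def \<rho>_def linear_diff[OF lK] linear_add[OF lK] linear_neg[OF lK] KL)
      then show ?thesis unfolding diameter_\<rho> barycenter_\<rho>[OF U] linear_cmul[OF lK] by simp
    qed
    then show ?thesis
      using fun_cong[OF d, of "(1 / diameter (\<rho> ` U)) *\<^sub>R (y - barycenter (\<rho> ` U))"] by (simp add: c)
  qed
  then show ?thesis unfolding top_polys_def by blast
qed

text \<open>
  Each part of the definition of the space is transported along \<open>\<rho>\<close>: boundary values on edges, the
  Laplacian, and the orthogonality to \<open>top_polys\<close>.
\<close>
lemma W_polygon_\<rho>:
  assumes vs: "simple_polygon vs" "simple_polygon (map \<rho> vs)"
    and w: "w \<in> W_polygon k (map \<rho> vs)"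
  shows "(\<lambda>x. w (\<rho> x)) \<in> W_polygon k vs"
proof -
  let ?U = "polygon_region vs" and ?V = "set vs"
  have r: "rigid \<rho>" unfolding rigid_def using orth \<rho>_def by blast
  have region: "polygon_region (map \<rho> vs) = \<rho> ` ?U" by (rule rigid_polygon_region[OF r])
  have dom: "trace_domain ?U ?V" by (rule polygon_trace_domain[OF _ vs(1)]) simp
  have dom': "trace_domain (\<rho> ` ?U) (\<rho> ` ?V)" using polygon_trace_domain[OF _ vs(2)] by (simp add: region)
  have U: "open ?U" "bounded ?U" "?U \<noteq> {}" using domU[OF dom] by auto
  have w': "w \<in> local_space k (\<rho> ` ?U) (\<rho> ` ?V) (\<lambda>g. \<forall>e \<in> edges (map \<rho> vs). \<exists>p \<in> polys k. \<forall>x \<in> e. g x = p x)"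
    using w by (simp add: W_polygon_def region)
  have wt: "w \<in> traced (\<rho> ` ?U)" by (rule local_space_traced[OF dom' w'])
  obtain g where g: "continuous_trace (\<rho> ` ?U) w g" "\<forall>e \<in> edges (map \<rho> vs). \<exists>p \<in> polys k. \<forall>x \<in> e. g x = p x"
    using w' by (auto simp: local_space_def)
  obtain p where p: "p \<in> polys k" "weak_laplacian (\<rho> ` ?U) w p" using w' by (auto simp: local_space_def)
  have worth: "\<forall>q \<in> top_polys k (\<rho> ` ?U). (LINT x:\<rho> ` ?U|lebesgue. (w x - Pi_nabla k (\<rho> ` ?U) (\<rho> ` ?V) w x) * q x) = 0"
    using w' by (simp add: local_space_def)
  have ge: "\<forall>e \<in> edges vs. \<exists>p \<in> polys k. \<forall>x \<in> e. g (\<rho> x) = p x"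
  proof
    fix e assume "e \<in> edges vs"
    then have "\<rho> ` e \<in> edges (map \<rho> vs)" unfolding \<rho>_def edges_affine_image[OF lL] by blast
    then obtain p where p: "p \<in> polys k" "\<forall>x \<in> \<rho> ` e. g x = p x" using g(2) by blast
    then show "\<exists>p \<in> polys k. \<forall>x \<in> e. g (\<rho> x) = p x"
      by (intro bexI[of _ "\<lambda>x. p (\<rho> x)"]) (auto intro: polys_\<rho>)
  qed
  have orthogonal: "(LINT x:?U|lebesgue. (w (\<rho> x) - Pi_nabla k ?U ?V (\<lambda>x. w (\<rho> x)) x) * q x) = 0" if q: "q \<in> top_polys k ?U" for q
  proof -
    have "(LINT x:?U|lebesgue. (w (\<rho> x) - Pi_nabla k ?U ?V (\<lambda>x. w (\<rho> x)) x) * q x) =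
        (LINT x:?U|lebesgue. (w (\<rho> x) - Pi_nabla k (\<rho> ` ?U) (\<rho> ` ?V) w (\<rho> x)) * q (\<sigma> (\<rho> x)))"
      unfolding Pi_nabla_\<rho>[OF dom dom' wt] \<sigma>\<rho> ..
    also have "\<dots> = (LINT y:\<rho> ` ?U|lebesgue. (w y - Pi_nabla k (\<rho> ` ?U) (\<rho> ` ?V) w y) * q (\<sigma> y))"
      by (rule set_integral_\<rho>)
    also have "\<dots> = 0" using bspec[OF worth top_polys_\<sigma>[OF U q]] .
    finally show ?thesis .
  qed
  show ?thesis unfolding W_polygon_def local_space_def
  proof (intro CollectI conjI)
    show "(\<lambda>x. w (\<rho> x)) \<in> H1 ?U" by (rule H1_\<rho>[OF traced_H1[OF dom' wt]])
    show "\<exists>g. continuous_trace ?U (\<lambda>x. w (\<rho> x)) g \<and> (\<forall>e \<in> edges vs. \<exists>p \<in> polys k. \<forall>x \<in> e. g x = p x)"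
      by (rule exI[of _ "\<lambda>x. g (\<rho> x)"]) (rule conjI[OF continuous_trace_\<rho>[OF U(1) g(1)] ge])
    show "\<exists>p \<in> polys k. weak_laplacian ?U (\<lambda>x. w (\<rho> x)) p"
      by (rule bexI[of _ "\<lambda>x. p (\<rho> x)"], rule weak_laplacian_\<rho>[OF U(1) traced_H1[OF dom' wt] p(2)], rule polys_\<rho>[OF p(1)])
    show "\<forall>q \<in> top_polys k ?U. (LINT x:?U|lebesgue. (w (\<rho> x) - Pi_nabla k ?U ?V (\<lambda>x. w (\<rho> x)) x) * q x) = 0"
      using orthogonal by (rule ballI)
  qed
qed

end

lemma rigid_rigid_pair:
  fixes \<rho> :: "real^2 \<Rightarrow> real^2"
  assumes "rigid \<rho>"
  shows "\<exists>\<sigma> L K a. rigid_pair \<rho> \<sigma> L K a"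
proof -
  obtain a L where L: "orthogonal_transformation L" "\<rho> = (\<lambda>x. a + L x)" using assms unfolding rigid_def by blast
  have "orthogonal_transformation (inv L)" by (rule orthogonal_transformation_inv[OF L(1)])
  then have "rigid_pair \<rho> (\<lambda>y. inv L (- a) + inv L y) L (inv L) a"
    using L orthogonal_transformation_inj[OF L(1)] orthogonal_transformation_surj[OF L(1)]
    by (intro rigid_pair.intro) (auto simp: orthogonal_transformation_linear inv_f_f surj_f_inv_f)
  then show ?thesis by blast
qed

lemma simple_polygon_rigid:
  assumes \<rho>: "rigid \<rho>" and s: "simple_polygon vs"
  shows "simple_polygon (map \<rho> vs)"
proof -
  obtain \<sigma> where \<sigma>: "\<And>x. \<sigma> (\<rho> x) = x" using rigid_inverse[OF \<rho>] by metis
  have inj: "inj \<rho>" using \<sigma> by (metis injI)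
  obtain a L where L: "linear L" "\<rho> = (\<lambda>x. a + L x)"
    using \<rho> unfolding rigid_def orthogonal_transformation_def by blast
  let ?n = "length vs"
  have n: "3 \<le> ?n" "distinct vs" using s by (auto simp: simple_polygon_def)
  have Si: "Suc i mod ?n < ?n" for i using n by (intro mod_less_divisor) linarith
  have e: "edge (map \<rho> vs) i = \<rho> ` edge vs i" if i: "i < ?n" for i
  proof -
    have "closed_segment (a + L p) (a + L q) = (\<lambda>x. a + L x) ` closed_segment p q" for p q
      unfolding closed_segment_translation closed_segment_linear_image[OF L(1)] by (simp add: image_image)
    then show ?thesis unfolding edge_def using i Si by (simp add: L(2))
  qed
  have "edge (map \<rho> vs) i \<inter> edge (map \<rho> vs) j =
      {map \<rho> vs ! i, map \<rho> vs ! (Suc i mod ?n)} \<inter> {map \<rho> vs ! j, map \<rho> vs ! (Suc j mod ?n)}"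
    if ij: "i < ?n" "j < ?n" "i \<noteq> j" for i j
  proof -
    have "edge vs i \<inter> edge vs j = {vs ! i, vs ! (Suc i mod ?n)} \<inter> {vs ! j, vs ! (Suc j mod ?n)}"
      using s ij unfolding simple_polygon_def by blast
    then have "\<rho> ` edge vs i \<inter> \<rho> ` edge vs j = \<rho> ` {vs ! i, vs ! (Suc i mod ?n)} \<inter> \<rho> ` {vs ! j, vs ! (Suc j mod ?n)}"
      unfolding image_Int[OF inj, symmetric] by simp
    then show ?thesis unfolding e[OF ij(1)] e[OF ij(2)] using ij Si by simp
  qed
  then show ?thesis using n inj unfolding simple_polygon_def
    by (auto simp: distinct_map inj_on_subset[OF inj subset_UNIV])
qed

lemma W_polygon_subspace:
  fixes vs :: "(real^'n) list"
  assumes "CARD('n) = 2" "simple_polygon vs"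
  shows "fun_subspace (W_polygon k vs)" "polys k \<subseteq> W_polygon k vs"
proof -
  note dom = polygon_trace_domain[OF assms]
  let ?P = "\<lambda>g. \<forall>e \<in> edges vs. \<exists>p \<in> polys k. \<forall>x \<in> e. g x = p x"
  have poly: "?P p" if "p \<in> polys k" for p using that by blast
  have add: "?P (\<lambda>x. g x + g' x)" if gg: "?P g" "?P g'" for g g'
  proof
    fix e assume e: "e \<in> edges vs"
    obtain p p' where p: "p \<in> polys k" "\<forall>x \<in> e. g x = p x" "p' \<in> polys k" "\<forall>x \<in> e. g' x = p' x" using gg e by blast
    then show "\<exists>p \<in> polys k. \<forall>x \<in> e. g x + g' x = p x"
      by (intro bexI[of _ "\<lambda>x. p x + p' x"] fun_subspace_add[OF polys_subspace]) auto
  qed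
  have scale: "?P (\<lambda>x. c *\<^sub>R g x)" if g: "?P g" for c g
  proof
    fix e assume e: "e \<in> edges vs"
    obtain p where p: "p \<in> polys k" "\<forall>x \<in> e. g x = p x" using g e by blast
    then show "\<exists>p \<in> polys k. \<forall>x \<in> e. c *\<^sub>R g x = p x"
      by (intro bexI[of _ "\<lambda>x. c *\<^sub>R p x"] fun_subspace_scale[OF polys_subspace]) auto
  qed
  show "fun_subspace (W_polygon k vs)" unfolding W_polygon_def
    by (rule local_space_subspace[OF dom poly[OF polys_const] add scale])
  show "polys k \<subseteq> W_polygon k vs" unfolding W_polygon_def
    using polys_local_space[OF dom, of ?P] poly by blast
qed

text \<open>By the invariance under rigid motions, the face condition can be checked in any one parametrisation.\<close>
lemma W_polygon_reparametrisation:
  fixes \<psi>0 :: "real^2 \<Rightarrow> real^'n"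
  assumes \<psi>0: "plane_isometry \<psi>0" and s: "simple_polygon vs0" and F: "F = map \<psi>0 vs0"
  shows "(\<exists>\<psi> vs. plane_isometry \<psi> \<and> F = map \<psi> vs \<and> g \<circ> \<psi> \<in> W_polygon k vs) \<longleftrightarrow> g \<circ> \<psi>0 \<in> W_polygon k vs0"
proof
  assume "\<exists>\<psi> vs. plane_isometry \<psi> \<and> F = map \<psi> vs \<and> g \<circ> \<psi> \<in> W_polygon k vs"
  then obtain \<psi> vs where *: "plane_isometry \<psi>" "F = map \<psi> vs" "g \<circ> \<psi> \<in> W_polygon k vs" by blast
  obtain \<rho> where \<rho>: "rigid \<rho>" "\<psi>0 = \<psi> \<circ> \<rho>" "vs = map \<rho> vs0"
    using reparametrisation[OF \<psi>0 *(1) _ s, of vs] F *(2) by auto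
  obtain \<sigma> L K a where "rigid_pair \<rho> \<sigma> L K a" using rigid_rigid_pair[OF \<rho>(1)] by blast
  then interpret rigid_pair \<rho> \<sigma> L K a .
  have "(\<lambda>x. (g \<circ> \<psi>) (\<rho> x)) \<in> W_polygon k vs0"
    by (rule W_polygon_\<rho>[OF s]) (use *(3) \<rho>(3) simple_polygon_rigid[OF \<rho>(1) s] in \<open>auto simp: o_def\<close>)
  then show "g \<circ> \<psi>0 \<in> W_polygon k vs0" by (simp add: \<rho>(2) o_def)
next
  assume "g \<circ> \<psi>0 \<in> W_polygon k vs0"
  then show "\<exists>\<psi> vs. plane_isometry \<psi> \<and> F = map \<psi> vs \<and> g \<circ> \<psi> \<in> W_polygon k vs" using \<psi>0 F by blast
qed

lemma polys_plane_isometry: "plane_isometry \<psi> \<Longrightarrow> p \<in> polys k \<Longrightarrow> p \<circ> \<psi> \<in> polys k"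
  by (auto simp: plane_isometry_def o_def intro: polys_affine)

text \<open>The properties of elements that the rest of the proof uses, common to both dimensions.\<close>
lemma W_cell_properties:
  fixes K :: "'n::finite cell"
  assumes K: "polytopal (region K) (cycles K)"
  shows "trace_domain (region K) (vertices K)" "W_cell k K \<subseteq> traced (region K)"
    "fun_subspace (W_cell k K)" "polys k \<subseteq> W_cell k K"
proof -
  have "trace_domain (region K) (vertices K) \<and> W_cell k K \<subseteq> traced (region K) \<and>
      fun_subspace (W_cell k K) \<and> polys k \<subseteq> W_cell k K"
  proof (cases "CARD('n) = 2")
    case True
    then obtain vs where vs: "cycles K = {vs}" "simple_polygon vs" "region K = polygon_region vs"
      using K by (auto simp: polytopal_def polygonal_def)
    have W: "W_cell k K = W_polygon k vs" using True vs(1) by (simp add: W_cell_def)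
    have V: "vertices K = set vs" by (simp add: vertices_def vs)
    note dom = polygon_trace_domain[OF True vs(2)]
    have "W_polygon k vs \<subseteq> traced (polygon_region vs)"
      unfolding W_polygon_def using local_space_traced[OF dom] by blast
    then show ?thesis unfolding W V vs(3) using dom W_polygon_subspace[OF True vs(2)] by blast
  next
    case False
    then have card: "CARD('n) = 3" and pK: "polyhedral (region K) (cycles K)" using K by (auto simp: polytopal_def)
    have W: "W_cell k K = W_polyhedron k K" using False by (simp add: W_cell_def)
    have dom: "trace_domain (region K) (vertices K)"
      unfolding vertices_def by (rule polyhedron_trace_domain[OF card pK])
    let ?P = "\<lambda>g. \<forall>F \<in> cycles K. \<exists>\<psi> vs. plane_isometry \<psi> \<and> F = map \<psi> vs \<and> g \<circ> \<psi> \<in> W_polygon k vs"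
    have face: "\<exists>\<psi> vs. plane_isometry \<psi> \<and> simple_polygon vs \<and> F = map \<psi> vs" if "F \<in> cycles K" for F
    proof -
      have "planar_polygon F" using pK that by (simp add: polyhedral_def)
      then show ?thesis unfolding planar_polygon_def by blast
    qed
    have card2: "CARD(2) = 2" by simp
    have poly: "?P p" if p: "p \<in> polys k" for p
    proof
      fix F assume "F \<in> cycles K"
      then obtain \<psi> vs where \<psi>: "plane_isometry \<psi>" "simple_polygon vs" "F = map \<psi> vs" using face by blast
      then show "\<exists>\<psi> vs. plane_isometry \<psi> \<and> F = map \<psi> vs \<and> p \<circ> \<psi> \<in> W_polygon k vs"
        unfolding W_polygon_reparametrisation[OF \<psi>]
        using polys_plane_isometry[OF \<psi>(1) p] W_polygon_subspace(2)[OF card2 \<psi>(2)] by blast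
    qed
    have add: "?P (\<lambda>x. g x + g' x)" if gg: "?P g" "?P g'" for g g'
    proof
      fix F assume F: "F \<in> cycles K"
      then obtain \<psi> vs where \<psi>: "plane_isometry \<psi>" "simple_polygon vs" "F = map \<psi> vs" using face by blast
      have "g \<circ> \<psi> \<in> W_polygon k vs" "g' \<circ> \<psi> \<in> W_polygon k vs"
        using gg F unfolding W_polygon_reparametrisation[OF \<psi>, symmetric] by blast+
      then have "(\<lambda>x. g x + g' x) \<circ> \<psi> \<in> W_polygon k vs"
        using fun_subspace_add[OF W_polygon_subspace(1)[OF card2 \<psi>(2)]] by (fastforce simp: o_def)
      then show "\<exists>\<psi> vs. plane_isometry \<psi> \<and> F = map \<psi> vs \<and> (\<lambda>x. g x + g' x) \<circ> \<psi> \<in> W_polygon k vs"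
        unfolding W_polygon_reparametrisation[OF \<psi>] .
    qed
    have scale: "?P (\<lambda>x. c *\<^sub>R g x)" if g: "?P g" for c g
    proof
      fix F assume F: "F \<in> cycles K"
      then obtain \<psi> vs where \<psi>: "plane_isometry \<psi>" "simple_polygon vs" "F = map \<psi> vs" using face by blast
      have "g \<circ> \<psi> \<in> W_polygon k vs"
        using g F unfolding W_polygon_reparametrisation[OF \<psi>, symmetric] by blast
      then have "(\<lambda>x. c *\<^sub>R g x) \<circ> \<psi> \<in> W_polygon k vs"
        using fun_subspace_scale[OF W_polygon_subspace(1)[OF card2 \<psi>(2)]] by (fastforce simp: o_def)
      then show "\<exists>\<psi> vs. plane_isometry \<psi> \<and> F = map \<psi> vs \<and> (\<lambda>x. c *\<^sub>R g x) \<circ> \<psi> \<in> W_polygon k vs"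
        unfolding W_polygon_reparametrisation[OF \<psi>] .
    qed
    have "fun_subspace (W_polyhedron k K)" unfolding W_polyhedron_def
      by (rule local_space_subspace[OF dom poly[OF polys_const] add scale])
    moreover have "polys k \<subseteq> W_polyhedron k K" unfolding W_polyhedron_def
      using polys_local_space[OF dom, of ?P] poly by blast
    moreover have "W_polyhedron k K \<subseteq> traced (region K)"
      unfolding W_polyhedron_def using local_space_traced[OF dom] by blast
    ultimately show ?thesis using dom W by simp
  qed
  then show "trace_domain (region K) (vertices K)" "W_cell k K \<subseteq> traced (region K)"
    "fun_subspace (W_cell k K)" "polys k \<subseteq> W_cell k K" by auto
qed

section \<open>The discrete forms\<close>

text \<open>
  The contributions of a cell to \<open>m_h\<close> and \<open>a_h\<close> both have this form, with the projections \<open>Pi_0_vec\<close>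
  and \<open>Pi_nabla_vec\<close> for \<open>P\<close>; linearity of the projection is what matters.
\<close>
lemma sym_bilinear_pullback:
  assumes V: "fun_subspace V" and b: "sym_bilinear Y b" and s: "sym_bilinear V s"
    and P: "\<And>v. v \<in> V \<Longrightarrow> P v \<in> Y" and Y: "Y \<subseteq> V"
    and add: "\<And>u v. u \<in> V \<Longrightarrow> v \<in> V \<Longrightarrow> P (\<lambda>x. u x + v x) = (\<lambda>x. P u x + P v x)"
    and scale: "\<And>c v. v \<in> V \<Longrightarrow> P (\<lambda>x. c *\<^sub>R v x) = (\<lambda>x. c *\<^sub>R P v x)"
  shows "sym_bilinear V (\<lambda>v w. b (P v) (P w) + r * s (\<lambda>x. v x - P v x) (\<lambda>x. w x - P w x))"
proof (rule sym_bilinearI)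
  have d: "(\<lambda>x. v x - P v x) \<in> V" if "v \<in> V" for v
    using fun_subspace_diff[OF V that] P[OF that] Y by blast
  have bs: "\<And>u v. u \<in> Y \<Longrightarrow> v \<in> Y \<Longrightarrow> b u v = b v u"
    "\<And>u v w. u \<in> Y \<Longrightarrow> v \<in> Y \<Longrightarrow> w \<in> Y \<Longrightarrow> b (\<lambda>x. u x + v x) w = b u w + b v w"
    "\<And>c u w. u \<in> Y \<Longrightarrow> w \<in> Y \<Longrightarrow> b (\<lambda>x. c *\<^sub>R u x) w = c * b u w"
    using b unfolding sym_bilinear_def by blast+
  {
    fix u v assume u: "u \<in> V" and v: "v \<in> V"
    show "b (P u) (P v) + r * s (\<lambda>x. u x - P u x) (\<lambda>x. v x - P v x) =
      b (P v) (P u) + r * s (\<lambda>x. v x - P v x) (\<lambda>x. u x - P u x)"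
      using bs(1)[OF P[OF u] P[OF v]] form_sym[OF V s d[OF u] d[OF v]] by simp
  next
    fix u v w assume u: "u \<in> V" and v: "v \<in> V" and w: "w \<in> V"
    have "(\<lambda>x. (u x + v x) - P (\<lambda>x. u x + v x) x) = (\<lambda>x. (u x - P u x) + (v x - P v x))"
      by (simp add: add[OF u v] algebra_simps)
    then show "b (P (\<lambda>x. u x + v x)) (P w) + r * s (\<lambda>x. (u x + v x) - P (\<lambda>x. u x + v x) x) (\<lambda>x. w x - P w x) =
      (b (P u) (P w) + r * s (\<lambda>x. u x - P u x) (\<lambda>x. w x - P w x)) +
      (b (P v) (P w) + r * s (\<lambda>x. v x - P v x) (\<lambda>x. w x - P w x))"
      using bs(2)[OF P[OF u] P[OF v] P[OF w]] form_add_left[OF V s d[OF u] d[OF v] d[OF w]]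
      by (simp only: add[OF u v]) (simp add: distrib_left)
  next
    fix c u w assume u: "u \<in> V" and w: "w \<in> V"
    have "(\<lambda>x. c *\<^sub>R u x - P (\<lambda>x. c *\<^sub>R u x) x) = (\<lambda>x. c *\<^sub>R (u x - P u x))"
      by (simp add: scale[OF u] scaleR_diff_right)
    then show "b (P (\<lambda>x. c *\<^sub>R u x)) (P w) + r * s (\<lambda>x. c *\<^sub>R u x - P (\<lambda>x. c *\<^sub>R u x) x) (\<lambda>x. w x - P w x) =
      c * (b (P u) (P w) + r * s (\<lambda>x. u x - P u x) (\<lambda>x. w x - P w x))"
      using bs(3)[OF P[OF u] P[OF w]] form_scale_left[OF V s d[OF u] d[OF w]]
      by (simp only: scale[OF u]) (simp add: distrib_left)
  }
qed

lemma componentwise_subspace: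
  assumes "fun_subspace X"
  shows "fun_subspace {v :: 'a \<Rightarrow> real^'n. \<forall>i. (\<lambda>x. v x $ i) \<in> X}"
  using fun_subspace_zero[OF assms] fun_subspace_add[OF assms] fun_subspace_scale[OF assms]
  by (intro fun_subspaceI) auto

definition vector_H1 :: "(real^'n) set \<Rightarrow> (real^'n \<Rightarrow> real^'n) set" where
  "vector_H1 U = {v. \<forall>i. (\<lambda>x. v x $ i) \<in> H1 U}"

lemma trace_mat_inner: "mat 1 \<bullet> (A :: real^'n^'n) = trace A"
proof -
  have "(\<Sum>j\<in>UNIV. (mat 1 :: real^'n^'n) $ i $ j * A $ i $ j) = A $ i $ i" for i
  proof -
    have "(\<Sum>j\<in>UNIV. (mat 1 :: real^'n^'n) $ i $ j * A $ i $ j) = (\<Sum>j\<in>UNIV. if j = i then A $ i $ j else 0)"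
      by (intro sum.cong) (auto simp: mat_def)
    then show ?thesis by simp
  qed
  then show ?thesis by (simp add: inner_vec_def trace_def)
qed

lemma elastic_symmetric: "elastic \<mu> lam \<tau> \<bullet> \<sigma> = elastic \<mu> lam \<sigma> \<bullet> \<tau>"
  unfolding elastic_def inner_add_left inner_scaleR_left trace_mat_inner
  by (simp add: inner_commute[of \<tau> \<sigma>])

lemma L2_matrix_iff:
  fixes f :: "'a::euclidean_space \<Rightarrow> real^'n^'m"
  shows "f \<in> L2 U \<longleftrightarrow> (\<forall>i j. (\<lambda>x. f x $ i $ j) \<in> L2 U)"
  by (subst L2_vec_iff) (use L2_vec_iff[where f = "\<lambda>x. f x $ i" for i] in blast)

context
  fixes U :: "(real^'n) set"
  assumes U: "open U"
begin

lemma jacobian_L2: "v \<in> vector_H1 U \<Longrightarrow> jacobian U v \<in> L2 U"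
  by (subst L2_vec_iff) (auto simp: jacobian_def vector_H1_def grad_weak_gradient(1))

lemma jacobian_add:
  assumes u: "u \<in> vector_H1 U" and v: "v \<in> vector_H1 U"
  shows "AE x in lebesgue. x \<in> U \<longrightarrow> jacobian U (\<lambda>x. u x + v x) x = jacobian U u x + jacobian U v x"
proof -
  have "AE x in lebesgue. \<forall>i. x \<in> U \<longrightarrow> grad U (\<lambda>y. u y $ i + v y $ i) x = grad U (\<lambda>y. u y $ i) x + grad U (\<lambda>y. v y $ i) x"
    unfolding AE_all_countable by (intro allI grad_add[OF U]) (use u v in \<open>auto simp: vector_H1_def\<close>)
  then show ?thesis by eventually_elim (simp add: jacobian_def vec_eq_iff)
qed

lemma jacobian_scale:
  assumes u: "u \<in> vector_H1 U"
  shows "AE x in lebesgue. x \<in> U \<longrightarrow> jacobian U (\<lambda>x. c *\<^sub>R u x) x = c *\<^sub>R jacobian U u x"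
proof -
  have "AE x in lebesgue. \<forall>i. x \<in> U \<longrightarrow> grad U (\<lambda>y. c * u y $ i) x = c *\<^sub>R grad U (\<lambda>y. u y $ i) x"
  proof (unfold AE_all_countable, intro allI)
    fix i
    have "(\<lambda>y. u y $ i) \<in> H1 U" using u by (simp add: vector_H1_def)
    from grad_scale[OF U this, of c]
    show "AE x in lebesgue. x \<in> U \<longrightarrow> grad U (\<lambda>y. c * u y $ i) x = c *\<^sub>R grad U (\<lambda>y. u y $ i) x"
      by simp
  qed
  then show ?thesis by eventually_elim (simp add: jacobian_def vec_eq_iff)
qed

lemma strain_L2:
  assumes v: "v \<in> vector_H1 U" shows "strain U v \<in> L2 U"
proof -
  have J: "\<And>i j. (\<lambda>x. jacobian U v x $ i $ j) \<in> L2 U" using jacobian_L2[OF v] L2_matrix_iff by blast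
  have "(\<lambda>x. (1/2) *\<^sub>R (jacobian U v x $ i $ j + jacobian U v x $ j $ i)) \<in> L2 U" for i j
    by (intro fun_subspace_scale[OF L2_subspace] fun_subspace_add[OF L2_subspace] J)
  then show ?thesis by (subst L2_matrix_iff) (simp add: strain_def transpose_def)
qed

lemma elastic_L2:
  assumes "f \<in> L2 U" shows "(\<lambda>x. elastic \<mu> lam (f x)) \<in> L2 U"
proof -
  have f: "\<And>i j. (\<lambda>x. f x $ i $ j) \<in> L2 U" using assms L2_matrix_iff by blast
  have "(\<lambda>x. (2 * \<mu>) *\<^sub>R f x $ i $ j + (lam * (mat 1 :: real^'a^'a) $ i $ j) *\<^sub>R (\<Sum>l\<in>UNIV. f x $ l $ l)) \<in> L2 U" for i j
    by (intro fun_subspace_scale[OF L2_subspace] fun_subspace_add[OF L2_subspace] fun_subspace_sum[OF L2_subspace] f)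
  then show ?thesis
    by (subst L2_matrix_iff) (simp add: elastic_def trace_def mult.assoc mult.commute mult.left_commute)
qed

lemma a_form_bilinear: "sym_bilinear (vector_H1 U) (a_form \<mu> lam U)"
proof (rule sym_bilinearI)
  fix u v
  show "a_form \<mu> lam U u v = a_form \<mu> lam U v u" by (simp add: a_form_def elastic_symmetric)
next
  fix u v w assume u: "u \<in> vector_H1 U" and v: "v \<in> vector_H1 U" and w: "w \<in> vector_H1 U"
  have e: "elastic \<mu> lam (A + B) = elastic \<mu> lam A + elastic \<mu> lam B" for A B :: "real^'n^'n"
    by (simp add: elastic_def trace_add algebra_simps)
  have t: "transpose (A + B) = transpose A + transpose B" for A B :: "real^'n^'n"
    by (simp add: transpose_def vec_eq_iff)
  have "AE x in lebesgue. x \<in> U \<longrightarrow> elastic \<mu> lam (strain U (\<lambda>x. u x + v x) x) =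
      elastic \<mu> lam (strain U u x) + elastic \<mu> lam (strain U v x)"
    using jacobian_add[OF u v]
  proof eventually_elim
    case (elim x)
    show ?case
    proof
      assume "x \<in> U"
      then have "strain U (\<lambda>x. u x + v x) x = strain U u x + strain U v x"
        using elim by (simp add: strain_def t algebra_simps)
      then show "elastic \<mu> lam (strain U (\<lambda>x. u x + v x) x) = elastic \<mu> lam (strain U u x) + elastic \<mu> lam (strain U v x)"
        by (simp add: e)
    qed
  qed
  from L2_cong_AE(3)[OF this, of "strain U w"]
  show "a_form \<mu> lam U (\<lambda>x. u x + v x) w = a_form \<mu> lam U u w + a_form \<mu> lam U v w"
    using form_add_left[OF L2_subspace L2_inner_bilinear elastic_L2[OF strain_L2[OF u]]
        elastic_L2[OF strain_L2[OF v]] strain_L2[OF w]] by (simp add: a_form_def L2_inner_def)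
next
  fix c u w assume u: "u \<in> vector_H1 U" and w: "w \<in> vector_H1 U"
  have e: "elastic \<mu> lam (c *\<^sub>R A) = c *\<^sub>R elastic \<mu> lam A" for A :: "real^'n^'n"
    by (simp add: elastic_def trace_def scaleR_add_right sum_distrib_left mult.assoc mult.commute mult.left_commute)
  have t: "transpose (c *\<^sub>R A) = c *\<^sub>R transpose A" for A :: "real^'n^'n"
    by (simp add: transpose_def vec_eq_iff)
  have "AE x in lebesgue. x \<in> U \<longrightarrow> elastic \<mu> lam (strain U (\<lambda>x. c *\<^sub>R u x) x) = c *\<^sub>R elastic \<mu> lam (strain U u x)"
    using jacobian_scale[OF u, of c]
  proof eventually_elim
    case (elim x)
    show ?case
    proof
      assume "x \<in> U"
      then have "strain U (\<lambda>x. c *\<^sub>R u x) x = c *\<^sub>R strain U u x"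
        using elim by (simp add: strain_def t algebra_simps)
      then show "elastic \<mu> lam (strain U (\<lambda>x. c *\<^sub>R u x) x) = c *\<^sub>R elastic \<mu> lam (strain U u x)"
        by (simp add: e)
    qed
  qed
  from L2_cong_AE(3)[OF this, of "strain U w"]
  show "a_form \<mu> lam U (\<lambda>x. c *\<^sub>R u x) w = c * a_form \<mu> lam U u w"
    using form_scale_left[OF L2_subspace L2_inner_bilinear elastic_L2[OF strain_L2[OF u]] strain_L2[OF w]]
    by (simp add: a_form_def L2_inner_def)
qed

end

context
  fixes K :: "'n::finite cell" and k :: nat
  assumes K: "polytopal (region K) (cycles K)"
begin

lemma region_domain: "trace_domain (region K) (vertices K)"
  by (rule W_cell_properties(1)[OF K])

lemma region_props: "open (region K)" "bounded (region K)" "region K \<noteq> {}"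
  using domU[OF region_domain] by auto

lemma V_cell_subspace: "fun_subspace (V_cell k K)"
  unfolding V_cell_def by (rule componentwise_subspace[OF W_cell_properties(3)[OF K]])

lemma V_cell_traced: "v \<in> V_cell k K \<Longrightarrow> (\<lambda>x. v x $ i) \<in> traced (region K)"
  using W_cell_properties(2)[OF K, of k] by (auto simp: V_cell_def)

lemma V_cell_L2: "v \<in> V_cell k K \<Longrightarrow> (\<lambda>x. v x $ i) \<in> L2 (region K)"
  by (rule H1_L2[OF traced_H1[OF region_domain V_cell_traced]])

definition vector_polys :: "nat \<Rightarrow> (real^'n \<Rightarrow> real^'n) set" where
  "vector_polys j = {v. \<forall>i. (\<lambda>x. v x $ i) \<in> polys j}"

lemma vector_polys_subset: "vector_polys k \<subseteq> V_cell k K" "vector_polys k \<subseteq> L2 (region K)"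
  "vector_polys k \<subseteq> vector_H1 (region K)"
proof -
  show "vector_polys k \<subseteq> V_cell k K"
    using W_cell_properties(4)[OF K, of k] by (auto simp: vector_polys_def V_cell_def)
  show "vector_polys k \<subseteq> L2 (region K)"
  proof
    fix v :: "real^'n \<Rightarrow> real^'n" assume "v \<in> vector_polys k"
    then have p: "\<And>i. (\<lambda>x. v x $ i) \<in> polys k" by (simp add: vector_polys_def)
    show "v \<in> L2 (region K)" by (subst L2_vec_iff) (intro allI polys_L2[OF region_props p])
  qed
  show "vector_polys k \<subseteq> vector_H1 (region K)"
    using polys_H1[OF region_props(1,2)] by (auto simp: vector_polys_def vector_H1_def)
qed

lemma cell_mass_bilinear:
  assumes S: "spd_form (region K) (V_cell k K) s"
  shows "sym_bilinear (V_cell k K) (\<lambda>v w. (LINT x:region K|lebesgue. Pi_0_vec k K v x \<bullet> Pi_0_vec k K w x) +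
     s (\<lambda>x. v x - Pi_0_vec k K v x) (\<lambda>x. w x - Pi_0_vec k K w x))"
proof -
  have s: "sym_bilinear (V_cell k K) s" using S unfolding spd_form_def sym_bilinear_def by blast
  have "sym_bilinear (V_cell k K) (\<lambda>v w. L2_inner (region K) (Pi_0_vec k K v) (Pi_0_vec k K w) +
     1 * s (\<lambda>x. v x - Pi_0_vec k K v x) (\<lambda>x. w x - Pi_0_vec k K w x))"
  proof (rule sym_bilinear_pullback[OF V_cell_subspace sym_bilinear_mono[OF L2_inner_bilinear vector_polys_subset(2)] s
        _ vector_polys_subset(1)])
    fix v assume v: "v \<in> V_cell k K"
    show "Pi_0_vec k K v \<in> vector_polys k"
      using Pi_0_polys[OF region_props V_cell_L2[OF v]] by (simp add: vector_polys_def Pi_0_vec_def)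
    show "Pi_0_vec k K (\<lambda>x. c *\<^sub>R v x) = (\<lambda>x. c *\<^sub>R Pi_0_vec k K v x)" for c
      using Pi_0_scale[OF region_props V_cell_L2[OF v]] by (simp add: Pi_0_vec_def fun_eq_iff vec_eq_iff)
    fix u assume u: "u \<in> V_cell k K"
    show "Pi_0_vec k K (\<lambda>x. u x + v x) = (\<lambda>x. Pi_0_vec k K u x + Pi_0_vec k K v x)"
      using Pi_0_add[OF region_props V_cell_L2[OF u] V_cell_L2[OF v]] by (simp add: Pi_0_vec_def fun_eq_iff vec_eq_iff)
  qed
  then show ?thesis by (simp add: L2_inner_def)
qed

lemma cell_stiffness_bilinear:
  assumes S: "spd_form (region K) (V_cell k K) s"
  shows "sym_bilinear (V_cell k K) (\<lambda>v w. a_form \<mu> lam (region K) (Pi_nabla_vec k K v) (Pi_nabla_vec k K w) +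
     r * s (\<lambda>x. v x - Pi_nabla_vec k K v x) (\<lambda>x. w x - Pi_nabla_vec k K w x))"
proof (rule sym_bilinear_pullback[OF V_cell_subspace
      sym_bilinear_mono[OF a_form_bilinear[OF region_props(1)] vector_polys_subset(3)] _ _ vector_polys_subset(1)])
  show "sym_bilinear (V_cell k K) s" using S unfolding spd_form_def sym_bilinear_def by blast
  fix v assume v: "v \<in> V_cell k K"
  note P = V_cell_traced[OF v]
  show "Pi_nabla_vec k K v \<in> vector_polys k"
    using Pi_nabla_polys[OF region_domain P] by (simp add: vector_polys_def Pi_nabla_vec_def)
  show "Pi_nabla_vec k K (\<lambda>x. c *\<^sub>R v x) = (\<lambda>x. c *\<^sub>R Pi_nabla_vec k K v x)" for c
    using Pi_nabla_scale[OF region_domain P] by (simp add: Pi_nabla_vec_def fun_eq_iff vec_eq_iff)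
  fix u assume u: "u \<in> V_cell k K"
  show "Pi_nabla_vec k K (\<lambda>x. u x + v x) = (\<lambda>x. Pi_nabla_vec k K u x + Pi_nabla_vec k K v x)"
    using Pi_nabla_add[OF region_domain V_cell_traced[OF u] P] by (simp add: Pi_nabla_vec_def fun_eq_iff vec_eq_iff)
qed

end

section \<open>The global space on a decomposition\<close>

lemma polytopal_regular:
  assumes "polytopal U B"
  shows "open U" "bounded U" "interior (closure U) = U"
  using assms polygon_Jordan(2,3,5) unfolding polytopal_def polygonal_def polyhedral_def by auto

lemma L2_norm_disjoint_sum:
  fixes g :: "'a::euclidean_space \<Rightarrow> 'b::euclidean_space"
  assumes fin: "finite M" and disj: "\<And>K K'. K \<in> M \<Longrightarrow> K' \<in> M \<Longrightarrow> K \<noteq> K' \<Longrightarrow> R K \<inter> R K' = {}"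
    and sub: "\<And>K. K \<in> M \<Longrightarrow> R K \<subseteq> U" "\<And>K. K \<in> M \<Longrightarrow> R K \<in> sets lebesgue" and g: "g \<in> L2 U"
  shows "(\<Sum>K\<in>M. (L2_norm (R K) g)\<^sup>2) \<le> (L2_norm U g)\<^sup>2"
proof -
  have gK: "integrable lebesgue (\<lambda>x. (norm (zero_ext (R K) g x))\<^sup>2)" if "K \<in> M" for K
    using L2_mono(1)[OF g sub(1)[OF that] sub(2)[OF that]] by (simp add: L2_iff)
  have "(\<Sum>K\<in>M. (L2_norm (R K) g)\<^sup>2) = (\<integral>x. (\<Sum>K\<in>M. (norm (zero_ext (R K) g x))\<^sup>2) \<partial>lebesgue)"
    unfolding L2_norm_power2_zero_ext by (rule Bochner_Integration.integral_sum[symmetric]) (rule gK)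
  also have "\<dots> \<le> (\<integral>x. (norm (zero_ext U g x))\<^sup>2 \<partial>lebesgue)"
  proof (rule integral_mono)
    show "integrable lebesgue (\<lambda>x. \<Sum>K\<in>M. (norm (zero_ext (R K) g x))\<^sup>2)"
      by (intro Bochner_Integration.integrable_sum gK)
    show "integrable lebesgue (\<lambda>x. (norm (zero_ext U g x))\<^sup>2)" using g by (simp add: L2_iff)
    fix x
    show "(\<Sum>K\<in>M. (norm (zero_ext (R K) g x))\<^sup>2) \<le> (norm (zero_ext U g x))\<^sup>2"
    proof (cases "\<exists>K\<in>M. x \<in> R K")
      case True
      then obtain K where K: "K \<in> M" "x \<in> R K" by blast
      have "(\<Sum>K\<in>M. (norm (zero_ext (R K) g x))\<^sup>2) = (\<Sum>K'\<in>M. if K' = K then (norm (g x))\<^sup>2 else 0)"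
        using K disj[OF _ K(1)] by (intro sum.cong) (auto simp: zero_ext_def)
      then show ?thesis using fin K sub(1)[OF K(1)] by (auto simp: zero_ext_def)
    next
      case False
      then have "(\<Sum>K\<in>M. (norm (zero_ext (R K) g x))\<^sup>2) = 0" by (intro sum.neutral) (auto simp: zero_ext_def)
      then show ?thesis by simp
    qed
  qed
  finally show ?thesis unfolding L2_norm_power2_zero_ext .
qed

context
  fixes \<Omega> :: "(real^'n) set" and M :: "'n cell set"
  assumes \<Omega>: "\<exists>B. polytopal \<Omega> B" and M: "decomposition \<Omega> M"
begin

lemma \<Omega>_props: "open \<Omega>" "bounded \<Omega>" "interior (closure \<Omega>) = \<Omega>" "\<Omega> \<in> sets lebesgue"
  using \<Omega> polytopal_regular[of \<Omega>] by auto

lemma mesh_finite: "finite M" and mesh_polytopal: "K \<in> M \<Longrightarrow> polytopal (region K) (cycles K)"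
  and mesh_disjoint: "K \<in> M \<Longrightarrow> K' \<in> M \<Longrightarrow> K \<noteq> K' \<Longrightarrow> region K \<inter> region K' = {}"
  using M by (auto simp: decomposition_def)

lemma mesh_region: "K \<in> M \<Longrightarrow> open (region K)" "K \<in> M \<Longrightarrow> bounded (region K)" "K \<in> M \<Longrightarrow> region K \<in> sets lebesgue"
  using region_props[OF mesh_polytopal] by auto

text \<open>
  A decomposition only determines the closure of the domain; a polygon or polyhedron is the interior of
  its closure.
\<close>
lemma region_subset: assumes "K \<in> M" shows "region K \<subseteq> \<Omega>"
proof -
  have "region K \<subseteq> closure \<Omega>" using M assms closure_subset unfolding decomposition_def by blast
  then have "region K \<subseteq> interior (closure \<Omega>)" by (rule interior_maximal[OF _ mesh_region(1)[OF assms]])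
  then show ?thesis using \<Omega>_props(3) by simp
qed

lemma V_h_subspace: "fun_subspace (V_h k \<Omega> M)"
proof -
  have "fun_subspace (W_h k \<Omega> M)"
  proof (rule fun_subspaceI)
    show "(\<lambda>_. 0) \<in> W_h k \<Omega> M" unfolding W_h_def
      using fun_subspace_zero[OF H10_subspace[OF \<Omega>_props(1)]] fun_subspace_zero[OF W_cell_properties(3)[OF mesh_polytopal]]
      by blast
  next
    fix u v assume "u \<in> W_h k \<Omega> M" "v \<in> W_h k \<Omega> M"
    then show "(\<lambda>x. u x + v x) \<in> W_h k \<Omega> M" unfolding W_h_def
      using fun_subspace_add[OF H10_subspace[OF \<Omega>_props(1)]] fun_subspace_add[OF W_cell_properties(3)[OF mesh_polytopal]]
      by blast
  next
    fix c u assume "u \<in> W_h k \<Omega> M"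
    then show "(\<lambda>x. c *\<^sub>R u x) \<in> W_h k \<Omega> M" unfolding W_h_def
      using fun_subspace_scale[OF H10_subspace[OF \<Omega>_props(1)]] fun_subspace_scale[OF W_cell_properties(3)[OF mesh_polytopal]]
      by blast
  qed
  then show ?thesis unfolding V_h_def by (rule componentwise_subspace)
qed

lemma V_h_V_cell: "K \<in> M \<Longrightarrow> V_h k \<Omega> M \<subseteq> V_cell k K"
  by (auto simp: V_h_def W_h_def V_cell_def)

lemma V_h_H1: "v \<in> V_h k \<Omega> M \<Longrightarrow> v \<in> vector_H1 \<Omega>"
  using H10_H1[OF \<Omega>_props(1)] by (auto simp: V_h_def W_h_def vector_H1_def)

lemma V_h_L2: "v \<in> V_h k \<Omega> M \<Longrightarrow> v \<in> L2 \<Omega>"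
  using V_h_H1[of v k] H1_L2 by (subst L2_vec_iff) (auto simp: vector_H1_def)

lemma m_h_bilinear:
  assumes "\<And>K. K \<in> M \<Longrightarrow> admissible_stabilisation k Cs K (S K)"
  shows "sym_bilinear (V_h k \<Omega> M) (m_h k S M)"
  unfolding m_h_def
proof (rule sym_bilinear_sum)
  fix K assume K: "K \<in> M"
  show "sym_bilinear (V_h k \<Omega> M) (\<lambda>v w. (LINT x:region K|lebesgue. Pi_0_vec k K v x \<bullet> Pi_0_vec k K w x) +
     S K (\<lambda>x. v x - Pi_0_vec k K v x) (\<lambda>x. w x - Pi_0_vec k K w x))"
    by (rule sym_bilinear_mono[OF cell_mass_bilinear[OF mesh_polytopal[OF K]] V_h_V_cell[OF K]])
      (use assms[OF K] in \<open>simp add: admissible_stabilisation_def\<close>)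
qed

lemma a_h_bilinear:
  assumes "\<And>K. K \<in> M \<Longrightarrow> admissible_stabilisation k Cs K (S K)"
  shows "sym_bilinear (V_h k \<Omega> M) (a_h k \<mu> lam S M)"
  unfolding a_h_def
proof (rule sym_bilinear_sum)
  fix K assume K: "K \<in> M"
  show "sym_bilinear (V_h k \<Omega> M) (\<lambda>v w. a_form \<mu> lam (region K) (Pi_nabla_vec k K v) (Pi_nabla_vec k K w) +
      (1 / measure lebesgue (region K)) * S K (\<lambda>x. v x - Pi_nabla_vec k K v x) (\<lambda>x. w x - Pi_nabla_vec k K w x))"
    by (rule sym_bilinear_mono[OF cell_stiffness_bilinear[OF mesh_polytopal[OF K]] V_h_V_cell[OF K]])
      (use assms[OF K] in \<open>simp add: admissible_stabilisation_def\<close>)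
qed

lemma H1_norm_vec_power2:
  assumes v: "v \<in> vector_H1 \<Omega>"
  shows "(H1_norm_vec \<Omega> v)\<^sup>2 = (L2_norm \<Omega> v)\<^sup>2 + (L2_norm \<Omega> (jacobian \<Omega> v))\<^sup>2"
proof -
  have vL: "v \<in> L2 \<Omega>" using v H1_L2 by (subst L2_vec_iff) (auto simp: vector_H1_def)
  have "(H1_norm_vec \<Omega> v)\<^sup>2 = (\<Sum>i\<in>UNIV. (H1_norm \<Omega> (\<lambda>x. v x $ i))\<^sup>2)"
    unfolding H1_norm_vec_def by (simp add: sum_nonneg)
  also have "\<dots> = (\<Sum>i\<in>UNIV. (L2_norm \<Omega> (\<lambda>x. v x $ i))\<^sup>2 + (L2_norm \<Omega> (grad \<Omega> (\<lambda>x. v x $ i)))\<^sup>2)"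
    by (simp add: H1_norm_def)
  also have "\<dots> = (L2_norm \<Omega> v)\<^sup>2 + (L2_norm \<Omega> (jacobian \<Omega> v))\<^sup>2"
    unfolding L2_norm_vec_power2[OF vL] L2_norm_vec_power2[OF jacobian_L2[OF \<Omega>_props(1) v]]
    by (simp add: sum.distrib jacobian_def)
  finally show ?thesis .
qed

lemma H1_norm_vec_nonneg: "0 \<le> H1_norm_vec \<Omega> v"
  by (simp add: H1_norm_vec_def sum_nonneg)

lemma L2_norm_le_H1_norm_vec:
  assumes "v \<in> vector_H1 \<Omega>" shows "L2_norm \<Omega> v \<le> H1_norm_vec \<Omega> v"
  by (rule power2_le_imp_le[OF _ H1_norm_vec_nonneg]) (simp add: H1_norm_vec_power2[OF assms])

lemma broken_seminorm_nonneg: "0 \<le> broken_seminorm M v"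
  by (simp add: broken_seminorm_def sum_nonneg)

text \<open>
  The gradients on the cells and the gradient on the whole domain are chosen independently, but they
  agree almost everywhere by uniqueness of weak gradients.
\<close>
lemma broken_seminorm_le_H1_norm_vec:
  assumes v: "v \<in> vector_H1 \<Omega>" shows "broken_seminorm M v \<le> H1_norm_vec \<Omega> v"
proof (rule power2_le_imp_le[OF _ H1_norm_vec_nonneg])
  have "L2_norm (region K) (jacobian (region K) v) = L2_norm (region K) (jacobian \<Omega> v)" if K: "K \<in> M" for K
  proof -
    have "AE x in lebesgue. x \<in> region K \<longrightarrow> grad (region K) (\<lambda>y. v y $ i) x = grad \<Omega> (\<lambda>y. v y $ i) x" for i
    proof -
      have vi: "(\<lambda>y. v y $ i) \<in> H1 \<Omega>" using v by (simp add: vector_H1_def)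
      note r = region_subset[OF K] mesh_region(3)[OF K]
      show ?thesis
        by (rule grad_AE[OF mesh_region(1)[OF K] L2_mono(1)[OF H1_L2[OF vi] r]
              L2_mono(1)[OF grad_weak_gradient(1)[OF vi] r] weak_gradient_mono[OF grad_weak_gradient(2)[OF vi] r(1)]])
    qed
    then have "AE x in lebesgue. \<forall>i. x \<in> region K \<longrightarrow> grad (region K) (\<lambda>y. v y $ i) x = grad \<Omega> (\<lambda>y. v y $ i) x"
      unfolding AE_all_countable by (rule allI)
    then have "AE x in lebesgue. x \<in> region K \<longrightarrow> jacobian (region K) v x = jacobian \<Omega> v x"
      by eventually_elim (simp add: jacobian_def vec_eq_iff)
    then show ?thesis by (rule L2_cong_AE(2))
  qed
  then have "(broken_seminorm M v)\<^sup>2 = (\<Sum>K\<in>M. (L2_norm (region K) (jacobian \<Omega> v))\<^sup>2)"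
    by (simp add: broken_seminorm_def sum_nonneg)
  also have "\<dots> \<le> (L2_norm \<Omega> (jacobian \<Omega> v))\<^sup>2"
    by (rule L2_norm_disjoint_sum[OF mesh_finite mesh_disjoint region_subset mesh_region(3) jacobian_L2[OF \<Omega>_props(1) v]])
  also have "\<dots> \<le> (H1_norm_vec \<Omega> v)\<^sup>2" by (simp add: H1_norm_vec_power2[OF v])
  finally show "(broken_seminorm M v)\<^sup>2 \<le> (H1_norm_vec \<Omega> v)\<^sup>2" .
qed

end

section \<open>The load\<close>

lemma zero_ext_slice: "zero_ext (I \<times> U) (\<lambda>(t, x). w t x) (t, x) = zero_ext I (\<lambda>t. zero_ext U (w t) x) t"
  by (simp add: zero_ext_def)

lemma AE_endpoints: "AE t in lebesgue. zero_ext {a..b::real} g t = zero_ext {a<..<b} g t"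
proof -
  have "AE t in lebesgue. t \<noteq> a" "AE t in lebesgue. t \<noteq> b"
    using AE_lborel_singleton by (auto intro: AE_completion)
  then show ?thesis by eventually_elim (auto simp: zero_ext_def)
qed

text \<open>
  Fubini's theorem holds for Borel functions on the product.  A square-integrable \<open>w\<close> on \<open>I \<times> U\<close> is
  only Lebesgue-measurable, so it is first replaced by a Borel function that agrees with it almost
  everywhere; almost every slice of \<open>w\<close> then agrees almost everywhere with a slice of that function.
\<close>

context
  fixes w :: "real \<Rightarrow> 'a::euclidean_space \<Rightarrow> real" and I U
  assumes w: "(\<lambda>(t, x). w t x) \<in> L2 (I \<times> U)"
begin

lemma slices_Borel_representative:
  "\<exists>F \<in> borel_measurable (lborel \<Otimes>\<^sub>M lborel).
     integrable (lborel \<Otimes>\<^sub>M lborel) (\<lambda>p. (F p)\<^sup>2) \<and>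
     (AE t in lebesgue. (AE x in lebesgue. zero_ext I (\<lambda>t. zero_ext U (w t) x) t = F (t, x)) \<and>
        integrable lborel (\<lambda>x. (F (t, x))\<^sup>2))"
proof -
  define W where "W = zero_ext (I \<times> U) (\<lambda>(t, x). w t x)"
  have W: "W \<in> borel_measurable lebesgue" "integrable lebesgue (\<lambda>p. (norm (W p))\<^sup>2)"
    using w unfolding L2_iff W_def by auto
  obtain F where F: "F \<in> borel_measurable lborel" and WF: "AE p in lborel. W p = F p"
    using completion_ex_borel_measurable_real[OF W(1)] by blast
  have WF': "AE p in lebesgue. (norm (W p))\<^sup>2 = (F p)\<^sup>2"
    using AE_completion[OF WF] by eventually_elim simp
  have F2: "(\<lambda>p. (F p)\<^sup>2) \<in> borel_measurable lborel" using F by (rule borel_measurable_power)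
  have "integrable lebesgue (\<lambda>p. (F p)\<^sup>2)" using lebesgue_integral_cong_AE(2)[OF WF'] W(2) by simp
  then have int: "integrable (lborel \<Otimes>\<^sub>M lborel) (\<lambda>p. (F p)\<^sup>2)"
    unfolding lborel_prod using integrable_completion[OF F2] by simp
  have "AE t in lborel. AE x in lborel. W (t, x) = F (t, x)"
    using WF unfolding lborel_prod[symmetric] by (rule lborel_pair.AE_pair)
  moreover have "AE t in lborel. integrable lborel (\<lambda>x. (F (t, x))\<^sup>2)"
    by (rule lborel_pair.AE_integrable_fst'[OF int])
  ultimately have "AE t in lborel. (AE x in lborel. W (t, x) = F (t, x)) \<and> integrable lborel (\<lambda>x. (F (t, x))\<^sup>2)"
    by eventually_elim simp
  then have "AE t in lebesgue. (AE x in lborel. W (t, x) = F (t, x)) \<and> integrable lborel (\<lambda>x. (F (t, x))\<^sup>2)"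
    by (rule AE_completion)
  then have "AE t in lebesgue. (AE x in lebesgue. W (t, x) = F (t, x)) \<and> integrable lborel (\<lambda>x. (F (t, x))\<^sup>2)"
    by eventually_elim (auto intro: AE_completion)
  then show ?thesis using F int unfolding W_def zero_ext_slice lborel_prod by blast
qed

lemma slices_L2: "AE t in lebesgue. t \<in> I \<longrightarrow> w t \<in> L2 U"
  and slices_L2_norm: "set_integrable lebesgue I (\<lambda>t. (L2_norm U (w t))\<^sup>2)"
  and slices_L2_inner: "e \<in> L2 U \<Longrightarrow> zero_ext I (\<lambda>t. L2_inner U (w t) e) \<in> borel_measurable lebesgue"
proof -
  obtain F where F[measurable]: "F \<in> borel_measurable (lborel \<Otimes>\<^sub>M lborel)"
    and int: "integrable (lborel \<Otimes>\<^sub>M lborel) (\<lambda>p. (F p)\<^sup>2)"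
    and ae: "AE t in lebesgue. (AE x in lebesgue. zero_ext I (\<lambda>t. zero_ext U (w t) x) t = F (t, x)) \<and>
        integrable lborel (\<lambda>x. (F (t, x))\<^sup>2)"
    using slices_Borel_representative by blast
  have Ft: "(\<lambda>x. F (t, x)) \<in> borel_measurable lborel" for t by measurable
  have Ft2: "(\<lambda>x. (F (t, x))\<^sup>2) \<in> borel_measurable lborel" for t by measurable
  show "AE t in lebesgue. t \<in> I \<longrightarrow> w t \<in> L2 U"
    using ae
  proof eventually_elim
    case (elim t)
    show ?case
    proof
      assume t: "t \<in> I"
      have 1: "AE x in lebesgue. zero_ext U (w t) x = F (t, x)" using elim t by (simp add: zero_ext_def)
      have 2: "AE x in lebesgue. (norm (zero_ext U (w t) x))\<^sup>2 = (F (t, x))\<^sup>2" using 1 by eventually_elim simp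
      show "w t \<in> L2 U" unfolding L2_iff lebesgue_integral_cong_AE(1)[OF 1] lebesgue_integral_cong_AE(2)[OF 2]
        using elim integrable_completion[OF Ft2] measurable_completion[OF Ft] by simp
    qed
  qed
  have "AE t in lebesgue. zero_ext I (\<lambda>t. (L2_norm U (w t))\<^sup>2) t = (\<integral>x. (F (t, x))\<^sup>2 \<partial>lborel)"
    using ae
  proof eventually_elim
    case (elim t)
    have 1: "AE x in lebesgue. (norm (zero_ext I (\<lambda>t. zero_ext U (w t) x) t))\<^sup>2 = (F (t, x))\<^sup>2"
      using conjunct1[OF elim] by eventually_elim simp
    have "(\<integral>x. (F (t, x))\<^sup>2 \<partial>lborel) = (\<integral>x. (norm (zero_ext I (\<lambda>t. zero_ext U (w t) x) t))\<^sup>2 \<partial>lebesgue)"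
      unfolding lebesgue_integral_cong_AE(3)[OF 1] by (rule integral_completion[OF Ft2, symmetric])
    then show ?case unfolding L2_norm_power2_zero_ext by (simp add: zero_ext_def)
  qed
  note cong = lebesgue_integral_cong_AE[OF this]
  have "integrable lborel (\<lambda>t. \<integral>x. (F (t, x))\<^sup>2 \<partial>lborel)" by (rule lborel_pair.integrable_fst'[OF int])
  then show "set_integrable lebesgue I (\<lambda>t. (L2_norm U (w t))\<^sup>2)"
    unfolding set_integrable_zero_ext cong(2) by (subst integrable_completion) auto
  assume e: "e \<in> L2 U"
  obtain E where E[measurable]: "E \<in> borel_measurable lborel" and eE: "AE x in lborel. zero_ext U e x = E x"
    using completion_ex_borel_measurable_real e unfolding L2_iff by blast
  have FE: "(\<lambda>x. F (t, x) * E x) \<in> borel_measurable lborel" for t by measurable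
  have "AE t in lebesgue. zero_ext I (\<lambda>t. L2_inner U (w t) e) t = (\<integral>x. F (t, x) * E x \<partial>lborel)"
    using ae
  proof eventually_elim
    case (elim t)
    have 1: "AE x in lebesgue. zero_ext I (\<lambda>t. zero_ext U (w t) x) t * zero_ext U e x = F (t, x) * E x"
      using conjunct1[OF elim] AE_completion[OF eE] by eventually_elim simp
    have "(\<integral>x. F (t, x) * E x \<partial>lborel) = (\<integral>x. zero_ext I (\<lambda>t. zero_ext U (w t) x) t * zero_ext U e x \<partial>lebesgue)"
      unfolding lebesgue_integral_cong_AE(3)[OF 1] by (rule integral_completion[OF FE, symmetric])
    then show ?case unfolding L2_inner_zero_ext by (simp add: zero_ext_def)
  qed
  note cong = lebesgue_integral_cong_AE[OF this]
  have "(\<lambda>t. \<integral>x. F (t, x) * E x \<partial>lborel) \<in> borel_measurable lborel"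
    by (rule lborel.borel_measurable_lebesgue_integral) measurable
  then show "zero_ext I (\<lambda>t. L2_inner U (w t) e) \<in> borel_measurable lebesgue"
    unfolding cong(1) by (rule measurable_completion)
qed

end

context
  fixes \<Omega> :: "(real^'n) set" and M :: "'n cell set"
  assumes \<Omega>: "\<exists>B. polytopal \<Omega> B" and M: "decomposition \<Omega> M"
begin

private lemmas R = region_props[OF mesh_polytopal[OF \<Omega> M]] and sub = region_subset[OF \<Omega> M] and meas = mesh_region(3)[OF \<Omega> M]

lemma f_h_on_cell:
  assumes K: "K \<in> M" and x: "x \<in> region K"
  shows "f_h k M f t x = Pi_0_vec k K (f t) x"
proof -
  have "f_h k M f t x = (\<Sum>K'\<in>M. if K' = K then Pi_0_vec k K (f t) x else 0)"
    unfolding f_h_def using mesh_disjoint[OF \<Omega> M _ K] x by (intro sum.cong) (auto simp: indicator_def)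
  then show ?thesis using mesh_finite[OF \<Omega> M] K by simp
qed

lemma zero_ext_cell:
  assumes K: "K \<in> M"
  shows "zero_ext \<Omega> (\<lambda>x. indicator (region K) x *\<^sub>R g x) = zero_ext (region K) g"
  using sub[OF K] by (auto simp: zero_ext_def fun_eq_iff indicator_def)

context
  fixes f :: "real \<Rightarrow> real^'n \<Rightarrow> real^'n" and t :: real
  assumes f: "f t \<in> L2 \<Omega>"
begin

lemma component_cell_L2: "K \<in> M \<Longrightarrow> (\<lambda>x. f t x $ i) \<in> L2 (region K)"
  using L2_mono(1)[OF f sub meas] unfolding L2_vec_iff[of "f t"] by blast

lemma Pi_0_vec_cell_L2:
  assumes K: "K \<in> M" shows "Pi_0_vec k K (f t) \<in> L2 (region K)"
  unfolding Pi_0_vec_def by (subst L2_vec_iff) (simp add: polys_L2[OF R[OF K] Pi_0_polys[OF R[OF K] component_cell_L2[OF K]]])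

lemma cell_term_L2:
  assumes K: "K \<in> M"
  shows "(\<lambda>x. indicator (region K) x *\<^sub>R Pi_0_vec k K (f t) x) \<in> L2 \<Omega>"
  using Pi_0_vec_cell_L2[OF K] by (simp add: L2_iff zero_ext_cell[OF K])

lemma f_h_L2: "f_h k M f t \<in> L2 \<Omega>"
  unfolding f_h_def[abs_def] by (rule fun_subspace_sum[OF L2_subspace cell_term_L2])

lemma f_h_norm: "(L2_norm \<Omega> (f_h k M f t))\<^sup>2 = (\<Sum>K\<in>M. (L2_norm (region K) (Pi_0_vec k K (f t)))\<^sup>2)"
proof -
  have "L2_inner \<Omega> (\<lambda>x. indicator (region K) x *\<^sub>R Pi_0_vec k K (f t) x) (f_h k M f t) =
      (L2_norm (region K) (Pi_0_vec k K (f t)))\<^sup>2" if K: "K \<in> M" for K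
  proof -
    have "zero_ext (region K) (Pi_0_vec k K (f t)) x \<bullet> zero_ext \<Omega> (f_h k M f t) x =
        (norm (zero_ext (region K) (Pi_0_vec k K (f t)) x))\<^sup>2" for x
      using sub[OF K] f_h_on_cell[OF K] by (auto simp: zero_ext_def power2_norm_eq_inner)
    then show ?thesis unfolding L2_inner_zero_ext zero_ext_cell[OF K] L2_norm_power2_zero_ext by simp
  qed
  moreover have "L2_inner \<Omega> (f_h k M f t) (f_h k M f t) =
      (\<Sum>K\<in>M. 1 * L2_inner \<Omega> (\<lambda>x. indicator (region K) x *\<^sub>R Pi_0_vec k K (f t) x) (f_h k M f t))"
    using form_sum_left[OF L2_subspace L2_inner_bilinear cell_term_L2 f_h_L2, where c = "\<lambda>_. 1"]
    by (simp add: f_h_def[abs_def])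
  ultimately show ?thesis by (simp add: L2_norm_power2)
qed

lemma Pi_0_vec_norm:
  assumes K: "K \<in> M"
  shows "(L2_norm (region K) (Pi_0_vec k K (f t)))\<^sup>2 = (\<Sum>i\<in>UNIV. (L2_norm (region K) (Pi_0 k (region K) (\<lambda>x. f t x $ i)))\<^sup>2)"
  by (subst L2_norm_vec_power2[OF Pi_0_vec_cell_L2[OF K]]) (simp add: Pi_0_vec_def)

lemma f_h_norm_le: "L2_norm \<Omega> (f_h k M f t) \<le> L2_norm \<Omega> (f t)"
proof (rule power2_le_imp_le[OF _ L2_norm_nonneg])
  have "(L2_norm \<Omega> (f_h k M f t))\<^sup>2 \<le> (\<Sum>K\<in>M. (L2_norm (region K) (f t))\<^sup>2)"
    unfolding f_h_norm
  proof (rule sum_mono)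
    fix K assume K: "K \<in> M"
    show "(L2_norm (region K) (Pi_0_vec k K (f t)))\<^sup>2 \<le> (L2_norm (region K) (f t))\<^sup>2"
      unfolding Pi_0_vec_norm[OF K] L2_norm_vec_power2[OF L2_mono(1)[OF f sub[OF K] meas[OF K]]]
      by (intro sum_mono power_mono Pi_0_norm_le[OF R[OF K]] component_cell_L2[OF K] L2_norm_nonneg)
  qed
  also have "\<dots> \<le> (L2_norm \<Omega> (f t))\<^sup>2"
    by (rule L2_norm_disjoint_sum[OF mesh_finite[OF \<Omega> M] mesh_disjoint[OF \<Omega> M] sub meas f])
  finally show "(L2_norm \<Omega> (f_h k M f t))\<^sup>2 \<le> (L2_norm \<Omega> (f t))\<^sup>2" .
qed

end

text \<open>
  The projection onto polynomials is an expansion in finitely many polynomials whose coefficients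
  are inner products with \<open>f t\<close>.  This makes the norm of the projected load a measurable function
  of time; the integrable majorant comes from the projections being contractions.
\<close>

lemma projection_coefficients:
  assumes K: "K \<in> M"
  shows "\<exists>(m::nat) e. (\<forall>j<m. e j \<in> L2 (region K)) \<and>
    (\<forall>w\<in>L2 (region K). (L2_norm (region K) (Pi_0 k (region K) w))\<^sup>2 = (\<Sum>j<m. (L2_inner (region K) w (e j))\<^sup>2))"
proof -
  obtain m :: nat and e where e: "\<forall>j<m. e j \<in> polys k"
    and ex: "\<forall>w\<in>L2 (region K). Pi_0 k (region K) w = (\<lambda>x. \<Sum>j<m. L2_inner (region K) w (e j) * e j x) \<and>
        (\<forall>q\<in>polys k. L2_inner (region K) (Pi_0 k (region K) w) q = L2_inner (region K) w q)"
    using Pi_0_expansion[OF R[OF K], of k] by blast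
  have eL: "e j \<in> L2 (region K)" if "j < m" for j using polys_L2[OF R[OF K]] e that by blast
  have "(L2_norm (region K) (Pi_0 k (region K) w))\<^sup>2 = (\<Sum>j<m. (L2_inner (region K) w (e j))\<^sup>2)"
    if w: "w \<in> L2 (region K)" for w
  proof -
    let ?p = "Pi_0 k (region K) w"
    have "(L2_norm (region K) ?p)\<^sup>2 = L2_inner (region K) w ?p"
      using Pi_0_inner[OF R[OF K] w Pi_0_polys[OF R[OF K] w]] by (simp add: L2_norm_power2)
    also have "\<dots> = L2_inner (region K) w (\<lambda>x. \<Sum>j<m. L2_inner (region K) w (e j) *\<^sub>R e j x)"
      using ex w by simp
    also have "\<dots> = (\<Sum>j<m. L2_inner (region K) w (e j) * L2_inner (region K) w (e j))"
      by (rule form_sum_right[OF L2_subspace L2_inner_bilinear eL w]) simp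
    finally show ?thesis by (simp add: power2_eq_square)
  qed
  then show ?thesis using eL by blast
qed

lemma f_h_norm_integrable:
  assumes f: "f \<in> L2_time T \<Omega>"
  shows "AE t in lebesgue. t \<in> {0<..<T} \<longrightarrow> f t \<in> L2 \<Omega>"
    and "set_integrable lebesgue {0..T} (\<lambda>t. L2_norm \<Omega> (f_h k M f t))"
proof -
  have f\<Omega>: "(\<lambda>(t, x). f t x $ i) \<in> L2 ({0<..<T} \<times> \<Omega>)" for i
    using f unfolding L2_time_def mem_Collect_eq by (subst (asm) L2_vec_iff) (simp add: case_prod_unfold)
  have fK: "(\<lambda>(t, x). f t x $ i) \<in> L2 ({0<..<T} \<times> region K)" if K: "K \<in> M" for i K
  proof (rule L2_mono(1)[OF f\<Omega>])
    have "open ({0<..<T} \<times> region K)" by (intro open_Times open_greaterThanLessThan R(1)[OF K])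
    then show "{0<..<T} \<times> region K \<in> sets lebesgue" by (intro sets_completionI_sets) (simp add: borel_open)
  qed (use sub[OF K] in auto)
  have "AE t in lebesgue. \<forall>i. t \<in> {0<..<T} \<longrightarrow> (\<lambda>x. f t x $ i) \<in> L2 \<Omega>"
    unfolding AE_all_countable by (intro allI slices_L2 f\<Omega>)
  then show ae: "AE t in lebesgue. t \<in> {0<..<T} \<longrightarrow> f t \<in> L2 \<Omega>"
    by eventually_elim (subst L2_vec_iff, blast)
  obtain m :: "'n cell \<Rightarrow> nat" and e where
    me: "\<forall>K\<in>M. (\<forall>j<m K. e K j \<in> L2 (region K)) \<and>
    (\<forall>w\<in>L2 (region K). (L2_norm (region K) (Pi_0 k (region K) w))\<^sup>2 = (\<Sum>j<m K. (L2_inner (region K) w (e K j))\<^sup>2))"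
  proof -
    have "\<forall>K\<in>M. \<exists>me. (\<forall>j<fst me. snd me j \<in> L2 (region K)) \<and>
    (\<forall>w\<in>L2 (region K). (L2_norm (region K) (Pi_0 k (region K) w))\<^sup>2 = (\<Sum>j<(fst me :: nat). (L2_inner (region K) w (snd me j))\<^sup>2))"
      using projection_coefficients[where k = k] by (simp add: split_paired_Ex)
    then obtain me where "\<forall>K\<in>M. (\<forall>j<fst (me K). snd (me K) j \<in> L2 (region K)) \<and>
    (\<forall>w\<in>L2 (region K). (L2_norm (region K) (Pi_0 k (region K) w))\<^sup>2 = (\<Sum>j<(fst (me K) :: nat). (L2_inner (region K) w (snd (me K) j))\<^sup>2))"
      by (rule bchoice[THEN exE])
    then show thesis by (rule that)
  qed
  let ?c = "\<lambda>K i j. zero_ext {0<..<T} (\<lambda>t. L2_inner (region K) (\<lambda>x. f t x $ i) (e K j))"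
  define g where "g t = sqrt (\<Sum>K\<in>M. \<Sum>i\<in>UNIV. \<Sum>j<m K. (?c K i j t)\<^sup>2)" for t
  have g: "g \<in> borel_measurable lebesgue" unfolding g_def[abs_def]
    by (intro measurable_compose[OF _ borel_measurable_sqrt] borel_measurable_sum borel_measurable_power slices_L2_inner fK) (use me in auto)
  have eq: "AE t in lebesgue. zero_ext {0..T} (\<lambda>t. L2_norm \<Omega> (f_h k M f t)) t = g t"
    using ae AE_endpoints[of 0 T "\<lambda>t. L2_norm \<Omega> (f_h k M f t)"]
  proof eventually_elim
    case (elim t)
    show ?case
    proof (cases "t \<in> {0<..<T}")
      case False
      then show ?thesis using elim(2) by (simp add: g_def zero_ext_eq_0)
    next
      case True
      then have ft: "f t \<in> L2 \<Omega>" using elim by blast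
      have "(L2_norm \<Omega> (f_h k M f t))\<^sup>2 = (\<Sum>K\<in>M. \<Sum>i\<in>UNIV. \<Sum>j<m K. (?c K i j t)\<^sup>2)"
        unfolding f_h_norm[where f = f and t = t, OF ft] zero_ext_eq[OF True]
        using me component_cell_L2[where f = f and t = t, OF ft] by (simp add: Pi_0_vec_norm[where f = f and t = t, OF ft])
      then have "L2_norm \<Omega> (f_h k M f t) = g t"
        unfolding g_def by (metis L2_norm_nonneg real_sqrt_unique)
      then show ?thesis using elim(2) True by (simp add: zero_ext_eq)
    qed
  qed
  have "integrable lebesgue g"
  proof (rule Bochner_Integration.integrable_bound[OF _ g])
    have I: "integrable lebesgue (zero_ext {0<..<T} (\<lambda>t. (L2_norm \<Omega> (\<lambda>x. f t x $ i))\<^sup>2))" for i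
      using slices_L2_norm[OF f\<Omega>, of i] by (simp add: set_integrable_zero_ext)
    have "integrable lebesgue (indicat_real {0<..<T})" by (rule lmeasurable_iff_integrable[THEN iffD1]) auto
    then show "integrable lebesgue (\<lambda>t. indicat_real {0<..<T} t + (\<Sum>i\<in>UNIV. zero_ext {0<..<T} (\<lambda>t. (L2_norm \<Omega> (\<lambda>x. f t x $ i))\<^sup>2) t))"
      by (intro Bochner_Integration.integrable_add Bochner_Integration.integrable_sum I)
    show "AE t in lebesgue. norm (g t) \<le>
      norm (indicat_real {0<..<T} t + (\<Sum>i\<in>UNIV. zero_ext {0<..<T} (\<lambda>t. (L2_norm \<Omega> (\<lambda>x. f t x $ i))\<^sup>2) t))"
      using ae eq AE_endpoints[of 0 T "\<lambda>t. L2_norm \<Omega> (f_h k M f t)"]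
    proof eventually_elim
      case (elim t)
      show ?case
      proof (cases "t \<in> {0<..<T}")
        case False
        then show ?thesis using elim by (simp add: zero_ext_eq_0)
      next
        case True
        then have ft: "f t \<in> L2 \<Omega>" using elim by blast
        have "g t = L2_norm \<Omega> (f_h k M f t)" using elim True by (simp add: zero_ext_eq)
        then have "\<bar>g t\<bar> \<le> L2_norm \<Omega> (f t)" using f_h_norm_le[where f = f and t = t, OF ft] by (simp add: L2_norm_nonneg)
        also have "\<dots> \<le> 1 + (L2_norm \<Omega> (f t))\<^sup>2"
          using sum_power2_ge_zero[of "L2_norm \<Omega> (f t) - 1/2" 0] by (simp add: power2_eq_square algebra_simps)
        also have "\<dots> = indicat_real {0<..<T} t + (\<Sum>i\<in>UNIV. zero_ext {0<..<T} (\<lambda>t. (L2_norm \<Omega> (\<lambda>x. f t x $ i))\<^sup>2) t)"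
          unfolding L2_norm_vec_power2[OF ft] using True by (simp add: zero_ext_eq)
        finally show ?thesis by simp
      qed
    qed
  qed
  then show "set_integrable lebesgue {0..T} (\<lambda>t. L2_norm \<Omega> (f_h k M f t))"
    unfolding set_integrable_zero_ext using lebesgue_integral_cong_AE(2)[OF eq] by simp
qed

end

section \<open>The stability estimate\<close>

text \<open>
  The assumptions of the theorem bound the forms from above.  By the Cauchy--Schwarz inequality a bound on
  the diagonal is enough for a bound on the absolute value, in every seminorm that dominates there.
\<close>
lemma form_bounded:
  assumes X: "fun_subspace X" and b: "sym_bilinear X b"
    and psd: "\<And>v. v \<in> X \<Longrightarrow> 0 \<le> b v v" and up: "\<And>v. v \<in> X \<Longrightarrow> b v v \<le> C * (N v)\<^sup>2"
    and v: "v \<in> X" and w: "w \<in> X" and N: "\<And>v. 0 \<le> N v" and C: "0 \<le> (C::real)"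
  shows "\<bar>b v w\<bar> \<le> C * N v * N w"
proof -
  have "(b v w)\<^sup>2 \<le> b v v * b w w" by (rule form_Cauchy_Schwarz[OF X b psd v w])
  also have "\<dots> \<le> (C * (N v)\<^sup>2) * (C * (N w)\<^sup>2)" by (intro mult_mono up v w psd) (simp add: C)
  also have "\<dots> = (C * N v * N w)\<^sup>2" by (simp add: power2_eq_square algebra_simps)
  finally have "(b v w)\<^sup>2 \<le> (C * N v * N w)\<^sup>2" .
  moreover have "0 \<le> C * N v * N w" using N C by simp
  ultimately show ?thesis by (simp add: abs_le_square_iff[symmetric])
qed

text \<open>
  Gradients are chosen from the set of all weak gradients, which is the same for \<open>u\<close> and \<open>v\<close>; hence the
  chosen ones are equal everywhere.
\<close>
lemma broken_seminorm_cong_AE: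
  assumes \<Omega>: "\<exists>B. polytopal \<Omega> B" and M: "decomposition \<Omega> M"
    and uv: "AE x in lebesgue. x \<in> \<Omega> \<longrightarrow> u x = v x"
  shows "broken_seminorm M u = broken_seminorm M v"
proof -
  have "grad (region K) (\<lambda>y. u y $ i) = grad (region K) (\<lambda>y. v y $ i)" if K: "K \<in> M" for K i
  proof -
    have "AE x in lebesgue. x \<in> region K \<longrightarrow> u x $ i = v x $ i"
      using uv by eventually_elim (use region_subset[OF \<Omega> M K] in auto)
    from weak_gradient_cong_AE[OF this] show ?thesis unfolding grad_def by simp
  qed
  then show ?thesis by (simp add: broken_seminorm_def jacobian_def[abs_def])
qed

theorem theorem3p5:
  fixes \<Omega> :: "(real^'n) set" and T :: real and k :: nat
    and \<mu>1 \<mu>2 lam1 lam2 \<gamma>1 \<gamma>2 Cs :: real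
    and H :: "real set" and Th :: "real \<Rightarrow> 'n cell set" and S :: "real \<Rightarrow> 'n stabilisation"
    and Cm Ca1 Ca2 cm \<alpha>0 \<alpha>1 :: real
  assumes "CARD('n) = 2 \<or> CARD('n) = 3"
    and "\<exists>B. polytopal \<Omega> B" and "simply_connected \<Omega>"
    and "T > 0" and "k \<ge> 1"
    and "\<mu>1 > 0" and "\<mu>2 > 0" and "lam1 > 0" and "lam2 > 0"
    and "\<And>h. h \<in> H \<Longrightarrow> decomposition \<Omega> (Th h) \<and> mesh_size (Th h) = h"
    and "\<gamma>1 > 0" and "\<gamma>2 > 0"
    and "\<And>h K. h \<in> H \<Longrightarrow> K \<in> Th h \<Longrightarrow> shape_regular \<gamma>1 \<gamma>2 K"
    and "Cs > 0"
    and "\<And>h K. h \<in> H \<Longrightarrow> K \<in> Th h \<Longrightarrow> admissible_stabilisation k Cs K (S h K)"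
    and "Cm > 0" and "Ca1 > 0" and "Ca2 > 0" and "cm > 0" and "\<alpha>0 > 0" and "\<alpha>1 > 0"
    and "\<And>h v w. h \<in> H \<Longrightarrow> v \<in> V_h k \<Omega> (Th h) \<Longrightarrow> w \<in> V_h k \<Omega> (Th h) \<Longrightarrow>
           m_h k (S h) (Th h) v w \<le> Cm * L2_norm \<Omega> v * L2_norm \<Omega> w"
    and "\<And>h v w. h \<in> H \<Longrightarrow> v \<in> V_h k \<Omega> (Th h) \<Longrightarrow> w \<in> V_h k \<Omega> (Th h) \<Longrightarrow>
           a_h k \<mu>1 lam1 (S h) (Th h) v w \<le> Ca1 * broken_seminorm (Th h) v * broken_seminorm (Th h) w"
    and "\<And>h v w. h \<in> H \<Longrightarrow> v \<in> V_h k \<Omega> (Th h) \<Longrightarrow> w \<in> V_h k \<Omega> (Th h) \<Longrightarrow>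
           a_h k \<mu>2 lam2 (S h) (Th h) v w \<le> Ca2 * broken_seminorm (Th h) v * broken_seminorm (Th h) w"
    and "\<And>h v. h \<in> H \<Longrightarrow> v \<in> V_h k \<Omega> (Th h) \<Longrightarrow>
           m_h k (S h) (Th h) v v \<ge> cm * (L2_norm \<Omega> v)\<^sup>2"
    and "\<And>h v. h \<in> H \<Longrightarrow> v \<in> V_h k \<Omega> (Th h) \<Longrightarrow>
           a_h k \<mu>1 lam1 (S h) (Th h) v v \<ge> \<alpha>0 * (broken_seminorm (Th h) v)\<^sup>2"
    and "\<And>h v. h \<in> H \<Longrightarrow> v \<in> V_h k \<Omega> (Th h) \<Longrightarrow>
           a_h k \<mu>2 lam2 (S h) (Th h) v v \<ge> \<alpha>1 * (broken_seminorm (Th h) v)\<^sup>2"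
  shows "\<exists>C > 0. \<forall>h \<in> H. \<forall>f \<in> L2_time T \<Omega>.
           \<forall>u0 \<in> V_h k \<Omega> (Th h). \<forall>u1 \<in> V_h k \<Omega> (Th h). \<forall>u u' u''.
             semidiscrete_solution k \<mu>1 lam1 \<mu>2 lam2 T \<Omega> (Th h) (S h) f u0 u1 u u' u'' \<longrightarrow>
             (SUP t\<in>{0..T}. ereal (L2_norm \<Omega> (u' t) + broken_seminorm (Th h) (u t)))
               \<le> ereal (C * (L2_norm \<Omega> u1 + broken_seminorm (Th h) u0 +
                     (LINT s:{0..T}|lebesgue. L2_norm \<Omega> (f_h k (Th h) f s))))"
proof (intro exI conjI ballI allI impI)
  let ?C = "(1 / sqrt cm + 1 / sqrt \<alpha>1) * (sqrt Cm + sqrt Ca2 + 2 / sqrt cm)"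
  show "?C > 0" using assms(16,18,19,21) by (intro mult_pos_pos add_pos_pos) auto
  note \<Omega> = assms(2)
  fix h f u0 u1 u u' u''
  assume h: "h \<in> H" and f: "f \<in> L2_time T \<Omega>" and u0: "u0 \<in> V_h k \<Omega> (Th h)" and u1: "u1 \<in> V_h k \<Omega> (Th h)"
    and sol: "semidiscrete_solution k \<mu>1 lam1 \<mu>2 lam2 T \<Omega> (Th h) (S h) f u0 u1 u u' u''"
  let ?V = "V_h k \<Omega> (Th h)" and ?m = "m_h k (S h) (Th h)"
  let ?a1 = "a_h k \<mu>1 lam1 (S h) (Th h)" and ?a2 = "a_h k \<mu>2 lam2 (S h) (Th h)"
  let ?n = "L2_norm \<Omega>" and ?s = "broken_seminorm (Th h)" and ?N = "H1_norm_vec \<Omega>"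
  have M: "decomposition \<Omega> (Th h)" using assms(10)[OF h] by blast
  note m_upper = assms(22)[OF h] and a_upper = assms(24)[OF h]
    and m_lower = assms(25)[OF h] and a1_lower = assms(26)[OF h] and a_lower = assms(27)[OF h]
  note V = V_h_subspace[OF \<Omega> M, of k]
  note m = m_h_bilinear[OF \<Omega> M assms(15)[OF h]] and a2 = a_h_bilinear[OF \<Omega> M assms(15)[OF h]]
  note H1 = V_h_H1[OF \<Omega> M, of _ k]
  have m2: "?m v v \<le> Cm * (?n v)\<^sup>2" if "v \<in> ?V" for v
    using m_upper[OF that that] by (simp add: power2_eq_square mult.assoc)
  have a22: "?a2 v v \<le> Ca2 * (?s v)\<^sup>2" if "v \<in> ?V" for v
    using a_upper[OF that that] by (simp add: power2_eq_square mult.assoc)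
  \<comment> \<open>Time derivatives are taken in the \<open>H\<^sup>1\<close> norm, so continuity of both forms is needed in that norm.\<close>
  have mN: "\<bar>?m v w\<bar> \<le> Cm * ?N v * ?N w" if v: "v \<in> ?V" and w: "w \<in> ?V" for v w
  proof (rule form_bounded[OF V m _ _ v w])
    show "0 \<le> ?m v v" if "v \<in> ?V" for v
      by (rule order_trans[OF _ m_lower[OF that]]) (use assms(19) in simp)
    show "?m v v \<le> Cm * (?N v)\<^sup>2" if v: "v \<in> ?V" for v
      by (rule order_trans[OF m2[OF v]])
        (use assms(16) in \<open>intro mult_left_mono power_mono L2_norm_le_H1_norm_vec[OF \<Omega> M] H1 v L2_norm_nonneg, simp\<close>)
  qed (use assms(16) in \<open>auto simp: H1_norm_vec_nonneg[OF \<Omega> M]\<close>)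
  have aN: "\<bar>?a2 v w\<bar> \<le> Ca2 * ?N v * ?N w" if v: "v \<in> ?V" and w: "w \<in> ?V" for v w
  proof (rule form_bounded[OF V a2 _ _ v w])
    show "0 \<le> ?a2 v v" if "v \<in> ?V" for v
      by (rule order_trans[OF _ a_lower[OF that]]) (use assms(21) in simp)
    show "?a2 v v \<le> Ca2 * (?N v)\<^sup>2" if v: "v \<in> ?V" for v
      by (rule order_trans[OF a22[OF v]])
        (use assms(18) in \<open>intro mult_left_mono power_mono broken_seminorm_le_H1_norm_vec[OF \<Omega> M] H1 v broken_seminorm_nonneg[OF \<Omega> M], simp\<close>)
  qed (use assms(18) in \<open>auto simp: H1_norm_vec_nonneg[OF \<Omega> M]\<close>)
  have C2: "C2_time T \<Omega> ?V u u' u''" and i0: "AE x in lebesgue. x \<in> \<Omega> \<longrightarrow> u 0 x = u0 x"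
    and i1: "AE x in lebesgue. x \<in> \<Omega> \<longrightarrow> u' 0 x = u1 x"
    and pde: "AE t in lebesgue. t \<in> {0<..T} \<longrightarrow> (\<forall>v \<in> ?V. ?m (u'' t) v + ?a1 (u' t) v + ?a2 (u t) v =
           (LINT x:\<Omega>|lebesgue. f_h k (Th h) f t x \<bullet> v x))"
    using sol unfolding semidiscrete_solution_def by auto
  have uV: "u t \<in> ?V \<and> u' t \<in> ?V \<and> u'' t \<in> ?V" if "t \<in> {0..T}" for t
    using C2 that unfolding C2_time_def by blast
  have eq: "AE t in lebesgue. t \<in> {0<..T} \<longrightarrow>
      ?m (u'' t) (u' t) + ?a1 (u' t) (u' t) + ?a2 (u t) (u' t) \<le> ?n (f_h k (Th h) f t) * ?n (u' t)"
    \<comment> \<open>The time \<open>T\<close> is excluded, since \<open>f\<close> is given on the open interval only.\<close>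
    using pde f_h_norm_integrable(1)[OF \<Omega> M f] AE_completion[OF AE_lborel_singleton[of T]]
  proof eventually_elim
    case (elim t)
    show ?case
    proof
      assume t: "t \<in> {0<..T}"
      then have "t \<in> {0..T}" "t \<in> {0<..<T}" using elim(3) by auto
      then have u': "u' t \<in> ?V" and ft: "f t \<in> L2 \<Omega>" using uV elim(2) by blast+
      have "?m (u'' t) (u' t) + ?a1 (u' t) (u' t) + ?a2 (u t) (u' t) = L2_inner \<Omega> (f_h k (Th h) f t) (u' t)"
        unfolding L2_inner_def using elim(1) t u' by blast
      also have "\<dots> \<le> ?n (f_h k (Th h) f t) * ?n (u' t)"
        using L2_Cauchy_Schwarz[OF f_h_L2[where f = f and t = t, OF \<Omega> M ft] V_h_L2[OF \<Omega> M u'], of k]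
        by (rule order_trans[OF abs_ge_self])
      finally show "?m (u'' t) (u' t) + ?a1 (u' t) (u' t) + ?a2 (u t) (u' t) \<le> ?n (f_h k (Th h) f t) * ?n (u' t)" .
    qed
  qed
  have s0: "?s (u 0) = ?s u0" by (rule broken_seminorm_cong_AE[OF \<Omega> M i0])
  have n1: "?n (u' 0) = ?n u1" by (rule L2_cong_AE(2)[OF i1])
  show "(SUP t\<in>{0..T}. ereal (?n (u' t) + ?s (u t))) \<le>
      ereal (?C * (?n u1 + ?s u0 + (LINT s:{0..T}|lebesgue. ?n (f_h k (Th h) f s))))"
  proof (rule SUP_least)
    fix t assume t: "t \<in> {0..T}"
    have "?n (u' t) + ?s (u t) \<le> ?C * (?n (u' 0) + ?s (u 0) + (LINT s:{0..T}|lebesgue. ?n (f_h k (Th h) f s)))"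
    proof (rule energy_estimate[OF V m a2, where N = ?N and u'' = u'' and ?a1.0 = ?a1 and \<phi> = "\<lambda>s. ?n (f_h k (Th h) f s)"])
      show "0 \<le> ?a1 v v" if "v \<in> ?V" for v
        by (rule order_trans[OF _ a1_lower[OF that]]) (use assms(20) in simp)
      show "t \<in> {0..T}" by (rule t)
      show "AE t in lebesgue. t \<in> {0<..T} \<longrightarrow>
        ?m (u'' t) (u' t) + ?a1 (u' t) (u' t) + ?a2 (u t) (u' t) \<le> ?n (f_h k (Th h) f t) * ?n (u' t)" by (rule eq)
    qed (use C2 in \<open>auto simp: C2_time_def time_derivative_def L2_norm_nonneg H1_norm_vec_nonneg[OF \<Omega> M]
        broken_seminorm_nonneg[OF \<Omega> M] intro: mN aN m2 a22 m_lower a_lower assms uV f_h_norm_integrable(2)[OF \<Omega> M f]\<close>)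
    then show "ereal (?n (u' t) + ?s (u t)) \<le>
        ereal (?C * (?n u1 + ?s u0 + (LINT s:{0..T}|lebesgue. ?n (f_h k (Th h) f s))))"
      unfolding s0 n1 by simp
  qed
qed

end
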